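(* Let $d\ge1$, $\alpha\in(1/2,\infty)^d$ and $C(\alpha)=\max_{i=1,\ldots,d}\frac{\alpha_i+1/2}{\alpha_i-1/2}$. Let $\mathbf{R}=(R_1,\ldots,R_d)$ be the vector of Riesz transforms for Laguerre function expansions of Hermite type with parameter $\alpha$ defined in the context. Then for every $1<p<\infty$ we have $$\|\mathbf{R}f\|_p\le24\,\big(1+\sqrt{C(\alpha)}\big)\,(p^*-1)\,\|f\|_p,\qquad f\in L^p((0,\infty)^d,dx),\quad p^*=\max\left(p,\frac p{p-1}\right).$$
   Context: All functions are real-valued, $\mathbb{N}=\{0,1,2,\ldots\}$. $L^p=L^p((0,\infty)^d,dx)$; for vector-valued functions $\|\mathbf{g}\|_p=\big(\int|\mathbf{g}|^p\,dx\big)^{1/p}$ with $|\cdot|$ the Euclidean norm. Let $\varphi_k^\alpha=\varphi_{k_1}^{\alpha_1}\otimes\cdots\otimes\varphi_{k_d}^{\alpha_d}$, $k\in\mathbb{N}^d$, be the $L^2$-normalized Laguerre functions of Hermite type, $\varphi_n^{a}(x)=\Big(\frac{2\,n!}{\Gamma(n+a+1)}\Big)^{1/2}L_n^{a}(x^2)\,x^{a+1/2}e^{-x^2/2}$, $x>0$, where $L_n^{a}$ is the classical Laguerre polynomial of degree $n$ and type $a$. They form an orthonormal basis of $L^2$ of eigenfunctions of $L=-\Delta+|x|^2+\sum_{i=1}^d\frac{\alpha_i^2-1/4}{x_i^2}$ with eigenvalues $\lambda_k=4|k|+2|\alpha|+2d$, where $|k|=\sum_ik_i$, $|\alpha|=\sum_i\alpha_i$.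 Let $\delta_i=\partial_{x_i}+x_i-\frac{\alpha_i+1/2}{x_i}$; then $\delta_i\varphi_k^\alpha=-2\sqrt{k_i}\,\varphi_{k-e_i}^{\alpha+e_i}$ (zero if $k_i=0$). The Riesz transforms ($R_i=\delta_iL^{-1/2}$) are $R_if=\sum_{k\in\mathbb{N}^d}\lambda_k^{-1/2}\langle f,\varphi_k^\alpha\rangle_{L^2}\,\delta_i\varphi_k^\alpha=-\sum_{k}\big(\frac{4k_i}{4|k|+2|\alpha|+2d}\big)^{1/2}\langle f,\varphi_k^\alpha\rangle_{L^2}\,\varphi_{k-e_i}^{\alpha+e_i}$ for $f\in L^2$, and $\mathbf{R}f=(R_1f,\ldots,R_df)$. For $f\in L^p$, $\mathbf{R}f$ is understood as the continuous extension of $\mathbf{R}$ from the dense subspace $\mathrm{lin}\{\varphi_k^\alpha\}$ (existence of the extension is part of the claim). *)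

theory Defs
  imports "HOL-Analysis.Analysis"
begin

definition orthant :: "(real ^ 'd) set" where
  "orthant = {x. \<forall>i. 0 < x $ i}"

(* The space L^p consists of functions, not classes; almost everywhere equal
   functions are at Lp_norm-distance 0. *)
definition Lp_space :: "real \<Rightarrow> (real ^ 'd \<Rightarrow> 'b::euclidean_space) set" where
  "Lp_space p = {f. f \<in> borel_measurable (lebesgue_on orthant) \<and>
     integrable (lebesgue_on orthant) (\<lambda>x. norm (f x) powr p)}"

definition Lp_norm :: "real \<Rightarrow> (real ^ 'd \<Rightarrow> 'b::euclidean_space) \<Rightarrow> real" where
  "Lp_norm p f = (LINT x|lebesgue_on orthant. norm (f x) powr p) powr (1 / p)"

definition L2_inner :: "(real ^ 'd \<Rightarrow> real) \<Rightarrow> (real ^ 'd \<Rightarrow> real) \<Rightarrow> real" where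
  "L2_inner f g = (LINT x|lebesgue_on orthant. f x * g x)"

definition laguerre_poly :: "nat \<Rightarrow> real \<Rightarrow> real \<Rightarrow> real" where
  "laguerre_poly n a x =
     (\<Sum>j\<le>n. (- 1) ^ j * ((real n + a) gchoose (n - j)) * x ^ j / fact j)"

definition laguerre_fun1 :: "real \<Rightarrow> nat \<Rightarrow> real \<Rightarrow> real" where
  "laguerre_fun1 a n x = sqrt (2 * fact n / Gamma (real n + a + 1)) *
     laguerre_poly n a (x\<^sup>2) * x powr (a + 1/2) * exp (- x\<^sup>2 / 2)"

definition laguerre_fun :: "real ^ 'd \<Rightarrow> nat ^ 'd \<Rightarrow> real ^ 'd \<Rightarrow> real" where
  "laguerre_fun \<alpha> k x = (\<Prod>i\<in>UNIV. laguerre_fun1 (\<alpha> $ i) (k $ i) (x $ i))"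

definition laguerre_eigenvalue :: "real ^ 'd \<Rightarrow> nat ^ 'd \<Rightarrow> real" where
  "laguerre_eigenvalue \<alpha> k =
     4 * real (\<Sum>i\<in>UNIV. k $ i) + 2 * (\<Sum>i\<in>UNIV. \<alpha> $ i) + 2 * real CARD('d)"

definition laguerre_span :: "real ^ 'd \<Rightarrow> (real ^ 'd \<Rightarrow> real) set" where
  "laguerre_span \<alpha> =
     {(\<lambda>x. \<Sum>k\<in>K. c k * laguerre_fun \<alpha> k x) | (K :: (nat ^ 'd) set) c. finite K}"

definition partial_deriv :: "'d \<Rightarrow> (real ^ 'd \<Rightarrow> real) \<Rightarrow> real ^ 'd \<Rightarrow> real" where
  "partial_deriv i f x = deriv (\<lambda>t. f (x + t *\<^sub>R axis i 1)) 0"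

definition laguerre_delta ::
    "real ^ 'd \<Rightarrow> 'd \<Rightarrow> (real ^ 'd \<Rightarrow> real) \<Rightarrow> real ^ 'd \<Rightarrow> real" where
  "laguerre_delta \<alpha> i f x =
     partial_deriv i f x + (x $ i - (\<alpha> $ i + 1/2) / x $ i) * f x"

definition riesz_partial_sum ::
    "real ^ 'd \<Rightarrow> 'd \<Rightarrow> (real ^ 'd \<Rightarrow> real) \<Rightarrow> (nat ^ 'd) set \<Rightarrow> real ^ 'd \<Rightarrow> real" where
  "riesz_partial_sum \<alpha> i f K x =
     (\<Sum>k\<in>K. laguerre_eigenvalue \<alpha> k powr (- 1/2) * L2_inner f (laguerre_fun \<alpha> k) *
        laguerre_delta \<alpha> i (laguerre_fun \<alpha> k) x)"

(* has_riesz \<alpha> i f g: the series over all multi-indices that defines the i-th Riesz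
   transform of f converges to g, unconditionally in L^2. *)
definition has_riesz ::
    "real ^ 'd \<Rightarrow> 'd \<Rightarrow> (real ^ 'd \<Rightarrow> real) \<Rightarrow> (real ^ 'd \<Rightarrow> real) \<Rightarrow> bool" where
  "has_riesz \<alpha> i f g \<longleftrightarrow> f \<in> Lp_space 2 \<and> g \<in> Lp_space 2 \<and>
     ((\<lambda>K. Lp_norm 2 (\<lambda>x. riesz_partial_sum \<alpha> i f K x - g x)) \<longlongrightarrow> 0)
       (finite_subsets_at_top UNIV)"

(* Continuity on the seminormed function space forces T to respect almost everywhere
   equality, so T is an operator on classes. *)
definition continuous_riesz_extension ::
    "real ^ 'd \<Rightarrow> real \<Rightarrow> ((real ^ 'd \<Rightarrow> real) \<Rightarrow> real ^ 'd \<Rightarrow> real ^ 'd) \<Rightarrow> bool" where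
  "continuous_riesz_extension \<alpha> p T \<longleftrightarrow>
     (\<forall>f\<in>Lp_space p. T f \<in> Lp_space p) \<and>
     (\<forall>f\<in>Lp_space p. \<forall>F. (\<forall>n. F n \<in> Lp_space p) \<and>
        (\<lambda>n. Lp_norm p (\<lambda>x. F n x - f x)) \<longlonglongrightarrow> 0 \<longrightarrow>
        (\<lambda>n. Lp_norm p (\<lambda>x. T (F n) x - T f x)) \<longlonglongrightarrow> 0) \<and>
     (\<forall>f\<in>laguerre_span \<alpha>. \<forall>i. has_riesz \<alpha> i f (\<lambda>x. T f x $ i))"

definition laguerre_C :: "real ^ 'd \<Rightarrow> real" where
  "laguerre_C \<alpha> = Max (range (\<lambda>i. (\<alpha> $ i + 1/2) / (\<alpha> $ i - 1/2)))"

end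

(*
  For finite Laguerre expansions f and g_i, of types alpha and alpha + e_i, let P_t f and
  Q_t g_i be their Poisson extensions, normalised so that delta_i P_t = Q_t delta_i. On
  eigenfunctions the integral of t mu exp (- 2 mu t) is 1 / (4 mu), hence
    <R f, g> = - 4 * (integral of t * (delta P_t f . d_t Q_t g) over the orthant times (0,oo)).
  For p >= 2 put b = beta (|P_t f|^2, |Q_t g|^2), where beta (|u|^2, |v|^2) is the Bellman
  function |v|^q + delta |u|^2 (|u|^p + |v|^q)^(1 - 2/p) with delta = (q - 1) / 8. Its convexity
  and the equations (d_t^2 + Laplacian) w = W w give
    (d_t^2 + Laplacian) b >= 3 delta * sqrt (energy of P_t f) * sqrt (energy of Q_t g),
  and integrating against t leaves only b at t = 0, because the boundary terms vanish at the walls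
  and at infinity. The zeroth order part of delta_i is controlled by the potential at the price of
  C(alpha), so |delta P_t f| <= (1 + sqrt C(alpha)) * sqrt (energy of P_t f). For p < 2 the roles of
  f and g are exchanged. Duality then bounds R on the span of the Laguerre functions.
  The span is dense in L^p: its closure is invariant under multiplication by y_i = exp (- x_i^2 / 8),
  whose Taylor series is dominated by a Gaussian, so the Stone-Weierstrass theorem in the variables
  y_i applies.
*)
theory Submission
  imports Defs "HOL-Computational_Algebra.Polynomial"
begin

section \<open>The spaces $L^p$ on the orthant\<close>

text \<open>The Bellman function of Nazarov and Treil is glued from two pieces along |u|^p = |v|^q
  and has to be mollified. The weight T = (|u|^p + |v|^q)^(1 - 2/p) of |u|^2 is a smooth substitute,
  comparable to the larger of |u|^(p - 2) and |v|^(2 - q). Adding e^2 to both squared norms keeps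
  away from the axes; e tends to 0 by dominated convergence. The convexity bound contains T |u'|^2
  and |v'|^2 / T, so T cancels in the geometric mean. The convexity of |v|^q degenerates like q - 1
  as q tends to 1. So delta is of this order, which causes the linear growth in p* - 1. The
  components of P_t f and Q_t g have different potentials, but all dominate that of type alpha, and
  both energies are formed with the latter. A Laguerre function behaves like x_i^(alpha_i + 1/2) at
  a wall. For alpha_i > 1/2 its first derivatives stay bounded; the second ones may blow up, but
  occur only in products with functions that vanish like x_i. For normalised f and g the integral of
  b at t = 0 is at most 1/8 + 9/8. Together with delta this gives 10/3, and 40/3 after the factor 4;
  the constant 24 leaves room.\<close>

abbreviation (input) MO :: "(real ^ 'd) measure" where "MO \<equiv> lebesgue_on orthant"

text \<open>Convexity of the power at the combination of \<open>a / l\<close> and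
  \<open>b / (1 - l)\<close>. The free weight \<open>l\<close> is what later turns an inequality
  between integrals into the triangle inequality.\<close>

lemma powr_add_convex:
  fixes a b l p :: real
  assumes "0 \<le> a" "0 \<le> b" "0 < l" "l < 1" "1 \<le> p"
  shows "(a + b) powr p \<le> l powr (1 - p) * a powr p + (1 - l) powr (1 - p) * b powr p"
proof -
  have e: "m * ((a / m) powr p) = m powr (1 - p) * a powr p" if "m > 0" "a \<ge> 0" for m a :: real
    using that by (simp add: powr_divide powr_diff)
  consider "a = 0" | "b = 0" | "a > 0" "b > 0" using assms by linarith
  then show ?thesis
  proof cases
    case 1
    have "1 \<le> (1 - l) powr (1 - p)"
      using powr_mono2'[of "1-p" "1-l" 1] assms by simp
    then show ?thesis using 1 assms mult_right_mono[of 1 "(1 - l) powr (1 - p)" "b powr p"] by simp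
  next
    case 2
    have "1 \<le> l powr (1 - p)"
      using powr_mono2'[of "1-p" l 1] assms by simp
    then show ?thesis using 2 assms mult_right_mono[of 1 "l powr (1 - p)" "a powr p"] by simp
  next
    case 3
    have "((1 - (1-l)) *\<^sub>R (a / l) + (1-l) *\<^sub>R (b / (1 - l))) powr p
        \<le> (1 - (1-l)) * (a / l) powr p + (1 - l) * (b / (1 - l)) powr p"
      using convex_onD[OF powr_convex[OF assms(5)], of "1-l" "a/l" "b/(1-l)"] 3 assms by simp
    then show ?thesis using 3 assms e[of l a] e[of "1-l" b] by simp
  qed
qed

lemma Lp_spaceI:
  "f \<in> borel_measurable MO \<Longrightarrow> integrable MO (\<lambda>x. norm (f x) powr p) \<Longrightarrow> f \<in> Lp_space p"
  by (simp add: Lp_space_def)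

lemma Lp_space_measurable [measurable_dest]: "f \<in> Lp_space p \<Longrightarrow> f \<in> borel_measurable MO"
  by (simp add: Lp_space_def)

lemma Lp_space_integrable: "f \<in> Lp_space p \<Longrightarrow> integrable MO (\<lambda>x. norm (f x) powr p)"
  by (simp add: Lp_space_def)

lemma Lp_space_bound:
  assumes "h \<in> Lp_space p" "f \<in> borel_measurable MO" "AE x in MO. norm (f x) \<le> c * norm (h x)" "0 \<le> p"
  shows "f \<in> Lp_space p"
proof (rule Lp_spaceI)
  show "integrable MO (\<lambda>x. norm (f x) powr p)"
  proof (rule Bochner_Integration.integrable_bound)
    show "integrable MO (\<lambda>x. \<bar>c\<bar> powr p * norm (h x) powr p)"
      using assms by (simp add: Lp_space_integrable)
    show "AE x in MO. norm (norm (f x) powr p) \<le> norm (\<bar>c\<bar> powr p * norm (h x) powr p)"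
      using assms(3)
    proof eventually_elim
      case (elim x)
      have "norm (f x) \<le> \<bar>c\<bar> * norm (h x)"
        using elim mult_right_mono[OF abs_ge_self[of c] norm_ge_zero[of "h x"]] by linarith
      then have "norm (f x) powr p \<le> (\<bar>c\<bar> * norm (h x)) powr p"
        using assms by (intro powr_mono2) auto
      then show ?case by (simp add: powr_mult)
    qed
  qed (use assms in measurable)
qed (use assms in auto)

lemma Lp_norm_nonneg [simp]: "0 \<le> Lp_norm p f"
  by (simp add: Lp_norm_def)

lemma Lp_norm_powr:
  assumes "0 < p"
  shows "Lp_norm p f powr p = (LINT x|MO. norm (f x) powr p)"
  using assms by (simp add: Lp_norm_def powr_powr Bochner_Integration.integral_nonneg)

lemma Lp_norm_le_iff:
  assumes "0 < p" "0 \<le> c"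
  shows "Lp_norm p f \<le> c \<longleftrightarrow> (LINT x|MO. norm (f x) powr p) \<le> c powr p"
proof
  assume "Lp_norm p f \<le> c"
  then show "(LINT x|MO. norm (f x) powr p) \<le> c powr p"
    using Lp_norm_powr[OF assms(1), of f] powr_mono2[of p "Lp_norm p f" c] assms by simp
next
  assume "(LINT x|MO. norm (f x) powr p) \<le> c powr p"
  then have "Lp_norm p f \<le> (c powr p) powr (1/p)"
    unfolding Lp_norm_def using assms by (intro powr_mono2) (auto intro!: Bochner_Integration.integral_nonneg)
  then show "Lp_norm p f \<le> c" using assms by (simp add: powr_powr)
qed

lemma Lp_norm_cong_AE:
  assumes "AE x in MO. f x = g x" "f \<in> borel_measurable MO" "g \<in> borel_measurable MO"
  shows "Lp_norm p f = Lp_norm p g"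
  unfolding Lp_norm_def
  by (subst integral_cong_AE[where g="\<lambda>x. norm (g x) powr p"])
     (use assms in \<open>auto intro: eventually_mono\<close>)

lemma Lp_norm_eq_0_iff:
  assumes "f \<in> Lp_space p" "0 < p"
  shows "Lp_norm p f = 0 \<longleftrightarrow> (AE x in MO. f x = 0)"
  using integral_nonneg_eq_0_iff_AE[OF Lp_space_integrable[OF assms(1)]] assms
  by (simp add: Lp_norm_def)

lemma Lp_norm_mono:
  assumes "AE x in MO. norm (f x) \<le> norm (g x)" "g \<in> Lp_space p" "f \<in> borel_measurable MO" "0 < p"
  shows "Lp_norm p f \<le> Lp_norm p g"
proof -
  have f: "f \<in> Lp_space p" by (rule Lp_space_bound[of g p f 1]) (use assms in auto)
  have "AE x in MO. norm (f x) powr p \<le> norm (g x) powr p"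
    using assms(1) by eventually_elim (use assms in \<open>auto intro!: powr_mono2\<close>)
  then have "(LINT x|MO. norm (f x) powr p) \<le> (LINT x|MO. norm (g x) powr p)"
    by (intro integral_mono_AE Lp_space_integrable f assms)
  then show ?thesis
    unfolding Lp_norm_def using assms by (intro powr_mono2) (auto intro!: Bochner_Integration.integral_nonneg)
qed

lemma Lp_norm_scale:
  assumes "0 < p"
  shows "Lp_norm p (\<lambda>x. c *\<^sub>R f x) = \<bar>c\<bar> * Lp_norm p f"
  using assms by (simp add: Lp_norm_def powr_mult powr_powr Bochner_Integration.integral_nonneg)

lemma Lp_norm_minus: "Lp_norm p (\<lambda>x. f x - g x) = Lp_norm p (\<lambda>x. g x - f x)"
  by (simp add: Lp_norm_def norm_minus_commute)

lemma Lp_space_scale: "f \<in> Lp_space p \<Longrightarrow> 0 \<le> p \<Longrightarrow> (\<lambda>x. c *\<^sub>R f x) \<in> Lp_space p"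
  by (rule Lp_space_bound[where h=f and c="\<bar>c\<bar>"]) auto

lemma Lp_integral_add_bound:
  assumes f: "f \<in> Lp_space p" and g: "g \<in> Lp_space p" and p: "1 \<le> p" and l: "0 < l" "l < 1"
  shows "integrable MO (\<lambda>x. norm (f x + g x) powr p)"
    and "(LINT x|MO. norm (f x + g x) powr p) \<le>
       l powr (1 - p) * (LINT x|MO. norm (f x) powr p) + (1 - l) powr (1 - p) * (LINT x|MO. norm (g x) powr p)"
proof -
  let ?b = "\<lambda>x. l powr (1 - p) * norm (f x) powr p + (1 - l) powr (1 - p) * norm (g x) powr p"
  have ib: "integrable MO ?b" using f g by (simp add: Lp_space_integrable)
  have le: "norm (f x + g x) powr p \<le> ?b x" for x
    using powr_mono2[OF _ _ norm_triangle_ineq[of "f x" "g x"], of p]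
      powr_add_convex[of "norm (f x)" "norm (g x)" l p] p l by simp
  show i: "integrable MO (\<lambda>x. norm (f x + g x) powr p)"
  proof (rule Bochner_Integration.integrable_bound[OF ib])
    show "AE x in MO. norm (norm (f x + g x) powr p) \<le> norm (?b x)"
      using le by (auto intro: order_trans[OF le])
  qed (use f g in measurable)
  have "(LINT x|MO. norm (f x + g x) powr p) \<le> (LINT x|MO. ?b x)"
    by (intro integral_mono i ib le)
  then show "(LINT x|MO. norm (f x + g x) powr p) \<le>
       l powr (1 - p) * (LINT x|MO. norm (f x) powr p) + (1 - l) powr (1 - p) * (LINT x|MO. norm (g x) powr p)"
    using f g by (simp add: Lp_space_integrable)
qed

lemma Lp_space_add:
  assumes "f \<in> Lp_space p" "g \<in> Lp_space p" "1 \<le> p"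
  shows "(\<lambda>x. f x + g x) \<in> Lp_space p"
  using Lp_integral_add_bound(1)[OF assms, of "1/2"] assms by (intro Lp_spaceI) auto

lemma Lp_space_diff:
  assumes "f \<in> Lp_space p" "g \<in> Lp_space p" "1 \<le> p"
  shows "(\<lambda>x. f x - g x) \<in> Lp_space p"
  using Lp_space_add[OF assms(1) Lp_space_scale[OF assms(2), of "-1"]] assms by simp

lemma Lp_space_zero: "(\<lambda>x. 0) \<in> Lp_space p"
  by (intro Lp_spaceI) auto

lemma Lp_space_sum:
  assumes "\<And>i. i \<in> I \<Longrightarrow> f i \<in> Lp_space p" "1 \<le> p"
  shows "(\<lambda>x. \<Sum>i\<in>I. f i x) \<in> Lp_space p"
  using assms(1) by (induction I rule: infinite_finite_induct) (auto intro: Lp_space_zero Lp_space_add[OF _ _ assms(2)])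

text \<open>Integrate the convexity bound and optimise over the convex weight.\<close>
lemma Lp_norm_triangle:
  assumes f: "f \<in> Lp_space p" and g: "g \<in> Lp_space p" and p: "1 \<le> p"
  shows "Lp_norm p (\<lambda>x. f x + g x) \<le> Lp_norm p f + Lp_norm p g"
proof -
  let ?F = "Lp_norm p f" and ?G = "Lp_norm p g"
  \<comment> \<open>Strict majorants \<open>a\<close> and \<open>b\<close> of the two norms keep
    \<open>l\<close> strictly between 0 and 1 even if a norm vanishes; they are released at the
    end.\<close>
  have *: "Lp_norm p (\<lambda>x. f x + g x) \<le> a + b" if ab: "?F < a" "?G < b" for a b
  proof -
    have pos: "a > 0" "b > 0" using ab Lp_norm_nonneg[of p f] Lp_norm_nonneg[of p g] by linarith+
    \<comment> \<open>With this weight the two terms of the bound become \<open>a\<close> and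
      \<open>b\<close> times the common factor \<open>(a + b) powr (p - 1)\<close>.\<close>
    define l where "l = a / (a + b)"
    have l: "0 < l" "l < 1" "1 - l = b / (a + b)" using pos by (auto simp: l_def field_simps)
    have e: "(m / (a + b)) powr (1 - p) * m powr p = m * (a + b) powr (p - 1)" if "m > 0" for m
    proof -
      have "(m / (a + b)) powr (1 - p) * m powr p = m powr (1 - p) * m powr p / (a + b) powr (1 - p)"
        using that pos by (simp add: powr_divide)
      also have "m powr (1 - p) * m powr p = m" using that by (simp flip: powr_add)
      also have "m / (a + b) powr (1 - p) = m * (a + b) powr (p - 1)"
        by (metis minus_diff_eq powr_minus_divide divide_inverse mult.right_neutral powr_minus inverse_inverse_eq)
      finally show ?thesis .
    qed
    have "(LINT x|MO. norm (f x + g x) powr p) \<le>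
       l powr (1 - p) * (LINT x|MO. norm (f x) powr p) + (1 - l) powr (1 - p) * (LINT x|MO. norm (g x) powr p)"
      by (rule Lp_integral_add_bound[OF f g p l(1,2)])
    also have "\<dots> = l powr (1 - p) * ?F powr p + (1 - l) powr (1 - p) * ?G powr p"
      using p by (simp add: Lp_norm_powr)
    also have "\<dots> \<le> l powr (1 - p) * a powr p + (1 - l) powr (1 - p) * b powr p"
      using ab p by (intro add_mono mult_left_mono powr_mono2) auto
    also have "\<dots> = a * (a + b) powr (p - 1) + b * (a + b) powr (p - 1)"
      unfolding l(3) unfolding l_def using e pos by simp
    also have "\<dots> = (a + b) powr p"
      using pos by (simp add: powr_diff) (simp flip: add_divide_distrib distrib_right)
    finally show ?thesis using pos p by (subst Lp_norm_le_iff) auto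
  qed
  show ?thesis
  proof (rule field_le_epsilon)
    fix e :: real assume "0 < e"
    then show "Lp_norm p (\<lambda>x. f x + g x) \<le> ?F + ?G + e"
      using *[of "?F + e/2" "?G + e/2"] by (simp add: field_simps)
  qed
qed

lemma Lp_norm_triangle3:
  assumes "f \<in> Lp_space p" "g \<in> Lp_space p" "h \<in> Lp_space p" "1 \<le> p"
  shows "Lp_norm p (\<lambda>x. f x - h x) \<le> Lp_norm p (\<lambda>x. f x - g x) + Lp_norm p (\<lambda>x. g x - h x)"
  using Lp_norm_triangle[OF Lp_space_diff[OF assms(1,2,4)] Lp_space_diff[OF assms(2,3,4)] assms(4)] by simp

lemma Lp_norm_diff_le:
  assumes "f \<in> Lp_space p" "g \<in> Lp_space p" "1 \<le> p"
  shows "\<bar>Lp_norm p f - Lp_norm p g\<bar> \<le> Lp_norm p (\<lambda>x. f x - g x)"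
  using Lp_norm_triangle[OF Lp_space_diff[OF assms(1,2,3)] assms(2,3)]
    Lp_norm_triangle[OF Lp_space_diff[OF assms(2,1,3)] assms(1,3)] Lp_norm_minus[of p f g]
  by simp

text \<open>Young's inequality, applied after dividing by strict majorants of the norms; letting the
  majorants decrease to the norms covers vanishing norms without a case distinction.\<close>

lemma Holder_inner:
  fixes f g :: "real ^ 'd \<Rightarrow> 'b::euclidean_space"
  assumes f: "f \<in> Lp_space p" and g: "g \<in> Lp_space q" and pq: "1 < p" "1/p + 1/q = 1"
  shows "integrable MO (\<lambda>x. f x \<bullet> g x)" "\<bar>LINT x|MO. f x \<bullet> g x\<bar> \<le> Lp_norm p f * Lp_norm q g"
proof -
  have q: "1 < q" using pq by (smt (verit) divide_less_eq_1 less_divide_eq_1 zero_less_divide_1_iff divide_nonpos_pos divide_le_0_1_iff)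
  have y: "\<bar>u \<bullet> v\<bar> \<le> norm u powr p / p + norm v powr q / q" for u v :: 'b
    using Cauchy_Schwarz_ineq2[of u v] Youngs_inequality[of p q "norm u" "norm v"] pq q by simp
  have i: "integrable MO (\<lambda>x. f x \<bullet> g x)" if "f \<in> Lp_space p" "g \<in> Lp_space q" for f g :: "real ^ 'd \<Rightarrow> 'b"
  proof (rule Bochner_Integration.integrable_bound)
    show "integrable MO (\<lambda>x. norm (f x) powr p / p + norm (g x) powr q / q)"
      using that by (simp add: Lp_space_integrable)
    show "AE x in MO. norm (f x \<bullet> g x) \<le> norm (norm (f x) powr p / p + norm (g x) powr q / q)"
      using y by (auto intro!: AE_I2 order_trans[OF y] )
  qed (use that in measurable)
  show "integrable MO (\<lambda>x. f x \<bullet> g x)" by (rule i[OF f g])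
  have *: "\<bar>LINT x|MO. f x \<bullet> g x\<bar> \<le> a * b" if ab: "Lp_norm p f < a" "Lp_norm q g < b" for a b
  proof -
    have pos: "a > 0" "b > 0" using ab Lp_norm_nonneg[of p f] Lp_norm_nonneg[of q g] by linarith+
    let ?f = "\<lambda>x. (1/a) *\<^sub>R f x" and ?g = "\<lambda>x. (1/b) *\<^sub>R g x"
    have fg: "?f \<in> Lp_space p" "?g \<in> Lp_space q" using f g pq q by (auto intro!: Lp_space_scale)
    have n: "(LINT x|MO. norm (?f x) powr p) \<le> 1" "(LINT x|MO. norm (?g x) powr q) \<le> 1"
      using Lp_norm_le_iff[of p 1 ?f] Lp_norm_le_iff[of q 1 ?g] pq q ab pos
        Lp_norm_scale[of p "1/a" f] Lp_norm_scale[of q "1/b" g] by auto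
    have "\<bar>LINT x|MO. ?f x \<bullet> ?g x\<bar> \<le> (LINT x|MO. \<bar>?f x \<bullet> ?g x\<bar>)"
      by (rule integral_abs_bound)
    also have "\<dots> \<le> (LINT x|MO. norm (?f x) powr p / p + norm (?g x) powr q / q)"
      by (intro integral_mono integrable_abs i fg y Bochner_Integration.integrable_add integrable_divide Lp_space_integrable)
    also have "\<dots> = (LINT x|MO. norm (?f x) powr p) / p + (LINT x|MO. norm (?g x) powr q) / q"
      using fg by (subst Bochner_Integration.integral_add) (auto dest!: Lp_space_integrable)
    also have "\<dots> \<le> 1/p + 1/q" using n pq q by (intro add_mono divide_right_mono) auto
    finally have "\<bar>LINT x|MO. ?f x \<bullet> ?g x\<bar> \<le> 1" using pq by simp
    then show ?thesis using pos by (simp add: field_simps abs_mult)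
  qed
  show "\<bar>LINT x|MO. f x \<bullet> g x\<bar> \<le> Lp_norm p f * Lp_norm q g"
  proof (rule tendsto_lowerbound)
    show "((\<lambda>e. (Lp_norm p f + e) * (Lp_norm q g + e)) \<longlongrightarrow> Lp_norm p f * Lp_norm q g) (at_right 0)"
      by (auto intro!: tendsto_eq_intros)
    show "\<forall>\<^sub>F e in at_right 0. \<bar>LINT x|MO. f x \<bullet> g x\<bar> \<le> (Lp_norm p f + e) * (Lp_norm q g + e)"
      unfolding eventually_at_right_field using * by (auto intro!: exI[of _ 1])
  qed simp
qed

lemma Lp_dominated_convergence:
  fixes F :: "nat \<Rightarrow> real ^ 'd \<Rightarrow> 'b::euclidean_space"
  assumes F: "\<And>n. F n \<in> borel_measurable MO" and f: "f \<in> borel_measurable MO"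
    and lim: "AE x in MO. (\<lambda>n. F n x) \<longlonglongrightarrow> f x"
    and h: "h \<in> Lp_space p" and dom: "\<And>n. AE x in MO. norm (F n x) \<le> c * norm (h x)" and p: "1 \<le> p"
  shows "f \<in> Lp_space p" "\<And>n. F n \<in> Lp_space p" "(\<lambda>n. Lp_norm p (\<lambda>x. F n x - f x)) \<longlonglongrightarrow> 0"
proof -
  have domf: "AE x in MO. norm (f x) \<le> c * norm (h x)"
  proof -
    have "AE x in MO. \<forall>n. norm (F n x) \<le> c * norm (h x)" using dom by (simp add: AE_all_countable)
    with lim show ?thesis
    proof eventually_elim
      case (elim x)
      show ?case by (rule LIMSEQ_le_const2[OF tendsto_norm[OF elim(1)]]) (use elim(2) in auto)
    qed
  qed
  show fp: "f \<in> Lp_space p" by (rule Lp_space_bound[OF h f domf]) (use p in auto)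
  show Fp: "F n \<in> Lp_space p" for n by (rule Lp_space_bound[OF h F dom]) (use p in auto)
  have "(\<lambda>n. LINT x|MO. norm (F n x - f x) powr p) \<longlonglongrightarrow> (LINT (x::real^'d)|MO. 0)"
  proof (rule integral_dominated_convergence[where w="\<lambda>x. (2*\<bar>c\<bar>) powr p * norm (h x) powr p"])
    show "integrable MO (\<lambda>x. (2*\<bar>c\<bar>) powr p * norm (h x) powr p)"
      using h by (simp add: Lp_space_integrable)
    show "AE x in MO. (\<lambda>n. norm (F n x - f x) powr p) \<longlonglongrightarrow> 0"
      using lim
    proof eventually_elim
      case (elim x)
      then have "(\<lambda>n. norm (F n x - f x)) \<longlonglongrightarrow> 0" by (simp add: LIM_zero_iff tendsto_norm_zero)
      then have "(\<lambda>n. norm (F n x - f x) powr p) \<longlonglongrightarrow> 0 powr p"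
        by (rule tendsto_powr'[OF _ tendsto_const]) (use p in auto)
      then show ?case using p by simp
    qed
    show "AE x in MO. norm (norm (F n x - f x) powr p) \<le> (2*\<bar>c\<bar>) powr p * norm (h x) powr p" for n
      using dom[of n] domf
    proof eventually_elim
      case (elim x)
      have "c * norm (h x) \<le> \<bar>c\<bar> * norm (h x)" by (simp add: mult_right_mono)
      then have "norm (F n x - f x) \<le> 2 * \<bar>c\<bar> * norm (h x)"
        using elim norm_triangle_ineq4[of "F n x" "f x"] by linarith
      then have "norm (F n x - f x) powr p \<le> (2 * \<bar>c\<bar> * norm (h x)) powr p"
        using p by (intro powr_mono2) auto
      then show ?case by (simp add: powr_mult)
    qed
  qed (use F f in auto)
  then have "(\<lambda>n. LINT x|MO. norm (F n x - f x) powr p) \<longlonglongrightarrow> 0" by simp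
  then have "(\<lambda>n. (LINT x|MO. norm (F n x - f x) powr p) powr (1/p)) \<longlonglongrightarrow> 0 powr (1/p)"
    by (rule tendsto_powr'[OF _ tendsto_const])
       (use p in \<open>auto intro!: Bochner_Integration.integral_nonneg always_eventually\<close>)
  then show "(\<lambda>n. Lp_norm p (\<lambda>x. F n x - f x)) \<longlonglongrightarrow> 0" using p by (simp add: Lp_norm_def)
qed

section \<open>Completeness and extension of Lipschitz operators\<close>

text \<open>Fatou's lemma for the p-th powers. The bound is required only from \<open>k0\<close> on
  because the differences of a Cauchy sequence are small only from some index on.\<close>

lemma Lp_norm_le_if_converges_AE:
  fixes G :: "nat \<Rightarrow> real ^ 'd \<Rightarrow> 'b::euclidean_space"
  assumes G: "\<And>k. G k \<in> Lp_space p" and lim: "AE x in MO. (\<lambda>k. G k x) \<longlonglongrightarrow> f x"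
    and f: "f \<in> borel_measurable MO" and le: "\<And>k. k \<ge> k0 \<Longrightarrow> Lp_norm p (G k) \<le> c" and p: "1 \<le> p"
  shows "f \<in> Lp_space p" "Lp_norm p f \<le> c"
proof -
  have c: "0 \<le> c" using order_trans[OF Lp_norm_nonneg le[OF order_refl]] .
  have "(\<integral>\<^sup>+x. ennreal (norm (f x) powr p) \<partial>MO) = (\<integral>\<^sup>+x. liminf (\<lambda>k. ennreal (norm (G k x) powr p)) \<partial>MO)"
  proof (rule nn_integral_cong_AE, use lim in eventually_elim)
    case (elim x)
    have "(\<lambda>k. norm (G k x) powr p) \<longlonglongrightarrow> norm (f x) powr p"
      by (rule tendsto_powr'[OF tendsto_norm[OF elim] tendsto_const]) (use p in auto)
    then have "(\<lambda>k. ennreal (norm (G k x) powr p)) \<longlonglongrightarrow> ennreal (norm (f x) powr p)"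
      by (rule tendsto_ennrealI)
    then show ?case by (intro lim_imp_Liminf[symmetric]) auto
  qed
  also have "\<dots> \<le> liminf (\<lambda>k. \<integral>\<^sup>+x. ennreal (norm (G k x) powr p) \<partial>MO)"
    by (rule nn_integral_liminf) (use G in measurable)
  also have "\<dots> \<le> ennreal (c powr p)"
  proof (rule Liminf_le)
    show "\<forall>\<^sub>F k in sequentially. (\<integral>\<^sup>+x. ennreal (norm (G k x) powr p) \<partial>MO) \<le> ennreal (c powr p)"
      using eventually_ge_at_top[of k0]
    proof eventually_elim
      case (elim k)
      have "(LINT x|MO. norm (G k x) powr p) \<le> c powr p"
        using le[OF elim] p c by (simp add: Lp_norm_le_iff)
      then show ?case
        by (subst nn_integral_eq_integral) (use G[of k] in \<open>auto simp: Lp_space_integrable ennreal_leI\<close>)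
    qed
  qed simp
  finally have nn: "(\<integral>\<^sup>+x. ennreal (norm (f x) powr p) \<partial>MO) \<le> ennreal (c powr p)" .
  have int: "integrable MO (\<lambda>x. norm (f x) powr p)"
    by (rule integrableI_bounded) (use f nn in \<open>auto intro: le_less_trans\<close>)
  then show "f \<in> Lp_space p" using f by (intro Lp_spaceI)
  have "ennreal (LINT x|MO. norm (f x) powr p) \<le> ennreal (c powr p)"
    using nn by (subst (asm) nn_integral_eq_integral[OF int]) auto
  then have "(LINT x|MO. norm (f x) powr p) \<le> c powr p" by (simp add: ennreal_le_iff)
  then show "Lp_norm p f \<le> c" using p c by (simp add: Lp_norm_le_iff)
qed

lemma Lp_complete:
  fixes F :: "nat \<Rightarrow> real ^ 'd \<Rightarrow> 'b::euclidean_space"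
  assumes F: "\<And>n. F n \<in> Lp_space p" and p: "1 \<le> p"
    and Cauchy: "\<And>e. 0 < e \<Longrightarrow> \<exists>N. \<forall>m\<ge>N. \<forall>n\<ge>N. Lp_norm p (\<lambda>x. F m x - F n x) < e"
  shows "\<exists>f\<in>Lp_space p. (\<lambda>n. Lp_norm p (\<lambda>x. F n x - f x)) \<longlonglongrightarrow> 0"
proof -
  have "\<exists>r. \<forall>k. \<forall>m\<ge>r k. \<forall>n\<ge>r k. Lp_norm p (\<lambda>x. F m x - F n x) < (1/4)^k"
    using Cauchy by (intro choice) simp
  then obtain r0 where r0: "\<And>k m n. m \<ge> r0 k \<Longrightarrow> n \<ge> r0 k \<Longrightarrow> Lp_norm p (\<lambda>x. F m x - F n x) < (1/4)^k"
    by blast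
  \<comment> \<open>The partial sum makes \<open>r\<close> nondecreasing and at least
    \<open>r0\<close>; the summand \<open>k\<close> makes it at least the identity.\<close>
  define r where "r k = (\<Sum>j\<le>k. r0 j) + k" for k
  have r_ge: "r k \<ge> r0 k" "r (Suc k) \<ge> r k" "r k \<ge> k" for k
    using member_le_sum[of k "{..k}" r0] by (auto simp: r_def)
  define G where "G k = F (r k)" for k
  have G: "G k \<in> Lp_space p" for k unfolding G_def by (rule F)
  have d: "(LINT x|MO. norm (G (Suc k) x - G k x) powr p) \<le> ((1/4)^k) powr p" for k
  proof -
    have "Lp_norm p (\<lambda>x. G (Suc k) x - G k x) < (1/4)^k"
      unfolding G_def by (rule r0) (use r_ge[of k] in auto)
    then show ?thesis using p by (subst Lp_norm_le_iff[symmetric]) auto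
  qed
  \<comment> \<open>The factor \<open>2^k\<close> is affordable since the differences decay like
    \<open>(1/4)^k\<close>: the integrals of \<open>u k x powr p\<close> remain summable, so almost
    everywhere \<open>u k x\<close> is bounded in \<open>k\<close>, and the increments of
    \<open>G\<close> decay like \<open>(1/2)^k\<close>.\<close>
  define u where "u k x = 2^k * norm (G (Suc k) x - G k x)" for k x
  have u_int: "integrable MO (\<lambda>x. u k x powr p)" for k
    using Lp_space_integrable[OF Lp_space_diff[OF G G p, of "Suc k" k]] by (simp add: u_def powr_mult)
  have u_le: "(LINT x|MO. u k x powr p) \<le> (1/2)^k" for k
  proof -
    have "(LINT x|MO. u k x powr p) = (2^k) powr p * (LINT x|MO. norm (G (Suc k) x - G k x) powr p)"
      by (simp add: u_def powr_mult)
    also have "\<dots> \<le> (2^k) powr p * ((1/4)^k) powr p" by (intro mult_left_mono d) auto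
    also have "\<dots> = ((1/2)^k) powr p"
      by (simp flip: powr_mult power_mult_distrib)
    also have "\<dots> \<le> ((1/2)^k) powr 1" using p by (intro powr_mono') (auto simp: power_le_one)
    finally show ?thesis by simp
  qed
  have "(\<integral>\<^sup>+x. (\<Sum>k. ennreal (u k x powr p)) \<partial>MO) = (\<Sum>k. \<integral>\<^sup>+x. ennreal (u k x powr p) \<partial>MO)"
    using u_int by (intro nn_integral_suminf) auto
  also have "\<dots> \<le> (\<Sum>k. ennreal ((1/2)^k))"
    using u_le by (intro suminf_le) (auto simp: nn_integral_eq_integral[OF u_int] intro: ennreal_leI)
  also have "\<dots> < \<infinity>" by (subst suminf_ennreal2) auto
  finally have "AE x in MO. (\<Sum>k. ennreal (u k x powr p)) \<noteq> \<infinity>"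
    using u_int by (intro nn_integral_PInf_AE) auto
  then have conv: "AE x in MO. convergent (\<lambda>k. G k x)"
  proof eventually_elim
    case (elim x)
    define s where "s = enn2real (\<Sum>k. ennreal (u k x powr p))"
    have s: "(\<Sum>k. ennreal (u k x powr p)) = ennreal s"
      using elim by (simp add: s_def less_top)
    have "u k x powr p \<le> s" for k
    proof -
      have "ennreal (u k x powr p) = (\<Sum>k\<in>{k}. ennreal (u k x powr p))" by simp
      also have "\<dots> \<le> ennreal s" unfolding s[symmetric] by (rule sum_le_suminf) auto
      finally show ?thesis by (simp add: s_def ennreal_le_iff)
    qed
    then have us: "u k x \<le> s powr (1/p)" for k
      using powr_mono2[of "1/p" "u k x powr p" s] p by (simp add: powr_powr u_def)
    have "norm (G (Suc k) x - G k x) \<le> s powr (1/p) * (1/2)^k" for k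
      using us[of k] by (simp add: u_def field_simps power_divide)
    then have "summable (\<lambda>k. G (Suc k) x - G k x)"
      by (intro summable_comparison_test'[OF summable_mult[OF summable_geometric], where N=0]) auto
    then have "convergent (\<lambda>n. \<Sum>k<n. G (Suc k) x - G k x)" by (simp add: summable_iff_convergent)
    then have "convergent (\<lambda>n. (\<Sum>k<n. G (Suc k) x - G k x) + G 0 x)"
      by (rule convergent_add[OF _ convergent_const])
    moreover have "(\<Sum>k<n. G (Suc k) x - G k x) + G 0 x = G n x" for n
      using sum_lessThan_telescope[of "\<lambda>k. G k x" n] by simp
    ultimately show ?case by simp
  qed
  define f where "f x = lim (\<lambda>k. G k x)" for x
  have f: "f \<in> borel_measurable MO" unfolding f_def using G by (intro borel_measurable_lim_metric) auto
  have lim: "AE x in MO. (\<lambda>k. G k x) \<longlonglongrightarrow> f x"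
    using conv by eventually_elim (simp add: f_def convergent_LIMSEQ_iff)
  have *: "(\<lambda>x. F n x - f x) \<in> Lp_space p \<and> Lp_norm p (\<lambda>x. F n x - f x) \<le> e"
    if N: "\<forall>m\<ge>N. \<forall>n\<ge>N. Lp_norm p (\<lambda>x. F m x - F n x) < e" "n \<ge> N" for n N e
  proof -
    have A: "AE x in MO. (\<lambda>k. F n x - G k x) \<longlonglongrightarrow> F n x - f x"
      using lim by eventually_elim (intro tendsto_intros)
    have B: "Lp_norm p (\<lambda>x. F n x - G k x) \<le> e" if "k \<ge> N" for k
      using N that r_ge(3)[of k] unfolding G_def by (intro less_imp_le) auto
    have C: "(\<lambda>x. F n x - f x) \<in> borel_measurable MO" using F[of n] f by measurable
    have D: "(\<lambda>x. F n x - G k x) \<in> Lp_space p" for k by (rule Lp_space_diff[OF F G p])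
    show ?thesis
      using Lp_norm_le_if_converges_AE[where G="\<lambda>k x. F n x - G k x" and ?k0.0=N, OF D A C B p] by auto
  qed
  obtain N1 where N1: "\<forall>m\<ge>N1. \<forall>n\<ge>N1. Lp_norm p (\<lambda>x. F m x - F n x) < 1" using Cauchy[of 1] by auto
  \<comment> \<open>\<open>f\<close> is recovered as \<open>F N1 - (F N1 - f)\<close>, a difference
    of two elements of the space.\<close>
  have "f \<in> Lp_space p"
    using Lp_space_diff[OF F[of N1] conjunct1[OF *[OF N1 order_refl]] p] by simp
  moreover have "(\<lambda>n. Lp_norm p (\<lambda>x. F n x - f x)) \<longlonglongrightarrow> 0"
  proof (rule LIMSEQ_I)
    fix e :: real assume "0 < e"
    then obtain N where N: "\<forall>m\<ge>N. \<forall>n\<ge>N. Lp_norm p (\<lambda>x. F m x - F n x) < e/2" using Cauchy[of "e/2"] by auto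
    have "\<bar>Lp_norm p (\<lambda>x. F n x - f x)\<bar> < e" if "n \<ge> N" for n
      using *[OF N that] \<open>0 < e\<close> by simp
    then show "\<exists>no. \<forall>n\<ge>no. norm (Lp_norm p (\<lambda>x. F n x - f x) - 0) < e" by auto
  qed
  ultimately show ?thesis by blast
qed

text \<open>Only the Lipschitz bound is used, no linearity. The limits are unique merely up to null
  sets, so values are chosen; the Lipschitz bound passes to any choice.\<close>

lemma Lp_Lipschitz_extension:
  fixes T0 :: "(real ^ 'd \<Rightarrow> 'a::euclidean_space) \<Rightarrow> real ^ 'd \<Rightarrow> 'b::euclidean_space"
  assumes p: "1 \<le> p" and S: "S \<subseteq> Lp_space p" and K: "0 \<le> K"
    and dense: "\<And>f e. f \<in> Lp_space p \<Longrightarrow> 0 < e \<Longrightarrow> \<exists>g\<in>S. Lp_norm p (\<lambda>x. g x - f x) < e"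
    and T0: "\<And>f. f \<in> S \<Longrightarrow> T0 f \<in> Lp_space p"
    and Lip: "\<And>f g. f \<in> S \<Longrightarrow> g \<in> S \<Longrightarrow>
       Lp_norm p (\<lambda>x. T0 f x - T0 g x) \<le> K * Lp_norm p (\<lambda>x. f x - g x)"
  shows "\<exists>T. (\<forall>f\<in>Lp_space p. T f \<in> Lp_space p) \<and>
     (\<forall>f\<in>Lp_space p. \<forall>g\<in>Lp_space p. Lp_norm p (\<lambda>x. T f x - T g x) \<le> K * Lp_norm p (\<lambda>x. f x - g x)) \<and>
     (\<forall>f\<in>S. T f = T0 f)"
proof -
  define Q where "Q f h \<longleftrightarrow> h \<in> Lp_space p \<and> (\<exists>F. (\<forall>n::nat. F n \<in> S) \<and>
      (\<lambda>n. Lp_norm p (\<lambda>x. F n x - f x)) \<longlonglongrightarrow> 0 \<and> (\<lambda>n. Lp_norm p (\<lambda>x. T0 (F n) x - h x)) \<longlonglongrightarrow> 0)" for f h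
  have QS: "Q f (T0 f)" if "f \<in> S" for f
    unfolding Q_def using that T0 p by (auto intro!: exI[of _ "\<lambda>_. f"] simp: Lp_norm_def)
  have QE: "\<exists>h. Q f h" if f: "f \<in> Lp_space p" for f
  proof -
    have "\<exists>F. \<forall>n. F n \<in> S \<and> Lp_norm p (\<lambda>x. F n x - f x) < 1 / real (Suc n)"
      by (rule choice) (use dense[OF f] in \<open>auto simp: Bex_def\<close>)
    then obtain F where FS: "\<And>n. F n \<in> S" and F: "\<And>n. Lp_norm p (\<lambda>x. F n x - f x) < 1 / real (Suc n)" by blast
    have "Lp_norm p (\<lambda>x. F n x - f x) \<le> inverse (real (Suc n))" for n
      using less_imp_le[OF F[of n]] by (simp add: divide_inverse)
    then have lim: "(\<lambda>n. Lp_norm p (\<lambda>x. F n x - f x)) \<longlonglongrightarrow> 0"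
      by (intro tendsto_sandwich[OF _ _ tendsto_const LIMSEQ_inverse_real_of_nat] always_eventually allI) auto
    have "\<exists>N. \<forall>m\<ge>N. \<forall>n\<ge>N. Lp_norm p (\<lambda>x. T0 (F m) x - T0 (F n) x) < e" if e: "0 < e" for e
    proof -
      \<comment> \<open>\<open>K + 1\<close> instead of \<open>K\<close> keeps the quotient
        meaningful for \<open>K = 0\<close>.\<close>
      define e' where "e' = e / (2 * (K + 1))"
      have e': "e' > 0" using e K by (simp add: e'_def)
      obtain N where N: "\<And>n. n \<ge> N \<Longrightarrow> Lp_norm p (\<lambda>x. F n x - f x) < e'"
        using order_tendstoD(2)[OF lim e'] by (auto simp: eventually_sequentially)
      have "Lp_norm p (\<lambda>x. T0 (F m) x - T0 (F n) x) < e" if mn: "m \<ge> N" "n \<ge> N" for m n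
      proof -
        have "Lp_norm p (\<lambda>x. F m x - F n x) \<le> Lp_norm p (\<lambda>x. F m x - f x) + Lp_norm p (\<lambda>x. f x - F n x)"
          by (rule Lp_norm_triangle3) (use FS S f p in auto)
        also have "\<dots> \<le> 2 * e'" using N[OF mn(1)] N[OF mn(2)] Lp_norm_minus[of p f "F n"] by simp
        finally have "K * Lp_norm p (\<lambda>x. F m x - F n x) \<le> K * (2 * e')" using K by (rule mult_left_mono)
        also have "\<dots> < (K + 1) * (2 * e')" using e' by simp
        also have "\<dots> = e" using K e by (simp add: e'_def divide_simps)
        finally show ?thesis using Lip[OF FS FS, of m n] by simp
      qed
      then show ?thesis by blast
    qed
    then obtain h where "h \<in> Lp_space p" "(\<lambda>n. Lp_norm p (\<lambda>x. T0 (F n) x - h x)) \<longlonglongrightarrow> 0"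
      using Lp_complete[of "\<lambda>n. T0 (F n)" p] T0 FS p by blast
    then show ?thesis unfolding Q_def using FS lim by blast
  qed
  \<comment> \<open>The first branch makes \<open>T\<close> equal to \<open>T0\<close> on
    \<open>S\<close> as a function and not only almost everywhere.\<close>
  define T where "T f = (if f \<in> S then T0 f else (SOME h. Q f h))" for f
  have QT: "Q f (T f)" if "f \<in> Lp_space p" for f
    using QS[of f] someI_ex[OF QE[OF that]] by (simp add: T_def)
  have TLip: "Lp_norm p (\<lambda>x. T f x - T g x) \<le> K * Lp_norm p (\<lambda>x. f x - g x)"
    if f: "f \<in> Lp_space p" and g: "g \<in> Lp_space p" for f g
  proof -
    obtain F where F: "\<And>n::nat. F n \<in> S" "(\<lambda>n. Lp_norm p (\<lambda>x. F n x - f x)) \<longlonglongrightarrow> 0"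
      "(\<lambda>n. Lp_norm p (\<lambda>x. T0 (F n) x - T f x)) \<longlonglongrightarrow> 0" "T f \<in> Lp_space p"
      using QT[OF f] unfolding Q_def by blast
    obtain G where G: "\<And>n::nat. G n \<in> S" "(\<lambda>n. Lp_norm p (\<lambda>x. G n x - g x)) \<longlonglongrightarrow> 0"
      "(\<lambda>n. Lp_norm p (\<lambda>x. T0 (G n) x - T g x)) \<longlonglongrightarrow> 0" "T g \<in> Lp_space p"
      using QT[OF g] unfolding Q_def by blast
    let ?a = "\<lambda>n. Lp_norm p (\<lambda>x. T0 (F n) x - T f x)" and ?b = "\<lambda>n. Lp_norm p (\<lambda>x. T0 (G n) x - T g x)"
      and ?c = "\<lambda>n. Lp_norm p (\<lambda>x. F n x - f x)" and ?d = "\<lambda>n. Lp_norm p (\<lambda>x. G n x - g x)"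
    have "Lp_norm p (\<lambda>x. T f x - T g x) \<le> ?a n + ?b n + K * (?c n + ?d n + Lp_norm p (\<lambda>x. f x - g x))" for n
    proof -
      have i: "T0 (F n) \<in> Lp_space p" "T0 (G n) \<in> Lp_space p" "F n \<in> Lp_space p" "G n \<in> Lp_space p"
        using F(1) G(1) T0 S by auto
      note tr = Lp_norm_triangle3[OF _ _ _ p]
      have "Lp_norm p (\<lambda>x. T f x - T g x) \<le> ?a n + ?b n + Lp_norm p (\<lambda>x. T0 (F n) x - T0 (G n) x)"
        using tr[OF F(4) i(1) G(4)] tr[OF i(1,2) G(4)] Lp_norm_minus[of p "T f" "T0 (F n)"] by simp
      moreover have "Lp_norm p (\<lambda>x. F n x - G n x) \<le> ?c n + ?d n + Lp_norm p (\<lambda>x. f x - g x)"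
        using tr[OF i(3) f i(4)] tr[OF f g i(4)] Lp_norm_minus[of p "G n" g] by simp
      ultimately show ?thesis
        using Lip[OF F(1) G(1), of n n] mult_left_mono[OF _ K] by fastforce
    qed
    moreover have "(\<lambda>n. ?a n + ?b n + K * (?c n + ?d n + Lp_norm p (\<lambda>x. f x - g x))) \<longlonglongrightarrow>
        0 + 0 + K * (0 + 0 + Lp_norm p (\<lambda>x. f x - g x))"
      by (intro tendsto_intros F G)
    ultimately show ?thesis using LIMSEQ_le_const by fastforce
  qed
  have "T f \<in> Lp_space p" if "f \<in> Lp_space p" for f using QT[OF that] by (simp add: Q_def)
  moreover have "T f = T0 f" if "f \<in> S" for f using that by (simp add: T_def)
  ultimately show ?thesis using TLip by (intro exI[of _ T]) blast
qed

section \<open>The Bellman function\<close>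

text \<open>The exponents are related by equations rather than definitions, so that the locale can
  be instantiated with p and q exchanged when \<open>p < 2\<close>. The value of \<delta> is
  proportional to \<open>q - 1\<close>, the size of the convexity of |\<eta>|^q, and small enough to
  absorb the mixed second derivative.\<close>

locale bellman =
  fixes p q \<theta> \<delta> :: real
  assumes p: "2 \<le> p" and q_def: "q = p / (p - 1)" and th_def: "\<theta> = 1 - 2 / p"
    and dl_def: "\<delta> = (q - 1) / 8"
begin

lemma q: "1 < q" "q \<le> 2" and th: "0 \<le> \<theta>" "\<theta> < 1" and dl: "0 < \<delta>" "\<delta> \<le> 1/8"
  using p by (auto simp: q_def th_def dl_def field_simps)

text \<open>The form dual to \<open>th_def\<close>: it makes \<open>Q C powr \<theta>\<close> equal
  to |\<eta>|^(2 - q), as \<open>P A powr \<theta>\<close> is |\<zeta>|^(p - 2).\<close>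

lemma thq: "\<theta> = 2 / q - 1" using p by (auto simp: q_def th_def field_simps)

definition P where "P A = A powr (p/2)"
definition Q where "Q C = C powr (q/2)"
definition N where "N A C = P A + Q C"
definition T where "T A C = N A C powr \<theta>"
text \<open>The Bellman function of \<open>(\<zeta>, \<eta>)\<close> in the squared variables \<open>A = |\<zeta>|\<^sup>2\<close>, \<open>C = |\<eta>|\<^sup>2\<close>.\<close>
definition \<beta> where "\<beta> A C = Q C + \<delta> * A * T A C"
text \<open>The derivative of \<open>\<delta> * A * N powr \<theta>\<close> with respect to
  \<open>N\<close>. Hence differentiating \<beta> in \<open>C\<close> multiplies the derivative of
  \<open>Q\<close> by \<open>1 + \<kappa>\<close>.\<close>

definition \<kappa> where "\<kappa> A C = \<delta> * \<theta> * A * T A C / N A C"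
text \<open>The suffixes stand for partial derivatives of \<beta>; \<open>deriv_beta\<close>,
  \<open>deriv_betaA\<close> and \<open>deriv_betaC\<close> justify this. The quotient
  \<open>P A / N A C\<close> lies between 0 and 1, which makes the signs readable.\<close>

definition \<beta>A where "\<beta>A A C = \<delta> * T A C * (1 + (p/2 - 1) * P A / N A C)"
definition \<beta>C where "\<beta>C A C = (q/2) * (Q C / C) * (1 + \<kappa> A C)"
definition \<beta>AA where "\<beta>AA A C = \<delta> * (T A C / (4 * A)) * (p - 2) * (P A / N A C) * (p + 2 - 2 * (P A / N A C))"
definition \<beta>AC where "\<beta>AC A C = \<delta> * ((2 - q) / 2) * T A C * (Q C / N A C)\<^sup>2 / C"
definition \<beta>CC where "\<beta>CC A C = (q/4) * (Q C / C\<^sup>2) *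
   ((q - 2) + \<kappa> A C * ((q - 1) * (2 * (P A / N A C) - 1) - 1))"

section \<open>Size, gradient and Hessian of the Bellman function\<close>

lemma pos: "0 < A \<Longrightarrow> 0 < P A" "0 < C \<Longrightarrow> 0 < Q C" "0 < A \<Longrightarrow> 0 < C \<Longrightarrow> 0 < N A C"
   "0 < A \<Longrightarrow> 0 < C \<Longrightarrow> 0 < T A C"
  by (simp_all add: P_def Q_def N_def T_def add_pos_pos) (smt (verit) powr_gt_zero)

text \<open>\<open>A\<close> is the power \<open>2 / p\<close> of \<open>P A\<close>, and
  \<open>2 / p + \<theta> = 1\<close>; replacing \<open>P A\<close> by the larger
  \<open>N A C\<close> gives the bound.\<close>

lemma AT_le: assumes "0 < A" "0 < C" shows "A * T A C \<le> N A C"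
proof -
  have "A = P A powr (2/p)" using assms p by (simp add: P_def powr_powr)
  also have "\<dots> \<le> N A C powr (2/p)" using pos assms p by (intro powr_mono2) (auto simp: N_def less_imp_le)
  finally have "A * T A C \<le> N A C powr (2/p) * N A C powr \<theta>"
    unfolding T_def by (rule mult_right_mono) simp
  also have "\<dots> = N A C" using pos(3)[OF assms] by (simp add: th_def flip: powr_add)
  finally show ?thesis .
qed

lemma C_eq: "0 < C \<Longrightarrow> C = Q C * Q C powr \<theta>"
  using q pos(2)[of C] by (simp add: thq Q_def powr_powr flip: powr_add) (simp add: field_simps)

text \<open>By \<open>C_eq\<close> the left side is \<open>Q C powr \<theta> * Q C\<close>, and
  \<open>T\<close> is the same power of the larger \<open>N\<close>.\<close>

lemma C_le: assumes "0 < A" "0 < C" shows "C \<le> T A C * Q C"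
proof -
  have "Q C powr \<theta> \<le> T A C" unfolding T_def using pos assms th by (intro powr_mono2) (auto simp: N_def less_imp_le)
  then show ?thesis using C_eq[OF assms(2)] pos(2)[OF assms(2)] by (metis mult.commute mult_le_cancel_left_pos)
qed

text \<open>Of one factor \<open>Q C\<close> the power \<open>1 - \<theta>\<close> is estimated by
  \<open>N\<close> and the power \<theta> is kept; by \<open>C_eq\<close> the latter completes the
  other factor \<open>Q C\<close> to \<open>C\<close>.\<close>

lemma TQ_le: assumes "0 < A" "0 < C" shows "T A C * Q C ^ 2 \<le> C * N A C"
proof -
  have N: "N A C > 0" and Q: "Q C > 0" using pos assms by auto
  have "Q C powr (1 - \<theta>) \<le> N A C powr (1 - \<theta>)"
    using pos assms th by (intro powr_mono2) (auto simp: N_def less_imp_le)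
  then have "Q C \<le> N A C powr (1 - \<theta>) * Q C powr \<theta>"
    using Q mult_right_mono[of "Q C powr (1 - \<theta>)" "N A C powr (1 - \<theta>)" "Q C powr \<theta>"] by (simp flip: powr_add)
  then have "T A C * Q C \<le> N A C * Q C powr \<theta>"
    using mult_left_mono[of "Q C" _ "T A C"] N unfolding T_def by (fastforce simp: mult.assoc[symmetric] simp flip: powr_add)
  then have "Q C * (T A C * Q C) \<le> Q C * (N A C * Q C powr \<theta>)" using Q by (intro mult_left_mono) auto
  also have "\<dots> = C * N A C" using C_eq[OF assms(2)] by (simp add: mult_ac)
  finally show ?thesis by (simp add: power2_eq_square mult_ac)
qed

lemma kappa: assumes "0 < A" "0 < C" shows "0 \<le> \<kappa> A C" "\<kappa> A C \<le> 1/8"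
proof -
  have N: "N A C > 0" and T: "T A C > 0" using pos assms by auto
  then show "0 \<le> \<kappa> A C" using assms th dl by (simp add: \<kappa>_def)
  have "A * T A C / N A C \<le> 1" using AT_le[OF assms] N by simp
  then have "(\<delta> * \<theta>) * (A * T A C / N A C) \<le> (1/8 * 1) * 1"
    using th dl N T assms by (intro mult_mono) auto
  then show "\<kappa> A C \<le> 1/8" by (simp add: \<kappa>_def)
qed

text \<open>The bounds contain \<open>T\<close> and \<open>1 / T\<close>, which is what lets
  \<open>T\<close> cancel when two energies are multiplied.\<close>

lemma beta_grad_lower:
  assumes "0 < A" "0 < C"
  shows "\<delta> * T A C \<le> \<beta>A A C" "1 / (2 * T A C) \<le> \<beta>C A C"
proof -
  have N: "N A C > 0" "T A C > 0" "P A > 0" "Q C > 0" using pos assms by auto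
  have "\<delta> * T A C * 1 \<le> \<beta>A A C" unfolding \<beta>A_def using N dl p by (intro mult_left_mono) auto
  then show "\<delta> * T A C \<le> \<beta>A A C" by simp
  have "1 / T A C \<le> Q C / C" using C_le[OF assms] N assms by (simp add: field_simps)
  then have "(1/2) * (1 / T A C) * 1 \<le> \<beta>C A C" unfolding \<beta>C_def
    using N assms q kappa[OF assms] by (intro mult_mono) auto
  then show "1 / (2 * T A C) \<le> \<beta>C A C" by simp
qed

text \<open>With \<open>a\<close>, \<open>c\<close> the inner products of two vectors with their
  velocities and \<open>z\<close>, \<open>y\<close> the squared speeds, the right side is the second
  derivative of \<beta> along a line, and the hypotheses on \<open>a\<close> and \<open>c\<close>
  are the Cauchy-Schwarz inequality. The term with \<open>\<beta>AA\<close> is nonnegative and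
  dropped; the one with \<open>\<beta>CC\<close> is nonpositive and compensated by
  \<open>\<beta>C\<close>; the mixed one is absorbed by completing a square.\<close>

lemma beta_Hessian_lower:
  assumes A: "0 < A" and C: "0 < C" and a: "a\<^sup>2 \<le> A * z" and c: "c\<^sup>2 \<le> C * y" and zy: "0 \<le> z" "0 \<le> y"
  shows "\<delta> * T A C * z + 3 * \<delta> * y / T A C \<le>
    4 * \<beta>AA A C * a\<^sup>2 + 8 * \<beta>AC A C * a * c + 4 * \<beta>CC A C * c\<^sup>2 + 2 * \<beta>A A C * z + 2 * \<beta>C A C * y"
proof -
  let ?N = "N A C" and ?T = "T A C" and ?Q = "Q C" and ?k = "\<kappa> A C"
  define w where "w = P A / ?N"
  have N: "?N > 0" "?T > 0" "P A > 0" "?Q > 0" using pos A C by auto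
  have w: "0 < w" "w < 1" using N by (auto simp: w_def N_def)
  note k = kappa[OF A C]
  have 1: "0 \<le> 4 * \<beta>AA A C * a\<^sup>2"
    unfolding \<beta>AA_def w_def[symmetric] using w p dl N A by (intro mult_nonneg_nonneg) auto
  have 2: "2 * \<delta> * ?T * z \<le> 2 * \<beta>A A C * z"
    using mult_right_mono[OF beta_grad_lower(1)[OF A C] zy(1)] by simp
  have 3: "7 / 8 * q * (q - 1) * y / ?T \<le> 4 * \<beta>CC A C * c\<^sup>2 + 2 * \<beta>C A C * y"
  proof -
    have "(q - 1) * (2 * w - 1) \<le> (q - 1) * 1" using w q by (intro mult_left_mono) auto
    then have "(q - 1) * (2 * w - 1) \<le> 1" by (rule order_trans) (use q in simp)
    then have "(q - 1) * (2 * w - 1) - 1 \<le> 0" by simp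
    then have "?k * ((q - 1) * (2 * w - 1) - 1) \<le> 0" using k by (simp add: mult_nonneg_nonpos)
    then have "\<beta>CC A C \<le> 0" unfolding \<beta>CC_def w_def[symmetric] using q N C
      by (intro mult_nonneg_nonpos) auto
    \<comment> \<open>Since \<open>\<beta>CC\<close> is nonpositive, the largest admissible
      \<open>c\<^sup>2\<close> is the worst case.\<close>
    then have "4 * \<beta>CC A C * (C * y) \<le> 4 * \<beta>CC A C * c\<^sup>2"
      using c by (simp add: mult_left_mono_neg)
    moreover have "4 * \<beta>CC A C * (C * y) + 2 * \<beta>C A C * y = (?Q / C) * q * y * ((q - 1) * (1 + ?k * (2 * w - 1)))"
      unfolding \<beta>CC_def \<beta>C_def w_def[symmetric] using C by (simp add: field_simps power2_eq_square)
    moreover have "(1 / ?T) * q * y * ((q - 1) * (7/8)) \<le> (?Q / C) * q * y * ((q - 1) * (1 + ?k * (2 * w - 1)))"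
    proof (intro mult_mono)
      show "1 / ?T \<le> ?Q / C" using C_le[OF A C] N C by (simp add: field_simps)
      \<comment> \<open>\<open>1 - 2 * w\<close> is at most 1 and \<open>\<kappa>\<close> at most
        1/8; this is the origin of the factor 7/8.\<close>
      have "?k * (1 - 2 * w) \<le> ?k * 1" using k w by (intro mult_left_mono) auto
      then show "7/8 \<le> 1 + ?k * (2 * w - 1)" using k(2) by (simp add: algebra_simps)
    qed (use q zy N C in auto)
    ultimately show ?thesis by (simp add: mult_ac)
  qed
  have 4: "- \<delta> * ?T * z - 4 * \<delta> * (2 - q)\<^sup>2 * y / ?T \<le> 8 * \<beta>AC A C * a * c"
  proof -
    let ?b = "\<beta>AC A C"
    \<comment> \<open>The square is completed in \<open>a\<close>: half of the available
      \<open>2 * \<delta> * T * z\<close> pays for it, and the remainder is a multiple of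
      \<open>c\<^sup>2\<close>.\<close>
    have "0 \<le> \<delta> * ?T / A * (a + 4 * ?b * c * A / (\<delta> * ?T))\<^sup>2" using dl N A by simp
    also have "\<dots> = \<delta> * ?T * (a\<^sup>2 / A) + 8 * ?b * a * c + 16 * ?b\<^sup>2 * A / (\<delta> * ?T) * c\<^sup>2"
      using dl N A by (simp add: field_simps power2_eq_square)
    finally have "- (\<delta> * ?T * (a\<^sup>2 / A)) - 16 * ?b\<^sup>2 * A / (\<delta> * ?T) * c\<^sup>2 \<le> 8 * ?b * a * c" by simp
    moreover have "\<delta> * ?T * (a\<^sup>2 / A) \<le> \<delta> * ?T * z"
      using a dl N A by (intro mult_left_mono) (auto simp: field_simps)
    moreover have "16 * ?b\<^sup>2 * A / (\<delta> * ?T) * c\<^sup>2 \<le> 16 * ?b\<^sup>2 * A / (\<delta> * ?T) * (C * y)"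
      using c dl N A by (intro mult_left_mono) auto
    moreover have "16 * ?b\<^sup>2 * A / (\<delta> * ?T) * (C * y) = 4 * \<delta> * (2 - q)\<^sup>2 * y * (?T * ?Q^4 * A / (C * ?N^4))"
      using dl N A C unfolding \<beta>AC_def by (simp add: field_simps power2_eq_square power4_eq_xxxx)
    moreover have "4 * \<delta> * (2 - q)\<^sup>2 * y * (?T * ?Q^4 * A / (C * ?N^4)) \<le> 4 * \<delta> * (2 - q)\<^sup>2 * y * (1 / ?T)"
    proof (rule mult_left_mono)
      \<comment> \<open>Three bounds are multiplied: \<open>A * T\<close> by \<open>N\<close>,
        \<open>T * Q\<^sup>2\<close> by \<open>C * N\<close>, and \<open>Q\<^sup>2\<close> by
        \<open>N\<^sup>2\<close>.\<close>
      have "?Q \<le> ?N" using N by (simp add: N_def)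
      then have "?Q^2 \<le> ?N^2" using N by (intro power_mono) auto
      then have "(A * ?T) * ((?T * ?Q^2) * ?Q^2) \<le> ?N * ((C * ?N) * ?N^2)"
        by (rule mult_mono[OF AT_le[OF A C] mult_mono[OF TQ_le[OF A C]]]) (use A C N in auto)
      then show "?T * ?Q^4 * A / (C * ?N^4) \<le> 1 / ?T"
        using N C by (simp add: field_simps power2_eq_square power4_eq_xxxx)
    qed (use dl zy in auto)
    ultimately show ?thesis by simp
  qed
  have 5: "3 * \<delta> * y / ?T \<le> 7 / 8 * q * (q - 1) * y / ?T - 4 * \<delta> * (2 - q)\<^sup>2 * y / ?T"
  proof -
    \<comment> \<open>This is the factored form of \<open>7 * q - 4 * (2 - q)\<^sup>2 - 3\<close>.
      The choice of \<delta> makes \<open>7 / 8 * q * (q - 1)\<close> equal to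
      \<open>7 * q * \<delta>\<close>, so that a multiple 3 of \<delta> is left over.\<close>
    have "0 \<le> (q - 1) * (19 - 4 * q)" using q by simp
    then have "3 \<le> 7 * q - 4 * (2 - q)\<^sup>2" by (simp add: power2_eq_square algebra_simps)
    then have "3 * (\<delta> * y / ?T) \<le> (7 * q - 4 * (2 - q)\<^sup>2) * (\<delta> * y / ?T)"
      using dl zy N by (intro mult_right_mono) auto
    moreover have "7 / 8 * q * (q - 1) * y / ?T = 7 * q * (\<delta> * y / ?T)" by (simp add: dl_def)
    moreover have "4 * \<delta> * (2 - q)\<^sup>2 * y / ?T = 4 * (2 - q)\<^sup>2 * (\<delta> * y / ?T)" "3 * \<delta> * y / ?T = 3 * (\<delta> * y / ?T)"
      by simp_all
    ultimately show ?thesis by (simp only: left_diff_distrib)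
  qed
  from 1 2 3 4 5 show ?thesis by linarith
qed

text \<open>As \<open>AT_le\<close>, but up to the boundary of the quadrant, because the arguments
  may vanish once the regularisation is removed; the rest is
  \<open>\<delta> \<le> 1/8\<close>.\<close>

lemma beta_upper:
  assumes "0 \<le> A" "0 \<le> C"
  shows "\<beta> A C \<le> 1/8 * A powr (p/2) + 9/8 * C powr (q/2)"
proof -
  have "A * T A C \<le> N A C"
  proof (cases "A = 0")
    case False
    then have N: "N A C > 0" using assms by (simp add: N_def P_def Q_def add_pos_nonneg)
    have "A = P A powr (2/p)" using assms p by (simp add: P_def powr_powr)
    also have "\<dots> \<le> N A C powr (2/p)" using p by (intro powr_mono2) (auto simp: N_def P_def Q_def)
    finally have "A * T A C \<le> N A C powr (2/p) * N A C powr \<theta>"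
      unfolding T_def by (rule mult_right_mono) simp
    also have "\<dots> = N A C" using N by (simp add: th_def flip: powr_add)
    finally show ?thesis .
  qed (use assms in \<open>simp add: N_def P_def Q_def\<close>)
  then have "\<delta> * (A * T A C) \<le> 1/8 * N A C"
    using dl assms by (intro mult_mono) (auto simp: T_def)
  then show ?thesis by (simp add: \<beta>_def N_def P_def Q_def)
qed

section \<open>Derivatives of the Bellman function along a curve\<close>

lemma deriv_PQ:
  assumes A: "(A has_real_derivative A1) (at s)" "0 < A s" and C: "(C has_real_derivative C1) (at s)" "0 < C s"
  shows "((\<lambda>s. P (A s)) has_real_derivative (p/2) * P (A s) / A s * A1) (at s)"
    and "((\<lambda>s. Q (C s)) has_real_derivative (q/2) * Q (C s) / C s * C1) (at s)"
    and "((\<lambda>s. N (A s) (C s)) has_real_derivative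
        (p/2) * P (A s) / A s * A1 + (q/2) * Q (C s) / C s * C1) (at s)"
    and "((\<lambda>s. T (A s) (C s)) has_real_derivative
        \<theta> * T (A s) (C s) / N (A s) (C s) * ((p/2) * P (A s) / A s * A1 + (q/2) * Q (C s) / C s * C1)) (at s)"
proof -
  have pw: "((\<lambda>s. f s powr r) has_real_derivative r * f s powr r / f s * f1) (at s)"
    if "(f has_real_derivative f1) (at s)" "0 < f s" for f f1 and r :: real
    by (rule DERIV_cong[OF DERIV_fun_powr[OF that]]) (use that in \<open>simp add: powr_diff\<close>)
  show 1: "((\<lambda>s. P (A s)) has_real_derivative (p/2) * P (A s) / A s * A1) (at s)"
    unfolding P_def by (rule pw[OF A])
  show 2: "((\<lambda>s. Q (C s)) has_real_derivative (q/2) * Q (C s) / C s * C1) (at s)"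
    unfolding Q_def by (rule pw[OF C])
  show 3: "((\<lambda>s. N (A s) (C s)) has_real_derivative
        (p/2) * P (A s) / A s * A1 + (q/2) * Q (C s) / C s * C1) (at s)"
    unfolding N_def by (rule DERIV_add[OF 1 2])
  show "((\<lambda>s. T (A s) (C s)) has_real_derivative
        \<theta> * T (A s) (C s) / N (A s) (C s) * ((p/2) * P (A s) / A s * A1 + (q/2) * Q (C s) / C s * C1)) (at s)"
    unfolding T_def by (rule pw[OF 3]) (use pos A C in simp)
qed

text \<open>Here \<open>m\<close> and \<open>n\<close> are the logarithmic derivatives of
  \<open>P\<close> and \<open>Q\<close> along the curve, \<open>w\<close> is the share of
  \<open>P\<close> in \<open>N\<close>, and \<open>r = 1 / p\<close>. In these variables the powers
  disappear, and the derivative formulas below become polynomial identities.\<close>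

lemma log_derivatives:
  assumes "0 < a" "0 < c"
  obtains r w m n where "p * r = 1" "q * (1 - r) = 1" "\<theta> = 1 - 2 * r"
     "P a = w * N a c" "Q c = (1 - w) * N a c" "(A1 :: real) = 2 * r * m * a" "(C1 :: real) = 2 * (1 - r) * n * c"
     "p / 2 * P a / a * A1 = w * N a c * m" "q / 2 * Q c / c * C1 = (1 - w) * N a c * n"
proof (rule that[of "1/p" "P a / N a c" "(p/2) * A1 / a" "(q/2) * C1 / c"])
  have N: "N a c \<noteq> 0" using pos assms by (metis less_irrefl)
  have q1: "1 - 1/p = 1/q" using p by (auto simp: q_def field_simps)
  show "q * (1 - 1 / p) = 1" unfolding q1 using q by simp
  show "C1 = 2 * (1 - 1 / p) * (q / 2 * C1 / c) * c" unfolding q1 using assms q by simp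
  show Q: "Q c = (1 - P a / N a c) * N a c"
    using N by (simp add: left_diff_distrib) (simp add: N_def)
  show "q / 2 * Q c / c * C1 = (1 - P a / N a c) * N a c * (q / 2 * C1 / c)"
    unfolding Q[symmetric] by simp
  show "p / 2 * P a / a * A1 = P a / N a c * N a c * (p / 2 * A1 / a)" using N by simp
  show "P a = P a / N a c * N a c" using N by simp
qed (use p assms in \<open>auto simp: th_def\<close>)

lemma deriv_beta:
  assumes A: "(A has_real_derivative A1) (at s)" "0 < A s" and C: "(C has_real_derivative C1) (at s)" "0 < C s"
  shows "((\<lambda>s. \<beta> (A s) (C s)) has_real_derivative \<beta>A (A s) (C s) * A1 + \<beta>C (A s) (C s) * C1) (at s)"
proof -
  note d = deriv_PQ[OF assms]
  obtain r w m n where e: "p * r = 1" "q * (1 - r) = 1" "\<theta> = 1 - 2 * r"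
     "P (A s) = w * N (A s) (C s)" "Q (C s) = (1 - w) * N (A s) (C s)" "A1 = 2 * r * m * A s" "C1 = 2 * (1 - r) * n * C s"
     "p / 2 * P (A s) / A s * A1 = w * N (A s) (C s) * m" "q / 2 * Q (C s) / C s * C1 = (1 - w) * N (A s) (C s) * n"
    using log_derivatives[OF A(2) C(2)] by metis
  have nz: "N (A s) (C s) \<noteq> 0" "A s \<noteq> 0" "C s \<noteq> 0" using pos(3)[OF A(2) C(2)] A C by auto
  \<comment> \<open>\<open>L\<close> is the logarithmic derivative of \<open>N\<close>, the mean of
    \<open>m\<close> and \<open>n\<close> with weights \<open>w\<close> and
    \<open>1 - w\<close>.\<close>
  define L where "L = w * m + (1 - w) * n"
  have dN: "w * N (A s) (C s) * m + (1 - w) * N (A s) (C s) * n = N (A s) (C s) * L" by (simp add: L_def algebra_simps)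
  note d = d[unfolded e(8,9) dN]
  have bC: "\<beta>C (A s) (C s) * C1 = (1 - w) * N (A s) (C s) * n * (1 + \<kappa> (A s) (C s))"
    unfolding \<beta>C_def e(9)[symmetric] by simp
  have k: "\<kappa> (A s) (C s) * N (A s) (C s) = \<delta> * \<theta> * A s * T (A s) (C s)" using nz by (simp add: \<kappa>_def)
  have "\<beta>A (A s) (C s) * A1 = \<delta> * T (A s) (C s) * (1 + (p/2 - 1) * w) * (2 * r * m * A s)"
    unfolding \<beta>A_def e(4,6) using nz by simp
  also have "\<dots> = \<delta> * T (A s) (C s) * (2 * r * A s + \<theta> * A s * w) * m"
    using e(1,3) by algebra
  finally have bA: "\<beta>A (A s) (C s) * A1 = \<delta> * T (A s) (C s) * (2 * r * A s + \<theta> * A s * w) * m" .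
  show ?thesis unfolding \<beta>_def
    apply (rule DERIV_cong[OF DERIV_add[OF d(2) DERIV_mult[OF DERIV_cmult[OF A(1)] d(4)]]])
    unfolding bA bC unfolding e(6) using nz(1) apply simp unfolding L_def using k by algebra
qed

lemma deriv_betaA:
  assumes A: "(A has_real_derivative A1) (at s)" "0 < A s" and C: "(C has_real_derivative C1) (at s)" "0 < C s"
  shows "((\<lambda>s. \<beta>A (A s) (C s)) has_real_derivative \<beta>AA (A s) (C s) * A1 + \<beta>AC (A s) (C s) * C1) (at s)"
proof -
  note d = deriv_PQ[OF assms]
  obtain r w m n where e: "p * r = 1" "q * (1 - r) = 1" "\<theta> = 1 - 2 * r"
     "P (A s) = w * N (A s) (C s)" "Q (C s) = (1 - w) * N (A s) (C s)" "A1 = 2 * r * m * A s" "C1 = 2 * (1 - r) * n * C s"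
     "p / 2 * P (A s) / A s * A1 = w * N (A s) (C s) * m" "q / 2 * Q (C s) / C s * C1 = (1 - w) * N (A s) (C s) * n"
    using log_derivatives[OF A(2) C(2)] by metis
  have nz: "N (A s) (C s) \<noteq> 0" "A s \<noteq> 0" "C s \<noteq> 0" using pos(3)[OF A(2) C(2)] A C by auto
  define L where "L = w * m + (1 - w) * n"
  have dN: "w * N (A s) (C s) * m + (1 - w) * N (A s) (C s) * n = N (A s) (C s) * L" by (simp add: L_def algebra_simps)
  note d = d[unfolded e(8,9) dN]
  have g: "((\<lambda>s. 1 + (p/2 - 1) * P (A s) / N (A s) (C s)) has_real_derivative (p/2 - 1) * w * (m - L)) (at s)"
    apply (rule DERIV_cong[OF DERIV_add[OF DERIV_const DERIV_divide[OF DERIV_cmult[OF d(1)] d(3) nz(1)]]])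
    unfolding e(4) using nz(1) by (simp add: field_simps)
  have w: "1 + (p/2 - 1) * P (A s) / N (A s) (C s) = 1 + (p/2 - 1) * w" unfolding e(4) using nz by simp
  have t: "\<theta> * T (A s) (C s) / N (A s) (C s) * (N (A s) (C s) * L) = \<theta> * T (A s) (C s) * L" using nz by simp
  have 1: "\<beta>AA (A s) (C s) * A1 = \<delta> * T (A s) (C s) * (p - 2) * w * (p + 2 - 2 * w) * r * m / 2"
    unfolding \<beta>AA_def e(4,6) using nz by simp
  have 2: "\<beta>AC (A s) (C s) * C1 = \<delta> * (2 - q) * T (A s) (C s) * (1 - w)\<^sup>2 * (1 - r) * n"
    unfolding \<beta>AC_def e(5,7) using nz by simp
  have 3: "\<theta> * L * (1 + (p/2 - 1) * w) + (p/2 - 1) * w * (m - L)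
     = (p - 2) * w * (p + 2 - 2 * w) * r * m / 2 + (2 - q) * (1 - w)\<^sup>2 * (1 - r) * n"
  proof -
    have "2 - q = q * \<theta>" using e(2,3) by algebra
    then have x: "(2 - q) * (1 - w)\<^sup>2 * (1 - r) * n = \<theta> * (1 - w)\<^sup>2 * n" using e(2) by algebra
    have y: "(p - 2) * w * (p + 2 - 2 * w) * r * m / 2 = \<theta> * w * (p/2 + 1 - w) * m" using e(1,3) by algebra
    have z: "p/2 - 1 = \<theta> * (p/2)" using e(1,3) by algebra
    show ?thesis unfolding x y unfolding z L_def using e(1,3) by algebra
  qed
  show ?thesis unfolding \<beta>A_def
    apply (rule DERIV_cong[OF DERIV_mult[OF DERIV_cmult[OF d(4)] g]])
    unfolding 1 2 w t using 3 by algebra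
qed

text \<open>The coefficient of \<open>A1\<close> is the same \<open>\<beta>AC\<close> as in
  \<open>deriv_betaA\<close>: the two mixed derivatives agree because
  \<open>2 - q = q * \<theta>\<close>.\<close>

lemma deriv_betaC:
  assumes A: "(A has_real_derivative A1) (at s)" "0 < A s" and C: "(C has_real_derivative C1) (at s)" "0 < C s"
  shows "((\<lambda>s. \<beta>C (A s) (C s)) has_real_derivative \<beta>AC (A s) (C s) * A1 + \<beta>CC (A s) (C s) * C1) (at s)"
proof -
  note d = deriv_PQ[OF assms]
  obtain r w m n where e: "p * r = 1" "q * (1 - r) = 1" "\<theta> = 1 - 2 * r"
     "P (A s) = w * N (A s) (C s)" "Q (C s) = (1 - w) * N (A s) (C s)" "A1 = 2 * r * m * A s" "C1 = 2 * (1 - r) * n * C s"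
     "p / 2 * P (A s) / A s * A1 = w * N (A s) (C s) * m" "q / 2 * Q (C s) / C s * C1 = (1 - w) * N (A s) (C s) * n"
    using log_derivatives[OF A(2) C(2)] by metis
  have nz: "N (A s) (C s) \<noteq> 0" "A s \<noteq> 0" "C s \<noteq> 0" using pos(3)[OF A(2) C(2)] A C by auto
  define L where "L = w * m + (1 - w) * n"
  have dN: "w * N (A s) (C s) * m + (1 - w) * N (A s) (C s) * n = N (A s) (C s) * L" by (simp add: L_def algebra_simps)
  note d = d[unfolded e(8,9) dN]
  define G k where "G = Q (C s) / C s" and "k = \<kappa> (A s) (C s)"
  have t: "\<theta> * T (A s) (C s) / N (A s) (C s) * (N (A s) (C s) * L) = \<theta> * T (A s) (C s) * L" using nz by simp
  have dG: "((\<lambda>s. Q (C s) / C s) has_real_derivative G * (n - 2 * (1 - r) * n)) (at s)"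
    apply (rule DERIV_cong[OF DERIV_divide[OF d(2) C(1) nz(3)]])
    unfolding e(5,7) G_def using nz by (simp add: field_simps)
  \<comment> \<open>\<open>\<kappa>\<close> is a constant times \<open>A * T / N\<close>, so its
    logarithmic derivative is the sum of those of \<open>A\<close> and \<open>T\<close> minus that
    of \<open>N\<close>.\<close>
  have dk: "((\<lambda>s. \<kappa> (A s) (C s)) has_real_derivative k * (2 * r * m + \<theta> * L - L)) (at s)"
    unfolding \<kappa>_def
    apply (rule DERIV_cong[OF DERIV_divide[OF DERIV_mult[OF DERIV_cmult[OF A(1)] d(4)] d(3) nz(1)]])
    unfolding t e(6) k_def \<kappa>_def using nz by (simp add: field_simps)
  have q2: "2 - q = q * \<theta>" using e(2,3) by algebra
  have 1: "\<beta>AC (A s) (C s) * A1 = q * k * G * (1 - w) * r * m"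
    unfolding \<beta>AC_def G_def k_def \<kappa>_def e(5,6) q2 using nz by (simp add: field_simps power2_eq_square)
  have 2: "\<beta>CC (A s) (C s) * C1 = (q/2) * G * ((1 - r) * n) * ((q - 2) + k * ((q - 1) * (2 * w - 1) - 1))"
    unfolding \<beta>CC_def G_def k_def[symmetric] e(7) e(4) using nz by (simp add: field_simps power2_eq_square)
  have 3: "(n - 2 * (1 - r) * n) * (1 + k) + k * (2 * r * m + \<theta> * L - L)
     = 2 * k * (1 - w) * r * m + (1 - r) * n * ((q - 2) + k * ((q - 1) * (2 * w - 1) - 1))"
    unfolding L_def using e(2,3) by algebra
  show ?thesis unfolding \<beta>C_def
    apply (rule DERIV_cong[OF DERIV_mult[OF DERIV_cmult[OF dG] DERIV_add[OF DERIV_const dk]]])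
    unfolding 1 2 G_def[symmetric] k_def[symmetric] using 3 by algebra
qed

end

section \<open>One-dimensional Laguerre functions\<close>

text \<open>This family contains the Laguerre functions and is closed under differentiation and under
  multiplication by powers of \<open>x\<close>, which reduces the one-dimensional theory to polynomial identities.\<close>
definition lf :: "real \<Rightarrow> real poly \<Rightarrow> real \<Rightarrow> real" where
  "lf s P x = x powr s * poly P (x\<^sup>2) * exp (- x\<^sup>2 / 2)"

text \<open>Polynomial part of the derivative: once \<open>x powr (s - 1)\<close> and the Gaussian
  are split off, \<open>s * P + y * (2 * P' - P)\<close> with \<open>y = x\<^sup>2\<close>
  remains.\<close>

definition lfD :: "real \<Rightarrow> real poly \<Rightarrow> real poly" where
  "lfD s P = smult s P + pCons 0 (2 * pderiv P - P)"

lemma lf_measurable [measurable]: "lf s P \<in> borel_measurable borel"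
proof -
  have [measurable]: "(\<lambda>x. poly P (x\<^sup>2)) \<in> borel_measurable borel" "(\<lambda>x::real. exp (- x\<^sup>2 / 2)) \<in> borel_measurable borel"
    by (intro borel_measurable_continuous_onI continuous_intros; simp)+
  show ?thesis unfolding lf_def[abs_def] by measurable
qed

lemma lf_smult: "lf s (smult c P) x = c * lf s P x"
  by (simp add: lf_def)

lemma lf_shift: "0 < x \<Longrightarrow> lf (s + 1) P x = x * lf s P x" "0 < x \<Longrightarrow> lf (s - 1) P x = lf s P x / x"
  by (simp_all add: lf_def powr_add powr_diff)

lemma lf_X: "0 < x \<Longrightarrow> lf s (pCons 0 P) x = lf (s + 2) P x"
  by (simp add: lf_def powr_add power2_eq_square flip: powr_realpow)

lemma lf_deriv:
  assumes x: "0 < x"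
  shows "(lf s P has_real_derivative lf (s - 1) (lfD s P) x) (at x)"
proof -
  have "(lf s P has_real_derivative
      (s * x powr (s - 1) * poly P (x\<^sup>2) + x powr s * (poly (pderiv P) (x\<^sup>2) * (2 * x))) * exp (- x\<^sup>2 / 2)
       + x powr s * poly P (x\<^sup>2) * (exp (- x\<^sup>2 / 2) * (- x))) (at x)"
    unfolding lf_def[abs_def]
    by (rule derivative_eq_intros refl poly_DERIV[THEN DERIV_chain2] has_real_derivative_powr | simp add: x)+
  moreover have "x powr s = x * x powr (s - 1)" using x by (simp add: powr_diff)
  ultimately show ?thesis
    by (simp add: lf_def lfD_def algebra_simps power2_eq_square)
qed

lemma lf_isCont: "0 < x \<Longrightarrow> isCont (lf s P) x"
  using lf_deriv DERIV_isCont by blast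

text \<open>The inequality \<open>u \<le> exp u\<close> at \<open>u = x\<^sup>2 / (2 * s)\<close>,
  raised to the power \<open>s / 2\<close>. The summand 1 serves \<open>s = 0\<close>, where
  \<open>(2 * s) powr (s/2)\<close> is \<open>0 powr 0 = 0\<close>.\<close>

lemma powr_le_exp:
  assumes "0 \<le> s" "0 < (x::real)"
  shows "x powr s \<le> (1 + (2 * s) powr (s/2)) * exp (x\<^sup>2 / 4)"
proof (cases "s = 0")
  case False
  then have s: "s > 0" using assms by simp
  have "x\<^sup>2 / (2 * s) \<le> exp (x\<^sup>2 / (2 * s))" using exp_ge_add_one_self[of "x\<^sup>2 / (2 * s)"] by linarith
  then have "(x\<^sup>2 / (2 * s)) powr (s/2) \<le> exp (x\<^sup>2 / (2 * s)) powr (s/2)"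
    using s by (intro powr_mono2) auto
  also have "\<dots> = exp (x\<^sup>2 / 4)" using s by (simp add: exp_powr_real field_simps)
  also have "(x\<^sup>2 / (2 * s)) powr (s/2) = x powr s / (2 * s) powr (s/2)"
    using s assms by (simp add: powr_divide powr_powr flip: powr_numeral)
  finally have "x powr s \<le> (2 * s) powr (s/2) * exp (x\<^sup>2 / 4)"
    using s by (simp add: field_simps)
  also have "\<dots> \<le> (1 + (2 * s) powr (s/2)) * exp (x\<^sup>2 / 4)" by (intro mult_right_mono) auto
  finally show ?thesis .
next
  case True
  then show ?thesis using assms by simp
qed

text \<open>Half of the exponent is given up to absorb the powers of \<open>x\<close>. Removing the
  constant coefficient replaces \<open>s\<close> by \<open>s + 2\<close>, hence the induction with
  \<open>s\<close> arbitrary.\<close>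

lemma lf_bound:
  assumes "0 \<le> s"
  shows "\<exists>M\<ge>0. \<forall>x>0. \<bar>lf s P x\<bar> \<le> M * exp (- x\<^sup>2 / 4)"
  using assms
proof (induction P arbitrary: s)
  case 0
  show ?case by (auto simp: lf_def intro!: exI[of _ 0])
next
  case (pCons c P)
  obtain M where M: "M \<ge> 0" "\<And>x. x > 0 \<Longrightarrow> \<bar>lf (s+2) P x\<bar> \<le> M * exp (- x\<^sup>2 / 4)"
    using pCons.IH[of "s+2"] pCons.prems by auto
  define K where "K = 1 + (2 * s) powr (s/2)"
  have "\<bar>lf s (pCons c P) x\<bar> \<le> (\<bar>c\<bar> * K + M) * exp (- x\<^sup>2 / 4)" if x: "x > 0" for x
  proof -
    have "lf s (pCons c P) x = c * (x powr s * exp (- x\<^sup>2 / 2)) + lf (s+2) P x"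
      using lf_X[OF x, of s P] by (simp add: lf_def algebra_simps)
    then have "\<bar>lf s (pCons c P) x\<bar> \<le> \<bar>c\<bar> * (x powr s * exp (- x\<^sup>2 / 2)) + \<bar>lf (s+2) P x\<bar>"
      by (metis abs_mult abs_triangle_ineq abs_of_nonneg exp_ge_zero mult_nonneg_nonneg powr_ge_zero)
    moreover have "x powr s * exp (- x\<^sup>2 / 2) \<le> K * exp (x\<^sup>2 / 4) * exp (- x\<^sup>2 / 2)"
      unfolding K_def using powr_le_exp[OF pCons.prems x] by (intro mult_right_mono) auto
    moreover have "\<dots> = K * exp (- x\<^sup>2 / 4)"
      by (simp add: mult.assoc flip: exp_add)
    ultimately have "\<bar>lf s (pCons c P) x\<bar> \<le> \<bar>c\<bar> * (K * exp (- x\<^sup>2 / 4)) + M * exp (- x\<^sup>2 / 4)"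
      using M(2)[OF x] by (smt (verit) abs_ge_zero mult_left_mono)
    then show ?thesis by (simp add: algebra_simps)
  qed
  moreover have "\<bar>c\<bar> * K + M \<ge> 0" using M by (simp add: K_def)
  ultimately show ?case by blast
qed

text \<open>Completing the square bounds the Gaussian by a multiple of
  \<open>exp (- \<bar>x\<bar>)\<close>, which is put together from two half-lines.\<close>

lemma gaussian_integrable:
  assumes "0 < c"
  shows "integrable lborel (\<lambda>x::real. exp (- c * x\<^sup>2))"
proof -
  have "(\<lambda>x::real. exp (- x)) absolutely_integrable_on {0..}"
    using integrable_on_exp_minus_to_infinity[of 1 0] by (intro nonnegative_absolutely_integrable_1) auto
  then have "integrable lborel (\<lambda>x::real. indicator {0..} x *\<^sub>R exp (- x))"
    unfolding set_integrable_def by (subst (asm) integrable_completion) auto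
  then have 2: "integrable lborel (\<lambda>x::real. indicator {0..} x *\<^sub>R exp (- x) + indicator {0..} (-x) *\<^sub>R exp (- (-x)))"
    using lborel_integrable_real_affine[of "\<lambda>x::real. indicator {0..} x *\<^sub>R exp (- x)" "-1" 0]
    by (intro Bochner_Integration.integrable_add) simp_all
  show ?thesis
  proof (rule Bochner_Integration.integrable_bound[OF integrable_mult_right[OF 2, of "exp (1 / (4*c))"]])
    show "AE x in lborel. norm (exp (- c * x\<^sup>2)) \<le>
       norm (exp (1 / (4*c)) * (indicator {0..} x *\<^sub>R exp (- x) + indicator {0..} (-x) *\<^sub>R exp (- (-x))))"
    proof (intro AE_I2)
      fix x :: real
      have "0 \<le> c * (\<bar>x\<bar> - 1/(2*c))\<^sup>2" using assms by simp
      also have "\<dots> = c * x\<^sup>2 - \<bar>x\<bar> + 1 / (4*c)" using assms by (simp add: power2_diff field_simps power2_eq_square)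
      finally have "exp (- c * x\<^sup>2) \<le> exp (1/(4*c)) * exp (- \<bar>x\<bar>)" by (simp flip: exp_add)
      also have "exp (- \<bar>x\<bar>) \<le> indicator {0..} x *\<^sub>R exp (- x) + indicator {0..} (-x) *\<^sub>R exp (- (-x))"
        by (auto simp: indicator_def)
      finally show "norm (exp (- c * x\<^sup>2)) \<le>
         norm (exp (1 / (4*c)) * (indicator {0..} x *\<^sub>R exp (- x) + indicator {0..} (-x) *\<^sub>R exp (- (-x))))"
        by (simp add: indicator_def)
    qed
  qed simp
qed

lemma lf_mult_bound:
  assumes "0 \<le> s" "0 \<le> t"
  shows "\<exists>M\<ge>0. \<forall>x>0. \<bar>lf s P x * lf t Q x\<bar> \<le> M * exp (- x\<^sup>2 / 2)"
proof -
  obtain M1 where 1: "M1 \<ge> 0" "\<And>x. x > 0 \<Longrightarrow> \<bar>lf s P x\<bar> \<le> M1 * exp (- x\<^sup>2 / 4)" using lf_bound[OF assms(1)] by blast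
  obtain M2 where 2: "M2 \<ge> 0" "\<And>x. x > 0 \<Longrightarrow> \<bar>lf t Q x\<bar> \<le> M2 * exp (- x\<^sup>2 / 4)" using lf_bound[OF assms(2)] by blast
  have "\<bar>lf s P x * lf t Q x\<bar> \<le> (M1 * M2) * exp (- x\<^sup>2 / 2)" if x: "x > 0" for x
  proof -
    have "\<bar>lf s P x * lf t Q x\<bar> \<le> (M1 * exp (- x\<^sup>2 / 4)) * (M2 * exp (- x\<^sup>2 / 4))"
      unfolding abs_mult using 1 2 x by (intro mult_mono) auto
    also have "\<dots> = (M1 * M2) * exp (- x\<^sup>2 / 2)" by (simp add: mult_ac flip: exp_add)
    finally show ?thesis .
  qed
  then show ?thesis using 1(1) 2(1) by (intro exI[of _ "M1 * M2"]) auto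
qed

lemma lf_mult_integrable:
  assumes "0 \<le> s" "0 \<le> t"
  shows "set_integrable lborel {0<..} (\<lambda>x. lf s P x * lf t Q x)"
proof -
  obtain M where M: "M \<ge> 0" "\<And>x. x > 0 \<Longrightarrow> \<bar>lf s P x * lf t Q x\<bar> \<le> M * exp (- x\<^sup>2 / 2)"
    using lf_mult_bound[OF assms] by blast
  have "integrable lborel (\<lambda>x::real. M * exp (- (1/2) * x\<^sup>2))"
    by (intro integrable_mult_right gaussian_integrable) simp
  then show ?thesis unfolding set_integrable_def
    by (rule Bochner_Integration.integrable_bound) (use M in \<open>auto simp: indicator_def\<close>)
qed

text \<open>The integrand is the derivative of \<open>lf s P * lf (s + 1) Q\<close>, which has a
  factor \<open>x\<close> to spare at 0 and Gaussian decay at infinity. The hypothesis keeps the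
  exponent \<open>s - 1\<close> nonnegative; for Laguerre functions of type \<open>a\<close> it
  reads \<open>a \<ge> 1/2\<close>.\<close>

lemma lf_integral_by_parts:
  assumes True: "1 \<le> s"
  shows "(LBINT x:{0<..}. lf (s - 1) (lfD s P) x * lf (s + 1) Q x + lf s P x * lf s (lfD (s + 1) Q) x) = 0"
proof -
  have s: "0 < s" using True by simp
  let ?f = "\<lambda>x. lf (s - 1) (lfD s P) x * lf (s + 1) Q x + lf s P x * lf s (lfD (s + 1) Q) x"
  let ?F = "\<lambda>x. lf s P x * lf (s + 1) Q x"
  obtain M where M: "M \<ge> 0" "\<And>x. x > 0 \<Longrightarrow> \<bar>lf s P x * lf s Q x\<bar> \<le> M * exp (- x\<^sup>2 / 2)"
    using lf_mult_bound[of s s] s by fastforce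
  obtain M' where M': "M' \<ge> 0" "\<And>x. x > 0 \<Longrightarrow> \<bar>?F x\<bar> \<le> M' * exp (- x\<^sup>2 / 2)"
    using lf_mult_bound[of s "s+1"] s by fastforce
  have "(LBINT x=0..\<infinity>. ?f x) = 0 - 0"
  proof (rule interval_integral_FTC_integrable)
    show "(?F has_vector_derivative ?f x) (at x)" if "0 < ereal x" for x
      unfolding has_real_derivative_iff_has_vector_derivative[symmetric]
      by (rule DERIV_cong[OF DERIV_mult[OF lf_deriv lf_deriv]]) (use that in auto)
    show "isCont ?f x" if "0 < ereal x" for x
      using that by (intro isCont_add isCont_mult lf_isCont) auto
    have "einterval 0 \<infinity> = {0<..}" by (auto simp: einterval_def)
    moreover have "set_integrable lborel {0<..} ?f"
      by (intro set_integral_add lf_mult_integrable) (use True in auto)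
    ultimately show "set_integrable lborel (einterval 0 \<infinity>) ?f" by simp
    have "(?F \<longlongrightarrow> 0) (at_right 0)"
    proof (rule tendsto_rabs_zero_cancel, rule tendsto_sandwich[OF _ _ tendsto_const])
      show "\<forall>\<^sub>F x in at_right 0. \<bar>?F x\<bar> \<le> M * x"
        unfolding eventually_at_right_field
      proof (intro exI[of _ 1] conjI allI impI)
        fix x :: real assume x: "0 < x" "x < 1"
        have "\<bar>?F x\<bar> = x * \<bar>lf s P x * lf s Q x\<bar>" using x by (simp add: lf_shift abs_mult)
        also have "\<dots> \<le> x * (M * 1)"
          using M x by (intro mult_left_mono order_trans[OF M(2)]) auto
        finally show "\<bar>?F x\<bar> \<le> M * x" by (simp add: mult.commute)
      qed simp
      show "((\<lambda>x. M * x) \<longlongrightarrow> 0) (at_right 0)" by (auto intro!: tendsto_eq_intros)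
    qed (auto intro: always_eventually)
    then show "((?F \<circ> real_of_ereal) \<longlongrightarrow> 0) (at_right 0)"
      by (simp add: ereal_tendsto_simps zero_ereal_def)
    have "(?F \<longlongrightarrow> 0) at_top"
    proof (rule tendsto_rabs_zero_cancel, rule tendsto_sandwich[OF _ _ tendsto_const])
      show "\<forall>\<^sub>F x in at_top. \<bar>?F x\<bar> \<le> M' * exp (- x)"
        using eventually_ge_at_top[of 2]
      proof eventually_elim
        case (elim x)
        have "\<bar>?F x\<bar> \<le> M' * exp (- x\<^sup>2 / 2)" using M'(2)[of x] elim by simp
        also have "\<dots> \<le> M' * exp (- x)" using elim M'(1) by (intro mult_left_mono) (auto simp: power2_eq_square)
        finally show ?case .
      qed
      show "((\<lambda>x. M' * exp (- x)) \<longlongrightarrow> 0) at_top"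
        by (rule tendsto_mult_right_zero[OF filterlim_compose[OF exp_at_bot filterlim_uminus_at_bot_at_top]])
    qed (auto intro: always_eventually)
    then show "((?F \<circ> real_of_ereal) \<longlongrightarrow> 0) (at_left \<infinity>)"
      by (simp add: ereal_tendsto_simps)
  qed auto
  then show ?thesis by (simp add: interval_lebesgue_integral_0_infty)
qed

section \<open>Laguerre polynomials: differential equation, ladder relation, orthonormality\<close>

definition lpoly :: "nat \<Rightarrow> real \<Rightarrow> real poly" where
  "lpoly n a = (\<Sum>j\<le>n. monom ((- 1) ^ j * ((real n + a) gchoose (n - j)) / fact j) j)"

lemma poly_lpoly: "poly (lpoly n a) x = laguerre_poly n a x"
  by (simp add: lpoly_def laguerre_poly_def poly_sum poly_monom)

lemma coeff_lpoly: "coeff (lpoly n a) j = (if j \<le> n then (- 1) ^ j * ((real n + a) gchoose (n - j)) / fact j else 0)"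
  by (simp add: lpoly_def coeff_sum if_distrib sum.delta cong: if_cong)

text \<open>\<open>n + a\<close> does not change when \<open>n\<close> decreases and
  \<open>a\<close> increases by 1, so the binomial coefficients on both sides are the same.\<close>

lemma pderiv_lpoly: "pderiv (lpoly n a) = (if n = 0 then 0 else - lpoly (n - 1) (a + 1))"
proof (cases n)
  case (Suc m)
  show ?thesis
    by (rule poly_eqI) (simp add: coeff_pderiv coeff_lpoly Suc add_ac divide_simps)
qed (simp add: lpoly_def pderiv_monom)

text \<open>Comparing coefficients leaves the two-term recurrence \<open>rec\<close>. Below the top
  degree it is the absorption identity of binomial coefficients; from the top degree on both sides
  vanish.\<close>

lemma laguerre_ODE:
  "pCons 0 (pderiv (pderiv (lpoly n a))) + smult (a + 1) (pderiv (lpoly n a)) - pCons 0 (pderiv (lpoly n a))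
    + smult (real n) (lpoly n a) = 0"
proof (rule poly_eqI)
  fix j
  have rec: "(real j + 1) * (real j + 1 + a) * coeff (lpoly n a) (Suc j) = - (real n - real j) * coeff (lpoly n a) j" for j
  proof (cases "j < n")
    case True
    then obtain m where m: "n = j + Suc m" by (metis add_Suc_right less_imp_Suc_add)
    define g where "g k = ((real n + a) gchoose k)" for k
    have g: "real (Suc m) * g (Suc m) = (a + 1 + real j) * g m"
      using gbinomial_mult_1[of "real n + a" m] unfolding g_def by (simp add: algebra_simps m)
    have c: "coeff (lpoly n a) j = (- 1) ^ j * g (Suc m) / fact j"
      "coeff (lpoly n a) (Suc j) = - ((- 1) ^ j * g m / (fact j * (real j + 1)))"
      by (simp_all add: coeff_lpoly g_def m add_ac mult_ac)
    have "(real j + 1) * (real j + 1 + a) * coeff (lpoly n a) (Suc j) = - ((- 1) ^ j / fact j * ((a + 1 + real j) * g m))"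
      unfolding c by (simp add: field_simps add_nonneg_eq_0_iff)
    also have "\<dots> = - (real n - real j) * coeff (lpoly n a) j"
      unfolding g[symmetric] c by (simp add: m field_simps)
    finally show ?thesis .
  qed (auto simp: coeff_lpoly)
  show "coeff (pCons 0 (pderiv (pderiv (lpoly n a))) + smult (a + 1) (pderiv (lpoly n a)) - pCons 0 (pderiv (lpoly n a))
    + smult (real n) (lpoly n a)) j = coeff 0 j"
    using rec[of j] by (cases j) (simp_all add: coeff_pCons coeff_pderiv algebra_simps)
qed

definition lnorm :: "real \<Rightarrow> nat \<Rightarrow> real" where
  "lnorm a n = sqrt (2 * fact n / Gamma (real n + a + 1))"

definition lfP :: "real \<Rightarrow> nat \<Rightarrow> real poly" where "lfP a n = smult (lnorm a n) (lpoly n a)"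

lemma laguerre_fun1_lf: "laguerre_fun1 a n = lf (a + 1/2) (lfP a n)"
  by (rule ext) (simp add: laguerre_fun1_def lf_def lfP_def lnorm_def poly_lpoly mult_ac)

lemma lfP_ODE: "pCons 0 (pderiv (pderiv (lfP a n))) + smult (a + 1) (pderiv (lfP a n)) - pCons 0 (pderiv (lfP a n))
    + smult (real n) (lfP a n) = 0"
proof -
  have "smult (lnorm a n) (pCons 0 (pderiv (pderiv (lpoly n a))) + smult (a + 1) (pderiv (lpoly n a)) - pCons 0 (pderiv (lpoly n a))
    + smult (real n) (lpoly n a)) = 0" by (simp only: laguerre_ODE smult_0_right)
  then show ?thesis by (simp add: lfP_def smult_add_right smult_diff_right pderiv_smult mult.commute)
qed

lemma lnorm_Suc: "lnorm a (Suc n) = sqrt (real (Suc n)) * lnorm (a + 1) n"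
  by (simp add: lnorm_def add_ac flip: real_sqrt_mult)

lemma pderiv_lfP: "pderiv (lfP a n) = (if n = 0 then 0 else smult (- sqrt n) (lfP (a + 1) (n - 1)))"
  by (cases n) (simp_all add: lfP_def pderiv_smult pderiv_lpoly lnorm_Suc)

text \<open>In the variable \<open>x\<^sup>2\<close> this is the Laguerre equation; it makes the
  functions eigenfunctions of the one-dimensional operator with potential
  \<open>x\<^sup>2 + (a\<^sup>2 - 1/4) / x\<^sup>2\<close>.\<close>

lemma lfD_lfD_lfP:
  assumes "s = a + 1/2" "0 < x"
  shows "lf (s - 1 - 1) (lfD (s - 1) (lfD s (lfP a n))) x =
    (x\<^sup>2 + (a\<^sup>2 - 1/4) / x\<^sup>2 - (4 * real n + 2 * a + 2)) * lf s (lfP a n) x"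
proof -
  let ?P = "lfP a n" and ?y = "x\<^sup>2"
  have ode: "?y * poly (pderiv (pderiv ?P)) ?y + (a + 1) * poly (pderiv ?P) ?y - ?y * poly (pderiv ?P) ?y
    + real n * poly ?P ?y = 0"
    using arg_cong[OF lfP_ODE[of a n], of "\<lambda>p. poly p ?y"] by simp
  have "poly (lfD (s - 1) (lfD s ?P)) ?y = (?y * ?y + (a\<^sup>2 - 1/4) - (4 * real n + 2 * a + 2) * ?y) * poly ?P ?y"
    unfolding lfD_def assms(1) using ode
    by (simp add: pderiv_add pderiv_diff pderiv_smult pderiv_pCons pderiv_mult) algebra
  moreover have "x powr (s - 1 - 1) = x powr s / ?y" using assms(2) by (simp add: powr_diff power2_eq_square)
  moreover have "(?y * ?y + (a\<^sup>2 - 1/4) - (4 * real n + 2 * a + 2) * ?y) = ?y * (?y + (a\<^sup>2 - 1/4) / ?y - (4 * real n + 2 * a + 2))"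
    using assms(2) by (simp add: field_simps)
  ultimately show ?thesis using assms(2) by (simp add: lf_def)
qed

text \<open>The coefficient \<open>x - s / x\<close> cancels the terms that come from
  differentiating \<open>x powr s\<close> and the Gaussian; only the derivative of the polynomial
  survives.\<close>

lemma lf_delta:
  assumes "0 < x"
  shows "lf (s - 1) (lfD s P) x + (x - s / x) * lf s P x = lf (s + 1) (2 * pderiv P) x"
  using assms by (simp add: lf_def lfD_def powr_diff powr_add field_simps power2_eq_square)

text \<open>For \<open>n = 0\<close> the truncated \<open>n - 1\<close> is harmless, because the
  factor \<open>sqrt n\<close> vanishes.\<close>

lemma lf_delta_lfP:
  assumes "0 < x" "s = a + 1/2"
  shows "lf (s - 1) (lfD s (lfP a n)) x + (x - s / x) * lf s (lfP a n) x =
     - 2 * sqrt n * lf (a + 1 + 1/2) (lfP (a + 1) (n - 1)) x"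
  unfolding lf_delta[OF assms(1)] using assms(2) by (simp add: pderiv_lfP lf_def add_ac)


text \<open>By \<open>lf_delta\<close> the left side pairs the images of the n-th and the m-th
  function under the first order operator. Integration by parts moves the operator from the first
  factor to the second, where the differential equation gives the multiple \<open>4 * m\<close> of
  the m-th function.\<close>

lemma lfP_ladder:
  assumes "1/2 < a"
  shows "(LBINT x:{0<..}. lf (a + 1/2 + 1) (2 * pderiv (lfP a n)) x * lf (a + 1/2 + 1) (2 * pderiv (lfP a m)) x)
    = 4 * real m * (LBINT x:{0<..}. lf (a + 1/2) (lfP a n) x * lf (a + 1/2) (lfP a m) x)"
proof -
  define s where "s = a + 1/2"
  define P Q where "P = lfP a n" and "Q = 2 * pderiv (lfP a m)"
  have s: "1 \<le> s" using assms by (simp add: s_def)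
  have eq: "lf (s - 1) (lfD s P) x * lf (s + 1) Q x + lf s P x * lf s (lfD (s + 1) Q) x
      = lf (s + 1) (2 * pderiv P) x * lf (s + 1) Q x - 4 * real m * (lf s P x * lf s (lfP a m) x)" if x: "x > 0" for x
  proof -
    let ?y = "x\<^sup>2" and ?P = "lfP a m"
    have ode: "?y * poly (pderiv (pderiv ?P)) ?y + (a + 1) * poly (pderiv ?P) ?y - ?y * poly (pderiv ?P) ?y
      + real m * poly ?P ?y = 0"
      using arg_cong[OF lfP_ODE[of a m], of "\<lambda>p. poly p ?y"] by simp
    have "poly (lfD (s + 1) Q) ?y = (?y - s) * poly Q ?y - 4 * real m * poly ?P ?y"
      unfolding lfD_def s_def Q_def using ode
      by (simp add: pderiv_add pderiv_diff pderiv_smult pderiv_pCons pderiv_mult) algebra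
    \<comment> \<open>That is, the adjoint \<open>- d/dx + x - s / x\<close> maps
      \<open>lf (s + 1) Q\<close> to \<open>4 * m\<close> times the m-th function.\<close>
    then have E: "lf s (lfD (s + 1) Q) x = (x - s / x) * lf (s + 1) Q x - 4 * real m * lf s ?P x"
    proof -
      assume a: "poly (lfD (s + 1) Q) ?y = (?y - s) * poly Q ?y - 4 * real m * poly ?P ?y"
      have "lf s (lfD (s + 1) Q) x = (?y - s) * lf s Q x - 4 * real m * lf s ?P x"
        unfolding lf_def a by (simp add: algebra_simps)
      also have "?y - s = (x - s / x) * x" using x by (simp add: field_simps power2_eq_square)
      finally show ?thesis using lf_shift(1)[OF x, of s Q] by simp
    qed
    show ?thesis unfolding lf_delta[OF x, symmetric] E by (simp only: algebra_simps)
  qed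
  have i: "set_integrable lborel {0<..} (\<lambda>x. lf (s + 1) (2 * pderiv P) x * lf (s + 1) Q x)"
     "set_integrable lborel {0<..} (\<lambda>x. 4 * real m * (lf s P x * lf s (lfP a m) x))"
    using s by (intro set_integrable_mult_right lf_mult_integrable; simp)+
  have "0 = (LBINT x:{0<..}. lf (s - 1) (lfD s P) x * lf (s + 1) Q x + lf s P x * lf s (lfD (s + 1) Q) x)"
    using lf_integral_by_parts[OF s] by simp
  also have "\<dots> = (LBINT x:{0<..}. lf (s + 1) (2 * pderiv P) x * lf (s + 1) Q x - 4 * real m * (lf s P x * lf s (lfP a m) x))"
    by (intro set_lebesgue_integral_cong) (use eq in auto)
  also have "\<dots> = (LBINT x:{0<..}. lf (s + 1) (2 * pderiv P) x * lf (s + 1) Q x)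
     - (LBINT x:{0<..}. 4 * real m * (lf s P x * lf s (lfP a m) x))"
    by (rule set_integral_diff(2)[OF i])
  finally show ?thesis by (simp add: s_def P_def Q_def)
qed

text \<open>The substitution \<open>t = x\<^sup>2\<close> turns the integral into that of
  \<open>Gamma (a + 1)\<close>, which the normalising factor divides out.\<close>

lemma lfP_norm0:
  assumes "1/2 < a"
  shows "(LBINT x:{0<..}. lf (a + 1/2) (lfP a 0) x * lf (a + 1/2) (lfP a 0) x) = 1"
proof -
  let ?f = "\<lambda>t. t powr (a + 1 - 1) / exp t"
  have G: "(?f has_integral Gamma (a + 1)) {0<..}"
  proof -
    have "(?f has_integral Gamma (a + 1)) {0..}" using assms by (intro Gamma_integral_real) simp
    then show ?thesis
      by (subst has_integral_spike_set_eq[where T="{0..}"]) (auto intro: negligible_subset[of "{0}"])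
  qed
  have "?f absolutely_integrable_on {0<..}"
    using G by (intro nonnegative_absolutely_integrable_1) (auto simp: has_integral_integrable)
  moreover have im: "(\<lambda>x::real. x\<^sup>2) ` {0<..} = {0<..}"
    by (auto simp: image_iff) (metis greaterThan_iff real_sqrt_gt_zero real_sqrt_pow2 less_imp_le)
  moreover have inj: "inj_on (\<lambda>x::real. x\<^sup>2) {0<..}" by (auto intro!: inj_onI simp: power2_eq_iff)
  ultimately have "(\<lambda>x. \<bar>2 * x\<bar> * ?f (x\<^sup>2)) absolutely_integrable_on {0<..} \<and>
     integral {0<..} (\<lambda>x. \<bar>2 * x\<bar> * ?f (x\<^sup>2)) = Gamma (a + 1)"
    using G by (subst has_absolute_integral_change_of_variables_1')
      (auto intro!: derivative_eq_intros simp: integral_unique)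
  then have 1: "integral {0<..} (\<lambda>x. \<bar>2 * x\<bar> * ?f (x\<^sup>2)) = Gamma (a + 1)" ..
  have g: "Gamma (a + 1) > 0" using assms by simp
  have e: "lf (a + 1/2) (lfP a 0) x * lf (a + 1/2) (lfP a 0) x = (\<bar>2 * x\<bar> * ?f (x\<^sup>2)) / Gamma (a + 1)" if "x > 0" for x
  proof -
    have "(lnorm a 0)\<^sup>2 = 2 / Gamma (a + 1)" using g by (simp add: lnorm_def)
    moreover have "lf (a + 1/2) (lfP a 0) x = lnorm a 0 * x powr (a + 1/2) * exp (- x\<^sup>2 / 2)"
      by (simp add: lf_def lfP_def lpoly_def)
    then have "lf (a + 1/2) (lfP a 0) x * lf (a + 1/2) (lfP a 0) x
      = (lnorm a 0)\<^sup>2 * (x powr (a + 1/2) * x powr (a + 1/2)) * (exp (- x\<^sup>2 / 2) * exp (- x\<^sup>2 / 2))"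
      by (simp only: power2_eq_square mult_ac)
    ultimately have "lf (a + 1/2) (lfP a 0) x * lf (a + 1/2) (lfP a 0) x
      = 2 / Gamma (a + 1) * (x powr (a + 1/2) * x powr (a + 1/2)) * (exp (- x\<^sup>2 / 2) * exp (- x\<^sup>2 / 2))"
      by simp
    also have "x powr (a + 1/2) * x powr (a + 1/2) = x * (x\<^sup>2) powr a"
    proof -
      have "x powr (a + 1/2) * x powr (a + 1/2) = x powr (2 * a + 1)" by (simp flip: powr_add)
      also have "\<dots> = x * x powr (2 * a)" using that by (simp add: powr_add)
      also have "x powr (2 * a) = (x\<^sup>2) powr a" using that by (simp add: powr_powr flip: powr_numeral)
      finally show ?thesis .
    qed
    also have "exp (- x\<^sup>2 / 2) * exp (- x\<^sup>2 / 2) = exp (- x\<^sup>2)" by (simp flip: exp_add)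
    also have "\<dots> = 1 / exp (x\<^sup>2)" by (simp add: exp_minus inverse_eq_divide)
    finally have *: "lf (a + 1/2) (lfP a 0) x * lf (a + 1/2) (lfP a 0) x =
      2 / Gamma (a + 1) * (x * (x\<^sup>2) powr a) * (1 / exp (x\<^sup>2))" .
    have "\<bar>2 * x\<bar> = 2 * x" using that by simp
    then show ?thesis unfolding * by (simp only: divide_inverse mult_ac mult_1_left add_diff_cancel_right')
  qed
  have "(LBINT x:{0<..}. lf (a + 1/2) (lfP a 0) x * lf (a + 1/2) (lfP a 0) x) =
     integral {0<..} (\<lambda>x. lf (a + 1/2) (lfP a 0) x * lf (a + 1/2) (lfP a 0) x)"
    using assms by (intro set_borel_integral_eq_integral lf_mult_integrable) auto
  also have "\<dots> = integral {0<..} (\<lambda>x. (\<bar>2 * x\<bar> * ?f (x\<^sup>2)) / Gamma (a + 1))"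
    by (intro Henstock_Kurzweil_Integration.integral_cong) (use e in auto)
  also have "\<dots> = 1" unfolding integral_divide 1 using g by simp
  finally show ?thesis .
qed

text \<open>Induction along the ladder: \<open>lfP_ladder\<close> passes from
  \<open>(n, m, a)\<close> to \<open>(n - 1, m - 1, a + 1)\<close> until one index is 0, where the
  derivative vanishes. Hence \<open>a\<close> has to be arbitrary.\<close>

lemma lfP_orthonormal:
  assumes "1/2 < a"
  shows "(LBINT x:{0<..}. lf (a + 1/2) (lfP a n) x * lf (a + 1/2) (lfP a m) x) = (if n = m then 1 else 0)"
  using assms
proof (induction n arbitrary: a m)
  case (0 a m)
  show ?case
  proof (cases m)
    case 0 then show ?thesis using lfP_norm0[OF \<open>1/2 < a\<close>] by simp
  next
    case (Suc k)
    then show ?thesis using lfP_ladder[OF \<open>1/2 < a\<close>, of 0 m] by (simp add: pderiv_lfP lf_def)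
  qed
next
  case (Suc n a m)
  let ?I = "LBINT x:{0<..}. lf (a + 1/2) (lfP a (Suc n)) x * lf (a + 1/2) (lfP a m) x"
  show ?case
  proof (cases m)
    case 0
    \<comment> \<open>With second index 0 the ladder only says \<open>0 = 0\<close>, so it is used
      with the indices exchanged.\<close>
    then show ?thesis using lfP_ladder[OF \<open>1/2 < a\<close>, of 0 "Suc n"] by (simp add: pderiv_lfP lf_def mult.commute)
  next
    case m: (Suc k)
    have "4 * real m * ?I = (LBINT x:{0<..}. lf (a + 1/2 + 1) (2 * pderiv (lfP a (Suc n))) x * lf (a + 1/2 + 1) (2 * pderiv (lfP a m)) x)"
      using lfP_ladder[OF Suc.prems, of "Suc n" m] by simp
    also have "\<dots> = (LBINT x:{0<..}. (4 * sqrt (Suc n) * sqrt m) * (lf (a + 1 + 1/2) (lfP (a + 1) n) x * lf (a + 1 + 1/2) (lfP (a + 1) k) x))"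
      by (intro set_lebesgue_integral_cong) (auto simp: pderiv_lfP m lf_def algebra_simps)
    also have "\<dots> = (4 * sqrt (Suc n) * sqrt m) * (if n = k then 1 else 0)"
      unfolding set_integral_mult_right using Suc.IH[of "a+1" k] Suc.prems by simp
    finally have *: "4 * real m * ?I = 4 * (sqrt (Suc n) * sqrt m) * (if n = k then 1 else 0)" by simp
    show ?thesis
    proof (cases "n = k")
      case True
      then have "4 * real m * ?I = 4 * real m" using * m by simp
      then show ?thesis using m True by simp
    qed (use * m in auto)
  qed
qed

section \<open>Integration over the orthant and over time\<close>

lemma open_orthant: "open (orthant :: (real ^ 'd) set)"
proof -
  have "orthant = (\<Inter>i. {x :: real ^ 'd. 0 < x $ i})" by (auto simp: orthant_def)
  also have "open \<dots>" by (intro open_INT) (auto intro!: open_Collect_less continuous_intros)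
  finally show ?thesis .
qed

lemma orthant_borel [measurable, simp]: "orthant \<in> sets borel"
  by (intro borel_open open_orthant)

text \<open>Iterated integrals are taken over these Borel measures; for Borel integrands
  \<open>MO_integral\<close> returns to the Lebesgue measure of the definitions.\<close>

abbreviation MX :: "(real ^ 'd) measure" where "MX \<equiv> restrict_space lborel orthant"
abbreviation MT :: "real measure" where "MT \<equiv> restrict_space lborel {0<..}"

lemma MX_measurable: "f \<in> borel_measurable borel \<Longrightarrow> f \<in> borel_measurable MX"
  by (intro measurable_restrict_space1) simp

lemma MO_measurable: "f \<in> borel_measurable borel \<Longrightarrow> f \<in> borel_measurable MO"
  by (intro measurable_restrict_space1 measurable_completion) simp

lemma MO_integral:
  fixes f :: "real ^ 'd \<Rightarrow> real"
  assumes [measurable]: "f \<in> borel_measurable borel"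
  shows "integrable MO f \<longleftrightarrow> integrable MX f" "(LINT x|MO. f x) = (LINT x|MX. f x)"
  by (auto simp: integrable_restrict_space integral_restrict_space integrable_completion integral_completion)

lemma AE_MO: "(AE x in MO. P x) \<longleftrightarrow> (AE x in lebesgue. x \<in> orthant \<longrightarrow> P x)"
  by (subst AE_restrict_space_iff) auto

lemma space_MO [simp]: "space MO = orthant" and space_MX [simp]: "space MX = orthant" and space_MT [simp]: "space MT = {0<..}"
  by (auto simp: space_restrict_space)

interpretation MX: sigma_finite_measure "MX :: (real ^ 'd) measure"
  by (rule sigma_finite_measure_restrict_space) (auto intro: lborel.sigma_finite_measure_axioms)

interpretation MT: sigma_finite_measure MT
  by (rule sigma_finite_measure_restrict_space) (auto intro: lborel.sigma_finite_measure_axioms)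

interpretation MXT: pair_sigma_finite "MX :: (real ^ 'd) measure" MT ..

text \<open>\<open>lborel\<close> on \<open>real ^ 'd\<close> is the image of a product measure
  indexed by basis vectors; \<open>ix\<close> reads off the coordinate that belongs to a basis
  vector.\<close>

lemma
  fixes f :: "'d::finite \<Rightarrow> real \<Rightarrow> real"
  assumes f: "\<And>i. integrable lborel (f i)" and [measurable]: "\<And>i. f i \<in> borel_measurable borel"
  shows integrable_lborel_prod: "integrable lborel (\<lambda>x :: real ^ 'd. \<Prod>i\<in>UNIV. f i (x $ i))"
    and integral_lborel_prod: "(LINT x|lborel. (\<Prod>i\<in>UNIV. f i ((x :: real ^ 'd) $ i))) = (\<Prod>i\<in>UNIV. LINT x|lborel. f i x)"
proof -
  define ix where "ix b = (THE i. b = (axis i 1 :: real ^ 'd))" for b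
  have ix: "ix (axis i 1) = i" for i unfolding ix_def by (auto simp: axis_eq_axis)
  have B: "(Basis :: (real ^ 'd) set) = range (\<lambda>i. axis i 1)" by (auto simp: Basis_vec_def)
  have re: "(\<Prod>b\<in>Basis. g (ix b)) = (\<Prod>i\<in>UNIV. g i)" for g :: "'d \<Rightarrow> real"
    unfolding B by (subst prod.reindex) (auto simp: ix inj_on_def axis_eq_axis)
  let ?G = "\<lambda>g. \<Sum>b\<in>Basis. g b *\<^sub>R (b :: real ^ 'd)"
  have comp: "(\<Prod>i\<in>UNIV. f i (?G g $ i)) = (\<Prod>b\<in>Basis. f (ix b) (g b))" for g
  proof -
    have "?G g $ i = g (axis i 1)" for i
    proof -
      have "?G g $ i = ?G g \<bullet> axis i 1" by (simp add: inner_axis)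
      also have "\<dots> = g (axis i 1)" by (subst inner_sum_left_Basis) (auto simp: axis_in_Basis_iff)
      finally show ?thesis .
    qed
    then have "(\<Prod>i\<in>UNIV. f i (?G g $ i)) = (\<Prod>i\<in>UNIV. f i (g (axis i 1)))" by simp
    also have "\<dots> = (\<Prod>b\<in>Basis. f (ix b) (g b))"
      unfolding B by (subst prod.reindex) (auto simp: ix inj_on_def axis_eq_axis)
    finally show ?thesis .
  qed
  interpret product_sigma_finite "\<lambda>_ :: real ^ 'd. lborel :: real measure" ..
  have m: "(\<lambda>x :: real ^ 'd. \<Prod>i\<in>UNIV. f i (x $ i)) \<in> borel_measurable borel" by measurable
  have m2: "?G \<in> measurable (\<Pi>\<^sub>M b\<in>Basis. lborel) borel" by measurable
  have "integrable (\<Pi>\<^sub>M b\<in>Basis. lborel) (\<lambda>g. \<Prod>b\<in>Basis. f (ix b) (g b))"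
    by (rule product_integrable_prod) (use f in auto)
  then show "integrable lborel (\<lambda>x :: real ^ 'd. \<Prod>i\<in>UNIV. f i (x $ i))"
    by (subst lborel_eq) (simp only: integrable_distr_eq[OF m2 m] comp)
  have "(LINT x|lborel. (\<Prod>i\<in>UNIV. f i ((x :: real ^ 'd) $ i))) = (LINT g|(\<Pi>\<^sub>M b\<in>Basis. lborel). (\<Prod>b\<in>Basis. f (ix b) (g b)))"
    by (subst lborel_eq) (simp only: integral_distr[OF m2 m] comp)
  also have "\<dots> = (\<Prod>b\<in>Basis. LINT x|lborel. f (ix b) x)"
    by (rule product_integral_prod) (use f in auto)
  finally show "(LINT x|lborel. (\<Prod>i\<in>UNIV. f i ((x :: real ^ 'd) $ i))) = (\<Prod>i\<in>UNIV. LINT x|lborel. f i x)"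
    using re[of "\<lambda>i. LINT x|lborel. f i x"] by simp
qed

lemma
  fixes f :: "'d::finite \<Rightarrow> real \<Rightarrow> real"
  assumes f: "\<And>i. set_integrable lborel {0<..} (f i)" and [measurable]: "\<And>i. f i \<in> borel_measurable borel"
  shows integrable_MX_prod: "integrable MX (\<lambda>x :: real ^ 'd. \<Prod>i\<in>UNIV. f i (x $ i))"
    and integral_MX_prod: "(LINT x|MX. (\<Prod>i\<in>UNIV. f i ((x :: real ^ 'd) $ i))) = (\<Prod>i\<in>UNIV. LBINT x:{0<..}. f i x)"
proof -
  define g where "g i x = indicator {0<..} x * f i x" for i x
  have ind: "indicator orthant x = (\<Prod>i\<in>UNIV. indicator {0<..} (x $ i) :: real)" for x :: "real ^ 'd"
    by (auto simp: indicator_def orthant_def)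
  have eq: "indicator orthant x * (\<Prod>i\<in>UNIV. f i (x $ i)) = (\<Prod>i\<in>UNIV. g i (x $ i))" for x :: "real ^ 'd"
    by (simp add: ind g_def prod.distrib)
  have g: "integrable lborel (g i)" "g i \<in> borel_measurable borel" for i
    using f[of i] unfolding g_def[abs_def] by (auto simp: set_integrable_def)
  show "integrable MX (\<lambda>x :: real ^ 'd. \<Prod>i\<in>UNIV. f i (x $ i))"
    using integrable_lborel_prod[of g, OF g] by (simp add: integrable_restrict_space eq)
  show "(LINT x|MX. (\<Prod>i\<in>UNIV. f i ((x :: real ^ 'd) $ i))) = (\<Prod>i\<in>UNIV. LBINT x:{0<..}. f i x)"
    using integral_lborel_prod[of g, OF g] by (simp add: integral_restrict_space eq set_lebesgue_integral_def g_def)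
qed

text \<open>Common majorant in space: the product over the coordinates of the decay in
  \<open>lf_bound\<close>.\<close>

definition gs :: "real ^ 'd \<Rightarrow> real" where "gs x = exp (- (norm x)\<^sup>2 / 4)"

lemma norm_vec_sq: "(norm (x :: real ^ 'd))\<^sup>2 = (\<Sum>i\<in>UNIV. (x $ i)\<^sup>2)"
  unfolding norm_vec_def L2_set_def by (simp add: sum_nonneg)

lemma gs_prod: "gs x = (\<Prod>i\<in>UNIV. exp (- (x $ i)\<^sup>2 / 4))"
  by (simp add: gs_def norm_vec_sq exp_sum sum_negf flip: exp_sum sum_divide_distrib)

lemma gs_pos [simp]: "0 < gs x" "0 \<le> gs x" "gs x \<le> 1" by (auto simp: gs_def)

lemma gs_measurable [measurable]: "gs \<in> borel_measurable borel"
  unfolding gs_def[abs_def] by measurable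

lemma gs_integrable: "integrable lborel gs"
proof -
  have "integrable lborel (\<lambda>x :: real ^ 'd. \<Prod>i\<in>(UNIV::'d set). (\<lambda>_ y. exp (- y\<^sup>2 / 4)) i (x $ i))"
    by (rule integrable_lborel_prod) (use gaussian_integrable[of "1/4"] in auto)
  then show ?thesis unfolding gs_prod[abs_def] by simp
qed

lemma gs_integrable_MX: "integrable MX gs"
  by (subst integrable_restrict_space) (auto intro!: integrable_mult_indicator gs_integrable simp del: real_scaleR_def)

text \<open>\<open>h\<close> is extended by 0 across the walls; the bound by \<open>x $ i\<close>
  makes the extension continuous in direction \<open>i\<close>. Its increment over a unit step is
  the integral of the derivative along that step. When this is integrated over all \<open>x\<close>,
  translation invariance turns the increment into 0 and the other side into the integral of the
  derivative.\<close>

lemma integral_partial_deriv_zero: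
  fixes h h' :: "real ^ 'd \<Rightarrow> real" and i :: 'd
  assumes [measurable]: "h \<in> borel_measurable borel" "h' \<in> borel_measurable borel"
    and der: "\<And>x. x \<in> orthant \<Longrightarrow> ((\<lambda>s. h (x + s *\<^sub>R axis i 1)) has_real_derivative h' x) (at 0)"
    and b1: "\<And>x. x \<in> orthant \<Longrightarrow> \<bar>h x\<bar> \<le> M * gs x"
    and b2: "\<And>x. x \<in> orthant \<Longrightarrow> \<bar>h x\<bar> \<le> M * x $ i"
    and b3: "\<And>x. x \<in> orthant \<Longrightarrow> \<bar>h' x\<bar> \<le> M * gs x"
  shows "(LINT x|MX. h' x) = 0"
proof -
  let ?e = "axis i 1 :: real ^ 'd"
  define g where "g x = indicator orthant x * h x" for x
  define g' where "g' x = indicator orthant x * h' x" for x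
  have [measurable]: "g \<in> borel_measurable borel" "g' \<in> borel_measurable borel" unfolding g_def g'_def by measurable
  have dom: "integrable lborel (\<lambda>x. indicator orthant x * k x)"
    if k: "\<And>x. x \<in> orthant \<Longrightarrow> \<bar>k x\<bar> \<le> M * gs x" and [measurable]: "k \<in> borel_measurable borel" for k :: "real ^ 'd \<Rightarrow> real"
  proof (rule Bochner_Integration.integrable_bound[OF integrable_mult_right[OF gs_integrable, of M]])
    show "AE x in lborel. norm (indicator orthant x * k x) \<le> norm (M * gs x)"
      using order_trans[OF k abs_ge_self] by (auto simp: indicator_def)
  qed measurable
  have gi: "integrable lborel g" "integrable lborel g'"
    unfolding g_def g'_def by (intro dom b1 b3; simp)+
  have ftc: "((\<lambda>s. g' (x + s *\<^sub>R ?e)) has_integral g (x + ?e) - g x) {0..1}" for x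
  proof (cases "\<exists>j. j \<noteq> i \<and> x $ j \<le> 0")
    \<comment> \<open>The line in direction \<open>i\<close> misses the orthant if another
      coordinate is not positive.\<close>
    case True
    then obtain j where "j \<noteq> i" "x $ j \<le> 0" by blast
    then have "x + s *\<^sub>R ?e \<notin> orthant" for s by (auto simp: orthant_def axis_def not_less intro!: exI[of _ j])
    from this this[of 0] this[of 1] show ?thesis by (simp add: g_def g'_def)
  next
    case False
    then have pos: "0 < x $ j" if "j \<noteq> i" for j using that by (auto simp: not_le)
    have cmp: "(x + s *\<^sub>R ?e) $ j = (if j = i then x $ i + s else x $ j)" for s j by (simp add: axis_def)
    have mem: "x + s *\<^sub>R ?e \<in> orthant \<longleftrightarrow> - (x $ i) < s" for s
    proof
      assume "x + s *\<^sub>R ?e \<in> orthant"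
      then have "0 < (x + s *\<^sub>R ?e) $ i" unfolding orthant_def by blast
      then show "- (x $ i) < s" unfolding cmp by simp
    next
      assume "- (x $ i) < s"
      then show "x + s *\<^sub>R ?e \<in> orthant" unfolding orthant_def mem_Collect_eq cmp using pos by auto
    qed
    let ?G = "\<lambda>s. g (x + s *\<^sub>R ?e)"
    \<comment> \<open>The line crosses the wall only at the parameter \<open>- (x $ i)\<close>.
      There the extension need not be differentiable; continuity is enough for the fundamental
      theorem.\<close>
    have d: "(?G has_real_derivative g' (x + s *\<^sub>R ?e)) (at s)" if "s \<noteq> - (x $ i)" for s
    proof (cases "- (x $ i) < s")
      case True
      have "((\<lambda>r. h (x + s *\<^sub>R ?e + r *\<^sub>R ?e)) has_real_derivative h' (x + s *\<^sub>R ?e)) (at (s + - s))"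
        using der[of "x + s *\<^sub>R ?e"] mem True by simp
      then have "((\<lambda>r. h (x + s *\<^sub>R ?e + (r - s) *\<^sub>R ?e)) has_real_derivative h' (x + s *\<^sub>R ?e)) (at s)"
        unfolding DERIV_shift by simp
      then have "((\<lambda>r. h (x + r *\<^sub>R ?e)) has_real_derivative h' (x + s *\<^sub>R ?e)) (at s)"
        by (simp add: algebra_simps)
      moreover have "\<forall>\<^sub>F r in nhds s. ?G r = h (x + r *\<^sub>R ?e)"
        using eventually_nhds_in_open[of "{- (x $ i)<..}" s] True
        by (auto simp: g_def mem elim!: eventually_mono)
      ultimately show ?thesis
        using True mem by (subst DERIV_cong_ev[OF refl _ refl]) (auto simp: g'_def)
    next
      case False
      have "\<forall>\<^sub>F r in nhds s. r \<in> {..<- (x $ i)}"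
        using False that by (intro eventually_nhds_in_open) auto
      then have ev: "\<forall>\<^sub>F r in nhds s. ?G r = 0"
        by eventually_elim (simp add: g_def mem)
      have "g' (x + s *\<^sub>R ?e) = 0" using False by (simp add: g'_def mem)
      then show ?thesis using DERIV_cong_ev[OF refl ev refl, of 0] by simp
    qed
    have "isCont ?G s" for s
    proof (cases "s = - (x $ i)")
      case True
      have "(?G \<longlongrightarrow> 0) (at s)"
      proof (rule tendsto_rabs_zero_cancel, rule tendsto_sandwich[OF _ _ tendsto_const])
        have "\<bar>?G r\<bar> \<le> \<bar>M\<bar> * \<bar>r - s\<bar>" for r
        proof (cases "s < r")
          case True
          then have "\<bar>?G r\<bar> \<le> M * (x $ i + r)"
            using b2[of "x + r *\<^sub>R ?e"] \<open>s = - (x $ i)\<close> mem[of r] by (simp add: g_def axis_def)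
          also have "\<dots> \<le> \<bar>M\<bar> * \<bar>r - s\<bar>" using True \<open>s = - (x $ i)\<close> by (simp add: mult_right_mono add.commute)
          finally show ?thesis .
        qed (use mem \<open>s = - (x $ i)\<close> in \<open>simp add: g_def\<close>)
        then show "\<forall>\<^sub>F r in at s. \<bar>?G r\<bar> \<le> \<bar>M\<bar> * \<bar>r - s\<bar>" by simp
        show "((\<lambda>r. \<bar>M\<bar> * \<bar>r - s\<bar>) \<longlongrightarrow> 0) (at s)" by (auto intro!: tendsto_eq_intros)
      qed auto
      moreover have "?G s = 0" using mem[of s] True by (simp add: g_def)
      ultimately show ?thesis by (simp add: isCont_def)
    qed (use d DERIV_isCont in blast)
    then have "continuous_on {0..1} ?G" by (simp add: continuous_at_imp_continuous_on)
    then have "((\<lambda>s. g' (x + s *\<^sub>R ?e)) has_integral (?G 1 - ?G 0)) {0..1}"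
      by (intro fundamental_theorem_of_calculus_strong[where S="{- (x $ i)}"])
         (use d in \<open>auto simp: has_real_derivative_iff_has_vector_derivative[symmetric]\<close>)
    then show ?thesis by simp
  qed
  have shift: "integrable lborel (\<lambda>x. k (x + v))" "(LINT x|lborel. k (x + v)) = (LINT x|lborel. k x)"
    if "integrable lborel k" for k :: "real ^ 'd \<Rightarrow> real" and v
  proof -
    have [measurable]: "k \<in> borel_measurable borel" using that by auto
    have "integrable (distr lborel borel ((+) v)) k" using that by (simp add: lborel_distr_plus)
    then show "integrable lborel (\<lambda>x. k (x + v))" by (simp add: integrable_distr_eq add.commute)
    have "(LINT x|distr lborel borel ((+) v). k x) = (LINT x|lborel. k (v + x))" by (intro integral_distr) auto
    then show "(LINT x|lborel. k (x + v)) = (LINT x|lborel. k x)" by (simp add: lborel_distr_plus add.commute)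
  qed
  define F where "F = (\<lambda>(s :: real, x). indicator {0..1} s * g' (x + s *\<^sub>R ?e))"
  have [measurable]: "F \<in> borel_measurable (lborel \<Otimes>\<^sub>M lborel)" unfolding F_def by measurable
  have Fi: "integrable (lborel \<Otimes>\<^sub>M lborel) F"
  proof (rule lborel_pair.Fubini_integrable)
    have "(LINT x|lborel. norm (F (s, x))) = indicator {0..1} s * (LINT x|lborel. \<bar>g' x\<bar>)" for s
    proof -
      have "(LINT x|lborel. norm (F (s, x))) = (LINT x|lborel. indicator {0..1} s * \<bar>g' (x + s *\<^sub>R ?e)\<bar>)"
        by (simp add: F_def abs_mult)
      also have "\<dots> = indicator {0..1} s * (LINT x|lborel. \<bar>g' x\<bar>)"
        using shift(2)[OF integrable_abs[OF gi(2)], of "s *\<^sub>R ?e"] by simp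
      finally show ?thesis .
    qed
    then show "integrable lborel (\<lambda>s. LINT x|lborel. norm (F (s, x)))" by simp
    show "AE s in lborel. integrable lborel (\<lambda>x. F (s, x))"
      using shift(1)[OF gi(2)] by (simp add: F_def)
  qed measurable
  have "(LINT s|lborel. LINT x|lborel. F (s, x)) = (LINT x|lborel. LINT s|lborel. F (s, x))"
    using lborel_pair.Fubini_integral[of "\<lambda>s x. F (s, x)"] Fi by (simp add: case_prod_beta')
  moreover have "(LINT s|lborel. LINT x|lborel. F (s, x)) = (LINT x|lborel. g' x)"
  proof -
    have "(LINT x|lborel. F (s, x)) = indicator {0..1} s * (LINT x|lborel. g' x)" for s
      using shift(2)[OF gi(2), of "s *\<^sub>R ?e"] by (simp add: F_def)
    then show ?thesis by simp
  qed
  moreover have "(LINT x|lborel. LINT s|lborel. F (s, x)) = (LINT x|lborel. g (x + ?e) - g x)"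
  proof (rule integral_cong_AE)
    have "AE x in lborel. integrable lborel (\<lambda>s. F (s, x))"
      using lborel_pair.AE_integrable_snd[of "\<lambda>s x. F (s, x)"] Fi by (simp add: case_prod_beta')
    then show "AE x in lborel. (LINT s|lborel. F (s, x)) = g (x + ?e) - g x"
    proof eventually_elim
      case (elim x)
      then have "set_integrable lborel {0..1} (\<lambda>s. g' (x + s *\<^sub>R ?e))" by (simp add: F_def set_integrable_def)
      from set_borel_integral_eq_integral(2)[OF this] integral_unique[OF ftc[of x]]
      show ?case by (simp add: F_def set_lebesgue_integral_def)
    qed
  qed measurable
  moreover have "(LINT x|lborel. g (x + ?e) - g x) = 0"
    using shift[OF gi(1), of ?e] gi(1) by simp
  ultimately have "(LINT x|lborel. g' x) = 0" by simp
  then show ?thesis by (simp add: integral_restrict_space g'_def)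
qed

lemma t_exp_le: "0 < c \<Longrightarrow> 0 \<le> t \<Longrightarrow> t * exp (- c * t) \<le> (2 / c) * exp (- (c/2) * t)" for c t :: real
proof -
  assume c: "0 < c" "0 \<le> t"
  have "(c/2) * t \<le> exp ((c/2) * t)" using exp_ge_add_one_self[of "(c/2)*t"] by linarith
  then have "t \<le> (2/c) * exp ((c/2) * t)" using c by (simp add: field_simps)
  then have "t * exp (- c * t) \<le> (2/c) * exp ((c/2) * t) * exp (- c * t)" by (intro mult_right_mono) auto
  also have "\<dots> = (2/c) * exp (- (c/2) * t)" by (simp add: mult.assoc flip: exp_add)
  finally show ?thesis .
qed

lemma exp_integrable_Ici: assumes "0 < c" shows "set_integrable lborel {0..} (\<lambda>t::real. exp (- c * t))"
proof -
  have "(\<lambda>x::real. exp (- c * x)) absolutely_integrable_on {0..}"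
    using integrable_on_exp_minus_to_infinity[of c 0] assms by (intro nonnegative_absolutely_integrable_1) auto
  then show ?thesis
    unfolding set_integrable_def by (subst (asm) integrable_completion) auto
qed

lemma MT_integral:
  fixes f :: "real \<Rightarrow> real"
  assumes [measurable]: "f \<in> borel_measurable borel"
  shows "integrable MT f \<longleftrightarrow> set_integrable lborel {0..} f" "(LINT t|MT. f t) = (LBINT t:{0..}. f t)"
proof -
  have ae: "AE t in lborel. indicator {0<..} t *\<^sub>R f t = indicator {0..} t *\<^sub>R f t"
    using AE_lborel_singleton[of "0::real"] by eventually_elim (auto simp: indicator_def)
  show "integrable MT f \<longleftrightarrow> set_integrable lborel {0..} f"
    unfolding set_integrable_def by (subst integrable_restrict_space, simp) (rule integrable_cong_AE[OF _ _ ae]; measurable)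
  show "(LINT t|MT. f t) = (LBINT t:{0..}. f t)"
    unfolding set_lebesgue_integral_def by (subst integral_restrict_space, simp) (rule integral_cong_AE[OF _ _ ae]; measurable)
qed

lemma exp_integrable_MT: "0 < c \<Longrightarrow> integrable MT (\<lambda>t. exp (- c * t))"
  using exp_integrable_Ici by (subst MT_integral) auto

text \<open>\<open>t * v1 t - v t\<close> is a primitive of \<open>t * v2 t\<close>; the exponential
  decay of \<open>v1\<close> removes its first term at infinity.\<close>

lemma integral_t_second_deriv:
  fixes v v1 v2 :: "real \<Rightarrow> real"
  assumes [measurable]: "v2 \<in> borel_measurable borel" and c: "0 < c"
    and d1: "\<And>t. 0 \<le> t \<Longrightarrow> (v has_real_derivative v1 t) (at t)"
    and d2: "\<And>t. 0 \<le> t \<Longrightarrow> (v1 has_real_derivative v2 t) (at t)"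
    and b1: "\<And>t. 0 \<le> t \<Longrightarrow> \<bar>v1 t\<bar> \<le> M * exp (- c * t)"
    and b2: "\<And>t. 0 \<le> t \<Longrightarrow> \<bar>v2 t\<bar> \<le> M * exp (- c * t)"
    and lim: "(v \<longlongrightarrow> L) at_top"
  shows "(LINT t|MT. t * v2 t) = v 0 - L"
proof -
  have M: "0 \<le> M" using b1[of 0] by simp
  have bnd: "t * (M * exp (- c * t)) \<le> M * (2/c) * exp (- (c/2) * t)" if "0 \<le> t" for t
    using mult_left_mono[OF t_exp_le[OF c that] M] by (simp add: mult_ac)
  have int: "set_integrable lborel {0..} (\<lambda>t. t * v2 t)"
  proof -
    have "integrable lborel (\<lambda>t. M * (2/c) * (indicator {0..} t *\<^sub>R exp (- (c/2) * t)))"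
      using exp_integrable_Ici[of "c/2"] c by (intro integrable_mult_right) (auto simp: set_integrable_def)
    then show ?thesis unfolding set_integrable_def
    proof (rule Bochner_Integration.integrable_bound)
      show "AE t in lborel. norm (indicator {0..} t *\<^sub>R (t * v2 t)) \<le> norm (M * (2/c) * (indicator {0..} t *\<^sub>R exp (- (c/2) * t)))"
      proof (intro AE_I2)
        fix t :: real
        have "\<bar>t * v2 t\<bar> \<le> M * (2/c) * exp (- (c/2) * t)" if "t \<ge> 0"
          using order_trans[OF mult_left_mono[OF b2[OF that] that] bnd[OF that]] that by (simp add: abs_mult)
        then show "norm (indicator {0..} t *\<^sub>R (t * v2 t)) \<le> norm (M * (2/c) * (indicator {0..} t *\<^sub>R exp (- (c/2) * t)))"
          using M c by (auto simp: indicator_def)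
      qed
    qed measurable
  qed
  have fin: "(LBINT t:{0..T}. t * v2 t) = (T * v1 T - v T) + v 0" if T: "0 \<le> T" for T
  proof -
    have "((\<lambda>t. t * v2 t) has_integral ((T * v1 T - v T) - (0 * v1 0 - v 0))) {0..T}"
    proof (rule fundamental_theorem_of_calculus[OF T])
      fix t assume t: "t \<in> {0..T}"
      have "((\<lambda>t. t * v1 t - v t) has_real_derivative t * v2 t) (at t)"
        by (rule DERIV_cong[OF DERIV_diff[OF DERIV_mult[OF DERIV_ident d2] d1]]) (use t in auto)
      then show "((\<lambda>t. t * v1 t - v t) has_vector_derivative t * v2 t) (at t within {0..T})"
        by (simp add: has_real_derivative_iff_has_vector_derivative has_vector_derivative_at_within)
    qed
    moreover have "set_integrable lborel {0..T} (\<lambda>t. t * v2 t)"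
      by (rule set_integrable_subset[OF int]) auto
    ultimately show ?thesis by (simp add: set_borel_integral_eq_integral(2) integral_unique)
  qed
  have "((\<lambda>T. LBINT t:{0..T}. t * v2 t) \<longlongrightarrow> (LBINT t:{0..}. t * v2 t)) at_top"
    by (rule tendsto_set_lebesgue_integral_at_top[OF _ int]) auto
  moreover have "((\<lambda>T. LBINT t:{0..T}. t * v2 t) \<longlongrightarrow> (0 - L) + v 0) at_top"
  proof (rule Lim_transform_eventually)
    have "((\<lambda>T. T * v1 T) \<longlongrightarrow> 0) at_top"
    proof (rule tendsto_rabs_zero_cancel, rule tendsto_sandwich[OF _ _ tendsto_const])
      show "\<forall>\<^sub>F T in at_top. \<bar>T * v1 T\<bar> \<le> M * (2/c) * exp (- (c/2) * T)"
        using eventually_ge_at_top[of 0]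
      proof eventually_elim
        case (elim t)
        then show ?case
          using order_trans[OF mult_left_mono[OF b1[OF elim] elim] bnd[OF elim]] by (simp add: abs_mult)
      qed
      have "filterlim (\<lambda>T. - (c/2) * T) at_bot at_top"
        using c by (intro filterlim_tendsto_neg_mult_at_bot[OF tendsto_const] filterlim_ident) auto
      then show "((\<lambda>T. M * (2/c) * exp (- (c/2) * T)) \<longlongrightarrow> 0) at_top"
        by (intro tendsto_mult_right_zero filterlim_compose[OF exp_at_bot])
    qed (auto intro: always_eventually)
    then show "((\<lambda>T. (T * v1 T - v T) + v 0) \<longlongrightarrow> (0 - L) + v 0) at_top"
      by (intro tendsto_intros lim)
    show "\<forall>\<^sub>F T in at_top. (T * v1 T - v T) + v 0 = (LBINT t:{0..T}. t * v2 t)"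
      using eventually_ge_at_top[of 0] by eventually_elim (simp add: fin)
  qed
  ultimately have "(LBINT t:{0..}. t * v2 t) = (0 - L) + v 0" by (rule tendsto_unique[rotated]) simp
  then show ?thesis by (subst MT_integral) auto
qed

section \<open>Integrability and Fubini on the product of orthant and time\<close>

lemma XT_measurable:
  fixes f :: "real ^ 'd \<Rightarrow> real \<Rightarrow> real"
  assumes "(\<lambda>z. f (fst z) (snd z)) \<in> borel_measurable borel"
  shows "(\<lambda>z. f (fst z) (snd z)) \<in> borel_measurable (MX \<Otimes>\<^sub>M MT)"
proof -
  have "(\<lambda>z. (fst z, snd z)) \<in> measurable (MX \<Otimes>\<^sub>M MT) (borel \<Otimes>\<^sub>M borel)"
    by (intro measurable_Pair measurable_compose[OF measurable_fst] measurable_compose[OF measurable_snd] measurable_restrict_space1) auto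
  then have "(\<lambda>z. (fst z, snd z)) \<in> measurable (MX \<Otimes>\<^sub>M MT) borel" by (simp add: borel_prod)
  from measurable_compose[OF this assms] show ?thesis by simp
qed

lemma XT_integrable:
  fixes f :: "real ^ 'd \<Rightarrow> real \<Rightarrow> real"
  assumes m: "(\<lambda>z. f (fst z) (snd z)) \<in> borel_measurable borel" and c: "0 < c"
    and b: "\<And>x t. x \<in> orthant \<Longrightarrow> 0 < t \<Longrightarrow> \<bar>f x t\<bar> \<le> M * exp (- c * t) * gs x"
  shows "integrable (MX \<Otimes>\<^sub>M MT) (\<lambda>z. f (fst z) (snd z))"
proof -
  have "integrable (MX \<Otimes>\<^sub>M MT) (\<lambda>z :: (real ^ 'd) \<times> real. (M * gs (fst z)) * exp (- c * snd z))"
  proof (rule MXT.Fubini_integrable)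
    have "(\<lambda>z. (M * gs (fst z)) * exp (- c * snd z)) \<in> borel_measurable (borel :: ((real ^ 'd) \<times> real) measure)"
      by (simp add: borel_prod[symmetric])
    then show "(\<lambda>z :: (real ^ 'd) \<times> real. (M * gs (fst z)) * exp (- c * snd z)) \<in> borel_measurable (MX \<Otimes>\<^sub>M MT)"
      by (rule XT_measurable[where f="\<lambda>x t. M * gs x * exp (- c * t)"])
    have "(LINT t|MT. norm (M * gs x * exp (- c * t))) = \<bar>M\<bar> * gs x * (LINT t|MT. exp (- c * t))" for x :: "real ^ 'd"
      by (simp add: abs_mult)
    then show "integrable MX (\<lambda>x :: real ^ 'd. LINT t|MT. norm (M * gs (fst (x, t)) * exp (- c * snd (x, t))))"
      by (simp add: gs_integrable_MX)
    show "AE x :: real ^ 'd in MX. integrable MT (\<lambda>t. M * gs (fst (x, t)) * exp (- c * snd (x, t)))"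
      using exp_integrable_MT[OF c] by simp
  qed
  then show ?thesis
  proof (rule Bochner_Integration.integrable_bound)
    show "AE z in MX \<Otimes>\<^sub>M MT. norm (f (fst z) (snd z)) \<le> norm ((M * gs (fst z)) * exp (- c * snd z))"
    proof (intro AE_I2)
      fix z :: "(real ^ 'd) \<times> real" assume "z \<in> space (MX \<Otimes>\<^sub>M MT)"
      then have "fst z \<in> orthant" "0 < snd z" by (auto simp: space_pair_measure)
      from order_trans[OF b[OF this] abs_ge_self]
      show "norm (f (fst z) (snd z)) \<le> norm ((M * gs (fst z)) * exp (- c * snd z))"
        by (simp add: mult_ac)
    qed
  qed (rule XT_measurable[OF m])
qed

lemma XT_Fubini:
  fixes f :: "real ^ 'd \<Rightarrow> real \<Rightarrow> real"
  assumes "integrable (MX \<Otimes>\<^sub>M MT) (\<lambda>z. f (fst z) (snd z))"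
  shows "(LINT z|(MX \<Otimes>\<^sub>M MT). f (fst z) (snd z)) = (LINT x|MX. LINT t|MT. f x t)"
    "(LINT z|(MX \<Otimes>\<^sub>M MT). f (fst z) (snd z)) = (LINT t|MT. LINT x|MX. f x t)"
proof -
  show "(LINT z|(MX \<Otimes>\<^sub>M MT). f (fst z) (snd z)) = (LINT x|MX. LINT t|MT. f x t)"
    using MXT.integral_fst'[OF assms] by simp
  show "(LINT z|(MX \<Otimes>\<^sub>M MT). f (fst z) (snd z)) = (LINT t|MT. LINT x|MX. f x t)"
    using MXT.integral_snd[of f] assms by (simp add: case_prod_beta')
qed

section \<open>The Bellman function along a curve\<close>

context bellman
begin

text \<open>The summand \<open>e\<^sup>2\<close> keeps the arguments of \<open>\<beta>\<close> in the open quadrant, where it is smooth.\<close>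
definition Asum :: "'n set \<Rightarrow> real \<Rightarrow> ('n \<Rightarrow> real) \<Rightarrow> real" where
  "Asum I e f = e\<^sup>2 + (\<Sum>n\<in>I. (f n)\<^sup>2)"

text \<open>\<open>B1\<close> and \<open>B2\<close> are the first two derivatives of \<open>\<beta> (Asum I e f) (Asum J e f)\<close> along a curve
  with \<open>f' = f1\<close> and \<open>f1' = f2\<close>.\<close>
definition B1 :: "'n set \<Rightarrow> 'n set \<Rightarrow> real \<Rightarrow> ('n \<Rightarrow> real) \<Rightarrow> ('n \<Rightarrow> real) \<Rightarrow> real" where
  "B1 I J e f f1 = \<beta>A (Asum I e f) (Asum J e f) * (2 * (\<Sum>n\<in>I. f n * f1 n))
     + \<beta>C (Asum I e f) (Asum J e f) * (2 * (\<Sum>n\<in>J. f n * f1 n))"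

definition B2 :: "'n set \<Rightarrow> 'n set \<Rightarrow> real \<Rightarrow> ('n \<Rightarrow> real) \<Rightarrow> ('n \<Rightarrow> real) \<Rightarrow> ('n \<Rightarrow> real) \<Rightarrow> real" where
  "B2 I J e f f1 f2 =
     4 * \<beta>AA (Asum I e f) (Asum J e f) * (\<Sum>n\<in>I. f n * f1 n)\<^sup>2
   + 8 * \<beta>AC (Asum I e f) (Asum J e f) * (\<Sum>n\<in>I. f n * f1 n) * (\<Sum>n\<in>J. f n * f1 n)
   + 4 * \<beta>CC (Asum I e f) (Asum J e f) * (\<Sum>n\<in>J. f n * f1 n)\<^sup>2
   + 2 * \<beta>A (Asum I e f) (Asum J e f) * (\<Sum>n\<in>I. (f1 n)\<^sup>2 + f n * f2 n)
   + 2 * \<beta>C (Asum I e f) (Asum J e f) * (\<Sum>n\<in>J. (f1 n)\<^sup>2 + f n * f2 n)"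

lemma Asum_pos: "0 < e \<Longrightarrow> 0 < Asum I e f"
  by (simp add: Asum_def add_pos_nonneg sum_nonneg)

lemma Asum_deriv:
  assumes "\<And>n. (f n has_real_derivative f1 n) (at s)"
  shows "((\<lambda>s. Asum I e (\<lambda>n. f n s)) has_real_derivative 2 * (\<Sum>n\<in>I. f n s * f1 n)) (at s)"
  unfolding Asum_def
  by (rule derivative_eq_intros DERIV_sum DERIV_power assms refl)+ (simp add: sum_distrib_left mult_ac)

lemma B1_deriv:
  assumes "\<And>n. (f n has_real_derivative f1 n) (at s)" "0 < e"
  shows "((\<lambda>s. \<beta> (Asum I e (\<lambda>n. f n s)) (Asum J e (\<lambda>n. f n s))) has_real_derivative B1 I J e (\<lambda>n. f n s) f1) (at s)"
  unfolding B1_def by (rule deriv_beta[OF Asum_deriv[OF assms(1)] Asum_pos[OF assms(2)] Asum_deriv[OF assms(1)] Asum_pos[OF assms(2)]])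

lemma B2_deriv:
  assumes d: "\<And>n. (f n has_real_derivative f1 n s) (at s)" "\<And>n. (f1 n has_real_derivative f2 n) (at s)" and e: "0 < e"
  shows "((\<lambda>s. B1 I J e (\<lambda>n. f n s) (\<lambda>n. f1 n s)) has_real_derivative B2 I J e (\<lambda>n. f n s) (\<lambda>n. f1 n s) f2) (at s)"
proof -
  have s: "((\<lambda>s. 2 * (\<Sum>n\<in>K. f n s * f1 n s)) has_real_derivative 2 * (\<Sum>n\<in>K. (f1 n s)\<^sup>2 + f n s * f2 n)) (at s)" for K
    by (rule DERIV_cong[OF DERIV_cmult[OF DERIV_sum[OF DERIV_mult[OF d]]]]) (simp add: power2_eq_square mult_ac)
  note A = Asum_deriv[OF d(1)] Asum_pos[OF e]
  show ?thesis unfolding B1_def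
    by (rule DERIV_cong[OF DERIV_add[OF DERIV_mult[OF deriv_betaA[OF A A] s] DERIV_mult[OF deriv_betaC[OF A A] s]]])
       (simp add: B2_def power2_eq_square algebra_simps)
qed

text \<open>\<open>beta_Hessian_lower\<close> with its hypotheses supplied by Cauchy-Schwarz. The
  terms with \<open>f2\<close> stay as they are: the differential equation controls only their sum
  over all directions.\<close>

lemma B2_lower:
  assumes "finite I" "finite J" "0 < e"
  shows "\<delta> * T (Asum I e f) (Asum J e f) * (\<Sum>n\<in>I. (f1 n)\<^sup>2) + 3 * \<delta> * (\<Sum>n\<in>J. (f1 n)\<^sup>2) / T (Asum I e f) (Asum J e f)
     + 2 * \<beta>A (Asum I e f) (Asum J e f) * (\<Sum>n\<in>I. f n * f2 n) + 2 * \<beta>C (Asum I e f) (Asum J e f) * (\<Sum>n\<in>J. f n * f2 n)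
     \<le> B2 I J e f f1 f2"
proof -
  have cs: "(\<Sum>n\<in>K. f n * f1 n)\<^sup>2 \<le> Asum K e f * (\<Sum>n\<in>K. (f1 n)\<^sup>2)" if "finite K" for K
  proof -
    have "(\<Sum>n\<in>K. f n * f1 n)\<^sup>2 \<le> (\<Sum>n\<in>K. (f n)\<^sup>2) * (\<Sum>n\<in>K. (f1 n)\<^sup>2)" by (rule Cauchy_Schwarz_ineq_sum)
    also have "\<dots> \<le> Asum K e f * (\<Sum>n\<in>K. (f1 n)\<^sup>2)" by (intro mult_right_mono) (auto simp: Asum_def sum_nonneg)
    finally show ?thesis .
  qed
  from beta_Hessian_lower[OF Asum_pos[OF assms(3)] Asum_pos[OF assms(3)] cs[OF assms(1)] cs[OF assms(2)] sum_nonneg sum_nonneg]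
  show ?thesis unfolding B2_def by (simp add: sum.distrib distrib_left)
qed

lemma second_derivs_bounded:
  assumes "0 < l"
  obtains K where "0 \<le> K" "\<And>A C. l \<le> A \<Longrightarrow> A \<le> R \<Longrightarrow> l \<le> C \<Longrightarrow> C \<le> R \<Longrightarrow>
     \<bar>\<beta>A A C\<bar> \<le> K \<and> \<bar>\<beta>C A C\<bar> \<le> K \<and> \<bar>\<beta>AA A C\<bar> \<le> K \<and> \<bar>\<beta>AC A C\<bar> \<le> K \<and> \<bar>\<beta>CC A C\<bar> \<le> K"
proof -
  let ?S = "{l..R} \<times> {l..R}"
  have nz: "\<And>z. z \<in> ?S \<Longrightarrow> fst z \<noteq> 0" "\<And>z. z \<in> ?S \<Longrightarrow> snd z \<noteq> 0" "\<And>z. z \<in> ?S \<Longrightarrow> N (fst z) (snd z) \<noteq> 0"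
    using assms pos(3) by (auto simp: less_imp_neq[THEN not_sym])
  have P: "continuous_on ?S (\<lambda>z. P (fst z))" and Q: "continuous_on ?S (\<lambda>z. Q (snd z))"
    unfolding P_def Q_def using nz by (intro continuous_on_powr continuous_intros; blast)+
  have N: "continuous_on ?S (\<lambda>z. N (fst z) (snd z))" unfolding N_def by (intro continuous_intros P Q)
  have T: "continuous_on ?S (\<lambda>z. T (fst z) (snd z))" unfolding T_def using nz by (intro continuous_on_powr continuous_intros N; blast)
  have k: "continuous_on ?S (\<lambda>z. \<kappa> (fst z) (snd z))" unfolding \<kappa>_def using nz by (intro continuous_intros N T; blast)
  have c: "continuous_on ?S (\<lambda>z. \<beta>A (fst z) (snd z))" "continuous_on ?S (\<lambda>z. \<beta>C (fst z) (snd z))"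
     "continuous_on ?S (\<lambda>z. \<beta>AA (fst z) (snd z))" "continuous_on ?S (\<lambda>z. \<beta>AC (fst z) (snd z))" "continuous_on ?S (\<lambda>z. \<beta>CC (fst z) (snd z))"
    unfolding \<beta>A_def \<beta>C_def \<beta>AA_def \<beta>AC_def \<beta>CC_def
    using nz by (intro continuous_intros P Q N T k; force)+
  have b: "\<exists>K. \<forall>z\<in>?S. \<bar>g z\<bar> \<le> K" if "continuous_on ?S g" for g :: "real \<times> real \<Rightarrow> real"
  proof -
    have "compact (g ` ?S)" using that by (intro compact_continuous_image compact_Times) auto
    then have "bounded (g ` ?S)" by (rule compact_imp_bounded)
    then show ?thesis unfolding bounded_iff by force
  qed
  obtain K1 K2 K3 K4 K5 where K: "\<forall>z\<in>?S. \<bar>\<beta>A (fst z) (snd z)\<bar> \<le> K1" "\<forall>z\<in>?S. \<bar>\<beta>C (fst z) (snd z)\<bar> \<le> K2"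
    "\<forall>z\<in>?S. \<bar>\<beta>AA (fst z) (snd z)\<bar> \<le> K3" "\<forall>z\<in>?S. \<bar>\<beta>AC (fst z) (snd z)\<bar> \<le> K4" "\<forall>z\<in>?S. \<bar>\<beta>CC (fst z) (snd z)\<bar> \<le> K5"
    using c[THEN b] by blast
  show ?thesis
  proof (rule that[of "\<bar>K1\<bar> + \<bar>K2\<bar> + \<bar>K3\<bar> + \<bar>K4\<bar> + \<bar>K5\<bar>"])
    fix A C assume "l \<le> A" "A \<le> R" "l \<le> C" "C \<le> R"
    then have "(A, C) \<in> ?S" by auto
    from K[THEN bspec, OF this]
    show "\<bar>\<beta>A A C\<bar> \<le> \<bar>K1\<bar> + \<bar>K2\<bar> + \<bar>K3\<bar> + \<bar>K4\<bar> + \<bar>K5\<bar> \<and> \<bar>\<beta>C A C\<bar> \<le> \<bar>K1\<bar> + \<bar>K2\<bar> + \<bar>K3\<bar> + \<bar>K4\<bar> + \<bar>K5\<bar> \<and>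
      \<bar>\<beta>AA A C\<bar> \<le> \<bar>K1\<bar> + \<bar>K2\<bar> + \<bar>K3\<bar> + \<bar>K4\<bar> + \<bar>K5\<bar> \<and> \<bar>\<beta>AC A C\<bar> \<le> \<bar>K1\<bar> + \<bar>K2\<bar> + \<bar>K3\<bar> + \<bar>K4\<bar> + \<bar>K5\<bar> \<and>
      \<bar>\<beta>CC A C\<bar> \<le> \<bar>K1\<bar> + \<bar>K2\<bar> + \<bar>K3\<bar> + \<bar>K4\<bar> + \<bar>K5\<bar>" by auto
  qed simp
qed

text \<open>The source of the majorants for the integrals over space and time. The bounds are linear
  in \<open>r\<close>, so that \<open>r\<close> can be the decay in space and time or, for
  \<open>B1\<close>, the distance \<open>x $ i\<close> to a wall. Of \<open>f2\<close> only the
  product with \<open>f\<close> is assumed bounded, because second derivatives may blow up at a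
  wall.\<close>

lemma B_bounds:
  fixes I J :: "'n set"
  assumes fin: "finite I" "finite J" and e: "0 < e" and M: "0 \<le> M"
  obtains K where "0 \<le> K"
   "\<And>(f :: 'n \<Rightarrow> real) f1 r. (\<And>n. \<bar>f n\<bar> \<le> M * r) \<Longrightarrow> (\<And>n. \<bar>f1 n\<bar> \<le> M) \<Longrightarrow> 0 \<le> r \<Longrightarrow> (\<And>n. \<bar>f n\<bar> \<le> M) \<Longrightarrow> \<bar>B1 I J e f f1\<bar> \<le> K * r"
   "\<And>(f :: 'n \<Rightarrow> real) f1 f2 r. (\<And>n. \<bar>f n\<bar> \<le> M) \<Longrightarrow> (\<And>n. \<bar>f1 n\<bar> \<le> M) \<Longrightarrow> 0 \<le> r \<Longrightarrow> r \<le> 1 \<Longrightarrow> (\<And>n. (f1 n)\<^sup>2 \<le> M\<^sup>2 * r) \<Longrightarrow>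
       (\<And>n. \<bar>f n * f1 n\<bar> \<le> M\<^sup>2 * r) \<Longrightarrow> (\<And>n. \<bar>f n * f2 n\<bar> \<le> M\<^sup>2 * r) \<Longrightarrow> \<bar>B2 I J e f f1 f2\<bar> \<le> K * r"
proof -
  define m where "m = real (card I + card J)"
  have m: "0 \<le> m" by (simp add: m_def)
  define R where "R = e\<^sup>2 + m * M\<^sup>2"
  obtain K where K: "0 \<le> K" "\<And>A C. e\<^sup>2 \<le> A \<Longrightarrow> A \<le> R \<Longrightarrow> e\<^sup>2 \<le> C \<Longrightarrow> C \<le> R \<Longrightarrow>
     \<bar>\<beta>A A C\<bar> \<le> K \<and> \<bar>\<beta>C A C\<bar> \<le> K \<and> \<bar>\<beta>AA A C\<bar> \<le> K \<and> \<bar>\<beta>AC A C\<bar> \<le> K \<and> \<bar>\<beta>CC A C\<bar> \<le> K"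
    using second_derivs_bounded[of "e\<^sup>2" R] e by auto
  have sm: "\<bar>\<Sum>n\<in>L. g n\<bar> \<le> m * B" if "L = I \<or> L = J" "\<And>n. \<bar>g n\<bar> \<le> B" "0 \<le> B" for g :: "'n \<Rightarrow> real" and B L
  proof -
    have "\<bar>\<Sum>n\<in>L. g n\<bar> \<le> (\<Sum>n\<in>L. \<bar>g n\<bar>)" by (rule sum_abs)
    also have "\<dots> \<le> real (card L) * B" by (rule sum_bounded_above) (rule that)
    also have "\<dots> \<le> m * B" using that by (intro mult_right_mono) (auto simp: m_def)
    finally show ?thesis .
  qed
  have AB: "e\<^sup>2 \<le> Asum L e f \<and> Asum L e f \<le> R" if "\<And>n. \<bar>f n\<bar> \<le> M" "L = I \<or> L = J" for f :: "'n \<Rightarrow> real" and L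
  proof -
    have "\<bar>\<Sum>n\<in>L. (f n)\<^sup>2\<bar> \<le> m * M\<^sup>2"
      using that(1) by (intro sm[OF that(2)]) (auto simp: abs_le_square_iff[symmetric] M)
    then show ?thesis by (auto simp: Asum_def R_def sum_nonneg)
  qed
  show ?thesis
  proof (rule that[of "4 * K * m * M\<^sup>2 + 16 * K * (m * M\<^sup>2)\<^sup>2 + 8 * K * (m * M\<^sup>2)"])
    show "0 \<le> 4 * K * m * M\<^sup>2 + 16 * K * (m * M\<^sup>2)\<^sup>2 + 8 * K * (m * M\<^sup>2)" using K m by simp
  next
    fix f f1 :: "'n \<Rightarrow> real" and r assume f: "\<And>n. \<bar>f n\<bar> \<le> M * r" and f1: "\<And>n. \<bar>f1 n\<bar> \<le> M" and r: "0 \<le> r" and fM: "\<And>n. \<bar>f n\<bar> \<le> M"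
    have s: "\<bar>\<Sum>n\<in>L. f n * f1 n\<bar> \<le> m * (M\<^sup>2 * r)" if "L = I \<or> L = J" for L
    proof (rule sm[OF that])
      fix n show "\<bar>f n * f1 n\<bar> \<le> M\<^sup>2 * r"
        using mult_mono[OF f[of n] f1[of n]] M r by (simp add: abs_mult power2_eq_square mult_ac)
    qed (use r in simp)
    note k = K(2)[OF conjunct1[OF AB] conjunct2[OF AB] conjunct1[OF AB] conjunct2[OF AB], of f I f J]
    have "\<bar>\<beta>A (Asum I e f) (Asum J e f) * (2 * (\<Sum>n\<in>I. f n * f1 n))\<bar> \<le> K * (2 * (m * (M\<^sup>2 * r)))"
      unfolding abs_mult using k fM s K by (intro mult_mono) auto
    moreover have "\<bar>\<beta>C (Asum I e f) (Asum J e f) * (2 * (\<Sum>n\<in>J. f n * f1 n))\<bar> \<le> K * (2 * (m * (M\<^sup>2 * r)))"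
      unfolding abs_mult using k fM s K by (intro mult_mono) auto
    ultimately have "\<bar>B1 I J e f f1\<bar> \<le> 2 * (K * (2 * (m * (M\<^sup>2 * r))))" unfolding B1_def by linarith
    also have "\<dots> = (4 * K * m * M\<^sup>2) * r" by simp
    also have "\<dots> \<le> (4 * K * m * M\<^sup>2 + 16 * K * (m * M\<^sup>2)\<^sup>2 + 8 * K * (m * M\<^sup>2)) * r"
      using K m r by (intro mult_right_mono) auto
    finally show "\<bar>B1 I J e f f1\<bar> \<le> (4 * K * m * M\<^sup>2 + 16 * K * (m * M\<^sup>2)\<^sup>2 + 8 * K * (m * M\<^sup>2)) * r" .
  next
    fix f f1 f2 :: "'n \<Rightarrow> real" and r assume fM: "\<And>n. \<bar>f n\<bar> \<le> M" and r: "0 \<le> r" "r \<le> 1"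
      and f1: "\<And>n. (f1 n)\<^sup>2 \<le> M\<^sup>2 * r" and ff1: "\<And>n. \<bar>f n * f1 n\<bar> \<le> M\<^sup>2 * r" and ff2: "\<And>n. \<bar>f n * f2 n\<bar> \<le> M\<^sup>2 * r"
    note k = K(2)[OF conjunct1[OF AB] conjunct2[OF AB] conjunct1[OF AB] conjunct2[OF AB], of f I f J]
    define h where "h = m * M\<^sup>2"
    have h: "0 \<le> h" using m by (simp add: h_def)
    have s1: "\<bar>\<Sum>n\<in>L. f n * f1 n\<bar> \<le> h * r" if "L = I \<or> L = J" for L
      using sm[OF that ff1] r by (simp add: h_def mult_ac)
    have s2: "\<bar>\<Sum>n\<in>L. (f1 n)\<^sup>2 + f n * f2 n\<bar> \<le> 2 * h * r" if "L = I \<or> L = J" for L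
    proof -
      have "\<bar>(f1 n)\<^sup>2 + f n * f2 n\<bar> \<le> 2 * (M\<^sup>2 * r)" for n
        using f1[of n] ff2[of n] by (simp add: abs_le_iff) (smt (verit) zero_le_power2)
      from sm[OF that this] r show ?thesis by (simp add: h_def mult_ac)
    qed
    have rr: "(h * r) * (h * r) \<le> h\<^sup>2 * r"
      using mult_right_mono[OF r(2), of "h * h * r"] h r by (simp add: power2_eq_square mult_ac)
    have s11: "\<bar>(\<Sum>n\<in>L. f n * f1 n) * (\<Sum>n\<in>L'. f n * f1 n)\<bar> \<le> h\<^sup>2 * r" if "L = I \<or> L = J" "L' = I \<or> L' = J" for L L'
      unfolding abs_mult by (rule order_trans[OF mult_mono[OF s1[OF that(1)] s1[OF that(2)]] rr]) (use h r in auto)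
    have t: "\<bar>x * a * y\<bar> \<le> x * K * b" if "\<bar>a\<bar> \<le> K" "\<bar>y\<bar> \<le> b" "0 \<le> x" for x a y b :: real
      unfolding abs_mult using that K by (intro mult_mono) auto
    have "\<bar>4 * \<beta>AA (Asum I e f) (Asum J e f) * (\<Sum>n\<in>I. f n * f1 n)\<^sup>2\<bar> \<le> 4 * K * (h\<^sup>2 * r)"
      using k fM s11[of I I] by (intro t) (auto simp: power2_eq_square)
    moreover have "\<bar>8 * \<beta>AC (Asum I e f) (Asum J e f) * ((\<Sum>n\<in>I. f n * f1 n) * (\<Sum>n\<in>J. f n * f1 n))\<bar> \<le> 8 * K * (h\<^sup>2 * r)"
      using k fM s11[of I J] by (intro t) auto
    moreover have "\<bar>4 * \<beta>CC (Asum I e f) (Asum J e f) * (\<Sum>n\<in>J. f n * f1 n)\<^sup>2\<bar> \<le> 4 * K * (h\<^sup>2 * r)"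
      using k fM s11[of J J] by (intro t) (auto simp: power2_eq_square)
    moreover have "\<bar>2 * \<beta>A (Asum I e f) (Asum J e f) * (\<Sum>n\<in>I. (f1 n)\<^sup>2 + f n * f2 n)\<bar> \<le> 2 * K * (2 * h * r)"
      using k fM s2[of I] by (intro t) auto
    moreover have "\<bar>2 * \<beta>C (Asum I e f) (Asum J e f) * (\<Sum>n\<in>J. (f1 n)\<^sup>2 + f n * f2 n)\<bar> \<le> 2 * K * (2 * h * r)"
      using k fM s2[of J] by (intro t) auto
    ultimately have "\<bar>B2 I J e f f1 f2\<bar> \<le> 16 * K * (h\<^sup>2 * r) + 8 * K * (h * r)"
      unfolding B2_def mult.assoc[of "8 * \<beta>AC (Asum I e f) (Asum J e f)"] by linarith
    also have "\<dots> \<le> (4 * K * m * M\<^sup>2 + 16 * K * h\<^sup>2 + 8 * K * h) * r"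
      using K m r by (simp add: distrib_right)
    finally show "\<bar>B2 I J e f f1 f2\<bar> \<le> (4 * K * m * M\<^sup>2 + 16 * K * (m * M\<^sup>2)\<^sup>2 + 8 * K * (m * M\<^sup>2)) * r"
      by (simp add: h_def)
  qed
qed

section \<open>Removing the regularisation\<close>

lemma powr_subadd:
  assumes "0 \<le> x" "0 \<le> y" "0 \<le> r" "r \<le> (1::real)"
  shows "(x + y) powr r \<le> x powr r + y powr r"
proof (cases "x + y = 0")
  case False
  then have s: "x + y > 0" using assms by simp
  have *: "z * (x + y) powr (r - 1) \<le> z powr r" if "0 \<le> z" "z \<le> x + y" for z
  proof (cases "z = 0")
    case False
    then have "(x + y) powr (r - 1) \<le> z powr (r - 1)" using that assms by (intro powr_mono2') auto
    then have "z * (x + y) powr (r - 1) \<le> z * z powr (r - 1)" using that by (intro mult_left_mono) auto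
    also have "\<dots> = z powr r" using that False by (simp add: powr_diff)
    finally show ?thesis .
  qed simp
  have "(x + y) powr r = x * (x + y) powr (r - 1) + y * (x + y) powr (r - 1)"
    using s by (simp add: powr_diff flip: distrib_right add_divide_distrib)
  also have "\<dots> \<le> x powr r + y powr r" using assms by (intro add_mono *) auto
  finally show ?thesis .
qed (use assms in simp)

text \<open>A majorant independent of \<open>e\<close>, for dominated convergence. The value at
  \<open>a = c = 0\<close> is subtracted since a positive constant is not integrable over the
  orthant. In \<open>c\<close> the bound is only of order \<open>q / 2\<close>, because that power
  is not Lipschitz at 0 unless \<open>q = 2\<close>.\<close>

lemma beta_diff_bounds:
  assumes R: "0 \<le> R"
  obtains K where "0 \<le> K" "\<And>e a c. 0 < e \<Longrightarrow> e \<le> 1 \<Longrightarrow> 0 \<le> a \<Longrightarrow> a \<le> R \<Longrightarrow> 0 \<le> c \<Longrightarrow> c \<le> R \<Longrightarrow>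
     \<bar>\<beta> (e\<^sup>2 + a) (e\<^sup>2 + c) - \<beta> (e\<^sup>2) (e\<^sup>2)\<bar> \<le> K * (a + c powr (q/2))"
proof -
  define K1 where "K1 = (p/2) * (1 + R) powr (p/2 - 1)"
  define K2 where "K2 = ((1 + R) powr (p/2) + (1 + R) powr (q/2)) powr \<theta>"
  have K12: "0 \<le> K1" "0 \<le> K2" using p by (auto simp: K1_def K2_def)
  show ?thesis
  proof (rule that[of "2 + K1 + K2"])
    show "0 \<le> 2 + K1 + K2" using K12 by simp
    fix e a c :: real assume e: "0 < e" "e \<le> 1" and a: "0 \<le> a" "a \<le> R" and c: "0 \<le> c" "c \<le> R"
    have e2: "0 < e\<^sup>2" "e\<^sup>2 \<le> 1" using e by (auto simp: power_le_one)
    let ?A = "e\<^sup>2 + a" and ?C = "e\<^sup>2 + c"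
    have A: "0 < ?A" "?A \<le> 1 + R" and C: "0 < ?C" "?C \<le> 1 + R" using e2 a c by linarith+
    have Q: "Q ?C - Q (e\<^sup>2) \<le> c powr (q/2)" unfolding Q_def
      using powr_subadd[of "e\<^sup>2" c "q/2"] q e2 c by simp
    have Q0: "Q (e\<^sup>2) \<le> Q ?C" unfolding Q_def using q c e2 by (intro powr_mono2) auto
    have P: "P ?A - P (e\<^sup>2) \<le> K1 * a"
    proof (cases "a = 0")
      case False
      then have lt: "e\<^sup>2 < ?A" using a by simp
      obtain z where z: "e\<^sup>2 < z" "z < ?A" "P ?A - P (e\<^sup>2) = (?A - e\<^sup>2) * ((p/2) * z powr (p/2 - 1))"
        unfolding P_def using MVT2[OF lt, of "\<lambda>x. x powr (p/2)" "\<lambda>z. (p/2) * z powr (p/2 - 1)", OF has_real_derivative_powr] e2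
        by auto
      have "z powr (p/2 - 1) \<le> (1 + R) powr (p/2 - 1)" using z A e2 p by (intro powr_mono2) linarith+
      then have "(p/2) * z powr (p/2 - 1) \<le> K1" unfolding K1_def using p by (intro mult_left_mono) auto
      then have "a * ((p/2) * z powr (p/2 - 1)) \<le> a * K1" using a by (intro mult_left_mono) auto
      then show ?thesis using z(3) by (simp add: mult.commute)
    qed simp
    have P0: "P (e\<^sup>2) \<le> P ?A" unfolding P_def using p a e2 by (intro powr_mono2) auto
    let ?N = "N ?A ?C" and ?Nz = "N (e\<^sup>2) (e\<^sup>2)" and ?T = "T ?A ?C" and ?Tz = "T (e\<^sup>2) (e\<^sup>2)"
    have N0: "0 < ?Nz" "?Nz \<le> ?N" using pos e2 P0 Q0 by (auto simp: N_def)
    have T0: "?Tz \<le> ?T" unfolding T_def using N0 th by (intro powr_mono2) auto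
    have PQ: "P ?A \<le> (1 + R) powr (p/2)" "Q ?C \<le> (1 + R) powr (q/2)"
      unfolding P_def Q_def using A C p q by (intro powr_mono2; linarith)+
    have TK: "?T \<le> K2" unfolding T_def K2_def N_def
      using pos A C th by (intro powr_mono2 add_mono PQ) (auto simp: add_nonneg_nonneg less_imp_le)
    \<comment> \<open>\<open>N powr (\<theta> - 1)\<close> decreases in \<open>N\<close>, so the
      increment of \<open>T\<close> is at most that of \<open>N\<close> times
      \<open>?Tz / ?Nz\<close>; the factor \<open>e\<^sup>2\<close> compensates this quotient by
      \<open>AT_le\<close>.\<close>
    have TT: "e\<^sup>2 * (?T - ?Tz) \<le> ?N - ?Nz"
    proof -
      have "?N powr (\<theta> - 1) \<le> ?Nz powr (\<theta> - 1)" using N0 th by (intro powr_mono2') auto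
      then have "?N * ?N powr (\<theta> - 1) \<le> ?N * ?Nz powr (\<theta> - 1)" using N0 by (intro mult_left_mono) auto
      then have "?T \<le> ?N * (?Tz / ?Nz)" using N0 unfolding T_def by (simp add: powr_diff)
      then have "?T - ?Tz \<le> (?N - ?Nz) * (?Tz / ?Nz)"
        unfolding left_diff_distrib using N0 by simp
      from mult_left_mono[OF this, of "e\<^sup>2"]
      have "e\<^sup>2 * (?T - ?Tz) \<le> (?N - ?Nz) * (e\<^sup>2 * ?Tz / ?Nz)" by (simp add: mult_ac)
      also have "\<dots> \<le> (?N - ?Nz) * 1" using AT_le[OF e2(1) e2(1)] N0 by (intro mult_left_mono) auto
      finally show ?thesis by simp
    qed
    have "\<beta> ?A ?C - \<beta> (e\<^sup>2) (e\<^sup>2) = (Q ?C - Q (e\<^sup>2)) + \<delta> * (a * ?T + e\<^sup>2 * (?T - ?Tz))"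
      unfolding \<beta>_def by (simp add: algebra_simps)
    moreover have "a * ?T + e\<^sup>2 * (?T - ?Tz) \<le> a * K2 + (K1 * a + c powr (q/2))"
      using TT P Q mult_left_mono[OF TK a(1)] by (simp add: N_def)
    moreover have nn: "0 \<le> a * ?T + e\<^sup>2 * (?T - ?Tz)" using a T0 e2 by (simp add: T_def)
    ultimately have *: "0 \<le> \<beta> ?A ?C - \<beta> (e\<^sup>2) (e\<^sup>2)" "\<beta> ?A ?C - \<beta> (e\<^sup>2) (e\<^sup>2) \<le> c powr (q/2) + 1 * (a * K2 + (K1 * a + c powr (q/2)))"
      using Q Q0 dl mult_mono[of \<delta> 1 "a * ?T + e\<^sup>2 * (?T - ?Tz)" "a * K2 + (K1 * a + c powr (q/2))"] by auto
    have "c powr (q/2) + 1 * (a * K2 + (K1 * a + c powr (q/2))) \<le> (2 + K1 + K2) * (a + c powr (q/2))"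
      using K12 a by (simp add: algebra_simps)
    then show "\<bar>\<beta> ?A ?C - \<beta> (e\<^sup>2) (e\<^sup>2)\<bar> \<le> (2 + K1 + K2) * (a + c powr (q/2))" using * by linarith
  qed
qed

lemma beta_diff_tendsto:
  assumes a: "0 \<le> a" and c: "0 \<le> c" and e: "e \<longlonglongrightarrow> 0"
  shows "(\<lambda>n. \<beta> ((e n)\<^sup>2 + a) ((e n)\<^sup>2 + c) - \<beta> ((e n)\<^sup>2) ((e n)\<^sup>2)) \<longlonglongrightarrow> \<beta> a c"
proof (cases "a = 0 \<and> c = 0")
  \<comment> \<open>For \<open>p = 2\<close> the exponent \<theta> is 0 and \<open>T\<close> jumps
    from 1 to \<open>0 powr 0 = 0\<close> at the origin, so this point is kept out of the continuity
    argument; here the difference vanishes identically.\<close>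
  case True
  then show ?thesis by (simp add: \<beta>_def Q_def)
next
  case False
  have e2: "(\<lambda>n. (e n)\<^sup>2) \<longlonglongrightarrow> 0" using tendsto_power[OF e, of 2] by simp
  have s: "(\<lambda>n. (e n)\<^sup>2 + b) \<longlonglongrightarrow> b" for b using tendsto_add[OF e2 tendsto_const[of b]] by simp
  have P: "(\<lambda>n. P ((e n)\<^sup>2 + b)) \<longlonglongrightarrow> P b" and Q: "(\<lambda>n. Q ((e n)\<^sup>2 + b)) \<longlonglongrightarrow> Q b" if "0 \<le> b" for b
    unfolding P_def Q_def using that p q
    by (intro tendsto_powr'[OF s tendsto_const]; auto intro!: always_eventually)+
  have N: "(\<lambda>n. N ((e n)\<^sup>2 + b) ((e n)\<^sup>2 + d)) \<longlonglongrightarrow> N b d" if "0 \<le> b" "0 \<le> d" for b d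
    unfolding N_def by (intro tendsto_add P Q that)
  have "N a c > 0" using False a c by (auto simp: N_def P_def Q_def add_pos_nonneg add_nonneg_pos)
  then have T: "(\<lambda>n. T ((e n)\<^sup>2 + a) ((e n)\<^sup>2 + c)) \<longlonglongrightarrow> T a c"
    unfolding T_def by (intro tendsto_powr N a c tendsto_const) auto
  have 1: "(\<lambda>n. \<beta> ((e n)\<^sup>2 + a) ((e n)\<^sup>2 + c)) \<longlonglongrightarrow> \<beta> a c"
    unfolding \<beta>_def by (intro tendsto_intros Q c s T)
  \<comment> \<open>At the origin the upper bound of \<beta> replaces the continuity of
    \<open>T\<close>.\<close>
  have "(\<lambda>n. \<beta> ((e n)\<^sup>2 + 0) ((e n)\<^sup>2 + 0)) \<longlonglongrightarrow> 0"
  proof (rule tendsto_sandwich[OF _ _ tendsto_const])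
    show "\<forall>\<^sub>F n in sequentially. \<beta> ((e n)\<^sup>2 + 0) ((e n)\<^sup>2 + 0) \<le> 1/8 * P ((e n)\<^sup>2 + 0) + 9/8 * Q ((e n)\<^sup>2 + 0)"
      unfolding P_def Q_def by (intro always_eventually allI beta_upper) auto
    show "\<forall>\<^sub>F n in sequentially. 0 \<le> \<beta> ((e n)\<^sup>2 + 0) ((e n)\<^sup>2 + 0)"
      using dl by (intro always_eventually allI) (auto simp: \<beta>_def Q_def T_def)
    have "(\<lambda>n. 1/8 * P ((e n)\<^sup>2 + 0) + 9/8 * Q ((e n)\<^sup>2 + 0)) \<longlonglongrightarrow> 1/8 * P 0 + 9/8 * Q 0"
      by (intro tendsto_intros P Q) auto
    then show "(\<lambda>n. 1/8 * P ((e n)\<^sup>2 + 0) + 9/8 * Q ((e n)\<^sup>2 + 0)) \<longlonglongrightarrow> 0" by (simp add: P_def Q_def)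
  qed
  then show ?thesis using tendsto_diff[OF 1] by fastforce
qed

end

section \<open>The bilinear embedding\<close>

lemma section_measurable:
  fixes f :: "'a::euclidean_space \<Rightarrow> 'b::euclidean_space \<Rightarrow> real"
  assumes "(\<lambda>z. f (fst z) (snd z)) \<in> borel_measurable borel"
  shows "(\<lambda>x. f x t) \<in> borel_measurable borel" "(\<lambda>t. f x t) \<in> borel_measurable borel"
proof -
  have "(\<lambda>x. (x, t)) \<in> measurable borel borel" "(\<lambda>t. (x, t)) \<in> measurable borel borel"
    by (intro borel_measurable_continuous_onI continuous_intros)+
  from measurable_compose[OF this(1) assms] measurable_compose[OF this(2) assms]
  show "(\<lambda>x. f x t) \<in> borel_measurable borel" "(\<lambda>t. f x t) \<in> borel_measurable borel" by simp_all
qed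

lemma snd_borel [measurable]: "(\<lambda>z :: 'a::euclidean_space \<times> 'b::euclidean_space. snd z) \<in> borel_measurable borel"
  by (intro borel_measurable_continuous_onI continuous_intros)

text \<open>Here \<open>w1\<close>, \<open>w2\<close> are the spatial and \<open>wt\<close>, \<open>wtt\<close> the time derivatives of \<open>w\<close>. The second derivative
  \<open>w2\<close> may blow up at the wall \<open>x\<^sub>i = 0\<close>; since \<open>w\<close> vanishes there, the products \<open>w \<cdot> w2\<close> in the
  second derivatives of \<open>b\<close> stay bounded, and the boundary terms \<open>w \<cdot> w1\<close> vanish.\<close>
locale flow =
  fixes w :: "'n \<Rightarrow> real ^ 'd \<Rightarrow> real \<Rightarrow> real" and w1 w2 :: "'n \<Rightarrow> 'd \<Rightarrow> real ^ 'd \<Rightarrow> real \<Rightarrow> real"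
    and wt wtt :: "'n \<Rightarrow> real ^ 'd \<Rightarrow> real \<Rightarrow> real" and W :: "'n \<Rightarrow> real ^ 'd \<Rightarrow> real" and V :: "real ^ 'd \<Rightarrow> real" and c M :: real
  assumes c: "0 < c" and M: "0 \<le> M"
    and V: "\<And>x. x \<in> orthant \<Longrightarrow> 0 \<le> V x" "\<And>n x. x \<in> orthant \<Longrightarrow> V x \<le> W n x"
    and mV: "V \<in> borel_measurable borel"
    and mw: "\<And>n. (\<lambda>z. w n (fst z) (snd z)) \<in> borel_measurable borel"
    and mw1: "\<And>n i. (\<lambda>z. w1 n i (fst z) (snd z)) \<in> borel_measurable borel"
    and mw2: "\<And>n i. (\<lambda>z. w2 n i (fst z) (snd z)) \<in> borel_measurable borel"
    and mwt: "\<And>n. (\<lambda>z. wt n (fst z) (snd z)) \<in> borel_measurable borel"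
    and mwtt: "\<And>n. (\<lambda>z. wtt n (fst z) (snd z)) \<in> borel_measurable borel"
    and dx: "\<And>n i x t. x \<in> orthant \<Longrightarrow> ((\<lambda>s. w n (x + s *\<^sub>R axis i 1) t) has_real_derivative w1 n i x t) (at 0)"
    and dxx: "\<And>n i x t. x \<in> orthant \<Longrightarrow> ((\<lambda>s. w1 n i (x + s *\<^sub>R axis i 1) t) has_real_derivative w2 n i x t) (at 0)"
    and dt: "\<And>n x t. x \<in> orthant \<Longrightarrow> (w n x has_real_derivative wt n x t) (at t)"
    and dtt: "\<And>n x t. x \<in> orthant \<Longrightarrow> (wt n x has_real_derivative wtt n x t) (at t)"
    and bw: "\<And>n x t. x \<in> orthant \<Longrightarrow> 0 \<le> t \<Longrightarrow> \<bar>w n x t\<bar> \<le> M * (exp (- c * t) * gs x)"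
    and bwx: "\<And>n i x t. x \<in> orthant \<Longrightarrow> 0 \<le> t \<Longrightarrow> \<bar>w n x t\<bar> \<le> M * x $ i * (exp (- c * t) * gs x)"
    and bw1: "\<And>n i x t. x \<in> orthant \<Longrightarrow> 0 \<le> t \<Longrightarrow> \<bar>w1 n i x t\<bar> \<le> M * (exp (- c * t) * gs x)"
    and bw2: "\<And>n i x t. x \<in> orthant \<Longrightarrow> 0 \<le> t \<Longrightarrow> x $ i * \<bar>w2 n i x t\<bar> \<le> M * (exp (- c * t) * gs x)"
    and bwt: "\<And>n x t. x \<in> orthant \<Longrightarrow> 0 \<le> t \<Longrightarrow> \<bar>wt n x t\<bar> \<le> M * (exp (- c * t) * gs x)"
    and bwtt: "\<And>n x t. x \<in> orthant \<Longrightarrow> 0 \<le> t \<Longrightarrow> \<bar>wtt n x t\<bar> \<le> M * (exp (- c * t) * gs x)"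
    and pde: "\<And>n x t. x \<in> orthant \<Longrightarrow> 0 \<le> t \<Longrightarrow> wtt n x t + (\<Sum>i\<in>UNIV. w2 n i x t) = W n x * w n x t"
begin

text \<open>Formed with the common lower bound \<open>V\<close> instead of the potentials
  \<open>W n\<close>, so that the same potential appears in the energies of both index sets.\<close>

definition energy :: "'n set \<Rightarrow> real ^ 'd \<Rightarrow> real \<Rightarrow> real" where
  "energy I x t = (\<Sum>n\<in>I. (wt n x t)\<^sup>2 + (\<Sum>i\<in>UNIV. (w1 n i x t)\<^sup>2) + V x * (w n x t)\<^sup>2)"

lemma measurable_flow [measurable]:
  "\<And>n. (\<lambda>z. w n (fst z) (snd z)) \<in> borel_measurable borel"
  "\<And>n i. (\<lambda>z. w1 n i (fst z) (snd z)) \<in> borel_measurable borel"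
  "\<And>n i. (\<lambda>z. w2 n i (fst z) (snd z)) \<in> borel_measurable borel"
  "\<And>n. (\<lambda>z. wt n (fst z) (snd z)) \<in> borel_measurable borel"
  "\<And>n. (\<lambda>z. wtt n (fst z) (snd z)) \<in> borel_measurable borel"
  "(\<lambda>z :: (real ^ 'd) \<times> real. V (fst z)) \<in> borel_measurable borel"
proof -
  have "(fst :: (real ^ 'd) \<times> real \<Rightarrow> _) \<in> borel_measurable borel"
    by (intro borel_measurable_continuous_onI continuous_intros)
  from measurable_compose[OF this mV] show "(\<lambda>z :: (real ^ 'd) \<times> real. V (fst z)) \<in> borel_measurable borel" .
qed (rule mw mw1 mw2 mwt mwtt)+

lemma decay_le_1: "0 \<le> t \<Longrightarrow> exp (- c * t) * gs x \<le> 1" "0 \<le> exp (- c * t) * gs x"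
  using c mult_mono[of "exp (- c * t)" 1 "gs x" 1] by auto

end

locale bellman_flow = bellman p q \<theta> \<delta> + flow w w1 w2 wt wtt W V c M
  for p q \<theta> \<delta> :: real and w :: "'n \<Rightarrow> real ^ 'd \<Rightarrow> real \<Rightarrow> real" and w1 w2 wt wtt W V c M +
  fixes I J :: "'n set"
  assumes fin: "finite I" "finite J"
begin

abbreviation "b e x t \<equiv> \<beta> (Asum I e (\<lambda>n. w n x t)) (Asum J e (\<lambda>n. w n x t))"
abbreviation "b1x e i x t \<equiv> B1 I J e (\<lambda>n. w n x t) (\<lambda>n. w1 n i x t)"
abbreviation "b2x e i x t \<equiv> B2 I J e (\<lambda>n. w n x t) (\<lambda>n. w1 n i x t) (\<lambda>n. w2 n i x t)"
abbreviation "b1t e x t \<equiv> B1 I J e (\<lambda>n. w n x t) (\<lambda>n. wt n x t)"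
abbreviation "b2t e x t \<equiv> B2 I J e (\<lambda>n. w n x t) (\<lambda>n. wt n x t) (\<lambda>n. wtt n x t)"

lemma b_measurable [measurable]:
  "(\<lambda>z. b1x e i (fst z) (snd z)) \<in> borel_measurable borel"
  "(\<lambda>z. b2x e i (fst z) (snd z)) \<in> borel_measurable borel"
  "(\<lambda>z. b2t e (fst z) (snd z)) \<in> borel_measurable borel"
  unfolding B1_def B2_def \<beta>A_def \<beta>C_def \<beta>AA_def \<beta>AC_def \<beta>CC_def \<kappa>_def T_def N_def P_def Q_def Asum_def
  by measurable

lemma b_bounds:
  assumes e: "0 < e"
  obtains K where "0 \<le> K"
    "\<And>i x t. x \<in> orthant \<Longrightarrow> 0 \<le> t \<Longrightarrow> \<bar>b1x e i x t\<bar> \<le> K * (exp (- c * t) * gs x)"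
    "\<And>i x t. x \<in> orthant \<Longrightarrow> 0 \<le> t \<Longrightarrow> \<bar>b1x e i x t\<bar> \<le> K * x $ i"
    "\<And>x t. x \<in> orthant \<Longrightarrow> 0 \<le> t \<Longrightarrow> \<bar>b1t e x t\<bar> \<le> K * (exp (- c * t) * gs x)"
    "\<And>i x t. x \<in> orthant \<Longrightarrow> 0 \<le> t \<Longrightarrow> \<bar>b2x e i x t\<bar> \<le> K * (exp (- c * t) * gs x)"
    "\<And>x t. x \<in> orthant \<Longrightarrow> 0 \<le> t \<Longrightarrow> \<bar>b2t e x t\<bar> \<le> K * (exp (- c * t) * gs x)"
proof (rule B_bounds[OF fin e M])
  fix K
  assume K: "0 \<le> K"
   "\<And>(f :: 'n \<Rightarrow> real) f1 r. (\<And>n. \<bar>f n\<bar> \<le> M * r) \<Longrightarrow> (\<And>n. \<bar>f1 n\<bar> \<le> M) \<Longrightarrow> 0 \<le> r \<Longrightarrow> (\<And>n. \<bar>f n\<bar> \<le> M) \<Longrightarrow> \<bar>B1 I J e f f1\<bar> \<le> K * r"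
   "\<And>(f :: 'n \<Rightarrow> real) f1 f2 r. (\<And>n. \<bar>f n\<bar> \<le> M) \<Longrightarrow> (\<And>n. \<bar>f1 n\<bar> \<le> M) \<Longrightarrow> 0 \<le> r \<Longrightarrow> r \<le> 1 \<Longrightarrow> (\<And>n. (f1 n)\<^sup>2 \<le> M\<^sup>2 * r) \<Longrightarrow>
       (\<And>n. \<bar>f n * f1 n\<bar> \<le> M\<^sup>2 * r) \<Longrightarrow> (\<And>n. \<bar>f n * f2 n\<bar> \<le> M\<^sup>2 * r) \<Longrightarrow> \<bar>B2 I J e f f1 f2\<bar> \<le> K * r"
  show ?thesis
  proof (rule that[OF K(1)])
    fix i and x :: "real ^ 'd" and t :: real assume x: "x \<in> orthant" and t: "0 \<le> t"
    let ?r = "exp (- c * t) * gs x"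
    note r = decay_le_1(2)[of t x] decay_le_1(1)[OF t, of x]
    have rM: "M * ?r \<le> M" using mult_left_mono[OF r(2) M] by simp
    have rr: "(M * ?r) * (M * ?r) \<le> M\<^sup>2 * ?r"
      using mult_right_mono[OF rM, of "M * ?r"] M r by (simp add: power2_eq_square mult_ac)
    have xi: "0 < x $ i" using x by (simp add: orthant_def)
    have fM: "\<bar>w n x t\<bar> \<le> M" "\<bar>w1 n i x t\<bar> \<le> M" "\<bar>wt n x t\<bar> \<le> M" for n
      using bw[OF x t, of n] bw1[OF x t, of n i] bwt[OF x t, of n] rM by linarith+
    have pr: "\<bar>u * v\<bar> \<le> M\<^sup>2 * ?r" if "\<bar>u\<bar> \<le> M * ?r" "\<bar>v\<bar> \<le> M * ?r" for u v
      unfolding abs_mult by (rule order_trans[OF mult_mono[OF that] rr]) (use M r in auto)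
    have sq: "u\<^sup>2 \<le> M\<^sup>2 * ?r" if "\<bar>u\<bar> \<le> M * ?r" for u
      using pr[OF that that] by (simp add: power2_eq_square)
    \<comment> \<open>The factor \<open>x $ i\<close> in the bound of \<open>w\<close> is the one
      that \<open>bw2\<close> needs.\<close>
    have w2: "\<bar>w n x t * w2 n i x t\<bar> \<le> M\<^sup>2 * ?r" for n
    proof -
      have "\<bar>w n x t\<bar> * \<bar>w2 n i x t\<bar> \<le> (M * x $ i * ?r) * \<bar>w2 n i x t\<bar>" by (intro mult_right_mono bwx x t) auto
      also have "\<dots> = (M * ?r) * (x $ i * \<bar>w2 n i x t\<bar>)" by simp
      also have "\<dots> \<le> (M * ?r) * (M * ?r)" by (intro mult_left_mono bw2 x t) (use M r in auto)
      also note rr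
      finally show ?thesis by (simp only: abs_mult)
    qed
    show "\<bar>b1x e i x t\<bar> \<le> K * ?r" by (intro K(2) bw x t fM r)
    show "\<bar>b1t e x t\<bar> \<le> K * ?r" by (intro K(2) bw x t fM r)
    show "\<bar>b1x e i x t\<bar> \<le> K * x $ i"
    proof (intro K(2) fM)
      fix n
      have "M * x $ i * ?r \<le> M * x $ i * 1" using M xi r by (intro mult_left_mono) auto
      then show "\<bar>w n x t\<bar> \<le> M * x $ i" using bwx[OF x t, of n i] by simp
    qed (use xi in simp)
    show "\<bar>b2x e i x t\<bar> \<le> K * ?r" by (intro K(3) fM r sq pr w2 bw bw1 x t)
    show "\<bar>b2t e x t\<bar> \<le> K * ?r" by (intro K(3) fM r sq pr bw bwt bwtt x t)
  qed
qed

lemma b2x_integral_zero: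
  assumes e: "0 < e" and t: "0 \<le> t"
  shows "(LINT x|MX. b2x e i x t) = 0"
proof -
  obtain K where K: "0 \<le> K"
    "\<And>i x t. x \<in> orthant \<Longrightarrow> 0 \<le> t \<Longrightarrow> \<bar>b1x e i x t\<bar> \<le> K * (exp (- c * t) * gs x)"
    "\<And>i x t. x \<in> orthant \<Longrightarrow> 0 \<le> t \<Longrightarrow> \<bar>b1x e i x t\<bar> \<le> K * x $ i"
    "\<And>i x t. x \<in> orthant \<Longrightarrow> 0 \<le> t \<Longrightarrow> \<bar>b2x e i x t\<bar> \<le> K * (exp (- c * t) * gs x)"
    using b_bounds[OF e] by metis
  have "K * (exp (- c * t) * gs x) \<le> K * gs x" for x :: "real ^ 'd"
    using K(1) c t mult_right_mono[of "exp (- c * t)" 1 "gs x"] by (intro mult_left_mono) auto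
  note bb = order_trans[OF _ this]
  show ?thesis
  proof (rule integral_partial_deriv_zero[where h="\<lambda>x. b1x e i x t" and M=K and i=i])
    fix x :: "real ^ 'd" assume x: "x \<in> orthant"
    show "((\<lambda>s. b1x e i (x + s *\<^sub>R axis i 1) t) has_real_derivative b2x e i x t) (at 0)"
      using B2_deriv[where s=0 and f="\<lambda>n s. w n (x + s *\<^sub>R axis i 1) t" and ?f1.0="\<lambda>n s. w1 n i (x + s *\<^sub>R axis i 1) t", OF _ dxx[OF x] e]
        dx[OF x] by simp
  qed (use K(2-4) t bb section_measurable(1)[OF b_measurable(1)] section_measurable(1)[OF b_measurable(2)] in auto)
qed

lemma b_tendsto:
  assumes e: "0 < e" and x: "x \<in> orthant"
  shows "((\<lambda>t. b e x t) \<longlongrightarrow> \<beta> (e\<^sup>2) (e\<^sup>2)) at_top"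
proof -
  have w0: "((\<lambda>t. w n x t) \<longlongrightarrow> 0) at_top" for n
  proof (rule tendsto_rabs_zero_cancel, rule tendsto_sandwich[OF _ _ tendsto_const])
    show "\<forall>\<^sub>F t in at_top. \<bar>w n x t\<bar> \<le> M * (exp (- c * t) * gs x)"
      using eventually_ge_at_top[of 0] by eventually_elim (rule bw[OF x])
    have "filterlim (\<lambda>t. - c * t) at_bot at_top"
      using c by (intro filterlim_tendsto_neg_mult_at_bot[OF tendsto_const] filterlim_ident) auto
    then show "((\<lambda>t. M * (exp (- c * t) * gs x)) \<longlongrightarrow> 0) at_top"
      by (intro tendsto_mult_right_zero tendsto_mult_left_zero filterlim_compose[OF exp_at_bot])
  qed (auto intro: always_eventually)
  have A: "((\<lambda>t. Asum L e (\<lambda>n. w n x t)) \<longlongrightarrow> e\<^sup>2) at_top" for L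
  proof -
    have "((\<lambda>t. Asum L e (\<lambda>n. w n x t)) \<longlongrightarrow> e\<^sup>2 + (\<Sum>n\<in>L. 0\<^sup>2)) at_top"
      unfolding Asum_def by (intro tendsto_intros w0)
    then show ?thesis by simp
  qed
  have e2: "e\<^sup>2 > 0" using e by simp
  have PQ: "((\<lambda>t. P (Asum I e (\<lambda>n. w n x t))) \<longlongrightarrow> P (e\<^sup>2)) at_top" "((\<lambda>t. Q (Asum J e (\<lambda>n. w n x t))) \<longlongrightarrow> Q (e\<^sup>2)) at_top"
    unfolding P_def Q_def using e2 by (intro tendsto_powr A tendsto_const; simp)+
  have T: "((\<lambda>t. T (Asum I e (\<lambda>n. w n x t)) (Asum J e (\<lambda>n. w n x t))) \<longlongrightarrow> T (e\<^sup>2) (e\<^sup>2)) at_top"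
    unfolding T_def N_def using pos(3)[OF e2 e2] by (intro tendsto_powr tendsto_add PQ tendsto_const) (simp add: N_def)
  show ?thesis unfolding \<beta>_def by (intro tendsto_intros PQ A T)
qed

lemma b2t_integral:
  assumes e: "0 < e" and x: "x \<in> orthant"
  shows "(LINT t|MT. t * b2t e x t) = b e x 0 - \<beta> (e\<^sup>2) (e\<^sup>2)"
proof -
  obtain K where K: "0 \<le> K"
    "\<And>x t. x \<in> orthant \<Longrightarrow> 0 \<le> t \<Longrightarrow> \<bar>b1t e x t\<bar> \<le> K * (exp (- c * t) * gs x)"
    "\<And>x t. x \<in> orthant \<Longrightarrow> 0 \<le> t \<Longrightarrow> \<bar>b2t e x t\<bar> \<le> K * (exp (- c * t) * gs x)"
    using b_bounds[OF e] by metis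
  have "K * (exp (- c * t) * gs x) \<le> K * exp (- c * t)" for t :: real
    using K(1) mult_left_mono[of "gs x" 1 "exp (- c * t)"] by (intro mult_left_mono) auto
  note bb = order_trans[OF _ this]
  show ?thesis
  proof (rule integral_t_second_deriv[where c=c and M=K and ?v1.0="\<lambda>t. b1t e x t", OF _ c _ _ _ _ b_tendsto[OF e x]])
    show "((\<lambda>t. b e x t) has_real_derivative b1t e x t) (at t)" for t
      using B1_deriv[where s=t and f="\<lambda>n. w n x" and ?f1.0="\<lambda>n. wt n x t" and I=I and J=J, OF dt[OF x] e] by simp
    show "((\<lambda>t. b1t e x t) has_real_derivative b2t e x t) (at t)" for t
      using B2_deriv[where s=t and f="\<lambda>n. w n x" and ?f1.0="\<lambda>n. wt n x" and ?f2.0="\<lambda>n. wtt n x t" and I=I and J=J, OF dt[OF x] dtt[OF x] e] by simp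
  qed (use K(2,3) x bb section_measurable(2)[OF b_measurable(3)] in auto)
qed

text \<open>Summation over time and all directions brings in the equation, whose contribution
  \<open>W n x * (w n x t)\<^sup>2\<close> completes the squared derivatives to the energies. What
  remains is an inequality of arithmetic and geometric means with weights \<open>T\<close> and
  \<open>1 / T\<close>.\<close>

lemma b2_sum_lower:
  assumes e: "0 < e" and x: "x \<in> orthant" and t: "0 \<le> t"
  shows "3 * \<delta> * (sqrt (energy I x t) * sqrt (energy J x t)) \<le> b2t e x t + (\<Sum>i\<in>UNIV. b2x e i x t)"
proof -
  let ?A = "Asum I e (\<lambda>n. w n x t)" and ?C = "Asum J e (\<lambda>n. w n x t)"
  let ?T = "T ?A ?C"
  have T: "0 < ?T" using pos Asum_pos[OF e] by blast
  have Vx: "0 \<le> V x" using V(1)[OF x] .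
  define S where "S L = (\<Sum>n\<in>L. (wt n x t)\<^sup>2) + (\<Sum>i\<in>UNIV. \<Sum>n\<in>L. (w1 n i x t)\<^sup>2)" for L
  define Z where "Z L = (\<Sum>n\<in>L. (w n x t)\<^sup>2)" for L
  have Z: "0 \<le> Z L" for L unfolding Z_def by (rule sum_nonneg) simp
  have EnS: "energy L x t = S L + V x * Z L" for L
  proof -
    have "(\<Sum>n\<in>L. \<Sum>i\<in>UNIV. (w1 n i x t)\<^sup>2) = (\<Sum>i\<in>UNIV. \<Sum>n\<in>L. (w1 n i x t)\<^sup>2)" by (rule sum.swap)
    then show ?thesis unfolding energy_def S_def Z_def by (simp add: sum.distrib sum_distrib_left)
  qed
  have En0: "0 \<le> energy L x t" for L unfolding energy_def using Vx by (intro sum_nonneg add_nonneg_nonneg mult_nonneg_nonneg) auto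
  have Wz: "V x * Z L \<le> (\<Sum>n\<in>L. w n x t * wtt n x t) + (\<Sum>i\<in>UNIV. \<Sum>n\<in>L. w n x t * w2 n i x t)" for L
  proof -
    have "(\<Sum>n\<in>L. w n x t * wtt n x t) + (\<Sum>i\<in>UNIV. \<Sum>n\<in>L. w n x t * w2 n i x t)
      = (\<Sum>n\<in>L. w n x t * (wtt n x t + (\<Sum>i\<in>UNIV. w2 n i x t)))"
      by (subst sum.swap) (simp add: distrib_left sum.distrib sum_distrib_left)
    also have "\<dots> = (\<Sum>n\<in>L. W n x * (w n x t)\<^sup>2)"
      by (simp add: pde[OF x t] power2_eq_square mult_ac)
    also have "\<dots> \<ge> (\<Sum>n\<in>L. V x * (w n x t)\<^sup>2)" by (intro sum_mono mult_right_mono V(2)[OF x]) auto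
    finally show ?thesis by (simp add: Z_def sum_distrib_left)
  qed
  have gl: "\<delta> * ?T \<le> \<beta>A ?A ?C" "1 / (2 * ?T) \<le> \<beta>C ?A ?C" using beta_grad_lower Asum_pos[OF e] by blast+
  have g0: "0 \<le> \<beta>A ?A ?C" "0 \<le> \<beta>C ?A ?C" using gl T dl by (auto intro: order_trans[rotated])
  have "\<delta> * ?T * S I + 3 * \<delta> * S J / ?T
     + 2 * \<beta>A ?A ?C * ((\<Sum>n\<in>I. w n x t * wtt n x t) + (\<Sum>i\<in>UNIV. \<Sum>n\<in>I. w n x t * w2 n i x t))
     + 2 * \<beta>C ?A ?C * ((\<Sum>n\<in>J. w n x t * wtt n x t) + (\<Sum>i\<in>UNIV. \<Sum>n\<in>J. w n x t * w2 n i x t))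
     \<le> b2t e x t + (\<Sum>i\<in>UNIV. b2x e i x t)"
  proof -
    note l = B2_lower[OF fin e, of "\<lambda>n. w n x t"]
    have "(\<Sum>i\<in>UNIV. \<delta> * ?T * (\<Sum>n\<in>I. (w1 n i x t)\<^sup>2) + 3 * \<delta> * (\<Sum>n\<in>J. (w1 n i x t)\<^sup>2) / ?T
      + 2 * \<beta>A ?A ?C * (\<Sum>n\<in>I. w n x t * w2 n i x t) + 2 * \<beta>C ?A ?C * (\<Sum>n\<in>J. w n x t * w2 n i x t)) \<le> (\<Sum>i\<in>UNIV. b2x e i x t)"
      by (intro sum_mono l)
    from add_mono[OF l[of "\<lambda>n. wt n x t" "\<lambda>n. wtt n x t"] this]
    show ?thesis
      by (simp add: S_def sum.distrib sum_distrib_left[symmetric] sum_divide_distrib[symmetric] distrib_left add_divide_distrib add_ac)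
  qed
  moreover have "\<delta> * ?T * (V x * Z I) \<le> 2 * \<beta>A ?A ?C * ((\<Sum>n\<in>I. w n x t * wtt n x t) + (\<Sum>i\<in>UNIV. \<Sum>n\<in>I. w n x t * w2 n i x t))"
    by (rule mult_mono[OF _ Wz]) (use gl(1) g0 Z Vx T dl in auto)
  moreover have "3 * \<delta> * (V x * Z J) / ?T \<le> 2 * \<beta>C ?A ?C * ((\<Sum>n\<in>J. w n x t * wtt n x t) + (\<Sum>i\<in>UNIV. \<Sum>n\<in>J. w n x t * w2 n i x t))"
  proof -
    \<comment> \<open>This amounts to \<open>3 * \<delta> \<le> 1\<close>.\<close>
    have "3 * \<delta> / ?T \<le> 2 * (1 / (2 * ?T))" using dl T by (simp add: divide_right_mono)
    then have "3 * \<delta> / ?T \<le> 2 * \<beta>C ?A ?C" using gl(2) by linarith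
    then have "(3 * \<delta> / ?T) * (V x * Z J) \<le> 2 * \<beta>C ?A ?C * ((\<Sum>n\<in>J. w n x t * wtt n x t) + (\<Sum>i\<in>UNIV. \<Sum>n\<in>J. w n x t * w2 n i x t))"
      by (rule mult_mono[OF _ Wz]) (use g0 Z Vx T dl in auto)
    then show ?thesis by simp
  qed
  moreover have "\<delta> * ?T * S I + \<delta> * ?T * (V x * Z I) = \<delta> * ?T * energy I x t" by (simp add: EnS distrib_left)
  moreover have "3 * \<delta> * S J / ?T + 3 * \<delta> * (V x * Z J) / ?T = 3 * \<delta> * energy J x t / ?T"
    by (simp add: EnS distrib_left add_divide_distrib)
  ultimately have 1: "\<delta> * ?T * energy I x t + 3 * \<delta> * energy J x t / ?T \<le> b2t e x t + (\<Sum>i\<in>UNIV. b2x e i x t)" by linarith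
  define u v where "u = sqrt (energy I x t)" and "v = sqrt (energy J x t)"
  have uv: "energy I x t = u * u" "energy J x t = v * v" using En0 by (auto simp: u_def v_def)
  \<comment> \<open>The quadratic form in \<open>u\<close> and \<open>v\<close> as a sum of squares.
    The second square is slack: a mixed coefficient up to \<open>2 * sqrt 3\<close> would be
    possible, 3 is claimed.\<close>
  have "0 \<le> \<delta> * ((3 / ?T) * (v - ?T * u / 2)\<^sup>2 + (?T / 4) * u\<^sup>2)" using dl T by simp
  also have "\<dots> = \<delta> * ?T * (u * u) + 3 * \<delta> * (v * v) / ?T - 3 * \<delta> * (u * v)"
    using T by (simp add: field_simps power2_eq_square)
  finally show ?thesis using 1[unfolded uv] unfolding u_def[symmetric] v_def[symmetric] by linarith
qed

text \<open>Fubini is used in both orders: at fixed \<open>t\<close> each spatial second derivative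
  integrates to 0, and at fixed \<open>x\<close> the second time derivative against \<open>t\<close>
  leaves the value at \<open>t = 0\<close>. Integrability comes along, since the second derivatives
  dominate the nonnegative integrand.\<close>

lemma energy_integrable:
  shows "integrable (MX \<Otimes>\<^sub>M MT) (\<lambda>z. snd z * (sqrt (energy I (fst z) (snd z)) * sqrt (energy J (fst z) (snd z))))"
    and "0 < e \<Longrightarrow> 3 * \<delta> * (LINT z|(MX \<Otimes>\<^sub>M MT). snd z * (sqrt (energy I (fst z) (snd z)) * sqrt (energy J (fst z) (snd z))))
       \<le> (LINT x|MX. b e x 0 - \<beta> (e\<^sup>2) (e\<^sup>2))"
proof -
  let ?G = "\<lambda>x t. t * (sqrt (energy I x t) * sqrt (energy J x t))"
  have En0: "0 \<le> energy L x t" if "x \<in> orthant" for L x t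
    unfolding energy_def using V(1)[OF that] by (intro sum_nonneg add_nonneg_nonneg mult_nonneg_nonneg) auto
  have main: "integrable (MX \<Otimes>\<^sub>M MT) (\<lambda>z. ?G (fst z) (snd z)) \<and>
     3 * \<delta> * (LINT z|(MX \<Otimes>\<^sub>M MT). ?G (fst z) (snd z)) \<le> (LINT x|MX. b e x 0 - \<beta> (e\<^sup>2) (e\<^sup>2))" if e: "0 < e" for e
  proof -
    obtain K where K: "0 \<le> K"
      "\<And>i x t. x \<in> orthant \<Longrightarrow> 0 \<le> t \<Longrightarrow> \<bar>b2x e i x t\<bar> \<le> K * (exp (- c * t) * gs x)"
      "\<And>x t. x \<in> orthant \<Longrightarrow> 0 \<le> t \<Longrightarrow> \<bar>b2t e x t\<bar> \<le> K * (exp (- c * t) * gs x)"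
      using b_bounds[OF e] by metis
    have dom: "\<bar>t * u\<bar> \<le> K * (2/c) * exp (- (c/2) * t) * gs x" if "\<bar>u\<bar> \<le> K * (exp (- c * t) * gs x)" "0 < t" for u t and x :: "real ^ 'd"
    proof -
      have "\<bar>t * u\<bar> \<le> t * (K * (exp (- c * t) * gs x))"
        using that by (simp add: abs_mult mult_left_mono)
      also have "\<dots> = K * (t * exp (- c * t)) * gs x" by simp
      also have "\<dots> \<le> K * ((2/c) * exp (- (c/2) * t)) * gs x"
        using t_exp_le[OF c, of t] that K(1) by (intro mult_right_mono mult_left_mono) auto
      finally show ?thesis by (simp add: mult_ac)
    qed
    have ix: "integrable (MX \<Otimes>\<^sub>M MT) (\<lambda>z. snd z * b2x e i (fst z) (snd z))" for i
    proof (rule XT_integrable[where f="\<lambda>x t. t * b2x e i x t" and c="c/2" and M="K * (2/c)"])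
      show "\<bar>t * b2x e i x t\<bar> \<le> K * (2/c) * exp (- (c/2) * t) * gs x" if "x \<in> orthant" "0 < t" for x t
        using that by (intro dom K(2)) auto
    qed (use c in \<open>auto intro!: borel_measurable_times b_measurable snd_borel\<close>)
    have it: "integrable (MX \<Otimes>\<^sub>M MT) (\<lambda>z. snd z * b2t e (fst z) (snd z))"
    proof (rule XT_integrable[where f="\<lambda>x t. t * b2t e x t" and c="c/2" and M="K * (2/c)"])
      show "\<bar>t * b2t e x t\<bar> \<le> K * (2/c) * exp (- (c/2) * t) * gs x" if "x \<in> orthant" "0 < t" for x t
        using that by (intro dom K(3)) auto
    qed (use c in \<open>auto intro!: borel_measurable_times b_measurable snd_borel\<close>)
    have itot: "integrable (MX \<Otimes>\<^sub>M MT) (\<lambda>z. snd z * b2t e (fst z) (snd z) + (\<Sum>i\<in>UNIV. snd z * b2x e i (fst z) (snd z)))"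
      by (intro Bochner_Integration.integrable_add Bochner_Integration.integrable_sum it ix)
    have le: "3 * \<delta> * ?G (fst z) (snd z) \<le> snd z * b2t e (fst z) (snd z) + (\<Sum>i\<in>UNIV. snd z * b2x e i (fst z) (snd z))"
      "0 \<le> ?G (fst z) (snd z)" if "z \<in> space (MX \<Otimes>\<^sub>M MT)" for z
    proof -
      have z: "fst z \<in> orthant" "0 < snd z" using that by (auto simp: space_pair_measure)
      have "snd z * (3 * \<delta> * (sqrt (energy I (fst z) (snd z)) * sqrt (energy J (fst z) (snd z))))
        \<le> snd z * (b2t e (fst z) (snd z) + (\<Sum>i\<in>UNIV. b2x e i (fst z) (snd z)))"
        using b2_sum_lower[OF e z(1), of "snd z"] z(2) by (intro mult_left_mono) auto
      then show "3 * \<delta> * ?G (fst z) (snd z) \<le> snd z * b2t e (fst z) (snd z) + (\<Sum>i\<in>UNIV. snd z * b2x e i (fst z) (snd z))"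
        by (simp add: distrib_left sum_distrib_left mult_ac)
      show "0 \<le> ?G (fst z) (snd z)" using z En0 by simp
    qed
    have mG: "(\<lambda>z. ?G (fst z) (snd z)) \<in> borel_measurable borel" unfolding energy_def by measurable
    have iG: "integrable (MX \<Otimes>\<^sub>M MT) (\<lambda>z. ?G (fst z) (snd z))"
    proof (rule Bochner_Integration.integrable_bound[OF integrable_mult_right[OF itot, of "1 / (3 * \<delta>)"]])
      show "AE z in MX \<Otimes>\<^sub>M MT. norm (?G (fst z) (snd z)) \<le>
         norm (1 / (3 * \<delta>) * (snd z * b2t e (fst z) (snd z) + (\<Sum>i\<in>UNIV. snd z * b2x e i (fst z) (snd z))))"
      proof (intro AE_I2)
        fix z assume z: "z \<in> space (MX \<Otimes>\<^sub>M MT :: ((real ^ 'd) \<times> real) measure)"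
        let ?X = "snd z * b2t e (fst z) (snd z) + (\<Sum>i\<in>UNIV. snd z * b2x e i (fst z) (snd z))"
        have "?G (fst z) (snd z) \<le> 1 / (3 * \<delta>) * ?X" using le(1)[OF z] dl by (simp add: field_simps)
        moreover have "norm (?G (fst z) (snd z)) = ?G (fst z) (snd z)" using le(2)[OF z] by simp
        ultimately show "norm (?G (fst z) (snd z)) \<le> norm (1 / (3 * \<delta>) * ?X)" using abs_ge_self[of "1 / (3 * \<delta>) * ?X"] by simp
      qed
    qed (rule XT_measurable[OF mG])
    have zx: "(LINT z|(MX \<Otimes>\<^sub>M MT). snd z * b2x e i (fst z) (snd z)) = 0" for i
    proof -
      have "(LINT z|(MX \<Otimes>\<^sub>M MT). snd z * b2x e i (fst z) (snd z)) = (LINT t|MT. LINT x|MX. t * b2x e i x t)"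
        using XT_Fubini(2)[where f="\<lambda>x t. t * b2x e i x t"] ix by simp
      also have "\<dots> = (LINT t|MT. 0)"
        by (intro Bochner_Integration.integral_cong) (auto simp: b2x_integral_zero[OF e])
      finally show ?thesis by simp
    qed
    have zt: "(LINT z|(MX \<Otimes>\<^sub>M MT). snd z * b2t e (fst z) (snd z)) = (LINT x|MX. b e x 0 - \<beta> (e\<^sup>2) (e\<^sup>2))"
    proof -
      have "(LINT z|(MX \<Otimes>\<^sub>M MT). snd z * b2t e (fst z) (snd z)) = (LINT x|MX. LINT t|MT. t * b2t e x t)"
        using XT_Fubini(1)[where f="\<lambda>x t. t * b2t e x t"] it by simp
      also have "\<dots> = (LINT x|MX. b e x 0 - \<beta> (e\<^sup>2) (e\<^sup>2))"
        by (intro Bochner_Integration.integral_cong) (auto simp: b2t_integral[OF e])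
      finally show ?thesis .
    qed
    have "3 * \<delta> * (LINT z|(MX \<Otimes>\<^sub>M MT). ?G (fst z) (snd z)) = (LINT z|(MX \<Otimes>\<^sub>M MT). 3 * \<delta> * ?G (fst z) (snd z))" by simp
    also have "\<dots> \<le> (LINT z|(MX \<Otimes>\<^sub>M MT). snd z * b2t e (fst z) (snd z) + (\<Sum>i\<in>UNIV. snd z * b2x e i (fst z) (snd z)))"
      by (rule integral_mono[OF integrable_mult_right[OF iG] itot le(1)])
    also have "\<dots> = (LINT z|(MX \<Otimes>\<^sub>M MT). snd z * b2t e (fst z) (snd z)) + (\<Sum>i\<in>UNIV. LINT z|(MX \<Otimes>\<^sub>M MT). snd z * b2x e i (fst z) (snd z))"
      using it ix by (subst Bochner_Integration.integral_add) (auto intro!: Bochner_Integration.integral_sum)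
    also have "\<dots> = (LINT x|MX. b e x 0 - \<beta> (e\<^sup>2) (e\<^sup>2))" by (simp add: zx zt)
    finally show ?thesis using iG by simp
  qed
  \<comment> \<open>The integrand does not involve \<open>e\<close>, so any positive value yields
    integrability.\<close>
  from main[of 1] show "integrable (MX \<Otimes>\<^sub>M MT) (\<lambda>z. ?G (fst z) (snd z))" by simp
  from main show "0 < e \<Longrightarrow> 3 * \<delta> * (LINT z|(MX \<Otimes>\<^sub>M MT). ?G (fst z) (snd z)) \<le> (LINT x|MX. b e x 0 - \<beta> (e\<^sup>2) (e\<^sup>2))" by blast
qed

text \<open>The limit of \<open>energy_integrable(2)\<close> as \<open>e\<close> tends to 0, by
  dominated convergence with \<open>beta_diff_bounds\<close>; then \<open>beta_upper\<close>
  separates the two norms at \<open>t = 0\<close>.\<close>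

theorem bilinear_embedding:
  "3 * \<delta> * (LINT z|(MX \<Otimes>\<^sub>M MT). snd z * (sqrt (energy I (fst z) (snd z)) * sqrt (energy J (fst z) (snd z))))
    \<le> 1/8 * (LINT x|MX. (\<Sum>n\<in>I. (w n x 0)\<^sup>2) powr (p/2)) + 9/8 * (LINT x|MX. (\<Sum>n\<in>J. (w n x 0)\<^sup>2) powr (q/2))"
proof -
  define a where "a L x = (\<Sum>n\<in>L. (w n x 0)\<^sup>2)" for L x
  define R where "R = real (card I + card J) * M\<^sup>2"
  have R: "0 \<le> R" by (simp add: R_def)
  have a0: "0 \<le> a L x" for L x by (simp add: a_def sum_nonneg)
  have m0: "(\<lambda>x. w n x 0) \<in> borel_measurable borel" for n by (rule section_measurable(1)[OF mw])
  have [measurable]: "a L \<in> borel_measurable borel" for L unfolding a_def[abs_def] using m0 by measurable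
  have aR: "a L x \<le> R * (gs x)\<^sup>2" if "x \<in> orthant" "L = I \<or> L = J" for L x
  proof -
    have "a L x \<le> real (card L) * (M * gs x)\<^sup>2" unfolding a_def
      using bw[OF that(1), of 0] M by (intro sum_bounded_above) (auto simp: abs_le_square_iff[symmetric])
    also have "\<dots> \<le> real (card I + card J) * (M * gs x)\<^sup>2" using that by (intro mult_right_mono) auto
    finally show ?thesis by (simp add: R_def power_mult_distrib mult_ac)
  qed
  have aR1: "a L x \<le> R" "a L x \<le> R * gs x" if "x \<in> orthant" "L = I \<or> L = J" for L x
  proof -
    have "(gs x)\<^sup>2 \<le> gs x" using mult_left_mono[of "gs x" 1 "gs x"] by (simp add: power2_eq_square)
    then have "R * (gs x)\<^sup>2 \<le> R * gs x" "R * gs x \<le> R * 1" using R by (intro mult_left_mono; simp)+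
    then show "a L x \<le> R" "a L x \<le> R * gs x" using aR[OF that] by linarith+
  qed
  \<comment> \<open>Since \<open>gs x \<le> 1\<close> and \<open>r \<ge> 1\<close>, the power of the
    Gaussian may be replaced by the Gaussian itself.\<close>
  have ap: "(a L x) powr (r/2) \<le> R powr (r/2) * gs x" if "x \<in> orthant" "L = I \<or> L = J" "1 \<le> r" for L x r
  proof -
    have "(a L x) powr (r/2) \<le> (R * (gs x)\<^sup>2) powr (r/2)" using aR[OF that(1,2)] a0 that(3) by (intro powr_mono2) auto
    also have "\<dots> = R powr (r/2) * gs x powr r" using R by (simp add: powr_mult powr_powr flip: powr_numeral)
    also have "\<dots> \<le> R powr (r/2) * gs x powr 1" using that(3) by (intro mult_left_mono powr_mono') auto
    finally show ?thesis by simp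
  qed
  have dom: "integrable MX f" if "\<And>x. x \<in> orthant \<Longrightarrow> \<bar>f x\<bar> \<le> K * gs x" "f \<in> borel_measurable borel" for f :: "real ^ 'd \<Rightarrow> real" and K
  proof (rule Bochner_Integration.integrable_bound[OF integrable_mult_right[OF gs_integrable_MX, of K]])
    show "AE x in MX. norm (f x) \<le> norm (K * gs x)" using order_trans[OF that(1) abs_ge_self] by (intro AE_I2) auto
  qed (rule MX_measurable[OF that(2)])
  have ip: "integrable MX (\<lambda>x. (a L x) powr (r/2))" if "L = I \<or> L = J" "1 \<le> r" for L r
  proof (rule dom)
    show "\<bar>(a L x) powr (r/2)\<bar> \<le> R powr (r/2) * gs x" if "x \<in> orthant" for x
      using ap[OF that \<open>L = I \<or> L = J\<close> \<open>1 \<le> r\<close>] by simp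
  qed measurable
  define E where "E n = 1 / real (Suc n)" for n
  have E: "0 < E n" "E n \<le> 1" for n by (auto simp: E_def)
  have E0: "E \<longlonglongrightarrow> 0" unfolding E_def[abs_def] using LIMSEQ_inverse_real_of_nat by (simp add: inverse_eq_divide)
  obtain K where K: "0 \<le> K" "\<And>e a c. 0 < e \<Longrightarrow> e \<le> 1 \<Longrightarrow> 0 \<le> a \<Longrightarrow> a \<le> R \<Longrightarrow> 0 \<le> c \<Longrightarrow> c \<le> R \<Longrightarrow>
     \<bar>\<beta> (e\<^sup>2 + a) (e\<^sup>2 + c) - \<beta> (e\<^sup>2) (e\<^sup>2)\<bar> \<le> K * (a + c powr (q/2))"
    using beta_diff_bounds[OF R] by blast
  have bm: "(\<lambda>x. \<beta> (k + a I x) (k + a J x)) \<in> borel_measurable borel" for k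
    unfolding \<beta>_def T_def N_def P_def Q_def by measurable
  have bA: "b e x 0 = \<beta> (e\<^sup>2 + a I x) (e\<^sup>2 + a J x)" for e x by (simp add: Asum_def a_def)
  have "(\<lambda>n. LINT x|MX. b (E n) x 0 - \<beta> ((E n)\<^sup>2) ((E n)\<^sup>2)) \<longlonglongrightarrow> (LINT x|MX. \<beta> (a I x) (a J x))"
  proof (rule integral_dominated_convergence[where w="\<lambda>x. (K * (R + R powr (q/2))) * gs x"])
    show "integrable MX (\<lambda>x. (K * (R + R powr (q/2))) * gs x)" by (intro integrable_mult_right gs_integrable_MX)
    show "AE x in MX. (\<lambda>n. b (E n) x 0 - \<beta> ((E n)\<^sup>2) ((E n)\<^sup>2)) \<longlonglongrightarrow> \<beta> (a I x) (a J x)"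
      unfolding bA by (intro AE_I2 beta_diff_tendsto a0 E0)
    show "AE x in MX. norm (b (E n) x 0 - \<beta> ((E n)\<^sup>2) ((E n)\<^sup>2)) \<le> (K * (R + R powr (q/2))) * gs x" for n
    proof (intro AE_I2)
      fix x :: "real ^ 'd" assume "x \<in> space MX"
      then have x: "x \<in> orthant" by simp
      have "norm (b (E n) x 0 - \<beta> ((E n)\<^sup>2) ((E n)\<^sup>2)) \<le> K * (a I x + a J x powr (q/2))"
        unfolding bA real_norm_def by (intro K(2) E a0 aR1 x) auto
      also have "\<dots> \<le> K * (R * gs x + R powr (q/2) * gs x)"
        using q by (intro mult_left_mono add_mono aR1 ap x K) auto
      finally show "norm (b (E n) x 0 - \<beta> ((E n)\<^sup>2) ((E n)\<^sup>2)) \<le> (K * (R + R powr (q/2))) * gs x"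
        by (simp add: algebra_simps)
    qed
    show "(\<lambda>x. \<beta> (a I x) (a J x)) \<in> borel_measurable MX" using bm[of 0] by (intro MX_measurable) simp
    show "(\<lambda>x. b (E n) x 0 - \<beta> ((E n)\<^sup>2) ((E n)\<^sup>2)) \<in> borel_measurable MX" for n
      unfolding bA using bm by (intro MX_measurable borel_measurable_diff) auto
  qed
  then have "3 * \<delta> * (LINT z|(MX \<Otimes>\<^sub>M MT). snd z * (sqrt (energy I (fst z) (snd z)) * sqrt (energy J (fst z) (snd z)))) \<le> (LINT x|MX. \<beta> (a I x) (a J x))"
    by (rule LIMSEQ_le_const) (use energy_integrable(2)[OF E(1)] in auto)
  also have "\<dots> \<le> (LINT x|MX. 1/8 * (a I x) powr (p/2) + 9/8 * (a J x) powr (q/2))"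
  proof (rule integral_mono)
    have bu: "0 \<le> \<beta> (a I x) (a J x)" for x using dl a0 by (simp add: \<beta>_def Q_def T_def)
    show i: "integrable MX (\<lambda>x. 1/8 * (a I x) powr (p/2) + 9/8 * (a J x) powr (q/2))"
      using ip p q by (intro Bochner_Integration.integrable_add integrable_mult_right) auto
    show "integrable MX (\<lambda>x. \<beta> (a I x) (a J x))"
    proof (rule Bochner_Integration.integrable_bound[OF i])
      have "norm (\<beta> (a I x) (a J x)) \<le> norm (1/8 * (a I x) powr (p/2) + 9/8 * (a J x) powr (q/2))" for x
        unfolding real_norm_def abs_of_nonneg[OF bu] by (rule order_trans[OF beta_upper[OF a0 a0] abs_ge_self])
      then show "AE x in MX. norm (\<beta> (a I x) (a J x)) \<le> norm (1/8 * (a I x) powr (p/2) + 9/8 * (a J x) powr (q/2))"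
        by (intro AE_I2)
    qed (use bm[of 0] in \<open>auto intro!: MX_measurable\<close>)
  qed (rule beta_upper[OF a0 a0])
  also have "\<dots> = 1/8 * (LINT x|MX. (a I x) powr (p/2)) + 9/8 * (LINT x|MX. (a J x) powr (q/2))"
    using ip p q by (subst Bochner_Integration.integral_add) auto
  finally show ?thesis by (simp add: a_def)
qed

end

section \<open>Poisson extensions of finite Laguerre expansions\<close>

definition pf :: "('d \<Rightarrow> real \<Rightarrow> real) \<Rightarrow> real ^ 'd \<Rightarrow> real" where
  "pf g x = (\<Prod>j\<in>UNIV. g j (x $ j))"

lemma pf_split: "pf g x = g i (x $ i) * (\<Prod>j\<in>UNIV - {i}. g j (x $ j))"
  unfolding pf_def by (subst prod.remove[of _ i]) auto

lemma pf_upd: "pf (g(i := h)) x = h (x $ i) * (\<Prod>j\<in>UNIV - {i}. g j (x $ j))"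
  by (subst pf_split[of _ _ i]) (auto intro!: prod.cong)

lemma pf_deriv:
  assumes "(g i has_real_derivative g' (x $ i)) (at (x $ i))"
  shows "((\<lambda>s. pf g (x + s *\<^sub>R axis i 1)) has_real_derivative pf (g(i := g')) x) (at 0)"
proof -
  have e: "pf g (x + s *\<^sub>R axis i 1) = g i (x $ i + s) * (\<Prod>j\<in>UNIV - {i}. g j (x $ j))" for s
    unfolding pf_split[of _ _ i] by (auto simp: axis_def intro!: prod.cong)
  have "((\<lambda>s. g i (x $ i + s)) has_real_derivative g' (x $ i)) (at 0)"
    using assms DERIV_shift[of "g i" "g' (x $ i)" 0 "x $ i"] by (simp add: add.commute)
  then show ?thesis unfolding e pf_upd by (rule DERIV_cmult_right)
qed

lemma pf_measurable:
  assumes [measurable]: "\<And>j. g j \<in> borel_measurable borel"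
  shows "pf g \<in> borel_measurable borel"
  unfolding pf_def[abs_def] by measurable

definition gbounded :: "(real \<Rightarrow> real) \<Rightarrow> bool" where
  "gbounded h \<longleftrightarrow> (\<exists>M\<ge>0. \<forall>y>0. \<bar>h y\<bar> \<le> M * exp (- y\<^sup>2 / 4))"

lemma gbounded_lf: "0 \<le> s \<Longrightarrow> gbounded (lf s P)"
  unfolding gbounded_def by (rule lf_bound)

lemma pf_bound:
  assumes "\<And>j. gbounded (g j)"
  shows "\<exists>M\<ge>0. \<forall>x\<in>orthant. \<bar>pf g x\<bar> \<le> M * gs x"
proof -
  have "\<exists>M. \<forall>j. M j \<ge> 0 \<and> (\<forall>y>0. \<bar>g j y\<bar> \<le> M j * exp (- y\<^sup>2 / 4))"
    using assms unfolding gbounded_def by (intro choice) blast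
  then obtain M where M: "\<And>j. M j \<ge> 0" "\<And>j y. y > 0 \<Longrightarrow> \<bar>g j y\<bar> \<le> M j * exp (- y\<^sup>2 / 4)" by blast
  have "\<bar>pf g x\<bar> \<le> (\<Prod>j\<in>UNIV. M j) * gs x" if "x \<in> orthant" for x
  proof -
    have "\<bar>pf g x\<bar> = (\<Prod>j\<in>UNIV. \<bar>g j (x $ j)\<bar>)" by (simp add: pf_def abs_prod)
    also have "\<dots> \<le> (\<Prod>j\<in>UNIV. M j * exp (- (x $ j)\<^sup>2 / 4))"
      using that M(2) by (intro prod_mono) (auto simp: orthant_def)
    finally show ?thesis by (simp add: prod.distrib gs_prod)
  qed
  moreover have "(\<Prod>j\<in>UNIV. M j) \<ge> 0" using M(1) by (simp add: prod_nonneg)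
  ultimately show ?thesis by blast
qed

section \<open>Laguerre functions in several variables and their derivatives\<close>

abbreviation (input) sh :: "real ^ 'd \<Rightarrow> 'd \<Rightarrow> real" where "sh b j \<equiv> b $ j + 1/2"

definition ph :: "real ^ 'd \<Rightarrow> nat ^ 'd \<Rightarrow> 'd \<Rightarrow> real \<Rightarrow> real" where
  "ph b k j = lf (sh b j) (lfP (b $ j) (k $ j))"
definition ph1 :: "real ^ 'd \<Rightarrow> nat ^ 'd \<Rightarrow> 'd \<Rightarrow> real \<Rightarrow> real" where
  "ph1 b k j = lf (sh b j - 1) (lfD (sh b j) (lfP (b $ j) (k $ j)))"
definition ph2 :: "real ^ 'd \<Rightarrow> nat ^ 'd \<Rightarrow> 'd \<Rightarrow> real \<Rightarrow> real" where
  "ph2 b k j = lf (sh b j - 1 - 1) (lfD (sh b j - 1) (lfD (sh b j) (lfP (b $ j) (k $ j))))"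

definition Ph where "Ph b k = pf (ph b k)"
definition Ph1 where "Ph1 b k i = pf ((ph b k)(i := ph1 b k i))"
definition Ph2 where "Ph2 b k i = pf ((ph b k)(i := ph2 b k i))"

lemma laguerre_fun_Ph: "laguerre_fun b k = Ph b k"
  by (rule ext) (simp add: laguerre_fun_def Ph_def pf_def ph_def laguerre_fun1_lf)

lemma ph_measurable [measurable]: "ph b k j \<in> borel_measurable borel" "ph1 b k j \<in> borel_measurable borel" "ph2 b k j \<in> borel_measurable borel"
  by (simp_all add: ph_def ph1_def ph2_def)

lemma Ph_measurable [measurable]: "Ph b k \<in> borel_measurable borel" "Ph1 b k i \<in> borel_measurable borel" "Ph2 b k i \<in> borel_measurable borel"
  unfolding Ph_def Ph1_def Ph2_def by (intro pf_measurable; simp add: fun_upd_def)+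

lemma Ph_deriv:
  assumes "x \<in> orthant"
  shows "((\<lambda>s. Ph b k (x + s *\<^sub>R axis i 1)) has_real_derivative Ph1 b k i x) (at 0)"
    and "((\<lambda>s. Ph1 b k i (x + s *\<^sub>R axis i 1)) has_real_derivative Ph2 b k i x) (at 0)"
proof -
  have xi: "0 < x $ i" using assms by (simp add: orthant_def)
  show "((\<lambda>s. Ph b k (x + s *\<^sub>R axis i 1)) has_real_derivative Ph1 b k i x) (at 0)"
    unfolding Ph_def Ph1_def by (rule pf_deriv) (unfold ph_def ph1_def, rule lf_deriv[OF xi])
  show "((\<lambda>s. Ph1 b k i (x + s *\<^sub>R axis i 1)) has_real_derivative Ph2 b k i x) (at 0)"
    unfolding Ph1_def Ph2_def
    using pf_deriv[of "(ph b k)(i := ph1 b k i)" i "ph2 b k i" x] lf_deriv[OF xi, of "sh b i - 1" "lfD (sh b i) (lfP (b $ i) (k $ i))", folded ph1_def ph2_def]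
    by simp
qed

text \<open>\<open>gbounded_lf\<close> needs a nonnegative exponent. The i-th factor has exponent
  \<open>b $ i + 1/2\<close>, and each derivative lowers it by 1. As \<open>b $ i > 1/2\<close>, the
  first derivative is covered; the exponent of the second may be negative, which the extra
  \<open>x $ i\<close> repairs.\<close>

lemma Ph_bounds:
  assumes b: "\<And>j. 1/2 < b $ j"
  shows "\<exists>M\<ge>0. \<forall>x\<in>orthant. \<bar>Ph b k x\<bar> \<le> M * gs x \<and>
     (\<forall>i. \<bar>Ph b k x\<bar> \<le> M * x $ i * gs x \<and> \<bar>Ph1 b k i x\<bar> \<le> M * gs x \<and> x $ i * \<bar>Ph2 b k i x\<bar> \<le> M * gs x)"
proof -
  have gb: "gbounded (ph b k j)" "gbounded (ph1 b k j)" "gbounded (lf (sh b j - 1) P)" for j P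
    unfolding ph_def ph1_def using b[of j] by (auto intro!: gbounded_lf)
  have gb_upd: "gbounded ((g(i := h)) j)" if "gbounded h" "\<And>j. gbounded (g j)" for g h j and i :: 'd using that by simp
  \<comment> \<open>A factor \<open>x $ i\<close> is split off the function (\<open>H1\<close>) and
    multiplied onto the second derivative (\<open>H2\<close>); the i-th factor has exponent
    \<open>b $ i - 1/2\<close> in both cases.\<close>
  define H1 where "H1 i = (ph b k)(i := lf (sh b i - 1) (lfP (b $ i) (k $ i)))" for i
  define H2 where "H2 i = (ph b k)(i := lf (sh b i - 1) (lfD (sh b i - 1) (lfD (sh b i) (lfP (b $ i) (k $ i)))))" for i
  have H1: "Ph b k x = x $ i * pf (H1 i) x" if "x \<in> orthant" for x i
  proof -
    have "lf (sh b i) (lfP (b $ i) (k $ i)) (x $ i) = x $ i * lf (sh b i - 1) (lfP (b $ i) (k $ i)) (x $ i)"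
      using lf_shift(1)[of "x $ i" "sh b i - 1"] that unfolding orthant_def diff_add_cancel by blast
    then show ?thesis unfolding H1_def pf_upd Ph_def pf_split[of "ph b k" x i] by (simp add: ph_def)
  qed
  have H2: "x $ i * Ph2 b k i x = pf (H2 i) x" if "x \<in> orthant" for x i
  proof -
    have "x $ i * lf (sh b i - 1 - 1) R (x $ i) = lf (sh b i - 1) R (x $ i)" for R
      using lf_shift(2)[of "x $ i" "sh b i - 1" R] that by (simp add: orthant_def less_imp_neq[THEN not_sym])
    then show ?thesis unfolding H2_def Ph2_def pf_upd by (simp add: ph2_def mult.assoc[symmetric])
  qed
  obtain M0 where M0: "M0 \<ge> 0" "\<And>x. x \<in> orthant \<Longrightarrow> \<bar>Ph b k x\<bar> \<le> M0 * gs x"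
    using pf_bound[of "ph b k"] gb unfolding Ph_def by blast
  have "\<exists>M. \<forall>i. M i \<ge> 0 \<and> (\<forall>x\<in>orthant. \<bar>Ph1 b k i x\<bar> \<le> M i * gs x)"
    unfolding Ph1_def by (intro choice allI) (rule pf_bound[unfolded Bex_def], rule gb_upd, (rule gb)+)
  then obtain M1 where M1: "\<And>i. M1 i \<ge> 0" "\<And>i x. x \<in> orthant \<Longrightarrow> \<bar>Ph1 b k i x\<bar> \<le> M1 i * gs x" by blast
  have "\<exists>M. \<forall>i. M i \<ge> 0 \<and> (\<forall>x\<in>orthant. \<bar>pf (H1 i) x\<bar> \<le> M i * gs x)"
    unfolding H1_def by (intro choice allI) (rule pf_bound[unfolded Bex_def], rule gb_upd, (rule gb)+)
  then obtain M2 where M2: "\<And>i. M2 i \<ge> 0" "\<And>i x. x \<in> orthant \<Longrightarrow> \<bar>pf (H1 i) x\<bar> \<le> M2 i * gs x" by blast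
  have "\<exists>M. \<forall>i. M i \<ge> 0 \<and> (\<forall>x\<in>orthant. \<bar>pf (H2 i) x\<bar> \<le> M i * gs x)"
    unfolding H2_def by (intro choice allI) (rule pf_bound[unfolded Bex_def], rule gb_upd, (rule gb)+)
  then obtain M3 where M3: "\<And>i. M3 i \<ge> 0" "\<And>i x. x \<in> orthant \<Longrightarrow> \<bar>pf (H2 i) x\<bar> \<le> M3 i * gs x" by blast
  define M where "M = M0 + (\<Sum>i\<in>UNIV. M1 i) + (\<Sum>i\<in>UNIV. M2 i) + (\<Sum>i\<in>UNIV. M3 i)"
  have s: "M1 i \<le> (\<Sum>i\<in>UNIV. M1 i)" "M2 i \<le> (\<Sum>i\<in>UNIV. M2 i)" "M3 i \<le> (\<Sum>i\<in>UNIV. M3 i)" for i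
    using M1 M2 M3 by (auto intro!: member_le_sum)
  have nn: "0 \<le> (\<Sum>i\<in>UNIV. M1 i)" "0 \<le> (\<Sum>i\<in>UNIV. M2 i)" "0 \<le> (\<Sum>i\<in>UNIV. M3 i)" using M1 M2 M3 by (auto intro!: sum_nonneg)
  have ml: "M0 \<le> M" "M1 i \<le> M" "M2 i \<le> M" "M3 i \<le> M" for i using s[of i] nn M0(1) unfolding M_def by linarith+
  note up = order_trans[OF _ mult_right_mono[OF _ gs_pos(2)]]
  have "\<bar>Ph b k x\<bar> \<le> M * gs x \<and> (\<forall>i. \<bar>Ph b k x\<bar> \<le> M * x $ i * gs x \<and> \<bar>Ph1 b k i x\<bar> \<le> M * gs x \<and> x $ i * \<bar>Ph2 b k i x\<bar> \<le> M * gs x)"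
    if x: "x \<in> orthant" for x
  proof (intro conjI allI)
    fix i
    have xi: "0 < x $ i" using x by (simp add: orthant_def)
    show "\<bar>Ph b k x\<bar> \<le> M * gs x" by (rule up[OF M0(2)[OF x] ml(1)])
    show "\<bar>Ph1 b k i x\<bar> \<le> M * gs x" by (rule up[OF M1(2)[OF x] ml(2)])
    have "\<bar>pf (H1 i) x\<bar> \<le> M * gs x" by (rule up[OF M2(2)[OF x] ml(3)])
    then have "x $ i * \<bar>pf (H1 i) x\<bar> \<le> x $ i * (M * gs x)" using xi by (intro mult_left_mono) auto
    then show "\<bar>Ph b k x\<bar> \<le> M * x $ i * gs x" unfolding H1[OF x, of i] using xi by (simp add: abs_mult mult_ac)
    have "\<bar>pf (H2 i) x\<bar> \<le> M * gs x" by (rule up[OF M3(2)[OF x] ml(4)])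
    then show "x $ i * \<bar>Ph2 b k i x\<bar> \<le> M * gs x" unfolding H2[OF x, symmetric] using xi by (simp add: abs_mult)
  qed
  moreover have "M \<ge> 0" using ml(1) M0(1) by linarith
  ultimately show ?thesis by blast
qed

definition potential :: "real ^ 'd \<Rightarrow> real ^ 'd \<Rightarrow> real" where
  "potential b x = (\<Sum>i\<in>UNIV. (x $ i)\<^sup>2 + ((b $ i)\<^sup>2 - 1/4) / (x $ i)\<^sup>2)"

lemma potential_measurable [measurable]: "potential b \<in> borel_measurable borel"
  unfolding potential_def[abs_def] by measurable

lemma Ph2_sum:
  assumes "x \<in> orthant"
  shows "(\<Sum>i\<in>UNIV. Ph2 b k i x) = (potential b x - laguerre_eigenvalue b k) * Ph b k x"
proof -
  have "Ph2 b k i x = ((x $ i)\<^sup>2 + ((b $ i)\<^sup>2 - 1/4) / (x $ i)\<^sup>2 - (4 * real (k $ i) + 2 * (b $ i) + 2)) * Ph b k x" for i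
  proof -
    have "0 < x $ i" using assms by (simp add: orthant_def)
    from lfD_lfD_lfP[OF refl this, of "b $ i" "k $ i"]
    have "ph2 b k i (x $ i) = ((x $ i)\<^sup>2 + ((b $ i)\<^sup>2 - 1/4) / (x $ i)\<^sup>2 - (4 * real (k $ i) + 2 * (b $ i) + 2)) * ph b k i (x $ i)"
      by (simp add: ph_def ph2_def)
    then show ?thesis unfolding Ph2_def pf_upd Ph_def pf_split[of "ph b k" x i] by simp
  qed
  then have "(\<Sum>i\<in>UNIV. Ph2 b k i x) =
      (\<Sum>i\<in>UNIV. (x $ i)\<^sup>2 + ((b $ i)\<^sup>2 - 1/4) / (x $ i)\<^sup>2 - (4 * real (k $ i) + 2 * (b $ i) + 2)) * Ph b k x"
    by (simp only: sum_distrib_right)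
  also have "(\<Sum>i\<in>UNIV. (x $ i)\<^sup>2 + ((b $ i)\<^sup>2 - 1/4) / (x $ i)\<^sup>2 - (4 * real (k $ i) + 2 * (b $ i) + 2)) = potential b x - laguerre_eigenvalue b k"
    by (simp add: potential_def laguerre_eigenvalue_def sum_subtractf sum.distrib sum_distrib_left)
  finally show ?thesis .
qed

text \<open>Gives the decay rate 1 in time for all finite expansions at once.\<close>

lemma eigenvalue_ge_1:
  assumes "\<And>j. 1/2 < b $ j"
  shows "1 \<le> laguerre_eigenvalue (b :: real ^ 'd) k"
proof -
  have "0 \<le> (\<Sum>i\<in>UNIV. b $ i)" using assms by (intro sum_nonneg) (smt (verit) field_sum_of_halves)
  moreover have "1 \<le> real CARD('d)" by (simp add: Suc_leI)
  moreover have "0 \<le> real (\<Sum>i\<in>UNIV. k $ i)" by (rule of_nat_0_le_iff)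
  ultimately show ?thesis unfolding laguerre_eigenvalue_def by linarith
qed

text \<open>\<open>- 1 * t\<close> is kept in this form to match \<open>- c * t\<close> in the
  locale \<open>flow\<close> with \<open>c = 1\<close>.\<close>

lemma mode_sum_bound:
  assumes "\<And>k. k \<in> K \<Longrightarrow> \<bar>F k\<bar> \<le> M k * g" "\<And>k. 1 \<le> m k" "0 \<le> t" "0 \<le> g" "\<And>k. 0 \<le> M k" "finite K"
    and "\<And>k. k \<in> K \<Longrightarrow> \<bar>d k\<bar> \<le> D k"
  shows "\<bar>\<Sum>k\<in>K. d k * exp (- m k * t) * F k\<bar> \<le> (\<Sum>k\<in>K. D k * M k) * (exp (- 1 * t) * (g::real))"
proof -
  have "\<bar>\<Sum>k\<in>K. d k * exp (- m k * t) * F k\<bar> \<le> (\<Sum>k\<in>K. \<bar>d k * exp (- m k * t) * F k\<bar>)" by (rule sum_abs)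
  also have "\<dots> \<le> (\<Sum>k\<in>K. (D k * exp (- 1 * t)) * (M k * g))"
  proof (rule sum_mono)
    fix k assume k: "k \<in> K"
    have "exp (- m k * t) \<le> exp (- 1 * t)" using assms(2)[of k] assms(3) mult_right_mono[of 1 "m k" t] by simp
    then show "\<bar>d k * exp (- m k * t) * F k\<bar> \<le> (D k * exp (- 1 * t)) * (M k * g)"
      unfolding abs_mult using assms(1,7)[OF k] assms(4,5) by (intro mult_mono) (auto intro: order_trans[OF abs_ge_zero])
  qed
  also have "\<dots> = (\<Sum>k\<in>K. D k * M k) * (exp (- 1 * t) * g)" unfolding sum_distrib_right by (simp add: mult_ac)
  finally show ?thesis .
qed

text \<open>The semigroups \<open>P\<^sub>t f\<close> (index \<open>None\<close>) and \<open>Q\<^sub>t g\<^sub>i\<close> (index \<open>Some i\<close>) of finite Laguerre expansions; the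
  shift \<open>2\<close> in the latter makes \<open>\<delta>\<^sub>i P\<^sub>t = Q\<^sub>t \<delta>\<^sub>i\<close>.\<close>

definition option_type :: "real ^ 'd \<Rightarrow> 'd option \<Rightarrow> real ^ 'd" where
  "option_type a n = (case n of None \<Rightarrow> a | Some i \<Rightarrow> a + axis i 1)"
definition option_eigenvalue :: "real ^ 'd \<Rightarrow> 'd option \<Rightarrow> nat ^ 'd \<Rightarrow> real" where
  "option_eigenvalue a n k = laguerre_eigenvalue (option_type a n) k + (case n of None \<Rightarrow> 0 | Some i \<Rightarrow> 2)"

definition mode_sum :: "(nat ^ 'd) set \<Rightarrow> (nat ^ 'd \<Rightarrow> real) \<Rightarrow> (nat ^ 'd \<Rightarrow> real) \<Rightarrow> (nat ^ 'd \<Rightarrow> real ^ 'd \<Rightarrow> real) \<Rightarrow> real ^ 'd \<Rightarrow> real \<Rightarrow> real" where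
  "mode_sum K m d F x t = (\<Sum>k\<in>K. d k * exp (- m k * t) * F k x)"

lemma mode_sum_measurable:
  fixes F :: "nat ^ 'd \<Rightarrow> real ^ 'd \<Rightarrow> real"
  assumes "\<And>k. F k \<in> borel_measurable borel"
  shows "(\<lambda>z. mode_sum K m d F (fst z) (snd z)) \<in> borel_measurable borel"
proof -
  have "(\<lambda>z :: (real ^ 'd) \<times> real. F k (fst z)) \<in> borel_measurable borel" for k
    by (rule measurable_compose[OF _ assms]) (intro borel_measurable_continuous_onI continuous_intros)
  then show ?thesis unfolding mode_sum_def by measurable
qed

text \<open>The squared frequency is the shifted eigenvalue, and \<open>Ph2_sum\<close> turns the
  spatial second derivatives into potential minus eigenvalue. In the sum the eigenvalue cancels and
  the shift moves into the potential.\<close>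

lemma flow_exists:
  fixes a :: "real ^ 'd" and K :: "'d option \<Rightarrow> (nat ^ 'd) set" and cf :: "'d option \<Rightarrow> nat ^ 'd \<Rightarrow> real"
  assumes a: "\<And>j. 1/2 < a $ j" and K: "\<And>n. finite (K n)"
  defines "m \<equiv> \<lambda>n k. sqrt (option_eigenvalue a n k)"
  shows "\<exists>M. flow (\<lambda>n. mode_sum (K n) (m n) (cf n) (Ph (option_type a n)))
     (\<lambda>n i. mode_sum (K n) (m n) (cf n) (\<lambda>k. Ph1 (option_type a n) k i)) (\<lambda>n i. mode_sum (K n) (m n) (cf n) (\<lambda>k. Ph2 (option_type a n) k i))
     (\<lambda>n. mode_sum (K n) (m n) (\<lambda>k. - m n k * cf n k) (Ph (option_type a n)))
     (\<lambda>n. mode_sum (K n) (m n) (\<lambda>k. (m n k)\<^sup>2 * cf n k) (Ph (option_type a n)))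
     (\<lambda>n x. potential (option_type a n) x + (case n of None \<Rightarrow> 0 | Some i \<Rightarrow> 2)) (potential a) 1 M"
proof -
  have ta: "1/2 < option_type a n $ j" for n j
    using a[of j] by (cases n) (auto simp: option_type_def axis_def)
  have eig1: "1 \<le> option_eigenvalue a n k" for n k
    using eigenvalue_ge_1[OF ta, of n k] by (cases n) (auto simp: option_eigenvalue_def)
  then have m1: "1 \<le> m n k" for n k by (simp add: m_def)
  have m2: "(m n k)\<^sup>2 = option_eigenvalue a n k" for n k using eig1[of n k] by (simp add: m_def)
  have "\<forall>n k. \<exists>M\<ge>0. \<forall>x\<in>orthant. \<bar>Ph (option_type a n) k x\<bar> \<le> M * gs x \<and>
     (\<forall>i. \<bar>Ph (option_type a n) k x\<bar> \<le> M * x $ i * gs x \<and> \<bar>Ph1 (option_type a n) k i x\<bar> \<le> M * gs x \<and> x $ i * \<bar>Ph2 (option_type a n) k i x\<bar> \<le> M * gs x)"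
    using Ph_bounds[OF ta] by blast
  then obtain B where B: "\<And>n k. 0 \<le> B n k" "\<And>n k x. x \<in> orthant \<Longrightarrow> \<bar>Ph (option_type a n) k x\<bar> \<le> B n k * gs x"
     "\<And>n k x i. x \<in> orthant \<Longrightarrow> \<bar>Ph (option_type a n) k x\<bar> \<le> B n k * x $ i * gs x"
     "\<And>n k x i. x \<in> orthant \<Longrightarrow> \<bar>Ph1 (option_type a n) k i x\<bar> \<le> B n k * gs x"
     "\<And>n k x i. x \<in> orthant \<Longrightarrow> x $ i * \<bar>Ph2 (option_type a n) k i x\<bar> \<le> B n k * gs x"
    by metis
  \<comment> \<open>One coefficient bound for the function and its first two time
    derivatives.\<close>
  define D where "D n k = \<bar>cf n k\<bar> * (1 + m n k + (m n k)\<^sup>2)" for n k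
  have D: "\<bar>cf n k\<bar> \<le> D n k" "\<bar>- m n k * cf n k\<bar> \<le> D n k" "\<bar>(m n k)\<^sup>2 * cf n k\<bar> \<le> D n k" for n k
    using m1[of n k] by (auto simp: D_def abs_mult distrib_left mult.commute)
  define Mn where "Mn n = (\<Sum>k\<in>K n. D n k * B n k)" for n
  have D0: "0 \<le> D n k" for n k using m1[of n k] by (simp add: D_def)
  have Mn0: "0 \<le> Mn n" for n unfolding Mn_def using D0 B(1) by (intro sum_nonneg mult_nonneg_nonneg)
  define M where "M = (\<Sum>n\<in>UNIV. Mn n)"
  have M: "Mn n \<le> M" "0 \<le> M" for n unfolding M_def using Mn0 by (auto intro!: member_le_sum sum_nonneg)
  have up: "\<bar>u\<bar> \<le> M * v" if "\<bar>u\<bar> \<le> Mn n * v" "0 \<le> v" for u v n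
    using that order_trans[OF that(1) mult_right_mono[OF M(1) that(2)]] by simp
  have msb: "\<bar>\<Sum>k\<in>K n. d k * exp (- m n k * t) * F k\<bar> \<le> M * (exp (- 1 * t) * g)"
    if "\<And>k. \<bar>F k\<bar> \<le> B n k * g" "0 \<le> t" "0 \<le> g" "\<And>k. \<bar>d k\<bar> \<le> D n k" for n d F g t
  proof (rule up)
    show "\<bar>\<Sum>k\<in>K n. d k * exp (- m n k * t) * F k\<bar> \<le> Mn n * (exp (- 1 * t) * g)"
      unfolding Mn_def by (rule mode_sum_bound[where m="m n"]) (use that m1 B(1) K in auto)
  qed (use that in simp)
  have "flow (\<lambda>n. mode_sum (K n) (m n) (cf n) (Ph (option_type a n)))
     (\<lambda>n i. mode_sum (K n) (m n) (cf n) (\<lambda>k. Ph1 (option_type a n) k i)) (\<lambda>n i. mode_sum (K n) (m n) (cf n) (\<lambda>k. Ph2 (option_type a n) k i))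
     (\<lambda>n. mode_sum (K n) (m n) (\<lambda>k. - m n k * cf n k) (Ph (option_type a n)))
     (\<lambda>n. mode_sum (K n) (m n) (\<lambda>k. (m n k)\<^sup>2 * cf n k) (Ph (option_type a n)))
     (\<lambda>n x. potential (option_type a n) x + (case n of None \<Rightarrow> 0 | Some i \<Rightarrow> 2)) (potential a) 1 M"
  proof
    fix x :: "real ^ 'd" assume x: "x \<in> orthant"
    have a4: "1/4 \<le> (a $ j)\<^sup>2" for j using a[of j] power_mono[of "1/2" "a $ j" 2] by (simp add: power2_eq_square)
    show "0 \<le> potential a x" unfolding potential_def using a4 by (intro sum_nonneg add_nonneg_nonneg divide_nonneg_nonneg) auto
    show "potential a x \<le> potential (option_type a n) x + (case n of None \<Rightarrow> 0 | Some i \<Rightarrow> 2)" for n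
    proof -
      \<comment> \<open>Raising the type increases the singular part of the potential, so the
        potential of type \<open>a\<close> is the smallest.\<close>
      have "(a $ j)\<^sup>2 \<le> (option_type a n $ j)\<^sup>2" for j
        using a[of j] by (intro power_mono) (auto simp: option_type_def axis_def split: option.split)
      then have "potential a x \<le> potential (option_type a n) x"
        unfolding potential_def by (intro sum_mono add_left_mono divide_right_mono) auto
      then show ?thesis by (auto split: option.split)
    qed
    fix n i and t :: real
    show "((\<lambda>s. mode_sum (K n) (m n) (cf n) (Ph (option_type a n)) (x + s *\<^sub>R axis i 1) t) has_real_derivative mode_sum (K n) (m n) (cf n) (\<lambda>k. Ph1 (option_type a n) k i) x t) (at 0)"
      unfolding mode_sum_def by (intro DERIV_sum DERIV_cmult Ph_deriv x)
    show "((\<lambda>s. mode_sum (K n) (m n) (cf n) (\<lambda>k. Ph1 (option_type a n) k i) (x + s *\<^sub>R axis i 1) t) has_real_derivative mode_sum (K n) (m n) (cf n) (\<lambda>k. Ph2 (option_type a n) k i) x t) (at 0)"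
      unfolding mode_sum_def by (intro DERIV_sum DERIV_cmult Ph_deriv x)
    have ex: "((\<lambda>t. \<Sum>k\<in>K n. d k * exp (- m n k * t) * F k) has_real_derivative (\<Sum>k\<in>K n. (- m n k * d k) * exp (- m n k * t) * F k)) (at t)" for d F
      by (intro DERIV_sum) (auto intro!: derivative_eq_intros)
    show "(mode_sum (K n) (m n) (cf n) (Ph (option_type a n)) x has_real_derivative mode_sum (K n) (m n) (\<lambda>k. - m n k * cf n k) (Ph (option_type a n)) x t) (at t)"
      unfolding mode_sum_def by (rule ex)
    show "(mode_sum (K n) (m n) (\<lambda>k. - m n k * cf n k) (Ph (option_type a n)) x has_real_derivative mode_sum (K n) (m n) (\<lambda>k. (m n k)\<^sup>2 * cf n k) (Ph (option_type a n)) x t) (at t)"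
      unfolding mode_sum_def by (rule DERIV_cong[OF ex]) (simp add: power2_eq_square mult_ac)
    assume t: "0 \<le> t"
    have xi: "0 < x $ i" using x by (simp add: orthant_def)
    have g: "0 \<le> exp (- 1 * t) * gs x" by simp
    show "\<bar>mode_sum (K n) (m n) (cf n) (Ph (option_type a n)) x t\<bar> \<le> M * (exp (- 1 * t) * gs x)"
      unfolding mode_sum_def by (intro msb B(2) x t D gs_pos)
    show "\<bar>mode_sum (K n) (m n) (\<lambda>k. - m n k * cf n k) (Ph (option_type a n)) x t\<bar> \<le> M * (exp (- 1 * t) * gs x)"
      unfolding mode_sum_def by (intro msb B(2) x t D gs_pos)
    show "\<bar>mode_sum (K n) (m n) (\<lambda>k. (m n k)\<^sup>2 * cf n k) (Ph (option_type a n)) x t\<bar> \<le> M * (exp (- 1 * t) * gs x)"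
      unfolding mode_sum_def by (intro msb B(2) x t D gs_pos)
    show "\<bar>mode_sum (K n) (m n) (cf n) (\<lambda>k. Ph1 (option_type a n) k i) x t\<bar> \<le> M * (exp (- 1 * t) * gs x)"
      unfolding mode_sum_def by (intro msb B(4) x t D gs_pos)
    \<comment> \<open>The same estimate with \<open>x $ i * gs x\<close> in the role of
      \<open>gs x\<close>.\<close>
    have "\<bar>mode_sum (K n) (m n) (cf n) (Ph (option_type a n)) x t\<bar> \<le> M * (exp (- 1 * t) * (x $ i * gs x))"
      unfolding mode_sum_def by (intro msb t D) (use B(3)[OF x] xi in \<open>auto simp: mult_ac\<close>)
    then show "\<bar>mode_sum (K n) (m n) (cf n) (Ph (option_type a n)) x t\<bar> \<le> M * x $ i * (exp (- 1 * t) * gs x)"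
      by (simp add: mult_ac)
    have "\<bar>\<Sum>k\<in>K n. cf n k * exp (- m n k * t) * (x $ i * Ph2 (option_type a n) k i x)\<bar> \<le> M * (exp (- 1 * t) * gs x)"
      by (intro msb t D) (use B(5)[OF x] xi in \<open>auto simp: abs_mult\<close>)
    moreover have "(\<Sum>k\<in>K n. cf n k * exp (- m n k * t) * (x $ i * Ph2 (option_type a n) k i x)) = x $ i * mode_sum (K n) (m n) (cf n) (\<lambda>k. Ph2 (option_type a n) k i) x t"
      unfolding mode_sum_def sum_distrib_left by (simp add: mult_ac)
    ultimately show "x $ i * \<bar>mode_sum (K n) (m n) (cf n) (\<lambda>k. Ph2 (option_type a n) k i) x t\<bar> \<le> M * (exp (- 1 * t) * gs x)"
      using xi by (simp add: abs_mult)
    have "(\<Sum>i\<in>UNIV. mode_sum (K n) (m n) (cf n) (\<lambda>k. Ph2 (option_type a n) k i) x t) = (\<Sum>k\<in>K n. cf n k * exp (- m n k * t) * (\<Sum>i\<in>UNIV. Ph2 (option_type a n) k i x))"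
      unfolding mode_sum_def by (subst sum.swap) (simp add: sum_distrib_left)
    then show "mode_sum (K n) (m n) (\<lambda>k. (m n k)\<^sup>2 * cf n k) (Ph (option_type a n)) x t + (\<Sum>i\<in>UNIV. mode_sum (K n) (m n) (cf n) (\<lambda>k. Ph2 (option_type a n) k i) x t) =
       (potential (option_type a n) x + (case n of None \<Rightarrow> 0 | Some i \<Rightarrow> 2)) * mode_sum (K n) (m n) (cf n) (Ph (option_type a n)) x t"
      unfolding mode_sum_def Ph2_sum[OF x] m2 option_eigenvalue_def
      by (simp add: sum_distrib_left algebra_simps flip: sum.distrib)
  qed (auto intro!: M mode_sum_measurable Ph_measurable)
  then show ?thesis by blast
qed

section \<open>The Riesz transforms as a bilinear form\<close>

lemma Ph_orthonormal:
  assumes b: "\<And>j. 1/2 < b $ j"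
  shows "integrable MX (\<lambda>x. Ph b k x * Ph b l x)" "(LINT x|MX. Ph b k x * Ph b l x) = (if k = l then 1 else 0)"
proof -
  define f where "f j y = ph b k j y * ph b l j y" for j y
  have eq: "Ph b k x * Ph b l x = (\<Prod>j\<in>UNIV. f j (x $ j))" for x
    by (simp add: Ph_def pf_def f_def prod.distrib)
  have i: "set_integrable lborel {0<..} (f j)" for j
    unfolding f_def ph_def using b[of j] by (intro lf_mult_integrable) auto
  have m: "f j \<in> borel_measurable borel" for j unfolding f_def by measurable
  have v: "(LBINT y:{0<..}. f j y) = (if k $ j = l $ j then 1 else 0)" for j
    unfolding f_def ph_def by (rule lfP_orthonormal[OF b])
  show "integrable MX (\<lambda>x. Ph b k x * Ph b l x)" unfolding eq by (rule integrable_MX_prod[OF i m])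
  show "(LINT x|MX. Ph b k x * Ph b l x) = (if k = l then 1 else 0)"
    unfolding eq integral_MX_prod[OF i m] v by (auto simp: vec_eq_iff)
qed

text \<open>For \<open>k $ i = 0\<close> the subtraction truncates; \<open>dPh\<close> is then 0
  because of its factor \<open>sqrt (real (k $ i))\<close>.\<close>

definition dec :: "'d \<Rightarrow> nat ^ 'd \<Rightarrow> nat ^ 'd" where
  "dec i k = (\<chi> j. if j = i then k $ j - 1 else k $ j)"

text \<open>Closed form of \<delta>_i applied to a Laguerre function. Being a multiple of
  \<open>Ph\<close> it is Borel on the whole space; it agrees with \<open>laguerre_delta\<close> on
  the orthant.\<close>

definition dPh :: "real ^ 'd \<Rightarrow> 'd \<Rightarrow> nat ^ 'd \<Rightarrow> real ^ 'd \<Rightarrow> real" where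
  "dPh a i k x = - 2 * sqrt (real (k $ i)) * Ph (a + axis i 1) (dec i k) x"

lemma dPh_measurable [measurable]: "dPh a i k \<in> borel_measurable borel"
  unfolding dPh_def[abs_def] by measurable

lemma dPh_eq:
  assumes "x \<in> orthant"
  shows "Ph1 a k i x + (x $ i - (a $ i + 1/2) / x $ i) * Ph a k x = dPh a i k x"
proof -
  have xi: "0 < x $ i" using assms by (simp add: orthant_def)
  have r: "(\<Prod>j\<in>UNIV - {i}. ph (a + axis i 1) (dec i k) j (x $ j)) = (\<Prod>j\<in>UNIV - {i}. ph a k j (x $ j))"
    by (rule prod.cong) (auto simp: ph_def dec_def axis_def)
  have "ph1 a k i (x $ i) + (x $ i - (a $ i + 1/2) / x $ i) * ph a k i (x $ i) =
      - 2 * sqrt (real (k $ i)) * lf (a $ i + 1 + 1/2) (lfP (a $ i + 1) (k $ i - 1)) (x $ i)"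
    unfolding ph_def ph1_def by (rule lf_delta_lfP[OF xi refl])
  also have "lf (a $ i + 1 + 1/2) (lfP (a $ i + 1) (k $ i - 1)) (x $ i) = ph (a + axis i 1) (dec i k) i (x $ i)"
    by (simp add: ph_def dec_def axis_def)
  finally have e: "ph1 a k i (x $ i) + (x $ i - (a $ i + 1/2) / x $ i) * ph a k i (x $ i) =
      - 2 * sqrt (real (k $ i)) * ph (a + axis i 1) (dec i k) i (x $ i)" .
  have "Ph1 a k i x + (x $ i - (a $ i + 1/2) / x $ i) * Ph a k x =
     (ph1 a k i (x $ i) + (x $ i - (a $ i + 1/2) / x $ i) * ph a k i (x $ i)) * (\<Prod>j\<in>UNIV - {i}. ph a k j (x $ j))"
    unfolding Ph1_def pf_upd Ph_def pf_split[of "ph a k" x i] by (simp only: distrib_right mult.assoc)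
  also have "\<dots> = dPh a i k x"
    unfolding e dPh_def Ph_def pf_split[of "ph (a + axis i 1) (dec i k)" x i] r by (simp only: mult.assoc)
  finally show ?thesis .
qed

lemma laguerre_delta_dPh:
  assumes "x \<in> orthant"
  shows "laguerre_delta a i (laguerre_fun a k) x = dPh a i k x"
  unfolding laguerre_delta_def partial_deriv_def laguerre_fun_Ph DERIV_imp_deriv[OF Ph_deriv(1)[OF assms]]
  by (rule dPh_eq[OF assms])

text \<open>Lowering \<open>k $ i\<close> costs 4 and raising the type gains 2; the difference is
  the shift 2 in \<open>option_eigenvalue\<close>.\<close>

lemma eigenvalue_dec:
  assumes "0 < k $ i"
  shows "laguerre_eigenvalue (a + axis i 1) (dec i k) + 2 = laguerre_eigenvalue (a :: real ^ 'd) k"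
proof -
  have "(\<Sum>j\<in>UNIV. k $ j) = Suc (\<Sum>j\<in>UNIV. dec i k $ j)"
    using assms by (simp add: sum.remove[of UNIV i] dec_def)
  moreover have "(\<Sum>j\<in>UNIV. (a + axis i 1) $ j) = (\<Sum>j\<in>UNIV. a $ j) + 1"
    by (simp add: sum.distrib axis_def)
  ultimately show ?thesis by (simp add: laguerre_eigenvalue_def)
qed

lemma t_exp_integral:
  assumes "0 < c"
  shows "(LINT t|MT. t * exp (- c * t)) = 1 / c\<^sup>2"
proof -
  have "(LINT t|MT. t * exp (- c * t)) = exp (- c * 0) / c\<^sup>2 - 0"
  proof (rule integral_t_second_deriv[where c=c and M="1 + 1 / c" and ?v1.0="\<lambda>t. - exp (- c * t) / c"])
    show "((\<lambda>t. exp (- c * t) / c\<^sup>2) has_real_derivative - exp (- c * t) / c) (at t)" for t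
      using assms by (auto intro!: derivative_eq_intros simp: power2_eq_square)
    show "((\<lambda>t. - exp (- c * t) / c) has_real_derivative exp (- c * t)) (at t)" for t
      using assms by (auto intro!: derivative_eq_intros)
    show "\<bar>- exp (- c * t) / c\<bar> \<le> (1 + 1 / c) * exp (- c * t)" "\<bar>exp (- c * t)\<bar> \<le> (1 + 1 / c) * exp (- c * t)" for t
      using assms by (auto simp: distrib_right)
    have "filterlim (\<lambda>t. - c * t) at_bot at_top"
      using assms by (intro filterlim_tendsto_neg_mult_at_bot[OF tendsto_const] filterlim_ident) auto
    then show "((\<lambda>t. exp (- c * t) / c\<^sup>2) \<longlongrightarrow> 0) at_top"
      unfolding divide_inverse by (intro tendsto_mult_left_zero filterlim_compose[OF exp_at_bot])
  qed (use assms in auto)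
  then show ?thesis by simp
qed

lemma XT_product_integral:
  fixes F :: "real ^ 'd \<Rightarrow> real"
  assumes c: "0 < c" and m: "F \<in> borel_measurable borel" and b: "\<And>x. x \<in> orthant \<Longrightarrow> \<bar>F x\<bar> \<le> M * gs x" and M: "0 \<le> M"
  shows "integrable (MX \<Otimes>\<^sub>M MT) (\<lambda>z. (snd z * exp (- c * snd z)) * F (fst z))"
    and "(LINT z|(MX \<Otimes>\<^sub>M MT). (snd z * exp (- c * snd z)) * F (fst z)) = (LINT x|MX. F x) / c\<^sup>2"
proof -
  have F: "(\<lambda>z :: (real ^ 'd) \<times> real. F (fst z)) \<in> borel_measurable borel"
    by (rule measurable_compose[OF _ m]) (intro borel_measurable_continuous_onI continuous_intros)
  show i: "integrable (MX \<Otimes>\<^sub>M MT) (\<lambda>z. (snd z * exp (- c * snd z)) * F (fst z))"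
  proof (rule XT_integrable[where f="\<lambda>x t. (t * exp (- c * t)) * F x" and c="c/2" and M="(2/c) * M"])
    show "(\<lambda>z. (snd z * exp (- c * snd z)) * F (fst z)) \<in> borel_measurable borel"
      by (intro borel_measurable_times snd_borel F borel_measurable_exp measurable_compose[OF snd_borel] borel_measurable_continuous_onI continuous_intros; simp?)
    show "\<bar>(t * exp (- c * t)) * F x\<bar> \<le> (2/c) * M * exp (- (c/2) * t) * gs x" if "x \<in> orthant" "0 < t" for x t
    proof -
      have "\<bar>(t * exp (- c * t)) * F x\<bar> = (t * exp (- c * t)) * \<bar>F x\<bar>" using that by (simp add: abs_mult)
      also have "\<dots> \<le> ((2/c) * exp (- (c/2) * t)) * (M * gs x)"
        by (rule mult_mono[OF t_exp_le[OF c] b[OF that(1)]]) (use that c in auto)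
      finally have "\<bar>(t * exp (- c * t)) * F x\<bar> \<le> ((2/c) * exp (- (c/2) * t)) * (M * gs x)" .
      then show ?thesis by (simp add: mult_ac)
    qed
  qed (use c in auto)
  have "(LINT z|(MX \<Otimes>\<^sub>M MT). (snd z * exp (- c * snd z)) * F (fst z)) = (LINT x|MX. LINT t|MT. (t * exp (- c * t)) * F x)"
    using XT_Fubini(1)[where f="\<lambda>x t. (t * exp (- c * t)) * F x"] i by simp
  also have "\<dots> = (LINT x|MX. (1 / c\<^sup>2) * F x)" by (simp only: Bochner_Integration.integral_mult_left_zero t_exp_integral[OF c])
  finally show "(LINT z|(MX \<Otimes>\<^sub>M MT). (snd z * exp (- c * snd z)) * F (fst z)) = (LINT x|MX. F x) / c\<^sup>2" by simp
qed

lemma option_type_gt: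
  fixes a :: "real ^ 'd"
  assumes "\<And>j. 1/2 < a $ j"
  shows "1/2 < (a + axis i 1) $ j"
  using assms[of j] by (auto simp: axis_def)

lemma Ph_bound:
  assumes b: "\<And>j. 1/2 < b $ j"
  obtains M where "0 \<le> M" "\<And>x. x \<in> orthant \<Longrightarrow> \<bar>Ph b k x\<bar> \<le> M * gs x"
  using Ph_bounds[OF b, of k] by blast

lemma dPh_integral:
  assumes a: "\<And>j. 1/2 < a $ j"
  shows "(LINT x|MX. dPh a i k x * Ph (a + axis i 1) l x) = - 2 * sqrt (real (k $ i)) * (if dec i k = l then 1 else 0)"
  unfolding dPh_def mult.assoc[of "- 2 * sqrt (real (k $ i))"] Bochner_Integration.integral_mult_right_zero Ph_orthonormal(2)[OF option_type_gt[OF a]] ..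

text \<open>On eigenfunctions this is \<open>\<integral>\<^sub>0\<^sup>\<infinity> t \<mu> e\<^sup>-\<^sup>2\<^sup>\<mu>\<^sup>t dt = 1 / (4\<mu>)\<close> with \<open>\<mu> = \<lambda>\<^sup>1\<^sup>/\<^sup>2\<close>; eigenfunctions with different
  frequencies are orthogonal.\<close>
lemma riesz_pairing_modes:
  fixes a :: "real ^ 'd" and k l :: "nat ^ 'd" and i :: 'd
  assumes a: "\<And>j. 1/2 < a $ j"
  defines "\<mu> \<equiv> sqrt (laguerre_eigenvalue a k)" and "\<nu> \<equiv> sqrt (laguerre_eigenvalue (a + axis i 1) l + 2)"
  shows "integrable (MX \<Otimes>\<^sub>M MT) (\<lambda>z. snd z * (exp (- \<mu> * snd z) * dPh a i k (fst z)) * (- \<nu> * exp (- \<nu> * snd z) * Ph (a + axis i 1) l (fst z)))"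
    and "(LINT z|(MX \<Otimes>\<^sub>M MT). snd z * (exp (- \<mu> * snd z) * dPh a i k (fst z)) * (- \<nu> * exp (- \<nu> * snd z) * Ph (a + axis i 1) l (fst z)))
      = - (1/4) * (laguerre_eigenvalue a k powr (-1/2) * (LINT x|MX. dPh a i k x * Ph (a + axis i 1) l x))"
    and "integrable MX (\<lambda>x. dPh a i k x * Ph (a + axis i 1) l x)"
proof -
  note b = option_type_gt[OF a, of i]
  have m1: "1 \<le> \<mu>" using eigenvalue_ge_1[OF a, of k] by (simp add: \<mu>_def)
  have n1: "1 \<le> \<nu>" using eigenvalue_ge_1[OF b, of l] by (simp add: \<nu>_def)
  obtain M1 where M1: "0 \<le> M1" "\<And>x. x \<in> orthant \<Longrightarrow> \<bar>Ph (a + axis i 1) (dec i k) x\<bar> \<le> M1 * gs x" using Ph_bound[OF b] by blast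
  obtain M2 where M2: "0 \<le> M2" "\<And>x. x \<in> orthant \<Longrightarrow> \<bar>Ph (a + axis i 1) l x\<bar> \<le> M2 * gs x" using Ph_bound[OF b] by blast
  define F where "F x = - \<nu> * (dPh a i k x * Ph (a + axis i 1) l x)" for x
  define M where "M = \<nu> * (2 * sqrt (real (k $ i)) * M1 * M2)"
  have F: "\<bar>F x\<bar> \<le> M * gs x" if x: "x \<in> orthant" for x
  proof -
    have "\<bar>Ph (a + axis i 1) (dec i k) x\<bar> * \<bar>Ph (a + axis i 1) l x\<bar> \<le> (M1 * gs x) * (M2 * gs x)"
      using M1 M2 x by (intro mult_mono) auto
    also have "\<dots> \<le> (M1 * gs x) * (M2 * 1)" using M1 M2 by (intro mult_left_mono) auto
    finally have "\<nu> * (2 * sqrt (real (k $ i))) * (\<bar>Ph (a + axis i 1) (dec i k) x\<bar> * \<bar>Ph (a + axis i 1) l x\<bar>) \<le> \<nu> * (2 * sqrt (real (k $ i))) * ((M1 * gs x) * (M2 * 1))"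
      using n1 by (intro mult_left_mono) auto
    then show ?thesis using n1 by (simp add: F_def M_def dPh_def abs_mult mult_ac)
  qed
  have M0: "0 \<le> M" using n1 M1 M2 by (simp add: M_def)
  have mF: "F \<in> borel_measurable borel" unfolding F_def[abs_def] by measurable
  have c: "0 < \<mu> + \<nu>" using m1 n1 by simp
  have eq: "snd z * (exp (- \<mu> * snd z) * dPh a i k (fst z)) * (- \<nu> * exp (- \<nu> * snd z) * Ph (a + axis i 1) l (fst z))
     = (snd z * exp (- (\<mu> + \<nu>) * snd z)) * F (fst z)" for z :: "(real ^ 'd) \<times> real"
  proof -
    have "exp (- (\<mu> + \<nu>) * snd z) = exp (- \<mu> * snd z) * exp (- \<nu> * snd z)"
      by (simp add: algebra_simps flip: exp_add)
    then show ?thesis by (simp add: F_def)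
  qed
  show "integrable (MX \<Otimes>\<^sub>M MT) (\<lambda>z. snd z * (exp (- \<mu> * snd z) * dPh a i k (fst z)) * (- \<nu> * exp (- \<nu> * snd z) * Ph (a + axis i 1) l (fst z)))"
    unfolding eq by (rule XT_product_integral(1)[OF c mF F M0])
  show "integrable MX (\<lambda>x. dPh a i k x * Ph (a + axis i 1) l x)"
    unfolding dPh_def mult.assoc[of "- 2 * sqrt (real (k $ i))"] by (intro integrable_mult_right Ph_orthonormal(1) b)
  have int: "(LINT x|MX. F x) = - \<nu> * (LINT x|MX. dPh a i k x * Ph (a + axis i 1) l x)"
    unfolding F_def by simp
  have E: "(LINT z|(MX \<Otimes>\<^sub>M MT). snd z * (exp (- \<mu> * snd z) * dPh a i k (fst z)) * (- \<nu> * exp (- \<nu> * snd z) * Ph (a + axis i 1) l (fst z)))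
      = (- \<nu> * (LINT x|MX. dPh a i k x * Ph (a + axis i 1) l x)) / (\<mu> + \<nu>)\<^sup>2"
  proof -
    have "(LINT z|(MX \<Otimes>\<^sub>M MT). (snd z * exp (- (\<mu> + \<nu>) * snd z)) * F (fst z)) = (LINT x|MX. F x) / (\<mu> + \<nu>)\<^sup>2"
      by (rule XT_product_integral(2)[OF c mF F M0])
    then show ?thesis unfolding eq int .
  qed
  show "(LINT z|(MX \<Otimes>\<^sub>M MT). snd z * (exp (- \<mu> * snd z) * dPh a i k (fst z)) * (- \<nu> * exp (- \<nu> * snd z) * Ph (a + axis i 1) l (fst z)))
      = - (1/4) * (laguerre_eigenvalue a k powr (-1/2) * (LINT x|MX. dPh a i k x * Ph (a + axis i 1) l x))"
  \<comment> \<open>Either the two frequencies coincide or the spatial integral is 0: for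
    \<open>k $ i = 0\<close> because of the factor \<open>sqrt (real (k $ i))\<close>, otherwise by
    orthogonality.\<close>
  proof (cases "k $ i > 0 \<and> dec i k = l")
    case True
    then have "\<nu> = \<mu>" using eigenvalue_dec[of k i a] by (simp add: \<mu>_def \<nu>_def)
    moreover have "laguerre_eigenvalue a k powr (-1/2) = 1 / \<mu>"
      using eigenvalue_ge_1[OF a, of k] by (simp add: \<mu>_def powr_minus_divide flip: powr_half_sqrt)
    ultimately show ?thesis unfolding E using m1
      by (simp add: power2_eq_square)
  next
    case False
    then have "(LINT x|MX. dPh a i k x * Ph (a + axis i 1) l x) = 0"
      unfolding dPh_integral[OF a] by auto
    then show ?thesis unfolding E by simp
  qed
qed

lemma laguerre_C_ge:
  assumes a: "\<And>j. 1/2 < a $ j"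
  shows "(a $ i + 1/2) / (a $ i - 1/2) \<le> laguerre_C a" "1 \<le> laguerre_C (a :: real ^ 'd)"
proof -
  show 1: "(a $ i + 1/2) / (a $ i - 1/2) \<le> laguerre_C a" for i unfolding laguerre_C_def by (rule Max_ge) auto
  have "1 \<le> (a $ i + 1/2) / (a $ i - 1/2)" for i using a[of i] by (simp add: field_simps)
  then show "1 \<le> laguerre_C a" using 1 order_trans by blast
qed

text \<open>The mixed term of the square is negative and dropped. With
  \<open>s = a $ i + 1/2\<close>, the square of \<open>s\<close> is \<open>s / (a $ i - 1/2)\<close>
  times \<open>(a $ i)\<^sup>2 - 1/4\<close>; this is where the quotient in
  \<open>laguerre_C\<close> comes from.\<close>

lemma delta_coefficient_bound:
  assumes a: "\<And>j. 1/2 < a $ j" and x: "x \<in> orthant"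
  shows "(\<Sum>i\<in>UNIV. (x $ i - (a $ i + 1/2) / x $ i)\<^sup>2) \<le> laguerre_C a * potential a x"
  unfolding potential_def sum_distrib_left
proof (rule sum_mono)
  fix i :: 'a
  have xi: "0 < x $ i" using x by (simp add: orthant_def)
  have ai: "0 < a $ i - 1/2" using a[of i] by simp
  let ?C = "laguerre_C a" and ?s = "a $ i + 1/2"
  have "?s = ?s / (a $ i - 1/2) * (a $ i - 1/2)" using ai by simp
  also have "\<dots> \<le> ?C * (a $ i - 1/2)" using ai laguerre_C_ge(1)[OF a] by (intro mult_right_mono) auto
  finally have "?s * ?s \<le> (?C * (a $ i - 1/2)) * ?s" using ai by (intro mult_right_mono) auto
  then have s: "?s\<^sup>2 \<le> ?C * ((a $ i)\<^sup>2 - 1/4)" by (simp add: power2_eq_square algebra_simps)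
  have "(x $ i - ?s / x $ i)\<^sup>2 = (x $ i)\<^sup>2 - 2 * ?s + ?s\<^sup>2 / (x $ i)\<^sup>2" using xi by (simp add: power2_diff power_divide)
  also have "\<dots> \<le> (x $ i)\<^sup>2 + ?s\<^sup>2 / (x $ i)\<^sup>2" using ai by simp
  also have "\<dots> \<le> ?C * (x $ i)\<^sup>2 + ?C * ((a $ i)\<^sup>2 - 1/4) / (x $ i)\<^sup>2"
    using laguerre_C_ge(2)[OF a] s mult_right_mono[of 1 ?C "(x $ i)\<^sup>2"] by (intro add_mono divide_right_mono) auto
  finally show "(x $ i - ?s / x $ i)\<^sup>2 \<le> ?C * ((x $ i)\<^sup>2 + ((a $ i)\<^sup>2 - 1/4) / (x $ i)\<^sup>2)" by (simp add: distrib_left)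
qed

section \<open>The Riesz transform of a finite expansion against vector-valued test
  functions\<close>

definition lsum :: "(nat ^ 'd) set \<Rightarrow> real ^ 'd \<Rightarrow> (nat ^ 'd \<Rightarrow> real) \<Rightarrow> real ^ 'd \<Rightarrow> real" where
  "lsum K b c x = (\<Sum>k\<in>K. c k * Ph b k x)"

text \<open>The Riesz transform of \<open>lsum K a c\<close> in closed form;
  \<open>riesz_on_span_rsum\<close> identifies the two on the orthant.\<close>

definition rsum :: "(nat ^ 'd) set \<Rightarrow> real ^ 'd \<Rightarrow> (nat ^ 'd \<Rightarrow> real) \<Rightarrow> real ^ 'd \<Rightarrow> real ^ 'd" where
  "rsum K a c x = (\<chi> i. \<Sum>k\<in>K. c k * laguerre_eigenvalue a k powr (-1/2) * dPh a i k x)"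

text \<open>Component \<open>i\<close> has type \<open>a + axis i 1\<close> because the i-th Riesz
  transform takes its values in expansions of that type.\<close>

definition gsum :: "('d \<Rightarrow> (nat ^ 'd) set) \<Rightarrow> real ^ 'd \<Rightarrow> ('d \<Rightarrow> nat ^ 'd \<Rightarrow> real) \<Rightarrow> real ^ 'd \<Rightarrow> real ^ 'd" where
  "gsum L a d x = (\<chi> i. lsum (L i) (a + axis i 1) (d i) x)"

lemma sq_powr_half: "(x\<^sup>2) powr (r/2) = \<bar>x :: real\<bar> powr r"
proof -
  have "x\<^sup>2 = \<bar>x\<bar> powr 2" by simp
  then show ?thesis by (simp only: powr_powr) simp
qed

text \<open>The norms are normalised because \<open>bilinear_embedding\<close> bounds the energy
  integral by a sum of a p-th and a q-th power; \<open>riesz_bilinear_Lp\<close> restores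
  homogeneity. The index \<open>None\<close> carries the extension of the scalar function,
  \<open>Some i\<close> that of component \<open>i\<close> of the test function.\<close>

lemma riesz_bilinear:
  fixes a :: "real ^ 'd" and p q :: real
  assumes a: "\<And>j. 1/2 < a $ j" and p: "1 < p" and q: "q = p / (p - 1)" and K: "finite K" and L: "\<And>i. finite (L i)"
    and f1: "(LINT x|MX. \<bar>lsum K a c x\<bar> powr p) \<le> 1" and g1: "(LINT x|MX. norm (gsum L a d x) powr q) \<le> 1"
  shows "\<bar>LINT x|MX. rsum K a c x \<bullet> gsum L a d x\<bar> \<le> 24 * (1 + sqrt (laguerre_C a)) * (max p q - 1)"
proof -
  define KK where "KK n = (case n of None \<Rightarrow> K | Some i \<Rightarrow> L i)" for n
  define cf where "cf n = (case n of None \<Rightarrow> c | Some i \<Rightarrow> d i)" for n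
  define m where "m n k = sqrt (option_eigenvalue a n k)" for n k
  have fK: "finite (KK n)" for n using K L by (simp add: KK_def split: option.split)
  define w where "w n = mode_sum (KK n) (m n) (cf n) (Ph (option_type a n))" for n
  define w1 where "w1 n i = mode_sum (KK n) (m n) (cf n) (\<lambda>k. Ph1 (option_type a n) k i)" for n i
  define w2 where "w2 n i = mode_sum (KK n) (m n) (cf n) (\<lambda>k. Ph2 (option_type a n) k i)" for n i
  define wt where "wt n = mode_sum (KK n) (m n) (\<lambda>k. - m n k * cf n k) (Ph (option_type a n))" for n
  define wtt where "wtt n = mode_sum (KK n) (m n) (\<lambda>k. (m n k)\<^sup>2 * cf n k) (Ph (option_type a n))" for n
  define W where "W n x = potential (option_type a n) x + (case n of None \<Rightarrow> 0 | Some i \<Rightarrow> 2)" for n x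
  obtain M where "flow w w1 w2 wt wtt W (potential a) 1 M"
    using flow_exists[where K=KK and cf=cf, OF a fK]
    unfolding w_def[abs_def] w1_def[abs_def] w2_def[abs_def] wt_def[abs_def] wtt_def[abs_def] W_def[abs_def] m_def[abs_def] by blast
  then interpret flow w w1 w2 wt wtt W "potential a" 1 M .
  \<comment> \<open>\<delta>_i applied to the extension of the scalar function. By
    \<open>dPh_eq\<close> it acts mode by mode and keeps the frequencies of
    \<open>None\<close>.\<close>
  define dw where "dw i = mode_sum K (m None) c (dPh a i)" for i
  have dw: "dw i x t = w1 None i x t + (x $ i - (a $ i + 1/2) / x $ i) * w None x t" if "x \<in> orthant" for i x t
    unfolding dw_def w1_def w_def mode_sum_def KK_def cf_def option_type_def
    by (simp add: dPh_eq[OF that, symmetric] sum_distrib_left algebra_simps sum.distrib sum_subtractf)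
  let ?E = "\<lambda>z. snd z * (sqrt (energy {None} (fst z) (snd z)) * sqrt (energy (range Some) (fst z) (snd z)))"
  let ?X = "\<lambda>z. snd z * (\<Sum>i\<in>UNIV. dw i (fst z) (snd z) * wt (Some i) (fst z) (snd z))"
  let ?s = "1 + sqrt (laguerre_C a)"
  have C1: "1 \<le> laguerre_C a" by (rule laguerre_C_ge[OF a])
  \<comment> \<open>Cauchy-Schwarz over the coordinates: the first factor is compared with the
    energy of \<open>None\<close>, while the second consists of time derivatives and is part of the
    energy of \<open>range Some\<close>.\<close>
  have pw: "\<bar>?X z\<bar> \<le> ?s * ?E z" if "z \<in> space (MX \<Otimes>\<^sub>M MT)" for z
  proof -
    obtain x t where z: "z = (x, t)" by (cases z)
    then have x: "x \<in> orthant" and t: "0 < t" using that by (auto simp: space_pair_measure)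
    have V0: "0 \<le> potential a x" by (rule V(1)[OF x])
    let ?r = "\<lambda>i. x $ i - (a $ i + 1/2) / x $ i"
    have "\<bar>\<Sum>i\<in>UNIV. dw i x t * wt (Some i) x t\<bar> \<le> (\<Sum>i\<in>UNIV. \<bar>dw i x t\<bar> * \<bar>wt (Some i) x t\<bar>)"
      by (rule order_trans[OF sum_abs]) (simp add: abs_mult)
    also have "\<dots> \<le> L2_set (\<lambda>i. dw i x t) UNIV * L2_set (\<lambda>i. wt (Some i) x t) UNIV" by (rule L2_set_mult_ineq)
    finally have 1: "\<bar>\<Sum>i\<in>UNIV. dw i x t * wt (Some i) x t\<bar> \<le> L2_set (\<lambda>i. dw i x t) UNIV * L2_set (\<lambda>i. wt (Some i) x t) UNIV" .
    have 2: "L2_set (\<lambda>i. wt (Some i) x t) UNIV \<le> sqrt (energy (range Some) x t)"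
    proof -
      have "energy (range Some) x t = (\<Sum>i\<in>UNIV. (wt (Some i) x t)\<^sup>2 + (\<Sum>j\<in>UNIV. (w1 (Some i) j x t)\<^sup>2) + potential a x * (w (Some i) x t)\<^sup>2)"
        unfolding energy_def by (subst sum.reindex) auto
      also have "\<dots> \<ge> (\<Sum>i\<in>UNIV. (wt (Some i) x t)\<^sup>2)"
      proof (rule sum_mono)
        fix i :: 'd
        have "0 \<le> (\<Sum>j\<in>UNIV. (w1 (Some i) j x t)\<^sup>2)" by (simp add: sum_nonneg)
        then show "(wt (Some i) x t)\<^sup>2 \<le> (wt (Some i) x t)\<^sup>2 + (\<Sum>j\<in>UNIV. (w1 (Some i) j x t)\<^sup>2) + potential a x * (w (Some i) x t)\<^sup>2"
          using V0 by simp
      qed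
      finally show ?thesis by (simp add: L2_set_def)
    qed
    have 3: "L2_set (\<lambda>i. dw i x t) UNIV \<le> ?s * sqrt (energy {None} x t)"
    proof -
      have energy: "energy {None} x t = (wt None x t)\<^sup>2 + (\<Sum>j\<in>UNIV. (w1 None j x t)\<^sup>2) + potential a x * (w None x t)\<^sup>2"
        by (simp add: energy_def)
      have nn: "0 \<le> (\<Sum>j\<in>UNIV. (w1 None j x t)\<^sup>2)" "0 \<le> potential a x * (w None x t)\<^sup>2" "0 \<le> (wt None x t)\<^sup>2"
        using V0 by (auto intro: sum_nonneg)
      have "L2_set (\<lambda>i. dw i x t) UNIV \<le> L2_set (\<lambda>i. w1 None i x t) UNIV + L2_set (\<lambda>i. ?r i * w None x t) UNIV"
        unfolding dw[OF x] by (rule L2_set_triangle_ineq)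
      also have "L2_set (\<lambda>i. w1 None i x t) UNIV \<le> sqrt (energy {None} x t)"
        unfolding L2_set_def energy using nn by simp
      also have "L2_set (\<lambda>i. ?r i * w None x t) UNIV \<le> sqrt (laguerre_C a) * sqrt (energy {None} x t)"
      proof -
        have "(\<Sum>i\<in>UNIV. (?r i * w None x t)\<^sup>2) = (\<Sum>i\<in>UNIV. (?r i)\<^sup>2) * (w None x t)\<^sup>2"
          by (simp add: power_mult_distrib sum_distrib_right)
        also have "\<dots> \<le> (laguerre_C a * potential a x) * (w None x t)\<^sup>2"
          by (intro mult_right_mono delta_coefficient_bound[OF a x]) simp
        also have "\<dots> \<le> laguerre_C a * energy {None} x t"
          using C1 nn unfolding energy by (subst mult.assoc, intro mult_left_mono) auto
        finally show ?thesis by (simp add: L2_set_def flip: real_sqrt_mult)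
      qed
      finally show ?thesis by (simp add: distrib_right)
    qed
    have "\<bar>\<Sum>i\<in>UNIV. dw i x t * wt (Some i) x t\<bar> \<le> (?s * sqrt (energy {None} x t)) * sqrt (energy (range Some) x t)"
      by (rule order_trans[OF 1 mult_mono[OF 3 2]]) (auto intro: order_trans[OF L2_set_nonneg 3] L2_set_nonneg)
    from mult_left_mono[OF this, of t] show ?thesis using t unfolding z by (simp add: abs_mult mult_ac)
  qed
  have modes: "integrable (MX \<Otimes>\<^sub>M MT) ?X"
    "(LINT z|(MX \<Otimes>\<^sub>M MT). ?X z) = - (1/4) * (LINT x|MX. rsum K a c x \<bullet> gsum L a d x)"
  proof -
    let ?Y = "\<lambda>i k l z. snd z * (exp (- sqrt (laguerre_eigenvalue a k) * snd z) * dPh a i k (fst z)) *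
       (- sqrt (laguerre_eigenvalue (a + axis i 1) l + 2) * exp (- sqrt (laguerre_eigenvalue (a + axis i 1) l + 2) * snd z) * Ph (a + axis i 1) l (fst z))"
    have X: "?X z = (\<Sum>i\<in>UNIV. \<Sum>k\<in>K. \<Sum>l\<in>L i. (c k * d i l) * ?Y i k l z)" for z
      unfolding dw_def wt_def mode_sum_def KK_def cf_def m_def option_eigenvalue_def option_type_def option.case
      unfolding sum_product unfolding sum_distrib_left
      by (intro sum.cong refl) (simp add: mult_ac)
    show "integrable (MX \<Otimes>\<^sub>M MT) ?X"
      unfolding X by (intro Bochner_Integration.integrable_sum integrable_mult_right riesz_pairing_modes(1) a)
    have RG: "rsum K a c x \<bullet> gsum L a d x = (\<Sum>i\<in>UNIV. \<Sum>k\<in>K. \<Sum>l\<in>L i. (c k * d i l) * (laguerre_eigenvalue a k powr (-1/2) * (dPh a i k x * Ph (a + axis i 1) l x)))" for x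
      unfolding inner_vec_def rsum_def gsum_def lsum_def vec_lambda_beta inner_real_def sum_product
      by (intro sum.cong refl) (simp add: mult_ac)
    have "(LINT z|(MX \<Otimes>\<^sub>M MT). ?X z) = (\<Sum>i\<in>UNIV. \<Sum>k\<in>K. \<Sum>l\<in>L i. (c k * d i l) * (- (1/4) * (laguerre_eigenvalue a k powr (-1/2) * (LINT x|MX. dPh a i k x * Ph (a + axis i 1) l x))))"
      unfolding X riesz_pairing_modes(2)[OF a, symmetric]
      by (subst Bochner_Integration.integral_sum Bochner_Integration.integral_mult_right_zero,
          (intro Bochner_Integration.integrable_sum integrable_mult_right riesz_pairing_modes(1) a)?)+ (rule refl)
    also have "\<dots> = - (1/4) * (\<Sum>i\<in>UNIV. \<Sum>k\<in>K. \<Sum>l\<in>L i. (c k * d i l) * (laguerre_eigenvalue a k powr (-1/2) * (LINT x|MX. dPh a i k x * Ph (a + axis i 1) l x)))"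
      unfolding sum_distrib_left by (intro sum.cong refl) simp
    also have "(\<Sum>i\<in>UNIV. \<Sum>k\<in>K. \<Sum>l\<in>L i. (c k * d i l) * (laguerre_eigenvalue a k powr (-1/2) * (LINT x|MX. dPh a i k x * Ph (a + axis i 1) l x))) = (LINT x|MX. rsum K a c x \<bullet> gsum L a d x)"
      unfolding RG
      by (subst Bochner_Integration.integral_sum Bochner_Integration.integral_mult_right_zero,
          (intro Bochner_Integration.integrable_sum integrable_mult_right riesz_pairing_modes(3) a)?)+ (rule refl)
    finally show "(LINT z|(MX \<Otimes>\<^sub>M MT). ?X z) = - (1/4) * (LINT x|MX. rsum K a c x \<bullet> gsum L a d x)" .
  qed
  have w0: "w None x 0 = lsum K a c x" "w (Some i) x 0 = gsum L a d x $ i" for x i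
    by (simp_all add: w_def mode_sum_def KK_def cf_def option_type_def lsum_def gsum_def)
  have If: "(\<Sum>n\<in>{None}. (w n x 0)\<^sup>2) powr (r/2) = \<bar>lsum K a c x\<bar> powr r" for x r
    by (simp add: w0 sq_powr_half)
  have Ig: "(\<Sum>n\<in>range Some. (w n x 0)\<^sup>2) powr (r/2) = norm (gsum L a d x) powr r" for x r
  proof -
    have "(\<Sum>n\<in>range Some. (w n x 0)\<^sup>2) = (norm (gsum L a d x))\<^sup>2"
      by (subst sum.reindex) (auto simp: w0 norm_vec_sq)
    then show ?thesis by (simp add: sq_powr_half)
  qed
  have qm: "q - 1 = 1 / (p - 1)" using p by (simp add: q field_simps)
  have S: "integrable (MX \<Otimes>\<^sub>M MT) ?E \<and> (LINT z|(MX \<Otimes>\<^sub>M MT). ?E z) \<le> (10/3) * (max p q - 1)"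
  proof (cases "2 \<le> p")
    case True
    have "p * 1 \<le> p * (p - 1)" using True by (intro mult_left_mono) auto
    then have "q \<le> p" using True by (simp add: q divide_le_eq)
    then have mx: "max p q = p" by simp
    interpret B: bellman_flow p q "1 - 2/p" "(q - 1)/8" w w1 w2 wt wtt W "potential a" 1 M "{None}" "range Some"
      by unfold_locales (use True q in auto)
    \<comment> \<open>Here \<open>3 * (q - 1) / 8\<close> times the integral is at most 10/8, and
      \<open>q - 1 = 1 / (p - 1)\<close>; hence the constant 10/3.\<close>
    have "3 * ((q - 1)/8) * (LINT z|(MX \<Otimes>\<^sub>M MT). ?E z) \<le> 1/8 * 1 + 9/8 * 1"
      using B.bilinear_embedding unfolding If Ig using f1 g1 by linarith
    moreover note qm
    ultimately have "(LINT z|(MX \<Otimes>\<^sub>M MT). ?E z) \<le> (10/3) * (p - 1)" using p by (simp add: field_simps)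
    then show ?thesis using B.energy_integrable(1) mx by simp
  next
    case False
    then have "p * (p - 1) \<le> p * 1" using p by (intro mult_left_mono) auto
    then have q2: "2 \<le> q" "p \<le> q" using p False by (simp_all add: q le_divide_eq)
    then have mx: "max p q = q" by simp
    have pq: "p = q / (q - 1)" unfolding qm unfolding q using p by simp
    \<comment> \<open>Now the conjugate exponent is at least 2, so the test function takes the first
      argument of \<beta>.\<close>
    interpret B: bellman_flow q p "1 - 2/q" "(p - 1)/8" w w1 w2 wt wtt W "potential a" 1 M "range Some" "{None}"
      by unfold_locales (use q2 pq in auto)
    have "3 * ((p - 1)/8) * (LINT z|(MX \<Otimes>\<^sub>M MT). ?E z) \<le> 1/8 * 1 + 9/8 * 1"
      using B.bilinear_embedding unfolding If Ig mult.commute[of "sqrt (energy (range Some) _ _)"] using f1 g1 by linarith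
    then have "(LINT z|(MX \<Otimes>\<^sub>M MT). ?E z) * (p - 1) \<le> 10/3" by argo
    then have "(LINT z|(MX \<Otimes>\<^sub>M MT). ?E z) \<le> (10/3) / (p - 1)" using p by (simp only: pos_le_divide_eq diff_gt_0_iff_gt)
    then have "(LINT z|(MX \<Otimes>\<^sub>M MT). ?E z) \<le> (10/3) * (q - 1)" unfolding qm by simp
    then show ?thesis using B.energy_integrable(1) mx by (simp add: mult.commute)
  qed
  have "\<bar>LINT z|(MX \<Otimes>\<^sub>M MT). ?X z\<bar> \<le> (LINT z|(MX \<Otimes>\<^sub>M MT). \<bar>?X z\<bar>)" by (rule integral_abs_bound)
  also have "\<dots> \<le> (LINT z|(MX \<Otimes>\<^sub>M MT). ?s * ?E z)"
    by (rule integral_mono[OF integrable_abs[OF modes(1)] integrable_mult_right[OF conjunct1[OF S]] pw])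
  also have "\<dots> \<le> ?s * ((10/3) * (max p q - 1))"
    unfolding Bochner_Integration.integral_mult_right_zero using C1 S by (intro mult_left_mono) auto
  \<comment> \<open>The factor 4 inverts the 1/4 of \<open>riesz_pairing_modes\<close>; the constant
    reached is 40/3.\<close>
  finally have "\<bar>LINT x|MX. rsum K a c x \<bullet> gsum L a d x\<bar> \<le> 4 * (?s * ((10/3) * (max p q - 1)))"
    unfolding modes(2) by simp
  also have "\<dots> \<le> 24 * ?s * (max p q - 1)"
  proof -
    have "0 \<le> ?s * (max p q - 1)" using C1 p by simp
    moreover have "4 * (?s * ((10/3) * r)) = (40/3) * (?s * r)" "24 * ?s * r = 24 * (?s * r)" for r :: real by simp_all
    ultimately show ?thesis by linarith
  qed
  finally show ?thesis .
qed

section \<open>Density of the Laguerre span\<close>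

lemma laguerre_span_lsum: "laguerre_span b = {lsum K b c | K c. finite K}"
  by (auto simp: laguerre_span_def lsum_def[abs_def] laguerre_fun_Ph)

lemma span_add:
  assumes "f \<in> laguerre_span b" "g \<in> laguerre_span b"
  shows "(\<lambda>x. f x + g x) \<in> laguerre_span b"
proof -
  obtain K c L d where f: "f = lsum K b c" "finite K" and g: "g = lsum L b d" "finite L"
    using assms unfolding laguerre_span_lsum by blast
  have "f x + g x = lsum (K \<union> L) b (\<lambda>k. (if k \<in> K then c k else 0) + (if k \<in> L then d k else 0)) x" for x
  proof -
    have "(\<Sum>k\<in>K \<union> L. (if k \<in> K then c k else 0) * Ph b k x) = (\<Sum>k\<in>K. c k * Ph b k x)"
      by (rule sum.mono_neutral_cong_right) (use f g in auto)
    moreover have "(\<Sum>k\<in>K \<union> L. (if k \<in> L then d k else 0) * Ph b k x) = (\<Sum>k\<in>L. d k * Ph b k x)"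
      by (rule sum.mono_neutral_cong_right) (use f g in auto)
    ultimately show ?thesis unfolding f g lsum_def distrib_right sum.distrib by simp
  qed
  then show ?thesis unfolding laguerre_span_lsum using f g
    by (intro CollectI exI[of _ "K \<union> L"] exI conjI) auto
qed

lemma span_scale:
  assumes "f \<in> laguerre_span b"
  shows "(\<lambda>x. r * f x) \<in> laguerre_span b"
proof -
  obtain K c where f: "f = lsum K b c" "finite K" using assms unfolding laguerre_span_lsum by blast
  have "(\<lambda>x. r * f x) = lsum K b (\<lambda>k. r * c k)" by (simp add: f lsum_def[abs_def] sum_distrib_left mult_ac)
  then show ?thesis unfolding laguerre_span_lsum using f by blast
qed

lemma span_zero: "(\<lambda>x. 0) \<in> laguerre_span b"
  unfolding laguerre_span_lsum by (intro CollectI exI[of _ "{}"] exI[of _ "\<lambda>_. 0"]) (simp add: lsum_def[abs_def])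

lemma span_sum:
  assumes "\<And>i. i \<in> I \<Longrightarrow> f i \<in> laguerre_span b"
  shows "(\<lambda>x. \<Sum>i\<in>I. f i x) \<in> laguerre_span b"
  using assms by (induction I rule: infinite_finite_induct) (auto intro: span_zero span_add)

lemma lsum_measurable [measurable]: "lsum K b c \<in> borel_measurable borel"
  unfolding lsum_def[abs_def] by measurable

lemma span_measurable: "f \<in> laguerre_span b \<Longrightarrow> f \<in> borel_measurable borel"
  unfolding laguerre_span_lsum using lsum_measurable by blast

definition gauss :: "real \<Rightarrow> real ^ 'd \<Rightarrow> real" where "gauss c x = exp (- c * (norm x)\<^sup>2)"

lemma gauss_measurable [measurable]: "gauss c \<in> borel_measurable borel"
  unfolding gauss_def[abs_def] by measurable

lemma gauss_pos [simp]: "0 < gauss c x" "0 \<le> gauss c x" by (simp_all add: gauss_def)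

lemma gauss_integrable:
  assumes "0 < c"
  shows "integrable lborel (gauss c :: real ^ 'd \<Rightarrow> real)"
proof -
  have "gauss c x = (\<Prod>i\<in>(UNIV::'d set). (\<lambda>_ y. exp (- c * y\<^sup>2)) i (x $ i))" for x :: "real ^ 'd"
    unfolding gauss_def norm_vec_sq by (simp add: sum_distrib_left exp_sum flip: sum_negf)
  moreover have "integrable lborel (\<lambda>x :: real ^ 'd. \<Prod>i\<in>(UNIV::'d set). (\<lambda>_ y. exp (- c * y\<^sup>2)) i (x $ i))"
    by (rule integrable_lborel_prod) (use gaussian_integrable[OF assms] in auto)
  ultimately show ?thesis by presburger
qed

lemma gauss_Lp:
  assumes "0 < c" "0 < p"
  shows "(gauss c :: real ^ 'd \<Rightarrow> real) \<in> Lp_space p"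
proof (rule Lp_spaceI[OF MO_measurable])
  have "norm (gauss c x) powr p = gauss (c * p) x" for x :: "real ^ 'd"
    by (simp add: gauss_def powr_def)
  moreover have "integrable MX (gauss (c * p))"
    using assms by (subst integrable_restrict_space) (auto intro!: integrable_mult_indicator gauss_integrable simp del: real_scaleR_def)
  ultimately show "integrable MO (\<lambda>x :: real ^ 'd. norm (gauss c x) powr p)"
    by (simp add: MO_integral)
qed simp

lemma Lp_gau_bound:
  assumes "f \<in> borel_measurable borel" "\<And>x. x \<in> orthant \<Longrightarrow> \<bar>f x\<bar> \<le> M * gauss c x" "0 < c" "0 < p"
  shows "f \<in> Lp_space p"
  by (rule Lp_space_bound[OF gauss_Lp[OF assms(3,4)] MO_measurable[OF assms(1)], where c=M]) (use assms in auto)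

lemma gs_gau: "gs x = gauss (1/4) x"
  by (simp add: gs_def gauss_def)

lemma span_bound:
  fixes b :: "real ^ 'd"
  assumes b: "\<And>j. 1/2 < b $ j" and f: "f \<in> laguerre_span b"
  obtains M where "0 \<le> M" "\<And>x. x \<in> orthant \<Longrightarrow> \<bar>f x\<bar> \<le> M * gs x"
proof -
  obtain K c where f: "f = lsum K b c" "finite K" using f unfolding laguerre_span_lsum by blast
  have "\<forall>k. \<exists>M. 0 \<le> M \<and> (\<forall>x\<in>orthant. \<bar>Ph b k x\<bar> \<le> M * gs x)" using Ph_bound[OF b] by metis
  then obtain M where M: "\<And>k. 0 \<le> M k" "\<And>k x. x \<in> orthant \<Longrightarrow> \<bar>Ph b k x\<bar> \<le> M k * gs x" by metis
  show ?thesis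
  proof (rule that[of "\<Sum>k\<in>K. \<bar>c k\<bar> * M k"])
    show "0 \<le> (\<Sum>k\<in>K. \<bar>c k\<bar> * M k)" using M by (simp add: sum_nonneg)
    fix x :: "real ^ 'd" assume x: "x \<in> orthant"
    have "\<bar>f x\<bar> \<le> (\<Sum>k\<in>K. \<bar>c k * Ph b k x\<bar>)" unfolding f lsum_def by (rule sum_abs)
    also have "\<dots> \<le> (\<Sum>k\<in>K. \<bar>c k\<bar> * (M k * gs x))" unfolding abs_mult by (intro sum_mono mult_left_mono M x) auto
    finally show "\<bar>f x\<bar> \<le> (\<Sum>k\<in>K. \<bar>c k\<bar> * M k) * gs x" unfolding sum_distrib_right by (simp add: mult_ac)
  qed
qed

lemma span_Lp:
  assumes b: "\<And>j. 1/2 < b $ j" and f: "f \<in> laguerre_span b" and p: "0 < p"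
  shows "f \<in> Lp_space p"
proof -
  obtain M where "\<And>x. x \<in> orthant \<Longrightarrow> \<bar>f x\<bar> \<le> M * gs x" using span_bound[OF b f] by blast
  then show ?thesis using span_measurable[OF f] p by (intro Lp_gau_bound[where M=M and c="1/4"]) (auto simp: gs_gau)
qed

lemma lfP_coeff:
  assumes "1/2 < a"
  shows "coeff (lfP a n) n \<noteq> 0" "degree (lfP a n) \<le> n"
proof -
  have "0 < Gamma (real n + a + 1)" using assms by simp
  then have "lnorm a n \<noteq> 0" by (simp add: lnorm_def)
  then show "coeff (lfP a n) n \<noteq> 0" by (simp add: lfP_def coeff_lpoly)
  show "degree (lfP a n) \<le> n" unfolding lfP_def by (rule degree_le) (simp add: coeff_lpoly)
qed

text \<open>The polynomials \<open>lfP a n\<close> are triangular with nonzero diagonal, so leading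
  coefficients can be removed successively.\<close>

lemma poly_lfP_expansion:
  assumes a: "1/2 < a"
  shows "degree P \<le> N \<Longrightarrow> \<exists>c. P = (\<Sum>n\<le>N. smult (c n) (lfP a n))"
proof (induction N arbitrary: P)
  case 0
  obtain d where d: "lfP a 0 = [:d:]" using lfP_coeff(2)[OF a, of 0] by (metis degree_eq_zeroE le_zero_eq)
  obtain e where e: "P = [:e:]" using 0 by (metis degree_eq_zeroE le_zero_eq)
  have "d \<noteq> 0" using lfP_coeff(1)[OF a, of 0] d by simp
  then show ?case by (intro exI[of _ "\<lambda>_. e / d"]) (simp add: d e)
next
  case (Suc N)
  define r where "r = coeff P (Suc N) / coeff (lfP a (Suc N)) (Suc N)"
  let ?Q = "P - smult r (lfP a (Suc N))"
  have "degree ?Q \<le> Suc N" using Suc.prems lfP_coeff(2)[OF a, of "Suc N"] by (intro degree_diff_le degree_smult_le[THEN order_trans]) auto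
  moreover have "coeff ?Q (Suc N) = 0" using lfP_coeff(1)[OF a, of "Suc N"] by (simp add: r_def)
  ultimately have "degree ?Q \<le> N"
    by (metis le_Suc_eq coeff_eq_0 leading_coeff_0_iff degree_0 le0)
  from Suc.IH[OF this] obtain c where c: "?Q = (\<Sum>n\<le>N. smult (c n) (lfP a n))" by blast
  have "(\<Sum>n\<le>N. smult (c n) (lfP a n)) = (\<Sum>n\<le>N. smult ((c(Suc N := r)) n) (lfP a n))" by (rule sum.cong) auto
  then have "P = (\<Sum>n\<le>Suc N. smult ((c(Suc N := r)) n) (lfP a n))" using c by (simp add: algebra_simps)
  then show ?case by blast
qed

lemma lf_sum: "lf s (\<Sum>i\<in>I. P i) x = (\<Sum>i\<in>I. lf s (P i) x)"
  by (simp add: lf_def poly_sum sum_distrib_left sum_distrib_right)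

text \<open>The coordinates in \<open>J\<close> carry arbitrary polynomials, the others single
  Laguerre factors. Expanding one more coordinate changes the index \<open>k\<close> there, so
  \<open>k\<close> is arbitrary in the induction.\<close>

lemma pf_lf_span:
  assumes b: "\<And>j. 1/2 < b $ j"
  shows "pf (\<lambda>j. lf (sh b j) (P j)) \<in> laguerre_span b"
proof -
  have "pf (\<lambda>j. if j \<in> J then lf (sh b j) (P j) else ph b k j) \<in> laguerre_span b" if "finite J" for J k
    using that
  proof (induction J arbitrary: k rule: finite_induct)
    case empty
    have "pf (\<lambda>j. ph b k j) = lsum {k} b (\<lambda>_. 1)" by (simp add: lsum_def[abs_def] Ph_def)
    then show ?case unfolding laguerre_span_lsum by auto
  next
    case (insert i J)
    obtain c where c: "P i = (\<Sum>n\<le>degree (P i). smult (c n) (lfP (b $ i) n))"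
      using poly_lfP_expansion[OF b order_refl] by blast
    let ?k = "\<lambda>n. \<chi> j. if j = i then n else k $ j"
    have "pf (\<lambda>j. if j \<in> insert i J then lf (sh b j) (P j) else ph b k j) x =
      (\<Sum>n\<le>degree (P i). c n * pf (\<lambda>j. if j \<in> J then lf (sh b j) (P j) else ph b (?k n) j) x)" for x
    proof -
      have "lf (sh b i) (P i) (x $ i) = (\<Sum>n\<le>degree (P i). c n * lf (sh b i) (lfP (b $ i) n) (x $ i))"
        by (subst c) (simp add: lf_sum lf_smult)
      moreover have "(\<Prod>j\<in>UNIV - {i}. (if j \<in> insert i J then lf (sh b j) (P j) else ph b k j) (x $ j)) =
        (\<Prod>j\<in>UNIV - {i}. (if j \<in> J then lf (sh b j) (P j) else ph b (?k n) j) (x $ j))" for n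
        by (rule prod.cong) (auto simp: ph_def)
      ultimately show ?thesis
        unfolding pf_split[of _ x i] using insert.hyps(2) by (simp add: sum_distrib_right ph_def mult.assoc)
    qed
    then have "pf (\<lambda>j. if j \<in> insert i J then lf (sh b j) (P j) else ph b k j) =
      (\<lambda>x. \<Sum>n\<le>degree (P i). c n * pf (\<lambda>j. if j \<in> J then lf (sh b j) (P j) else ph b (?k n) j) x)" by blast
    then show ?case by (simp only:) (intro span_sum span_scale insert.IH)
  qed
  from this[of UNIV] show ?thesis by simp
qed

section \<open>The closure of the span and its multipliers\<close>

definition Lp_closure :: "real \<Rightarrow> real ^ 'd \<Rightarrow> (real ^ 'd \<Rightarrow> real) set" where
  "Lp_closure p b = {f \<in> Lp_space p. \<forall>e>0. \<exists>g\<in>laguerre_span b. Lp_norm p (\<lambda>x. g x - f x) < e}"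

text \<open>The type is a parameter because density is needed for the given type and for each one
  raised by a unit vector.\<close>

locale laguerre_density =
  fixes b :: "real ^ 'd" and p :: real
  assumes b: "\<And>j. 1/2 < b $ j" and p: "1 \<le> p"
begin

lemma p0: "0 < p" using p by simp

lemma Lp_closure_Lp: "f \<in> Lp_closure p b \<Longrightarrow> f \<in> Lp_space p" by (simp add: Lp_closure_def)

lemma Lp_closure_span: "f \<in> laguerre_span b \<Longrightarrow> f \<in> Lp_closure p b"
  unfolding Lp_closure_def using span_Lp[OF b, of f p] p by (auto intro!: bexI[of _ f] simp: Lp_norm_def)

lemma Lp_closure_approx: "f \<in> Lp_closure p b \<Longrightarrow> 0 < e \<Longrightarrow> \<exists>g\<in>laguerre_span b. Lp_norm p (\<lambda>x. g x - f x) < e"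
  by (simp add: Lp_closure_def)

lemma Lp_closure_limit:
  assumes f: "f \<in> Lp_space p" and F: "\<And>n::nat. F n \<in> Lp_closure p b" and lim: "(\<lambda>n. Lp_norm p (\<lambda>x. F n x - f x)) \<longlonglongrightarrow> 0"
  shows "f \<in> Lp_closure p b"
  unfolding Lp_closure_def
proof (intro CollectI conjI f allI impI)
  fix e :: real assume e: "0 < e"
  obtain n where n: "Lp_norm p (\<lambda>x. F n x - f x) < e/2"
    using order_tendstoD(2)[OF lim, of "e/2"] e by (auto simp: eventually_sequentially)
  obtain g where g: "g \<in> laguerre_span b" "Lp_norm p (\<lambda>x. g x - F n x) < e/2"
    using Lp_closure_approx[OF F[of n], of "e/2"] e by auto
  have "Lp_norm p (\<lambda>x. g x - f x) \<le> Lp_norm p (\<lambda>x. g x - F n x) + Lp_norm p (\<lambda>x. F n x - f x)"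
    using p by (intro Lp_norm_triangle3 f Lp_closure_Lp[OF F] span_Lp[OF b g(1)]) auto
  then show "\<exists>g\<in>laguerre_span b. Lp_norm p (\<lambda>x. g x - f x) < e" using g n by (intro bexI[of _ g]) auto
qed

text \<open>The form in which limits are taken from here on: pointwise on the orthant, under a
  majorant in the space.\<close>

lemma Lp_closure_dominated:
  assumes F: "\<And>n. F n \<in> Lp_closure p b" and f: "f \<in> borel_measurable borel"
    and lim: "\<And>x. x \<in> orthant \<Longrightarrow> (\<lambda>n. F n x) \<longlonglongrightarrow> f x"
    and h: "h \<in> Lp_space p" and dom: "\<And>n x. x \<in> orthant \<Longrightarrow> \<bar>F n x\<bar> \<le> c * \<bar>h x\<bar>"
  shows "f \<in> Lp_closure p b"
proof -
  have "AE x in MO. (\<lambda>n. F n x) \<longlonglongrightarrow> f x" "\<And>n. AE x in MO. norm (F n x) \<le> c * norm (h x)"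
    by (intro AE_I2; use lim dom in simp)+
  note dc = Lp_dominated_convergence[OF Lp_space_measurable[OF Lp_closure_Lp[OF F]] MO_measurable[OF f] this(1) h this(2) p]
  show ?thesis by (rule Lp_closure_limit[OF dc(1) F dc(3)])
qed

lemma Lp_closure_add:
  assumes f: "f \<in> Lp_closure p b" and g: "g \<in> Lp_closure p b"
  shows "(\<lambda>x. f x + g x) \<in> Lp_closure p b"
  unfolding Lp_closure_def
proof (intro CollectI conjI allI impI)
  show "(\<lambda>x. f x + g x) \<in> Lp_space p" using f g p by (intro Lp_space_add Lp_closure_Lp) auto
  fix e :: real assume e: "0 < e"
  obtain u where u: "u \<in> laguerre_span b" "Lp_norm p (\<lambda>x. u x - f x) < e/2" using Lp_closure_approx[OF f, of "e/2"] e by auto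
  obtain v where v: "v \<in> laguerre_span b" "Lp_norm p (\<lambda>x. v x - g x) < e/2" using Lp_closure_approx[OF g, of "e/2"] e by auto
  have uv: "(\<lambda>x. u x - f x) \<in> Lp_space p" "(\<lambda>x. v x - g x) \<in> Lp_space p"
    by (rule Lp_space_diff[OF span_Lp[OF b u(1) p0] Lp_closure_Lp[OF f] p], rule Lp_space_diff[OF span_Lp[OF b v(1) p0] Lp_closure_Lp[OF g] p])
  have "Lp_norm p (\<lambda>x. (u x + v x) - (f x + g x)) < e"
    using Lp_norm_triangle[OF uv p] u v by (simp add: algebra_simps)
  then show "\<exists>h\<in>laguerre_span b. Lp_norm p (\<lambda>x. h x - (f x + g x)) < e" by (intro bexI[OF _ span_add[OF u(1) v(1)]])
qed

lemma Lp_closure_scale: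
  assumes f: "f \<in> Lp_closure p b"
  shows "(\<lambda>x. r * f x) \<in> Lp_closure p b"
  unfolding Lp_closure_def
proof (intro CollectI conjI allI impI)
  show "(\<lambda>x. r * f x) \<in> Lp_space p" using Lp_space_scale[OF Lp_closure_Lp[OF f], of r] p by simp
  fix e :: real assume e: "0 < e"
  then obtain u where u: "u \<in> laguerre_span b" "Lp_norm p (\<lambda>x. u x - f x) < e / (\<bar>r\<bar> + 1)"
    using Lp_closure_approx[OF f, of "e / (\<bar>r\<bar> + 1)"] by auto
  have "Lp_norm p (\<lambda>x. r * u x - r * f x) = \<bar>r\<bar> * Lp_norm p (\<lambda>x. u x - f x)"
    using Lp_norm_scale[of p r "\<lambda>x. u x - f x"] p by (simp add: right_diff_distrib)
  also have "\<dots> \<le> (\<bar>r\<bar> + 1) * Lp_norm p (\<lambda>x. u x - f x)" by (intro mult_right_mono) auto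
  also have "\<dots> < (\<bar>r\<bar> + 1) * (e / (\<bar>r\<bar> + 1))" using u by (intro mult_strict_left_mono) auto
  finally have "Lp_norm p (\<lambda>x. r * u x - r * f x) < e" by simp
  then show "\<exists>h\<in>laguerre_span b. Lp_norm p (\<lambda>x. h x - r * f x) < e" by (intro bexI[OF _ span_scale[OF u(1), of r]])
qed

lemma Lp_closure_sum: "(\<And>i. i \<in> I \<Longrightarrow> f i \<in> Lp_closure p b) \<Longrightarrow> (\<lambda>x. \<Sum>i\<in>I. f i x) \<in> Lp_closure p b"
  by (induction I rule: infinite_finite_induct) (auto intro: Lp_closure_span span_zero Lp_closure_add)

text \<open>Up to a constant, the lowest Laguerre function times an even monomial.\<close>

definition mon :: "('d \<Rightarrow> nat) \<Rightarrow> real ^ 'd \<Rightarrow> real" where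
  "mon n = pf (\<lambda>j. lf (sh b j) (monom 1 (n j)))"

lemma mon_measurable [measurable]: "mon n \<in> borel_measurable borel"
  unfolding mon_def by (rule pf_measurable) simp

lemma mon_mult: "mon n x * ((x $ i)\<^sup>2) ^ m = mon (n(i := n i + m)) x"
proof -
  have "(\<Prod>j\<in>UNIV - {i}. lf (sh b j) (monom 1 ((n(i := n i + m)) j)) (x $ j)) = (\<Prod>j\<in>UNIV - {i}. lf (sh b j) (monom 1 (n j)) (x $ j))"
    by (rule prod.cong) auto
  then show ?thesis unfolding mon_def pf_split[of _ x i] by (simp add: lf_def poly_monom power_add mult_ac)
qed

lemma mon_bound: "\<exists>M\<ge>0. \<forall>x\<in>orthant. \<bar>mon n x\<bar> \<le> M * gauss (1/4) x"
  unfolding mon_def gs_gau[symmetric] by (rule pf_bound, rule gbounded_lf) (use b in \<open>smt (verit) field_sum_of_halves\<close>)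

text \<open>These functions form an algebra containing each \<open>exp (- x\<^sub>i\<^sup>2 / 8)\<close> (lemma \<open>multiplier_exp\<close>).\<close>
definition multiplier :: "(real ^ 'd \<Rightarrow> real) \<Rightarrow> bool" where
  "multiplier a \<longleftrightarrow> a \<in> borel_measurable borel \<and> (\<exists>B. \<forall>x\<in>orthant. \<bar>a x\<bar> \<le> B) \<and> (\<forall>n. (\<lambda>x. mon n x * a x) \<in> Lp_closure p b)"

lemma multiplier_1: "multiplier (\<lambda>x. 1)"
  unfolding multiplier_def using Lp_closure_span[OF pf_lf_span[OF b]] by (auto simp: mon_def)

lemma multiplier_add: assumes "multiplier a" "multiplier c" shows "multiplier (\<lambda>x. a x + c x)"
proof -
  obtain B1 B2 where "\<forall>x\<in>orthant. \<bar>a x\<bar> \<le> B1" "\<forall>x\<in>orthant. \<bar>c x\<bar> \<le> B2" using assms unfolding multiplier_def by blast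
  then have "\<forall>x\<in>orthant. \<bar>a x + c x\<bar> \<le> B1 + B2" using abs_triangle_ineq add_mono order_trans by meson
  then show ?thesis using assms unfolding multiplier_def distrib_left by (auto intro: Lp_closure_add)
qed

lemma multiplier_scale: assumes "multiplier a" shows "multiplier (\<lambda>x. a x * r)"
proof -
  obtain B where "\<forall>x\<in>orthant. \<bar>a x\<bar> \<le> B" using assms unfolding multiplier_def by blast
  then have "\<forall>x\<in>orthant. \<bar>a x * r\<bar> \<le> B * \<bar>r\<bar>" by (auto simp: abs_mult intro: mult_right_mono)
  moreover have "(\<lambda>x. mon n x * (a x * r)) \<in> Lp_closure p b" for n
    using Lp_closure_scale[of "\<lambda>x. mon n x * a x" r] assms by (simp add: multiplier_def mult_ac)
  moreover have "(\<lambda>x. a x * r) \<in> borel_measurable borel" using assms unfolding multiplier_def by auto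
  ultimately show ?thesis unfolding multiplier_def by blast
qed

lemma multiplier_sum: assumes "\<And>i. i \<in> I \<Longrightarrow> multiplier (a i)" "finite I" shows "multiplier (\<lambda>x. \<Sum>i\<in>I. a i x)"
  using assms(2,1)
proof (induction I rule: finite_induct)
  case empty
  show ?case using multiplier_scale[OF multiplier_1, of 0] by simp
next
  case (insert i I)
  then show ?case using multiplier_add[of "a i" "\<lambda>x. \<Sum>i\<in>I. a i x"] by simp
qed

text \<open>The Taylor polynomials of the exponential only raise exponents in \<open>mon\<close>, by
  \<open>mon_mult\<close>. In absolute value they are at most
  \<open>exp ((norm x)\<^sup>2 / 8)\<close>, which uses up half of the decay rate 1/4 of
  \<open>mon\<close>; this is why the rate 1/8 is admissible.\<close>

lemma multiplier_exp:
  assumes a: "multiplier a"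
  shows "multiplier (\<lambda>x. a x * exp (- (x $ i)\<^sup>2 / 8))"
proof -
  obtain B where B: "\<And>x. x \<in> orthant \<Longrightarrow> \<bar>a x\<bar> \<le> B" using a unfolding multiplier_def by blast
  have ma [measurable]: "a \<in> borel_measurable borel" using a unfolding multiplier_def by blast
  have B1: "\<bar>a x * exp (- (x $ i)\<^sup>2 / 8)\<bar> \<le> B" if "x \<in> orthant" for x
    using mult_mono[OF B[OF that], of "exp (- (x $ i)\<^sup>2 / 8)" 1] order_trans[OF abs_ge_zero B[OF that]] by (simp add: abs_mult)
  have "(\<lambda>x. mon n x * (a x * exp (- (x $ i)\<^sup>2 / 8))) \<in> Lp_closure p b" for n
  proof -
    obtain M where M: "0 \<le> M" "\<And>x. x \<in> orthant \<Longrightarrow> \<bar>mon n x\<bar> \<le> M * gauss (1/4) x" using mon_bound by blast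
    have ex: "(\<lambda>k. u ^ k / fact k) sums exp u" for u :: real
      using exp_converges[of u] by (simp only: real_scaleR_def divide_inverse mult.commute)
    let ?z = "\<lambda>x. - (x $ i)\<^sup>2 / 8"
    let ?F = "\<lambda>N x. mon n x * a x * (\<Sum>k<N. (?z x) ^ k / fact k)"
    show ?thesis
    proof (rule Lp_closure_dominated[where F="?F" and h="gauss (1/8)" and c="M * B"])
      have "?F N = (\<lambda>x. \<Sum>k<N. ((-1/8) ^ k / fact k) * (mon (n(i := n i + k)) x * a x))" for N
      proof
        fix x :: "real ^ 'd"
        have "(?z x) ^ k = (-1/8) ^ k * ((x $ i)\<^sup>2) ^ k" for k
          unfolding power_mult_distrib[symmetric] by simp
        then show "?F N x = (\<Sum>k<N. ((-1/8) ^ k / fact k) * (mon (n(i := n i + k)) x * a x))"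
          by (simp add: sum_distrib_left mon_mult[symmetric] mult_ac)
      qed
      then show "?F N \<in> Lp_closure p b" for N
        using a unfolding multiplier_def by (simp only:) (intro Lp_closure_sum Lp_closure_scale; blast)
      show "(\<lambda>N. ?F N x) \<longlonglongrightarrow> mon n x * (a x * exp (?z x))" for x
      proof -
        have "(\<lambda>N. \<Sum>k<N. (?z x) ^ k / fact k) \<longlonglongrightarrow> exp (?z x)"
          using ex[of "?z x"] unfolding sums_def .
        from tendsto_mult_left[OF this, of "mon n x * a x"] show ?thesis by (simp add: mult.assoc)
      qed
      show "gauss (1/8) \<in> Lp_space p" using p by (intro gauss_Lp) auto
      fix N and x :: "real ^ 'd" assume x: "x \<in> orthant"
      let ?y = "(x $ i)\<^sup>2 / 8"
      have "\<bar>\<Sum>k<N. (?z x) ^ k / fact k\<bar> \<le> (\<Sum>k<N. ?y ^ k / fact k)"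
        by (rule order_trans[OF sum_abs]) (simp add: power_abs)
      also have "\<dots> \<le> exp ?y"
        using sum_le_suminf[of "\<lambda>k. ?y ^ k / fact k" "{..<N}"] ex[of ?y]
        by (simp add: sums_iff)
      also have "\<dots> \<le> exp ((norm x)\<^sup>2 / 8)"
        using component_le_norm_cart[of x i] by (simp add: abs_le_square_iff[symmetric])
      finally have s: "\<bar>\<Sum>k<N. (?z x) ^ k / fact k\<bar> \<le> exp ((norm x)\<^sup>2 / 8)" .
      have "\<bar>?F N x\<bar> = \<bar>mon n x\<bar> * \<bar>a x\<bar> * \<bar>\<Sum>k<N. (?z x) ^ k / fact k\<bar>" by (simp add: abs_mult)
      also have "\<dots> \<le> (M * gauss (1/4) x) * B * exp ((norm x)\<^sup>2 / 8)"
        using M(1) order_trans[OF abs_ge_zero B[OF x]] by (intro mult_mono M B x s) auto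
      also have "\<dots> = M * B * gauss (1/8) x" by (simp add: gauss_def mult_ac flip: exp_add)
      finally show "\<bar>?F N x\<bar> \<le> M * B * \<bar>gauss (1/8) x\<bar>" by simp
    qed measurable
  qed
  moreover have "(\<lambda>x. a x * exp (- (x $ i)\<^sup>2 / 8)) \<in> borel_measurable borel" by measurable
  ultimately show ?thesis unfolding multiplier_def using B1 by blast
qed

text \<open>Maps into the unit cube, whose compactness Stone-Weierstrass needs, and is injective on
  the orthant with inverse \<open>Yinv\<close>.\<close>

definition Y :: "real ^ 'd \<Rightarrow> real ^ 'd" where "Y x = (\<chi> i. exp (- (x $ i)\<^sup>2 / 8))"
definition Yinv :: "real ^ 'd \<Rightarrow> real ^ 'd" where "Yinv y = (\<chi> i. sqrt (- 8 * ln (y $ i)))"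

lemma Y_measurable [measurable]: "Y \<in> borel_measurable borel"
  unfolding Y_def[abs_def] by (intro borel_measurable_continuous_onI continuous_intros) simp

lemma Yinv_measurable [measurable]: "Yinv \<in> borel_measurable borel"
  by (rule borel_measurable_euclidean_space[THEN iffD2])
     (auto simp: Basis_vec_def inner_axis Yinv_def)

lemma Yinv_Y: "x \<in> orthant \<Longrightarrow> Yinv (Y x) = x"
  by (auto simp: Yinv_def Y_def vec_eq_iff orthant_def less_imp_le)

text \<open>In the product case the second induction hypothesis is applied to the multiplier
  \<open>\<lambda>x. a x * f (Y x)\<close>, hence \<open>a\<close> is arbitrary.\<close>

lemma multiplier_poly:
  assumes "real_polynomial_function g"
  shows "multiplier a \<Longrightarrow> multiplier (\<lambda>x. a x * g (Y x))"
  using assms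
proof (induction g arbitrary: a rule: real_polynomial_function.induct)
  case (linear f)
  have feq: "f y = (\<Sum>i\<in>UNIV. y $ i * f (axis i 1))" for y
  proof -
    have "f y = f (\<Sum>i\<in>UNIV. y $ i *\<^sub>R axis i 1)" by (simp add: basis_expansion flip: scalar_mult_eq_scaleR)
    also have "\<dots> = (\<Sum>i\<in>UNIV. y $ i * f (axis i 1))"
      using linear(1) by (simp add: linear_sum linear_scale bounded_linear.linear)
    finally show ?thesis .
  qed
  have "(\<lambda>x. a x * f (Y x)) = (\<lambda>x. \<Sum>i\<in>UNIV. (a x * exp (- (x $ i)\<^sup>2 / 8)) * f (axis i 1))"
    by (rule ext, subst feq) (simp add: Y_def sum_distrib_left mult_ac)
  then show ?case by (simp only:) (intro multiplier_sum multiplier_scale multiplier_exp linear finite)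
next
  case (const c)
  then show ?case by (rule multiplier_scale)
next
  case (add f g)
  then show ?case using multiplier_add[of "\<lambda>x. a x * f (Y x)" "\<lambda>x. a x * g (Y x)"] by (simp add: distrib_left)
next
  case (mult f g)
  then show ?case using mult.IH(2)[of "\<lambda>x. a x * f (Y x)"] by (simp add: mult.assoc)
qed

abbreviation "W0 \<equiv> mon (\<lambda>_. 0)"

lemma W0_pos: "x \<in> orthant \<Longrightarrow> 0 < W0 x"
  unfolding mon_def pf_def by (intro prod_pos) (auto simp: lf_def orthant_def less_imp_neq[THEN not_sym] intro!: mult_pos_pos)

lemma W0_Lp: "W0 \<in> Lp_space p"
  using Lp_closure_Lp[OF Lp_closure_span[OF pf_lf_span[OF b]]] by (simp add: mon_def)

lemma W0_cont:
  assumes "continuous_on UNIV (G :: real ^ 'd \<Rightarrow> real)"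
  shows "(\<lambda>x. W0 x * G (Y x)) \<in> Lp_closure p b"
proof -
  let ?C = "cbox 0 (\<chi> i. 1) :: (real ^ 'd) set"
  have YC: "Y x \<in> ?C" for x by (simp add: mem_box_cart Y_def)
  have cG: "continuous_on ?C G" using assms continuous_on_subset by blast
  have "\<exists>g. real_polynomial_function g \<and> (\<forall>y\<in>?C. \<bar>G y - g y\<bar> < 1 / real (Suc n))" for n
    by (rule Stone_Weierstrass_real_polynomial_function[OF compact_cbox cG, of "1 / real (Suc n)"]) auto
  then obtain g where g: "\<And>n. real_polynomial_function (g n)" "\<And>n y. y \<in> ?C \<Longrightarrow> \<bar>G y - g n y\<bar> < 1 / real (Suc n)"
    by metis
  have "bounded (G ` ?C)" by (intro compact_imp_bounded compact_continuous_image cG compact_cbox)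
  then obtain B where B: "\<And>y. y \<in> ?C \<Longrightarrow> \<bar>G y\<bar> \<le> B" unfolding bounded_iff by auto
  show ?thesis
  proof (rule Lp_closure_dominated[where F="\<lambda>n x. W0 x * g n (Y x)" and h=W0 and c="B + 1"])
    show "(\<lambda>x. W0 x * g n (Y x)) \<in> Lp_closure p b" for n
      using multiplier_poly[OF g(1) multiplier_1, of n] by (simp add: multiplier_def)
    show "(\<lambda>x. W0 x * G (Y x)) \<in> borel_measurable borel"
      using measurable_compose[OF Y_measurable borel_measurable_continuous_onI[OF assms]] by measurable
    show "(\<lambda>n. W0 x * g n (Y x)) \<longlonglongrightarrow> W0 x * G (Y x)" for x
    proof (intro tendsto_mult_left)
      have "\<bar>g n (Y x) - G (Y x)\<bar> \<le> inverse (real (Suc n))" for n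
        using g(2)[OF YC[of x], of n] by (simp add: abs_minus_commute inverse_eq_divide)
      then have "(\<lambda>n. g n (Y x) - G (Y x)) \<longlonglongrightarrow> 0"
        by (intro tendsto_rabs_zero_cancel[OF tendsto_sandwich[OF _ _ tendsto_const LIMSEQ_inverse_real_of_nat]]) auto
      then show "(\<lambda>n. g n (Y x)) \<longlonglongrightarrow> G (Y x)" by (simp add: LIM_zero_iff)
    qed
    show "W0 \<in> Lp_space p" by (rule W0_Lp)
    fix n x
    have "\<bar>g n (Y x)\<bar> \<le> B + 1"
      using g(2)[OF YC[of x], of n] B[OF YC[of x]] by (smt (verit) divide_le_eq_1 of_nat_Suc of_nat_0_le_iff)
    then have "\<bar>g n (Y x)\<bar> * \<bar>W0 x\<bar> \<le> (B + 1) * \<bar>W0 x\<bar>" by (rule mult_right_mono) simp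
    then show "\<bar>W0 x * g n (Y x)\<bar> \<le> (B + 1) * \<bar>W0 x\<bar>" by (simp only: abs_mult mult.commute)
  qed
qed

lemma ind_measurable: "A \<in> sets borel \<Longrightarrow> (\<lambda>x. W0 x * indicator A (Y x)) \<in> borel_measurable borel"
  by (rule borel_measurable_times[OF mon_measurable measurable_compose[OF Y_measurable borel_measurable_indicator]])

lemma W0_open:
  assumes "open (O' :: (real ^ 'd) set)"
  shows "(\<lambda>x. W0 x * indicator O' (Y x)) \<in> Lp_closure p b"
\<comment> \<open>\<open>infdist\<close> to the empty set is 0, so the complement must not be empty
  below.\<close>
proof (cases "O' = UNIV")
  case True
  then show ?thesis using W0_cont[of "\<lambda>_. 1"] by simp
next
  case False
  then have ne: "- O' \<noteq> {}" by auto
  \<comment> \<open>Truncated multiples of the distance to the complement are continuous and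
    increase to the indicator.\<close>
  let ?G = "\<lambda>n y. min 1 (real n * infdist y (- O'))"
  show ?thesis
  proof (rule Lp_closure_dominated[where F="\<lambda>n x. W0 x * ?G n (Y x)" and h=W0 and c=1])
    show "(\<lambda>x. W0 x * ?G n (Y x)) \<in> Lp_closure p b" for n by (intro W0_cont continuous_intros)
    show "(\<lambda>x. W0 x * indicator O' (Y x)) \<in> borel_measurable borel"
      by (rule ind_measurable[OF borel_open[OF assms]])
    show "(\<lambda>n. W0 x * ?G n (Y x)) \<longlonglongrightarrow> W0 x * indicator O' (Y x)" for x
    proof (intro tendsto_mult_left)
      show "(\<lambda>n. ?G n (Y x)) \<longlonglongrightarrow> indicator O' (Y x)"
      proof (cases "Y x \<in> O'")
        case True
        then have "0 < infdist (Y x) (- O')" using assms ne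
          by (metis ComplD closed_Compl in_closed_iff_infdist_zero infdist_nonneg less_eq_real_def)
        then obtain m where m: "1 < real m * infdist (Y x) (- O')" using ex_less_of_nat_mult by blast
        have "\<forall>\<^sub>F n in sequentially. ?G n (Y x) = 1"
          using eventually_ge_at_top[of m]
        proof eventually_elim
          case (elim n)
          then have "real m * infdist (Y x) (- O') \<le> real n * infdist (Y x) (- O')" by (intro mult_right_mono infdist_nonneg) auto
          then show ?case using m by simp
        qed
        then show ?thesis using True by (simp add: tendsto_eventually)
      next
        case False
        then show ?thesis by simp
      qed
    qed
    show "W0 \<in> Lp_space p" by (rule W0_Lp)
    show "\<bar>W0 x * ?G n (Y x)\<bar> \<le> 1 * \<bar>W0 x\<bar>" for n x
      using mult_left_mono[of "\<bar>?G n (Y x)\<bar>" 1 "\<bar>W0 x\<bar>"] infdist_nonneg[of "Y x" "- O'"] by (simp add: abs_mult)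
  qed
qed

text \<open>Dynkin's argument: open sets are stable under intersection and generate the Borel sets;
  complements and disjoint unions follow from linearity and dominated convergence.\<close>

lemma W0_borel:
  assumes "A \<in> sets (borel :: (real ^ 'd) measure)"
  shows "(\<lambda>x. W0 x * indicator A (Y x)) \<in> Lp_closure p b"
proof -
  have "Int_stable {S :: (real ^ 'd) set. open S}" by (auto simp: Int_stable_def)
  moreover have "{S :: (real ^ 'd) set. open S} \<subseteq> Pow UNIV" by auto
  moreover have "A \<in> sigma_sets UNIV {S. open S}" using assms by (simp add: borel_def)
  ultimately show ?thesis
  proof (induction rule: sigma_sets_induct_disjoint)
    case (basic A)
    then show ?case using W0_open by simp
  next
    case empty
    show ?case using Lp_closure_span[OF span_zero] by simp
  next
    case (compl A)
    have "(\<lambda>x. W0 x * indicator (UNIV - A) (Y x)) = (\<lambda>x. W0 x * indicator UNIV (Y x) + (-1) * (W0 x * indicator A (Y x)))"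
      by (auto simp: indicator_def)
    then show ?case by (simp only:) (intro Lp_closure_add Lp_closure_scale compl W0_open open_UNIV)
  next
    case (union A)
    have "A i \<in> sets borel" for i using union(2) by (auto simp: borel_def)
    then have mU: "(\<Union>i. A i) \<in> sets borel" by blast
    show ?case
    proof (rule Lp_closure_dominated[where F="\<lambda>n x. \<Sum>i<n. W0 x * indicator (A i) (Y x)" and h=W0 and c=1])
      show "(\<lambda>x. \<Sum>i<n. W0 x * indicator (A i) (Y x)) \<in> Lp_closure p b" for n by (intro Lp_closure_sum union(3))
      show "(\<lambda>x. W0 x * indicator (\<Union>i. A i) (Y x)) \<in> borel_measurable borel" by (rule ind_measurable[OF mU])
      have un: "(\<Sum>i<n. indicator (A i) (Y x)) = (indicator (\<Union>i<n. A i) (Y x) :: real)" for n x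
        using union(1) by (intro indicator_UN_disjoint[symmetric]) (auto simp: disjoint_family_on_def)
      show "(\<lambda>n. \<Sum>i<n. W0 x * indicator (A i) (Y x)) \<longlonglongrightarrow> W0 x * indicator (\<Union>i. A i) (Y x)" for x
        unfolding sum_distrib_left[symmetric] un by (intro tendsto_mult_left LIMSEQ_indicator_UN)
      show "W0 \<in> Lp_space p" by (rule W0_Lp)
      show "\<bar>\<Sum>i<n. W0 x * indicator (A i) (Y x)\<bar> \<le> 1 * \<bar>W0 x\<bar>" for n x
        unfolding sum_distrib_left[symmetric] un by (simp add: indicator_def)
    qed
  qed
qed

text \<open>Divided by the positive \<open>W0\<close>, the function is a Borel function of
  \<open>Y x\<close> on the orthant. Simple approximations of the latter are combinations of the
  indicators in \<open>W0_borel\<close>, and twice the function dominates them.\<close>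

theorem span_dense:
  assumes f: "f \<in> Lp_space p" and e: "0 < e"
  shows "\<exists>g\<in>laguerre_span b. Lp_norm p (\<lambda>x. g x - f x) < e"
proof -
  have "f \<in> borel_measurable (restrict_space lebesgue orthant)" using f by (rule Lp_space_measurable)
  then have "(\<lambda>x. indicator orthant x *\<^sub>R f x) \<in> borel_measurable lebesgue"
    by (subst (asm) borel_measurable_restrict_space_iff) auto
  \<comment> \<open>\<open>f\<close> is only Lebesgue measurable; a Borel function that agrees
    almost everywhere can be composed with \<open>Yinv\<close>.\<close>
  then obtain f0 where f0: "f0 \<in> borel_measurable borel" "AE x in lborel. indicator orthant x *\<^sub>R f x = f0 x"
    using completion_ex_borel_measurable_real[of _ lborel] by auto
  have ae: "AE x in MO. f0 x = f x"
    unfolding AE_MO using AE_completion[OF f0(2)] by eventually_elim (auto simp: indicator_def)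
  have m: "f \<in> borel_measurable MO" "f0 \<in> borel_measurable MO" using f f0 by (auto intro: Lp_space_measurable MO_measurable)
  have f0p: "f0 \<in> Lp_space p"
    by (rule Lp_space_bound[OF f m(2), where c=1]) (use ae p in \<open>auto elim: eventually_mono\<close>)
  define \<phi> where "\<phi> y = f0 (Yinv y) / W0 (Yinv y)" for y
  have "(\<lambda>y. f0 (Yinv y)) \<in> borel_measurable borel" "(\<lambda>y. W0 (Yinv y)) \<in> borel_measurable borel"
    by (rule measurable_compose[OF Yinv_measurable f0(1)], rule measurable_compose[OF Yinv_measurable mon_measurable])
  then have "\<phi> \<in> borel_measurable borel" unfolding \<phi>_def[abs_def] by measurable
  then obtain s where s: "\<And>n. simple_function borel (s n)" "\<And>y. (\<lambda>n. s n y) \<longlonglongrightarrow> \<phi> y" "\<And>n y. \<bar>s n y\<bar> \<le> 2 * \<bar>\<phi> y\<bar>"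
    using borel_measurable_implies_sequence_metric[of \<phi> borel 0] by auto
  have f0Y: "f0 x = W0 x * \<phi> (Y x)" if "x \<in> orthant" for x
    using W0_pos[OF that] by (simp add: \<phi>_def Yinv_Y[OF that])
  have "f0 \<in> Lp_closure p b"
  proof (rule Lp_closure_dominated[where F="\<lambda>n x. W0 x * s n (Y x)" and h=f0 and c=2])
    show "(\<lambda>x. W0 x * s n (Y x)) \<in> Lp_closure p b" for n
    proof -
      have fin: "finite (range (s n))" using simple_functionD(1)[OF s(1), of n] by simp
      have sn: "s n y = (\<Sum>v\<in>range (s n). v * indicator (s n -` {v}) y)" for y
      proof -
        have "(\<Sum>v\<in>range (s n). v * indicator (s n -` {v}) y) = (\<Sum>v\<in>range (s n). if v = s n y then v else 0)"
          by (rule sum.cong) (auto simp: indicator_def)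
        then show ?thesis using fin by (simp add: sum.delta)
      qed
      have "(\<lambda>x. W0 x * s n (Y x)) = (\<lambda>x. \<Sum>v\<in>range (s n). v * (W0 x * indicator (s n -` {v}) (Y x)))"
        by (rule ext, subst sn) (simp add: sum_distrib_left mult_ac)
      moreover have "s n -` {v} \<in> sets borel" for v using simple_functionD(2)[OF s(1), of n "{v}"] by simp
      ultimately show ?thesis by (simp only:) (intro Lp_closure_sum Lp_closure_scale W0_borel)
    qed
    show "(\<lambda>n. W0 x * s n (Y x)) \<longlonglongrightarrow> f0 x" if "x \<in> orthant" for x
      unfolding f0Y[OF that] by (intro tendsto_mult_left s)
    show "\<bar>W0 x * s n (Y x)\<bar> \<le> 2 * \<bar>f0 x\<bar>" if "x \<in> orthant" for n x
      using mult_left_mono[OF s(3)[of n "Y x"], of "\<bar>W0 x\<bar>"] unfolding f0Y[OF that] by (simp add: abs_mult)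
  qed (use f0 f0p in auto)
  then obtain g where g: "g \<in> laguerre_span b" "Lp_norm p (\<lambda>x. g x - f0 x) < e" using e unfolding Lp_closure_def by blast
  have "Lp_norm p (\<lambda>x. g x - f x) = Lp_norm p (\<lambda>x. g x - f0 x)"
    by (rule Lp_norm_cong_AE) (use ae m MO_measurable[OF span_measurable[OF g(1)]] in \<open>auto elim: eventually_mono\<close>)
  then show ?thesis using g by (intro bexI[OF _ g(1)]) simp
qed

end

section \<open>The Riesz transforms on $L^p$\<close>

text \<open>A crude bound, sufficient for density: the vector is a sum of components along the
  coordinate axes.\<close>

lemma Lp_norm_vec_le_sum:
  fixes f :: "'d \<Rightarrow> real ^ 'd \<Rightarrow> real"
  assumes f: "\<And>i. f i \<in> Lp_space p" and p: "1 \<le> p"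
  shows "(\<lambda>x. \<chi> i. f i x) \<in> Lp_space p" "Lp_norm p (\<lambda>x. \<chi> i. f i x) \<le> (\<Sum>i\<in>UNIV. Lp_norm p (f i))"
proof -
  define F :: "'d \<Rightarrow> real ^ 'd \<Rightarrow> real ^ 'd" where "F i x = f i x *\<^sub>R axis i 1" for i x
  have nF: "norm (F i x) = norm (f i x)" for i x by (simp add: F_def)
  have mF: "F i \<in> borel_measurable MO" for i
    using Lp_space_measurable[OF f[of i]] unfolding F_def[abs_def] by measurable
  have FL: "F i \<in> Lp_space p" for i
    using f[of i] mF[of i] by (simp add: Lp_space_def nF)
  have FN: "Lp_norm p (F i) = Lp_norm p (f i)" for i by (simp add: Lp_norm_def nF)
  have "Lp_norm p (\<lambda>x. \<Sum>i\<in>I. F i x) \<le> (\<Sum>i\<in>I. Lp_norm p (F i))" if "finite I" for I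
    using that
  proof (induction I rule: finite_induct)
    case empty
    then show ?case using p by (simp add: Lp_norm_def)
  next
    case (insert i I)
    then show ?case
      using Lp_norm_triangle[OF FL[of i] Lp_space_sum[of I F p, OF FL p] p] by simp
  qed
  from this[of UNIV] have le: "Lp_norm p (\<lambda>x. \<Sum>i\<in>UNIV. F i x) \<le> (\<Sum>i\<in>UNIV. Lp_norm p (f i))" by (simp add: FN)
  have eq: "(\<lambda>x. \<chi> i. f i x) = (\<lambda>x. \<Sum>i\<in>UNIV. F i x)"
    by (rule ext) (simp add: F_def vec_eq_iff axis_def if_distrib[where f="\<lambda>u. _ * u"] cong: if_cong)
  show "(\<lambda>x. \<chi> i. f i x) \<in> Lp_space p" unfolding eq by (intro Lp_space_sum FL p)
  show "Lp_norm p (\<lambda>x. \<chi> i. f i x) \<le> (\<Sum>i\<in>UNIV. Lp_norm p (f i))" unfolding eq by (rule le)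
qed

lemma Lp_space_component:
  fixes G :: "real ^ 'd \<Rightarrow> real ^ 'd"
  assumes "G \<in> Lp_space p" "0 < p"
  shows "(\<lambda>x. G x $ i) \<in> Lp_space p"
proof (rule Lp_space_bound[OF assms(1), where c=1])
  have "(\<lambda>x. G x \<bullet> axis i 1) \<in> borel_measurable MO" using Lp_space_measurable[OF assms(1)] by measurable
  then show "(\<lambda>x. G x $ i) \<in> borel_measurable MO" by (simp add: inner_axis)
qed (use assms component_le_norm_cart in auto)

lemma lsum_Lp:
  assumes "\<And>j. 1/2 < b $ j" "finite K" "0 < p"
  shows "lsum K b c \<in> Lp_space p"
  using assms by (intro span_Lp[where b=b]) (auto simp: laguerre_span_lsum)

lemma dPh_Lp:
  assumes "\<And>j. 1/2 < a $ j" "0 < p"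
  shows "dPh a i k \<in> Lp_space p"
proof -
  have "dPh a i k = lsum {dec i k} (a + axis i 1) (\<lambda>_. - 2 * sqrt (real (k $ i)))"
    by (simp add: dPh_def[abs_def] lsum_def[abs_def])
  then show ?thesis using lsum_Lp[OF option_type_gt[OF assms(1)] _ assms(2)] by (metis finite.emptyI finite_insert)
qed

lemma rsum_component_Lp:
  assumes a: "\<And>j. 1/2 < a $ j" and p: "1 \<le> p"
  shows "(\<lambda>x. \<Sum>k\<in>K. c k * laguerre_eigenvalue a k powr (-1/2) * dPh a i k x) \<in> Lp_space p"
proof (rule Lp_space_sum[OF _ p])
  fix k
  show "(\<lambda>x. c k * laguerre_eigenvalue a k powr (-1/2) * dPh a i k x) \<in> Lp_space p"
    using Lp_space_scale[OF dPh_Lp[OF a], of p "c k * laguerre_eigenvalue a k powr (-1/2)"] p by simp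
qed

lemma rsum_Lp:
  assumes a: "\<And>j. 1/2 < a $ j" and p: "1 \<le> p"
  shows "rsum K a c \<in> Lp_space p"
  using Lp_norm_vec_le_sum(1)[OF rsum_component_Lp[OF a p] p] by (simp add: rsum_def[abs_def])

lemma gsum_Lp:
  assumes a: "\<And>j. 1/2 < a $ j" and p: "1 \<le> p" and "\<And>i. finite (L i)"
  shows "gsum L a d \<in> Lp_space p"
  using Lp_norm_vec_le_sum(1)[OF lsum_Lp[OF option_type_gt[OF a] assms(3)] p] p by (simp add: gsum_def[abs_def])

text \<open>Each component is approximated separately in its own type, with error
  \<open>e / n\<close> for \<open>n\<close> coordinates.\<close>

lemma gsum_dense:
  fixes a :: "real ^ 'd"
  assumes a: "\<And>j. 1/2 < a $ j" and p: "1 \<le> p" and G: "G \<in> Lp_space p" and e: "0 < e"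
  shows "\<exists>L d. (\<forall>i. finite (L i)) \<and> Lp_norm p (\<lambda>x. gsum L a d x - G x) < e"
proof -
  define n where "n = real CARD('d)"
  have n: "0 < n" by (simp add: n_def)
  have "\<exists>L d. finite L \<and> Lp_norm p (\<lambda>x. lsum L (a + axis i 1) d x - G x $ i) < e / n" for i
  proof -
    interpret laguerre_density "a + axis i 1" p by standard (use option_type_gt[OF a] p in auto)
    show ?thesis
      using span_dense[OF Lp_space_component[OF G], of "e / n" i] e n p unfolding laguerre_span_lsum by auto
  qed
  then obtain L d where Ld: "\<And>i. finite (L i)" "\<And>i. Lp_norm p (\<lambda>x. lsum (L i) (a + axis i 1) (d i) x - G x $ i) < e / n"
    by metis
  have m: "(\<lambda>x. lsum (L i) (a + axis i 1) (d i) x - G x $ i) \<in> Lp_space p" for i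
    using p by (intro Lp_space_diff lsum_Lp option_type_gt a Ld Lp_space_component G) auto
  have "(\<lambda>x. gsum L a d x - G x) = (\<lambda>x. \<chi> i. lsum (L i) (a + axis i 1) (d i) x - G x $ i)"
    by (simp add: gsum_def vec_eq_iff fun_eq_iff)
  then have "Lp_norm p (\<lambda>x. gsum L a d x - G x) \<le> (\<Sum>i\<in>UNIV. Lp_norm p (\<lambda>x. lsum (L i) (a + axis i 1) (d i) x - G x $ i))"
    using Lp_norm_vec_le_sum(2)[OF m p] by simp
  also have "\<dots> < (\<Sum>i\<in>(UNIV :: 'd set). e / n)" by (intro sum_strict_mono Ld) auto
  also have "\<dots> = e" using n by (simp add: n_def)
  finally show ?thesis using Ld(1) by blast
qed

lemma rsum_scale: "rsum K a (\<lambda>k. r * c k) x = r *\<^sub>R rsum K a c x"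
  by (simp add: rsum_def vec_eq_iff sum_distrib_left mult_ac)

lemma lsum_scale: "lsum K a (\<lambda>k. r * c k) x = r * lsum K a c x"
  by (simp add: lsum_def sum_distrib_left mult_ac)

lemma gsum_scale: "gsum L a (\<lambda>i k. r * d i k) x = r *\<^sub>R gsum L a d x"
  by (simp add: gsum_def vec_eq_iff lsum_scale)

lemma borel_rsum_gsum [measurable]: "rsum K a c \<in> borel_measurable borel" "gsum L a d \<in> borel_measurable borel"
  by (rule borel_measurable_euclidean_space[THEN iffD2], auto simp: Basis_vec_def inner_axis rsum_def gsum_def)+

text \<open>Homogeneity applied to \<open>riesz_bilinear\<close>, with strict majorants so that
  vanishing norms need no special treatment.\<close>

lemma riesz_bilinear_Lp:
  fixes a :: "real ^ 'd"
  assumes a: "\<And>j. 1/2 < a $ j" and p: "1 < p" and q: "q = p / (p - 1)" and K: "finite K" and L: "\<And>i. finite (L i)"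
  shows "(LINT x|MO. rsum K a c x \<bullet> gsum L a d x)
    \<le> 24 * (1 + sqrt (laguerre_C a)) * (max p q - 1) * (Lp_norm p (lsum K a c) * Lp_norm q (gsum L a d))"
proof -
  let ?C = "24 * (1 + sqrt (laguerre_C a)) * (max p q - 1)"
  have C: "0 \<le> ?C" using laguerre_C_ge(2)[OF a] p by simp
  have q1: "0 < q" using p q by simp
  have *: "(LINT x|MO. rsum K a c x \<bullet> gsum L a d x) \<le> ?C * (A * B)"
    if AB: "Lp_norm p (lsum K a c) < A" "Lp_norm q (gsum L a d) < B" for A B
  proof -
    have pos: "0 < A" "0 < B" using AB Lp_norm_nonneg[of p "lsum K a c"] Lp_norm_nonneg[of q "gsum L a d"] by linarith+
    let ?c = "\<lambda>k. (1/A) * c k" and ?d = "\<lambda>i k. (1/B) * d i k"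
    have "lsum K a ?c = (\<lambda>x. (1/A) *\<^sub>R lsum K a c x)" by (rule ext) (simp only: lsum_scale real_scaleR_def)
    then have "Lp_norm p (lsum K a ?c) = \<bar>1/A\<bar> * Lp_norm p (lsum K a c)"
      using Lp_norm_scale[of p "1/A" "lsum K a c"] p by simp
    then have "Lp_norm p (lsum K a ?c) \<le> 1" using AB pos by (simp add: pos_divide_le_eq)
    then have 1: "(LINT x|MX. \<bar>lsum K a ?c x\<bar> powr p) \<le> 1"
      using Lp_norm_le_iff[of p 1 "lsum K a ?c"] p by (simp add: MO_integral(2))
    have "gsum L a ?d = (\<lambda>x. (1/B) *\<^sub>R gsum L a d x)" by (rule ext) (rule gsum_scale)
    then have "Lp_norm q (gsum L a ?d) = \<bar>1/B\<bar> * Lp_norm q (gsum L a d)"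
      using Lp_norm_scale[of q "1/B" "gsum L a d"] q1 by simp
    then have "Lp_norm q (gsum L a ?d) \<le> 1" using AB pos by (simp add: pos_divide_le_eq)
    then have 2: "(LINT x|MX. norm (gsum L a ?d x) powr q) \<le> 1"
      using Lp_norm_le_iff[of q 1 "gsum L a ?d"] q1 by (simp add: MO_integral(2))
    have "\<bar>LINT x|MX. rsum K a ?c x \<bullet> gsum L a ?d x\<bar> \<le> ?C"
      by (rule riesz_bilinear[OF a p q K L 1 2])
    moreover have "(LINT x|MX. rsum K a ?c x \<bullet> gsum L a ?d x) = (1/A) * ((1/B) * (LINT x|MX. rsum K a c x \<bullet> gsum L a d x))"
      unfolding rsum_scale gsum_scale by simp
    ultimately have "(1/A) * ((1/B) * (LINT x|MX. rsum K a c x \<bullet> gsum L a d x)) \<le> ?C" by linarith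
    then have "(LINT x|MX. rsum K a c x \<bullet> gsum L a d x) / (A * B) \<le> ?C" by simp
    then have "(LINT x|MX. rsum K a c x \<bullet> gsum L a d x) \<le> ?C * (A * B)"
      using pos by (simp only: pos_divide_le_eq[OF mult_pos_pos[OF pos]])
    then show ?thesis by (subst MO_integral(2)) auto
  qed
  show ?thesis
  proof (rule tendsto_lowerbound)
    show "((\<lambda>e. ?C * ((Lp_norm p (lsum K a c) + e) * (Lp_norm q (gsum L a d) + e))) \<longlongrightarrow> ?C * (Lp_norm p (lsum K a c) * Lp_norm q (gsum L a d))) (at_right 0)"
      by (auto intro!: tendsto_eq_intros)
    show "\<forall>\<^sub>F e in at_right 0. (LINT x|MO. rsum K a c x \<bullet> gsum L a d x) \<le> ?C * ((Lp_norm p (lsum K a c) + e) * (Lp_norm q (gsum L a d) + e))"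
      unfolding eventually_at_right_field using * by (auto intro!: exI[of _ 1])
  qed simp
qed

text \<open>Duality with the extremal function \<open>norm h powr (p - 2) *\<^sub>R h\<close>, where
  \<open>h\<close> is the Riesz transform. It is not a finite expansion, so \<open>gsum\<close>
  approximates it in L^q, and Hoelder's inequality controls the error.\<close>

lemma riesz_Lp_bound:
  fixes a :: "real ^ 'd"
  assumes a: "\<And>j. 1/2 < a $ j" and p: "1 < p" and K: "finite K"
  shows "Lp_norm p (rsum K a c) \<le> 24 * (1 + sqrt (laguerre_C a)) * (max p (p / (p - 1)) - 1) * Lp_norm p (lsum K a c)"
proof -
  define q where "q = p / (p - 1)"
  let ?C = "24 * (1 + sqrt (laguerre_C a)) * (max p q - 1)"
  have C: "0 \<le> ?C" using laguerre_C_ge(2)[OF a] p by simp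
  have qp: "(p - 1) * q = p" "1 < q" "1/p + 1/q = 1" using p by (auto simp: q_def field_simps)
  let ?h = "rsum K a c" and ?f = "lsum K a c"
  have h: "?h \<in> Lp_space p" using rsum_Lp[OF a] p by simp
  define g where "g x = norm (?h x) powr (p - 2) *\<^sub>R ?h x" for x
  have ng: "norm (g x) = norm (?h x) powr (p - 1)" for x
  proof (cases "?h x = 0")
    case False
    have "norm (?h x) powr (p - 2) * norm (?h x) = norm (?h x) powr (p - 2) * norm (?h x) powr 1" by simp
    also have "\<dots> = norm (?h x) powr (p - 1)" unfolding powr_add[symmetric] by (rule arg_cong) simp
    finally show ?thesis by (simp add: g_def)
  qed (simp add: g_def)
  have ngq: "norm (g x) powr q = norm (?h x) powr p" for x by (simp add: ng powr_powr qp)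
  have mg: "g \<in> borel_measurable MO" unfolding g_def[abs_def] using Lp_space_measurable[OF h] by measurable
  have gq: "g \<in> Lp_space q" by (rule Lp_spaceI[OF mg]) (simp add: ngq Lp_space_integrable[OF h])
  have hg: "?h x \<bullet> g x = norm (?h x) powr p" for x
  proof (cases "?h x = 0")
    case False
    have "?h x \<bullet> g x = norm (?h x) powr (p - 2) * norm (?h x) powr 2"
      using False by (simp add: g_def dot_square_norm)
    also have "\<dots> = norm (?h x) powr p" unfolding powr_add[symmetric] by (rule arg_cong) simp
    finally show ?thesis .
  qed (use p in \<open>simp add: g_def\<close>)
  have H: "Lp_norm p ?h powr p = (LINT x|MO. ?h x \<bullet> g x)" using p by (simp add: hg Lp_norm_powr)
  have Gn: "Lp_norm q g = Lp_norm p ?h powr (p - 1)"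
  proof -
    have "Lp_norm q g = (LINT x|MO. norm (?h x) powr p) powr (1/q)" by (simp add: Lp_norm_def ngq)
    also have "\<dots> = (Lp_norm p ?h powr p) powr (1/q)" using p by (simp add: Lp_norm_powr)
    also have "\<dots> = Lp_norm p ?h powr (p - 1)"
    proof -
      have "p * (1/q) = p - 1" using qp by (simp add: field_simps)
      then show ?thesis by (simp only: powr_powr)
    qed
    finally show ?thesis .
  qed
  have *: "Lp_norm p ?h powr p \<le> ?C * (Lp_norm p ?f * (Lp_norm q g + e)) + Lp_norm p ?h * e" if e: "0 < e" for e
  proof -
    obtain L d where Ld: "\<And>i. finite (L i)" "Lp_norm q (\<lambda>x. gsum L a d x - g x) < e"
      using gsum_dense[OF a _ gq e] qp by auto
    have gs: "gsum L a d \<in> Lp_space q" using gsum_Lp[OF a _ Ld(1)] qp by simp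
    have df: "(\<lambda>x. g x - gsum L a d x) \<in> Lp_space q" using qp by (intro Lp_space_diff gs gq) auto
    have "(LINT x|MO. ?h x \<bullet> g x) = (LINT x|MO. ?h x \<bullet> gsum L a d x + ?h x \<bullet> (g x - gsum L a d x))"
      by (simp add: inner_diff_right)
    also have "\<dots> = (LINT x|MO. ?h x \<bullet> gsum L a d x) + (LINT x|MO. ?h x \<bullet> (g x - gsum L a d x))"
      by (intro Bochner_Integration.integral_add Holder_inner(1)[OF h _ p qp(3)] gs df)
    also have "(LINT x|MO. ?h x \<bullet> gsum L a d x) \<le> ?C * (Lp_norm p ?f * Lp_norm q (gsum L a d))"
      by (rule riesz_bilinear_Lp[OF a p q_def K Ld(1)])
    also have "\<dots> \<le> ?C * (Lp_norm p ?f * (Lp_norm q g + e))"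
    proof (intro mult_left_mono C Lp_norm_nonneg)
      show "Lp_norm q (gsum L a d) \<le> Lp_norm q g + e"
        using Lp_norm_diff_le[OF gs gq] qp Ld(2) by simp
    qed
    also have "(LINT x|MO. ?h x \<bullet> (g x - gsum L a d x)) \<le> Lp_norm p ?h * e"
    proof -
      have "(LINT x|MO. ?h x \<bullet> (g x - gsum L a d x)) \<le> Lp_norm p ?h * Lp_norm q (\<lambda>x. g x - gsum L a d x)"
        using Holder_inner(2)[OF h df p qp(3)] by simp
      also have "\<dots> \<le> Lp_norm p ?h * e"
        using Ld(2) Lp_norm_minus[of q g "gsum L a d"] by (intro mult_left_mono) auto
      finally show ?thesis .
    qed
    finally show ?thesis unfolding H by simp
  qed
  have "Lp_norm p ?h powr p \<le> ?C * (Lp_norm p ?f * Lp_norm q g)"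
  proof (rule tendsto_lowerbound)
    show "((\<lambda>e. ?C * (Lp_norm p ?f * (Lp_norm q g + e)) + Lp_norm p ?h * e) \<longlongrightarrow> ?C * (Lp_norm p ?f * Lp_norm q g)) (at_right 0)"
      by (auto intro!: tendsto_eq_intros)
    show "\<forall>\<^sub>F e in at_right 0. Lp_norm p ?h powr p \<le> ?C * (Lp_norm p ?f * (Lp_norm q g + e)) + Lp_norm p ?h * e"
      unfolding eventually_at_right_field using * by (auto intro!: exI[of _ 1])
  qed simp
  \<comment> \<open>Dividing by the power \<open>p - 1\<close> of the norm of \<open>?h\<close>
    leaves the claim, unless that norm is 0.\<close>
  then have le: "Lp_norm p ?h powr p \<le> (?C * Lp_norm p ?f) * Lp_norm p ?h powr (p - 1)" by (simp add: Gn mult.assoc)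
  show ?thesis
  proof (cases "Lp_norm p ?h = 0")
    case True
    then show ?thesis using mult_nonneg_nonneg[OF C Lp_norm_nonneg[of p ?f]] by (simp add: q_def)
  next
    case False
    then have hp: "0 < Lp_norm p ?h" using Lp_norm_nonneg[of p ?h] by linarith
    have "Lp_norm p ?h * Lp_norm p ?h powr (p - 1) = Lp_norm p ?h powr p"
      using hp by (simp add: powr_diff)
    then have "Lp_norm p ?h * Lp_norm p ?h powr (p - 1) \<le> (?C * Lp_norm p ?f) * Lp_norm p ?h powr (p - 1)" using le by simp
    then have "Lp_norm p ?h \<le> ?C * Lp_norm p ?f" using hp by (simp add: mult_le_cancel_right)
    then show ?thesis by (simp add: q_def)
  qed
qed

section \<open>The Riesz transforms on the span and their extension\<close>

lemma L2_inner_lsum: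
  fixes a :: "real ^ 'd"
  assumes a: "\<And>j. 1/2 < a $ j" and K: "finite K"
  shows "L2_inner (lsum K a c) (laguerre_fun a k) = (if k \<in> K then c k else 0)"
proof -
  have "L2_inner (lsum K a c) (laguerre_fun a k) = (LINT x|MX. lsum K a c x * Ph a k x)"
    unfolding L2_inner_def laguerre_fun_Ph by (rule MO_integral(2)) measurable
  also have "\<dots> = (LINT x|MX. (\<Sum>l\<in>K. c l * (Ph a l x * Ph a k x)))"
    by (simp add: lsum_def sum_distrib_right mult.assoc)
  also have "\<dots> = (\<Sum>l\<in>K. c l * (LINT x|MX. Ph a l x * Ph a k x))"
    by (subst Bochner_Integration.integral_sum) (auto intro!: integrable_mult_right Ph_orthonormal(1) a)
  also have "\<dots> = (if k \<in> K then c k else 0)"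
    unfolding Ph_orthonormal(2)[OF a] using K by (simp add: if_distrib sum.delta' cong: if_cong)
  finally show ?thesis .
qed

text \<open>Summing over the indices with nonzero coefficient makes the value depend on
  \<open>f\<close> alone and not on a representation as a finite sum.\<close>

definition riesz_on_span :: "real ^ 'd \<Rightarrow> (real ^ 'd \<Rightarrow> real) \<Rightarrow> real ^ 'd \<Rightarrow> real ^ 'd" where
  "riesz_on_span a f x = (\<chi> i. riesz_partial_sum a i f {k. L2_inner f (laguerre_fun a k) \<noteq> 0} x)"

lemma riesz_on_span_partial_sum:
  assumes a: "\<And>j. 1/2 < a $ j" and f: "f \<in> laguerre_span a"
  shows "finite {k. L2_inner f (laguerre_fun a k) \<noteq> 0}"
    and "finite F \<Longrightarrow> {k. L2_inner f (laguerre_fun a k) \<noteq> 0} \<subseteq> F \<Longrightarrow> riesz_partial_sum a i f F x = riesz_on_span a f x $ i"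
proof -
  obtain K c where f: "f = lsum K a c" "finite K" using f unfolding laguerre_span_lsum by blast
  have "{k. L2_inner f (laguerre_fun a k) \<noteq> 0} \<subseteq> K" unfolding f(1) L2_inner_lsum[OF a f(2)] by auto
  then show "finite {k. L2_inner f (laguerre_fun a k) \<noteq> 0}" using f(2) finite_subset by blast
  show "riesz_partial_sum a i f F x = riesz_on_span a f x $ i" if "finite F" "{k. L2_inner f (laguerre_fun a k) \<noteq> 0} \<subseteq> F"
    unfolding riesz_on_span_def riesz_partial_sum_def vec_lambda_beta
    by (rule sum.mono_neutral_right) (use that in auto)
qed

lemma riesz_on_span_rsum:
  assumes a: "\<And>j. 1/2 < a $ j" and K: "finite K" and x: "x \<in> orthant"
  shows "riesz_on_span a (lsum K a c) x = rsum K a c x"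
proof -
  have f: "lsum K a c \<in> laguerre_span a" using K unfolding laguerre_span_lsum by blast
  have "riesz_on_span a (lsum K a c) x $ i = rsum K a c x $ i" for i
  proof -
    have "riesz_on_span a (lsum K a c) x $ i = riesz_partial_sum a i (lsum K a c) K x"
      by (rule riesz_on_span_partial_sum(2)[OF a f K, symmetric]) (auto simp: L2_inner_lsum[OF a K])
    also have "\<dots> = rsum K a c x $ i"
      unfolding riesz_partial_sum_def rsum_def laguerre_delta_dPh[OF x] L2_inner_lsum[OF a K]
      by (simp add: mult_ac)
    finally show ?thesis .
  qed
  then show ?thesis by (simp add: vec_eq_iff)
qed

lemma MO_cong:
  assumes "\<And>x. x \<in> orthant \<Longrightarrow> f x = g x"
  shows "f \<in> Lp_space p \<longleftrightarrow> g \<in> Lp_space p" "Lp_norm p f = Lp_norm p g"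
proof -
  have "f \<in> borel_measurable MO \<longleftrightarrow> g \<in> borel_measurable MO" by (rule measurable_cong) (use assms in simp)
  moreover have "integrable MO (\<lambda>x. norm (f x) powr p) \<longleftrightarrow> integrable MO (\<lambda>x. norm (g x) powr p)"
    by (rule Bochner_Integration.integrable_cong[OF refl]) (use assms in simp)
  moreover have "(LINT x|MO. norm (f x) powr p) = (LINT x|MO. norm (g x) powr p)"
    by (rule Bochner_Integration.integral_cong[OF refl]) (use assms in simp)
  ultimately show "f \<in> Lp_space p \<longleftrightarrow> g \<in> Lp_space p" "Lp_norm p f = Lp_norm p g"
    by (simp_all add: Lp_space_def Lp_norm_def)
qed

lemma riesz_on_span_Lp:
  assumes a: "\<And>j. 1/2 < a $ j" and f: "f \<in> laguerre_span a" and p: "1 \<le> p"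
  shows "riesz_on_span a f \<in> Lp_space p"
proof -
  obtain K c where f: "f = lsum K a c" "finite K" using f unfolding laguerre_span_lsum by blast
  show ?thesis unfolding f(1) by (rule MO_cong(1)[THEN iffD2]) (rule riesz_on_span_rsum[OF a f(2)], assumption, rule rsum_Lp[OF a p])
qed

text \<open>Over a common index set the difference is again a finite expansion, to which
  \<open>riesz_Lp_bound\<close> applies.\<close>

lemma riesz_on_span_Lipschitz:
  fixes a :: "real ^ 'd"
  assumes a: "\<And>j. 1/2 < a $ j" and f: "f \<in> laguerre_span a" and g: "g \<in> laguerre_span a" and p: "1 < p"
  shows "Lp_norm p (\<lambda>x. riesz_on_span a f x - riesz_on_span a g x)
    \<le> 24 * (1 + sqrt (laguerre_C a)) * (max p (p / (p - 1)) - 1) * Lp_norm p (\<lambda>x. f x - g x)"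
proof -
  obtain K c where f: "f = lsum K a c" "finite K" using f unfolding laguerre_span_lsum by blast
  obtain L d where g: "g = lsum L a d" "finite L" using g unfolding laguerre_span_lsum by blast
  have ext: "lsum K' a c' = lsum (K \<union> L) a (\<lambda>k. if k \<in> K' then c' k else 0)" if "K' \<subseteq> K \<union> L" for K' c'
    unfolding lsum_def by (rule ext, rule sum.mono_neutral_cong_left) (use that f g in auto)
  define c1 where "c1 k = (if k \<in> K then c k else 0)" for k
  define d1 where "d1 k = (if k \<in> L then d k else 0)" for k
  have fg: "f = lsum (K \<union> L) a c1" "g = lsum (K \<union> L) a d1"
    unfolding f(1) g(1) c1_def[abs_def] d1_def[abs_def] by (rule ext; simp)+
  have fin: "finite (K \<union> L)" using f g by simp
  have "Lp_norm p (\<lambda>x. riesz_on_span a f x - riesz_on_span a g x) = Lp_norm p (rsum (K \<union> L) a (\<lambda>k. c1 k - d1 k))"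
  proof (rule MO_cong(2))
    fix x :: "real ^ 'd" assume x: "x \<in> orthant"
    show "riesz_on_span a f x - riesz_on_span a g x = rsum (K \<union> L) a (\<lambda>k. c1 k - d1 k) x"
      unfolding fg riesz_on_span_rsum[OF a fin x] by (simp add: rsum_def vec_eq_iff left_diff_distrib sum_subtractf)
  qed
  also have "\<dots> \<le> 24 * (1 + sqrt (laguerre_C a)) * (max p (p / (p - 1)) - 1) * Lp_norm p (lsum (K \<union> L) a (\<lambda>k. c1 k - d1 k))"
    by (rule riesz_Lp_bound[OF a p fin])
  also have "lsum (K \<union> L) a (\<lambda>k. c1 k - d1 k) = (\<lambda>x. f x - g x)"
    unfolding fg by (simp add: lsum_def[abs_def] left_diff_distrib sum_subtractf)
  finally show ?thesis .
qed

lemma eventually_partial_sum: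
  assumes a: "\<And>j. 1/2 < a $ j" and f: "f \<in> laguerre_span a"
  shows "\<forall>\<^sub>F F in finite_subsets_at_top UNIV. Lp_norm 2 (\<lambda>x. riesz_partial_sum a i f F x - g x) = Lp_norm 2 (\<lambda>x. riesz_on_span a f x $ i - g x)"
proof -
  have "\<forall>\<^sub>F F in finite_subsets_at_top UNIV. finite F \<and> {k. L2_inner f (laguerre_fun a k) \<noteq> 0} \<subseteq> F \<and> F \<subseteq> UNIV"
    unfolding eventually_finite_subsets_at_top using riesz_on_span_partial_sum(1)[OF a f] by auto
  then show ?thesis by eventually_elim (simp add: riesz_on_span_partial_sum(2)[OF a f])
qed

lemma riesz_on_span_has_riesz:
  assumes a: "\<And>j. 1/2 < a $ j" and f: "f \<in> laguerre_span a"
  shows "has_riesz a i f (\<lambda>x. riesz_on_span a f x $ i)"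
  unfolding has_riesz_def
proof (intro conjI)
  show "f \<in> Lp_space 2" by (rule span_Lp[OF a f]) simp
  show "(\<lambda>x. riesz_on_span a f x $ i) \<in> Lp_space 2" by (rule Lp_space_component[OF riesz_on_span_Lp[OF a f]]) auto
  have "\<forall>\<^sub>F F in finite_subsets_at_top UNIV. Lp_norm 2 (\<lambda>x. riesz_partial_sum a i f F x - riesz_on_span a f x $ i) = 0"
    using eventually_partial_sum[OF a f, of i "\<lambda>x. riesz_on_span a f x $ i"] by eventually_elim (simp add: Lp_norm_def)
  then show "((\<lambda>F. Lp_norm 2 (\<lambda>x. riesz_partial_sum a i f F x - riesz_on_span a f x $ i)) \<longlongrightarrow> 0) (finite_subsets_at_top UNIV)"
    by (rule tendsto_eventually)
qed

text \<open>The partial sums no longer change once the index set contains all nonzero coefficients,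
  so their L^2 limit is determined up to null sets.\<close>

lemma has_riesz_unique:
  assumes a: "\<And>j. 1/2 < a $ j" and f: "f \<in> laguerre_span a" and g: "has_riesz a i f g"
  shows "AE x in MO. g x = riesz_on_span a f x $ i"
proof -
  have g2: "g \<in> Lp_space 2" and lim: "((\<lambda>F. Lp_norm 2 (\<lambda>x. riesz_partial_sum a i f F x - g x)) \<longlongrightarrow> 0) (finite_subsets_at_top UNIV)"
    using g unfolding has_riesz_def by auto
  have "((\<lambda>F. Lp_norm 2 (\<lambda>x. riesz_partial_sum a i f F x - g x)) \<longlongrightarrow> Lp_norm 2 (\<lambda>x. riesz_on_span a f x $ i - g x)) (finite_subsets_at_top UNIV)"
    by (rule tendsto_eventually[OF eventually_partial_sum[OF a f]])
  then have "Lp_norm 2 (\<lambda>x. riesz_on_span a f x $ i - g x) = 0"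
    using tendsto_unique[OF _ _ lim] by (simp add: finite_subsets_at_top_neq_bot)
  moreover have "(\<lambda>x. riesz_on_span a f x $ i - g x) \<in> Lp_space 2"
    by (intro Lp_space_diff g2 Lp_space_component riesz_on_span_Lp[OF a f]) auto
  ultimately have "AE x in MO. riesz_on_span a f x $ i - g x = 0" using Lp_norm_eq_0_iff[of "\<lambda>x. riesz_on_span a f x $ i - g x" 2] by simp
  then show ?thesis by eventually_elim simp
qed

text \<open>Existence is the Lipschitz extension from the dense span. Uniqueness holds because any
  continuous extension agrees with this one almost everywhere on the span, and a sequence of the
  span converges to \<open>f\<close>.\<close>

theorem theorem11:
  fixes \<alpha> :: "real ^ 'd" and p :: real
  assumes "\<forall>i. 1/2 < \<alpha> $ i" and "1 < p"
  shows "\<exists>T. continuous_riesz_extension \<alpha> p T \<and>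
    (\<forall>T'. continuous_riesz_extension \<alpha> p T' \<longrightarrow>
       (\<forall>f\<in>Lp_space p. AE x in lebesgue_on orthant. T' f x = T f x)) \<and>
    (\<forall>f\<in>Lp_space p.
       Lp_norm p (T f) \<le> 24 * (1 + sqrt (laguerre_C \<alpha>)) * (max p (p / (p - 1)) - 1) * Lp_norm p f)"
proof -
  have a: "1/2 < \<alpha> $ j" for j using assms(1) by blast
  have p1: "1 \<le> p" "0 < p" using assms(2) by auto
  let ?C = "24 * (1 + sqrt (laguerre_C \<alpha>)) * (max p (p / (p - 1)) - 1)"
  let ?S = "laguerre_span \<alpha>"
  have C: "0 \<le> ?C" using laguerre_C_ge(2)[OF a] assms(2) by simp
  interpret laguerre_density \<alpha> p by standard (use a p1 in auto)
  have "\<exists>T. (\<forall>f\<in>Lp_space p. T f \<in> Lp_space p) \<and>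
     (\<forall>f\<in>Lp_space p. \<forall>g\<in>Lp_space p. Lp_norm p (\<lambda>x. T f x - T g x) \<le> ?C * Lp_norm p (\<lambda>x. f x - g x)) \<and>
     (\<forall>f\<in>?S. T f = riesz_on_span \<alpha> f)"
    by (rule Lp_Lipschitz_extension[OF p1(1) _ C span_dense riesz_on_span_Lp[OF a _ p1(1)] riesz_on_span_Lipschitz[OF a _ _ assms(2)]])
       (auto intro: span_Lp[OF a _ p1(2)])
  then obtain T where T: "\<And>f. f \<in> Lp_space p \<Longrightarrow> T f \<in> Lp_space p"
     "\<And>f g. f \<in> Lp_space p \<Longrightarrow> g \<in> Lp_space p \<Longrightarrow> Lp_norm p (\<lambda>x. T f x - T g x) \<le> ?C * Lp_norm p (\<lambda>x. f x - g x)"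
     "\<And>f. f \<in> ?S \<Longrightarrow> T f = riesz_on_span \<alpha> f" by blast
  have lim: "(\<lambda>n. Lp_norm p (\<lambda>x. T (F n) x - T f x)) \<longlonglongrightarrow> 0"
    if "f \<in> Lp_space p" "\<And>n. F n \<in> Lp_space p" "(\<lambda>n. Lp_norm p (\<lambda>x. F n x - f x)) \<longlonglongrightarrow> 0" for f F
  proof (rule tendsto_sandwich[OF _ _ tendsto_const])
    show "\<forall>\<^sub>F n in sequentially. Lp_norm p (\<lambda>x. T (F n) x - T f x) \<le> ?C * Lp_norm p (\<lambda>x. F n x - f x)"
      using T(2) that by (intro always_eventually) auto
    show "(\<lambda>n. ?C * Lp_norm p (\<lambda>x. F n x - f x)) \<longlonglongrightarrow> 0" by (rule tendsto_mult_right_zero[OF that(3)])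
  qed auto
  show ?thesis
  proof (intro exI[of _ T] conjI allI impI ballI)
    show "continuous_riesz_extension \<alpha> p T"
      unfolding continuous_riesz_extension_def using T(1,3) lim riesz_on_span_has_riesz[OF a] by auto
    show "Lp_norm p (T f) \<le> ?C * Lp_norm p f" if "f \<in> Lp_space p" for f
    proof -
      \<comment> \<open>With the value 0 at 0, the Lipschitz bound becomes the norm bound.\<close>
      have "T (\<lambda>x. 0) = (\<lambda>x. 0)"
        unfolding T(3)[OF span_zero] by (simp add: riesz_on_span_def[abs_def] L2_inner_def riesz_partial_sum_def vec_eq_iff fun_eq_iff)
      then show ?thesis using T(2)[OF that Lp_space_zero] by simp
    qed
    fix T' :: "(real ^ 'd \<Rightarrow> real) \<Rightarrow> real ^ 'd \<Rightarrow> real ^ 'd" and f :: "real ^ 'd \<Rightarrow> real"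
    assume T': "continuous_riesz_extension \<alpha> p T'" and f: "f \<in> Lp_space p"
    have T'p: "\<And>f. f \<in> Lp_space p \<Longrightarrow> T' f \<in> Lp_space p" and T'r: "\<And>f i. f \<in> ?S \<Longrightarrow> has_riesz \<alpha> i f (\<lambda>x. T' f x $ i)"
      using T' unfolding continuous_riesz_extension_def by auto
    have "\<exists>F. \<forall>n. F n \<in> ?S \<and> Lp_norm p (\<lambda>x. F n x - f x) < inverse (real (Suc n))"
      by (rule choice) (use span_dense[OF f] in \<open>auto simp: Bex_def\<close>)
    then obtain F where FS: "\<And>n. F n \<in> ?S" and F: "\<And>n. Lp_norm p (\<lambda>x. F n x - f x) < inverse (real (Suc n))" by blast
    have FL: "F n \<in> Lp_space p" for n by (rule span_Lp[OF a FS p1(2)])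
    have F0: "(\<lambda>n. Lp_norm p (\<lambda>x. F n x - f x)) \<longlonglongrightarrow> 0"
      by (rule tendsto_sandwich[OF _ _ tendsto_const LIMSEQ_inverse_real_of_nat])
         (use less_imp_le[OF F] in \<open>auto intro!: always_eventually\<close>)
    have eq: "AE x in MO. T' (F n) x = T (F n) x" for n
    proof -
      \<comment> \<open>There are finitely many coordinates, so their exceptional null sets may be
        united.\<close>
      have "AE x in MO. \<forall>i. T' (F n) x $ i = riesz_on_span \<alpha> (F n) x $ i"
        using has_riesz_unique[OF a FS T'r[OF FS]] by (subst AE_all_countable) auto
      then show ?thesis unfolding T(3)[OF FS] by eventually_elim (simp add: vec_eq_iff)
    qed
    have "Lp_norm p (\<lambda>x. T' f x - T f x) \<le> Lp_norm p (\<lambda>x. T' (F n) x - T' f x) + Lp_norm p (\<lambda>x. T (F n) x - T f x)" for n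
    proof -
      have "Lp_norm p (\<lambda>x. T' (F n) x - T f x) = Lp_norm p (\<lambda>x. T (F n) x - T f x)"
        by (rule Lp_norm_cong_AE) (use eq[of n] Lp_space_measurable[OF T'p[OF FL[of n]]] Lp_space_measurable[OF T(1)[OF FL[of n]]]
              Lp_space_measurable[OF T(1)[OF f]] in \<open>auto elim: eventually_mono\<close>)
      then show ?thesis
        using Lp_norm_triangle3[OF T'p[OF f] T'p[OF FL[of n]] T(1)[OF f] p1(1)] Lp_norm_minus[of p "T' f" "T' (F n)"] by simp
    qed
    moreover have "(\<lambda>n. Lp_norm p (\<lambda>x. T' (F n) x - T' f x) + Lp_norm p (\<lambda>x. T (F n) x - T f x)) \<longlonglongrightarrow> 0 + 0"
    proof (rule tendsto_add)
      show "(\<lambda>n. Lp_norm p (\<lambda>x. T' (F n) x - T' f x)) \<longlonglongrightarrow> 0"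
        using T' f FL F0 unfolding continuous_riesz_extension_def by blast
    qed (rule lim[OF f FL F0])
    ultimately have "Lp_norm p (\<lambda>x. T' f x - T f x) \<le> 0" using LIMSEQ_le_const by fastforce
    then have "Lp_norm p (\<lambda>x. T' f x - T f x) = 0" using Lp_norm_nonneg[of p "\<lambda>x. T' f x - T f x"] by linarith
    then have "AE x in MO. T' f x - T f x = 0"
      using Lp_norm_eq_0_iff[OF Lp_space_diff[OF T'p[OF f] T(1)[OF f] p1(1)] p1(2)] by simp
    then show "AE x in MO. T' f x = T f x" by eventually_elim simp
  qed
qed

end
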